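(* Let $\Bbbk$ be a field, $\delta\in\Bbbk$, and $0\le n\le k$. Then: (a) $X(n)$ is semisimple if and only if $\mathsf{TL}_n(\delta-1)$ is semisimple. (b) If $X(n)$ is semisimple, its simple modules are of the form $Q_n\otimes\mathsf{TL}^\lambda$, where $\mathsf{TL}^\lambda$ is a simple $\mathsf{TL}_n(\delta-1)$-module. (c) $\mathsf{PTL}_k(\delta)$ is semisimple for any $\delta\in\Bbbk$ such that $\mathsf{TL}_n(\delta-1)$ is semisimple for all $n=0,1,\dots,k$.
   Context: Let $[k]=\{1,\dots,k\}$, $[k]'=\{1',\dots,k'\}$. A partial Brauer $k$-diagram is a set partition of $[k]\sqcup[k]'$ into blocks of size at most $2$, drawn with top row $1,\dots,k$ and bottom row $1',\dots,k'$; blocks of size $2$ are edges, singletons are isolated vertices. An edge is a cup if both endpoints are in $[k]$, a cap if both are in $[k]'$; cups and caps are horizontal, other edges vertical. A Motzkin $k$-diagram is a partial Brauer $k$-diagram that can be drawn in the rectangle without crossings. Product: place $d_1$ above $d_2$, identify $i'$ of $d_1$ with $i$ of $d_2$ (middle row), let $d_1\circ d_2$ record connectivity of the outer rows. $\mathsf M_k(\delta)$ is the unital associative $\Bbbk$-algebra free on the Motzkin $k$-diagrams with $d_1d_2=\delta^{N_1}d_1\circ d_2$, where $N_1$ is the number of closed loops in the middle row (interior paths contribute factor $1$). $p_j$ is the diagram with $j,j'$ isolated and vertical edges $\{i,i'\}$, $i\ne j$. For a Motzkin diagram $d$, $\bar d=\sum_{d'\le d}(-1)^{\beta(d)-\beta(d')}d'$,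 where $\beta$ is the number of blocks and $d'\le d$ means $d'$ is obtained from $d$ by removing zero or more edges; $\tilde d=\prod_i(1-p_i)\,d\,\prod_j(1-p_j)$, with $i$ (resp. $j$) running over the $i\in[k]$ (resp. $j$ with $j'\in[k]'$) that are endpoints of horizontal edges of $d$. A Motzkin diagram is balanced if it has as many cups as caps; $\mathcal D(k)$ is the set of balanced Motzkin $k$-diagrams and $\mathcal D_n(k)$ the subset of those with exactly $n$ edges. $\mathsf{PTL}_k(\delta)\subseteq\mathsf M_k(\delta)$ is the subalgebra spanned by $\{\tilde d\mid d\in\mathcal D(k)\}$; $\{\bar d\mid d\in\mathcal D(k)\}$ is also a $\Bbbk$-basis. $X(n)$ is the $\Bbbk$-span of $\{\bar d\mid d\in\mathcal D_n(k)\}$, a two-sided ideal of $\mathsf{PTL}_k(\delta)$ (an algebra with its own identity element; modules are unital). $\mathsf{TL}_n(\delta)$ is the Temperley--Lieb algebra: free on the planar $n$-diagrams all of whose blocks have exactly two elements, with $d_1d_2=\delta^{N_1}d_1\circ d_2$; $\mathsf{TL}_0(\delta)=\Bbbk$. $Q_n$ is the $\Bbbk$-vector space with basis the set of all $n$-element subsets of $[k]$; $\otimes=\otimes_\Bbbk$. Each $d\in\mathcal D_n(k)$ corresponds bijectively to a triple $(A,t,B)$, where $A,B\subseteq[k]$ are the sets of (indices of) non-isolated vertices in the top, bottom row of $d$, and $t$ is the Temperley--Lieb $n$-diagram obtained by deleting isolated vertices. There is an algebra isomorphism $X(n)\cong\mathrm{End}_\Bbbk(Q_n)\otimes\mathsf{TL}_n(\delta-1)$,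 $\bar d\mapsto E_{A,B}\otimes t$, where $E_{A,B}$ sends $B$ to $A$ and every other basis element to $0$. For a $\mathsf{TL}_n(\delta-1)$-module $N$, $X(n)$ acts on $Q_n\otimes N$ via this isomorphism and $(f\otimes t)(C\otimes v)=f(C)\otimes tv$. *)

theory Defs
  imports
    Complex_Main
    "HOL-Algebra.Module"
    "HOL-Algebra.AbelCoset"
    "HOL-Library.Disjoint_Sets"
    "HOL-Library.Function_Algebras"
begin

section \<open>Vector spaces of functions on a set of basis labels\<close>

text \<open>
  The free vector space on a finite set \<open>S\<close> of labels is modelled by the functions to the field
  that vanish outside \<open>S\<close>; addition is the pointwise one of \<^theory>\<open>HOL-Library.Function_Algebras\<close>.
\<close>

definition fscale :: "'k::field \<Rightarrow> ('d \<Rightarrow> 'k) \<Rightarrow> ('d \<Rightarrow> 'k)" where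
  "fscale c f = (\<lambda>d. c * f d)"

global_interpretation fvs: vector_space "fscale :: 'k::field \<Rightarrow> ('d \<Rightarrow> 'k) \<Rightarrow> ('d \<Rightarrow> 'k)"
  by unfold_locales (auto simp: fscale_def fun_eq_iff algebra_simps)

definition free_space :: "'d set \<Rightarrow> ('d \<Rightarrow> 'k::field) set" where
  "free_space S = {f. \<forall>d. d \<notin> S \<longrightarrow> f d = 0}"

definition basis_vec :: "'d \<Rightarrow> ('d \<Rightarrow> 'k::field)" where
  "basis_vec d = (\<lambda>x. if x = d then 1 else 0)"


section \<open>Diagrams\<close>

text \<open>\<open>Inl i\<close> is the top vertex \<open>i\<close> and \<open>Inr i\<close> is the bottom vertex \<open>i'\<close>.\<close>

type_synonym diagram = "(nat + nat) set set"

definition vertices :: "nat \<Rightarrow> (nat + nat) set" where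
  "vertices k = Inl ` {1..k} \<union> Inr ` {1..k}"

definition partial_brauer :: "nat \<Rightarrow> diagram set" where
  "partial_brauer k = {d. partition_on (vertices k) d \<and> (\<forall>b\<in>d. card b \<le> 2)}"

definition edges :: "diagram \<Rightarrow> diagram" where
  "edges d = {b \<in> d. card b = 2}"

definition cups :: "diagram \<Rightarrow> diagram" where
  "cups d = {e \<in> edges d. e \<subseteq> range Inl}"

definition caps :: "diagram \<Rightarrow> diagram" where
  "caps d = {e \<in> edges d. e \<subseteq> range Inr}"

text \<open>
  Running around the boundary of the rectangle one meets \<open>1, \<dots>, k, k', \<dots>, 1'\<close>.  A diagram can be
  drawn in the rectangle without crossings iff no two edges interlace in this order.
\<close>

definition boundary_pos :: "nat \<Rightarrow> nat + nat \<Rightarrow> nat" where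
  "boundary_pos k v = (case v of Inl i \<Rightarrow> i | Inr i \<Rightarrow> 2 * k + 1 - i)"

definition noncrossing :: "nat \<Rightarrow> diagram \<Rightarrow> bool" where
  "noncrossing k d \<longleftrightarrow>
     \<not> (\<exists>a b u v. {a, b} \<in> edges d \<and> {u, v} \<in> edges d \<and>
          boundary_pos k a < boundary_pos k u \<and> boundary_pos k u < boundary_pos k b \<and>
          boundary_pos k b < boundary_pos k v)"

definition motzkin :: "nat \<Rightarrow> diagram set" where
  "motzkin k = {d \<in> partial_brauer k. noncrossing k d}"

definition tl_diagrams :: "nat \<Rightarrow> diagram set" where
  "tl_diagrams n = {d \<in> motzkin n. \<forall>b\<in>d. card b = 2}"

definition balanced :: "nat \<Rightarrow> diagram set" where
  "balanced k = {d \<in> motzkin k. card (cups d) = card (caps d)}"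

definition balanced_n :: "nat \<Rightarrow> nat \<Rightarrow> diagram set" where
  "balanced_n k n = {d \<in> balanced k. card (edges d) = n}"

definition id_diag :: "nat \<Rightarrow> diagram" where
  "id_diag k = {{Inl i, Inr i} | i. i \<in> {1..k}}"

definition p_diag :: "nat \<Rightarrow> nat \<Rightarrow> diagram" where
  "p_diag k j = {{Inl j}, {Inr j}} \<union> {{Inl i, Inr i} | i. i \<in> {1..k} \<and> i \<noteq> j}"


subsection \<open>Composition\<close>

text \<open>
  Stacking \<open>d\<^sub>1\<close> on \<open>d\<^sub>2\<close> gives a graph on three rows, the bottom row of \<open>d\<^sub>1\<close> and the top row of
  \<open>d\<^sub>2\<close> both being the middle row.
\<close>

datatype stacked = Upper nat | Middle nat | Lower nat

definition stack_conn :: "diagram \<Rightarrow> diagram \<Rightarrow> (stacked \<times> stacked) set" where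
  "stack_conn d1 d2 =
     ({(x, y). \<exists>b\<in>d1. x \<in> case_sum Upper Middle ` b \<and> y \<in> case_sum Upper Middle ` b} \<union>
      {(x, y). \<exists>b\<in>d2. x \<in> case_sum Middle Lower ` b \<and> y \<in> case_sum Middle Lower ` b})\<^sup>*"

definition diag_comp :: "nat \<Rightarrow> diagram \<Rightarrow> diagram \<Rightarrow> diagram" where
  "diag_comp k d1 d2 =
     vertices k // {(x, y). x \<in> vertices k \<and> y \<in> vertices k \<and>
       (case_sum Upper Lower x, case_sum Upper Lower y) \<in> stack_conn d1 d2}"

text \<open>
  A connected component of the stacked graph is a closed loop iff it lies in the middle row and each
  of its vertices has degree 2, i.e. meets an edge of \<open>d\<^sub>1\<close> and an edge of \<open>d\<^sub>2\<close>.  The other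
  components contained in the middle row are the interior paths (possibly single vertices).
\<close>

definition loops :: "nat \<Rightarrow> diagram \<Rightarrow> diagram \<Rightarrow> nat" where
  "loops k d1 d2 =
     card {C. (\<exists>j\<in>{1..k}. C = stack_conn d1 d2 `` {Middle j}) \<and> C \<subseteq> Middle ` {1..k} \<and>
       (\<forall>i. Middle i \<in> C \<longrightarrow> Inr i \<in> \<Union> (edges d1) \<and> Inl i \<in> \<Union> (edges d2))}"


section \<open>Diagram algebras\<close>

definition diagram_algebra :: "diagram set \<Rightarrow> nat \<Rightarrow> 'k::field \<Rightarrow> (diagram \<Rightarrow> 'k) ring" where
  "diagram_algebra D k \<delta> =
     \<lparr> carrier = free_space D,
       mult = (\<lambda>f g. \<Sum>d1\<in>D. \<Sum>d2\<in>D.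
         fscale (f d1 * g d2 * \<delta> ^ loops k d1 d2) (basis_vec (diag_comp k d1 d2))),
       one = basis_vec (id_diag k),
       zero = 0,
       add = (+) \<rparr>"

definition motzkin_algebra :: "nat \<Rightarrow> 'k::field \<Rightarrow> (diagram \<Rightarrow> 'k) ring" where
  "motzkin_algebra k \<delta> = diagram_algebra (motzkin k) k \<delta>"

definition TL :: "nat \<Rightarrow> 'k::field \<Rightarrow> (diagram \<Rightarrow> 'k) ring" where
  "TL n \<delta> = diagram_algebra (tl_diagrams n) n \<delta>"

definition remove_edges :: "diagram \<Rightarrow> diagram \<Rightarrow> diagram" where
  "remove_edges F d = (d - F) \<union> {{v} | v. v \<in> \<Union> F}"

definition diag_le :: "diagram \<Rightarrow> diagram \<Rightarrow> bool" where
  "diag_le d' d \<longleftrightarrow> (\<exists>F \<subseteq> edges d. d' = remove_edges F d)"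

text \<open>The number of blocks of a diagram is its cardinality.\<close>

definition bar :: "diagram \<Rightarrow> (diagram \<Rightarrow> 'k::field)" where
  "bar d = (\<Sum>d' | diag_le d' d. fscale ((- 1) powi (int (card d) - int (card d'))) (basis_vec d'))"

text \<open>The elements \<open>1 - p\<^sub>i\<close> commute, so the (increasing) order of the factors is immaterial.\<close>

definition one_minus_p_prod :: "nat \<Rightarrow> 'k::field \<Rightarrow> nat set \<Rightarrow> (diagram \<Rightarrow> 'k)" where
  "one_minus_p_prod k \<delta> I =
     foldr (\<lambda>i f. (\<one>\<^bsub>motzkin_algebra k \<delta>\<^esub> - basis_vec (p_diag k i)) \<otimes>\<^bsub>motzkin_algebra k \<delta>\<^esub> f)
       (sorted_list_of_set I) \<one>\<^bsub>motzkin_algebra k \<delta>\<^esub>"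

definition tilde :: "nat \<Rightarrow> 'k::field \<Rightarrow> diagram \<Rightarrow> (diagram \<Rightarrow> 'k)" where
  "tilde k \<delta> d =
     one_minus_p_prod k \<delta> {i. Inl i \<in> \<Union> (cups d)} \<otimes>\<^bsub>motzkin_algebra k \<delta>\<^esub> basis_vec d
       \<otimes>\<^bsub>motzkin_algebra k \<delta>\<^esub> one_minus_p_prod k \<delta> {j. Inr j \<in> \<Union> (caps d)}"

definition PTL :: "nat \<Rightarrow> 'k::field \<Rightarrow> (diagram \<Rightarrow> 'k) ring" where
  "PTL k \<delta> = (motzkin_algebra k \<delta>)\<lparr>carrier := fvs.span (tilde k \<delta> ` balanced k)\<rparr>"

definition X_space :: "nat \<Rightarrow> nat \<Rightarrow> (diagram \<Rightarrow> 'k::field) set" where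
  "X_space k n = fvs.span (bar ` balanced_n k n)"

text \<open>\<open>X(n)\<close> is an algebra with its own identity element, in general not that of \<open>PTL k \<delta>\<close>.\<close>

definition X_alg :: "nat \<Rightarrow> 'k::field \<Rightarrow> nat \<Rightarrow> (diagram \<Rightarrow> 'k) ring" where
  "X_alg k \<delta> n = (PTL k \<delta>)\<lparr>carrier := X_space k n,
     one := (THE e. e \<in> X_space k n \<and>
       (\<forall>x \<in> X_space k n. e \<otimes>\<^bsub>PTL k \<delta>\<^esub> x = x \<and> x \<otimes>\<^bsub>PTL k \<delta>\<^esub> e = x))\<rparr>"


section \<open>Modules over noncommutative rings\<close>

text \<open>
  \<^locale>\<open>module\<close> requires a commutative ring; this is the same notion of a unital (left) module over
  an arbitrary ring.  The fields \<^const>\<open>mult\<close> and \<^const>\<open>one\<close> of the module record are irrelevant.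
  The predicate \<^locale>\<open>submodule\<close> makes no commutativity assumption and is used as it is.
\<close>

locale left_module = R?: ring R + M?: abelian_group M for R (structure) and M (structure) +
  assumes smult_closed [simp, intro]:
      "\<lbrakk>a \<in> carrier R; x \<in> carrier M\<rbrakk> \<Longrightarrow> a \<odot>\<^bsub>M\<^esub> x \<in> carrier M"
    and smult_l_distr:
      "\<lbrakk>a \<in> carrier R; b \<in> carrier R; x \<in> carrier M\<rbrakk> \<Longrightarrow>
        (a \<oplus>\<^bsub>R\<^esub> b) \<odot>\<^bsub>M\<^esub> x = a \<odot>\<^bsub>M\<^esub> x \<oplus>\<^bsub>M\<^esub> b \<odot>\<^bsub>M\<^esub> x"
    and smult_r_distr:
      "\<lbrakk>a \<in> carrier R; x \<in> carrier M; y \<in> carrier M\<rbrakk> \<Longrightarrow>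
        a \<odot>\<^bsub>M\<^esub> (x \<oplus>\<^bsub>M\<^esub> y) = a \<odot>\<^bsub>M\<^esub> x \<oplus>\<^bsub>M\<^esub> a \<odot>\<^bsub>M\<^esub> y"
    and smult_assoc1:
      "\<lbrakk>a \<in> carrier R; b \<in> carrier R; x \<in> carrier M\<rbrakk> \<Longrightarrow>
        (a \<otimes>\<^bsub>R\<^esub> b) \<odot>\<^bsub>M\<^esub> x = a \<odot>\<^bsub>M\<^esub> (b \<odot>\<^bsub>M\<^esub> x)"
    and smult_one [simp]:
      "x \<in> carrier M \<Longrightarrow> \<one>\<^bsub>R\<^esub> \<odot>\<^bsub>M\<^esub> x = x"

definition simple_module :: "('a, 'r) ring_scheme \<Rightarrow> ('a, 'm, 's) module_scheme \<Rightarrow> bool" where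
  "simple_module R M \<longleftrightarrow> left_module R M \<and> carrier M \<noteq> {\<zero>\<^bsub>M\<^esub>} \<and>
     (\<forall>H. submodule H R M \<longrightarrow> H = {\<zero>\<^bsub>M\<^esub>} \<or> H = carrier M)"

text \<open>A module is semisimple if every submodule is a direct summand (Lam, First Course, Section 2).\<close>

definition semisimple_module :: "('a, 'r) ring_scheme \<Rightarrow> ('a, 'm, 's) module_scheme \<Rightarrow> bool" where
  "semisimple_module R M \<longleftrightarrow> left_module R M \<and>
     (\<forall>H. submodule H R M \<longrightarrow>
       (\<exists>K. submodule K R M \<and> H \<inter> K = {\<zero>\<^bsub>M\<^esub>} \<and> H <+>\<^bsub>M\<^esub> K = carrier M))"

definition regular_module :: "('a, 'r) ring_scheme \<Rightarrow> ('a, 'a) module" where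
  "regular_module R =
     \<lparr> carrier = carrier R, mult = mult R, one = one R, zero = zero R, add = add R,
       smult = mult R \<rparr>"

definition semisimple_ring :: "('a, 'r) ring_scheme \<Rightarrow> bool" where
  "semisimple_ring R \<longleftrightarrow> semisimple_module R (regular_module R)"

definition module_iso ::
    "('a, 'r) ring_scheme \<Rightarrow> ('a, 'm, 's) module_scheme \<Rightarrow> ('a, 'n, 't) module_scheme \<Rightarrow> ('m \<Rightarrow> 'n) set" where
  "module_iso R M N = {\<phi> \<in> iso (add_monoid M) (add_monoid N).
     \<forall>a \<in> carrier R. \<forall>x \<in> carrier M. \<phi> (a \<odot>\<^bsub>M\<^esub> x) = a \<odot>\<^bsub>N\<^esub> \<phi> x}"


section \<open>Tensoring with a based vector space\<close>

text \<open>
  A unital module \<open>N\<close> over a unital algebra of functions \<open>R\<close> is a vector space via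
  \<open>c v = (c 1\<^sub>R) v\<close>.
\<close>

definition kscale :: "('d \<Rightarrow> 'k::field, 'r) ring_scheme \<Rightarrow> ('d \<Rightarrow> 'k, 'm, 's) module_scheme \<Rightarrow> 'k \<Rightarrow> 'm \<Rightarrow> 'm"
  where "kscale R N c v = fscale c \<one>\<^bsub>R\<^esub> \<odot>\<^bsub>N\<^esub> v"

text \<open>
  For a finite set \<open>S\<close>, the tensor product (over the field) of the space with basis \<open>S\<close> and \<open>N\<close> is
  the direct sum of copies of \<open>N\<close> indexed by \<open>S\<close>: the function \<open>w\<close> stands for the sum of the pure
  tensors \<open>C \<otimes> w C\<close> over \<open>C \<in> S\<close>, see \<open>tensor_expansion\<close> below.
\<close>

definition tensor_carrier :: "'c set \<Rightarrow> ('a, 'm, 's) module_scheme \<Rightarrow> ('c \<Rightarrow> 'm) set" where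
  "tensor_carrier S N = (S \<rightarrow>\<^sub>E carrier N)"

definition pure_tensor ::
    "'c set \<Rightarrow> ('d \<Rightarrow> 'k::field, 'r) ring_scheme \<Rightarrow> ('d \<Rightarrow> 'k, 'm, 's) module_scheme \<Rightarrow>
      ('c \<Rightarrow> 'k) \<Rightarrow> 'm \<Rightarrow> ('c \<Rightarrow> 'm)" where
  "pure_tensor S R N q v = (\<lambda>C\<in>S. kscale R N (q C) v)"

definition tensor_group :: "'c set \<Rightarrow> ('a, 'm, 's) module_scheme \<Rightarrow> ('c \<Rightarrow> 'm) ring" where
  "tensor_group S N =
     \<lparr> carrier = tensor_carrier S N, mult = undefined, one = undefined,
       zero = (\<lambda>C\<in>S. \<zero>\<^bsub>N\<^esub>), add = (\<lambda>w w'. \<lambda>C\<in>S. w C \<oplus>\<^bsub>N\<^esub> w' C) \<rparr>"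

text \<open>
  The operator \<open>f \<otimes> a\<close> sends the sum of the \<open>B \<otimes> w B\<close> to the sum of the \<open>f B \<otimes> a (w B)\<close>;
  on pure tensors it is given by \<open>tensor_op_pure\<close> below.
\<close>

definition tensor_op ::
    "'c set \<Rightarrow> ('d \<Rightarrow> 'k::field, 'r) ring_scheme \<Rightarrow> ('d \<Rightarrow> 'k, 'm, 's) module_scheme \<Rightarrow>
      (('c \<Rightarrow> 'k) \<Rightarrow> ('c \<Rightarrow> 'k)) \<Rightarrow> ('d \<Rightarrow> 'k) \<Rightarrow> ('c \<Rightarrow> 'm) \<Rightarrow> ('c \<Rightarrow> 'm)" where
  "tensor_op S R N f a w =
     finsum (tensor_group S N) (\<lambda>B. pure_tensor S R N (f (basis_vec B)) (a \<odot>\<^bsub>N\<^esub> w B)) S"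

lemma TL_simps:
  "carrier (TL n \<delta>) = free_space (tl_diagrams n)" "zero (TL n \<delta>) = 0" "add (TL n \<delta>) = (+)"
  "mult (TL n \<delta>) f g = (\<Sum>d1\<in>tl_diagrams n. \<Sum>d2\<in>tl_diagrams n.
         fscale (f d1 * g d2 * \<delta> ^ loops n d1 d2) (basis_vec (diag_comp n d1 d2)))"
  by (simp_all add: TL_def diagram_algebra_def)

lemma TL_mult_scale:
  "fscale c f \<otimes>\<^bsub>TL n \<delta>\<^esub> g = fscale c (f \<otimes>\<^bsub>TL n \<delta>\<^esub> g)"
  "f \<otimes>\<^bsub>TL n \<delta>\<^esub> fscale c g = fscale c (f \<otimes>\<^bsub>TL n \<delta>\<^esub> g)"
  unfolding TL_simps fvs.scale_sum_right
  by (intro sum.cong refl; simp add: fscale_def fun_eq_iff mult_ac)+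

lemma fscale_free: "f \<in> free_space S \<Longrightarrow> fscale c f \<in> free_space S"
  by (simp add: fscale_def free_space_def)

context
  fixes n :: nat and \<delta> :: "'k::field" and N :: "(diagram \<Rightarrow> 'k, 'm) module"
  assumes N: "left_module (TL n \<delta>) N"
begin

interpretation N: left_module "TL n \<delta>" N by (rule N)

lemma scalar_in_TL: "fscale c \<one>\<^bsub>TL n \<delta>\<^esub> \<in> carrier (TL n \<delta>)"
  using N.R.one_closed by (simp add: TL_simps(1) fscale_free)

lemma kscale_closed: "v \<in> carrier N \<Longrightarrow> kscale (TL n \<delta>) N c v \<in> carrier N"
  unfolding kscale_def using scalar_in_TL by simp

lemma kscale_add_left:
  "v \<in> carrier N \<Longrightarrow>
    kscale (TL n \<delta>) N (c + c') v = kscale (TL n \<delta>) N c v \<oplus>\<^bsub>N\<^esub> kscale (TL n \<delta>) N c' v"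
  unfolding kscale_def fvs.scale_left_distrib
  using N.smult_l_distr[OF scalar_in_TL scalar_in_TL] by (simp add: TL_simps)

lemma kscale_one: "v \<in> carrier N \<Longrightarrow> kscale (TL n \<delta>) N 1 v = v"
  unfolding kscale_def by simp

lemma kscale_zero: "v \<in> carrier N \<Longrightarrow> kscale (TL n \<delta>) N 0 v = \<zero>\<^bsub>N\<^esub>"
  using kscale_add_left[of v 0 0] kscale_closed[of v 0]
  by (metis N.M.add.l_cancel_one' add_0)

lemma kscale_act:
  assumes a: "a \<in> carrier (TL n \<delta>)" and v: "v \<in> carrier N"
  shows "kscale (TL n \<delta>) N c (a \<odot>\<^bsub>N\<^esub> v) = fscale c a \<odot>\<^bsub>N\<^esub> v"
    and "a \<odot>\<^bsub>N\<^esub> kscale (TL n \<delta>) N c v = fscale c a \<odot>\<^bsub>N\<^esub> v"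
  using N.smult_assoc1[OF scalar_in_TL a v, of c] N.smult_assoc1[OF a scalar_in_TL v, of c] a
  by (simp_all add: kscale_def TL_mult_scale)

lemma kscale_kscale:
  assumes v: "v \<in> carrier N"
  shows "kscale (TL n \<delta>) N c (kscale (TL n \<delta>) N c' v) = kscale (TL n \<delta>) N (c * c') v"
  using kscale_act(1)[OF scalar_in_TL v] by (simp add: kscale_def)

lemma tensor_group_abelian: "abelian_group (tensor_group S N)"
proof (rule abelian_groupI)
  fix x assume x: "x \<in> carrier (tensor_group S N)"
  show "\<exists>y\<in>carrier (tensor_group S N). y \<oplus>\<^bsub>tensor_group S N\<^esub> x = \<zero>\<^bsub>tensor_group S N\<^esub>"
    using x N.M.l_neg
    by (intro bexI[of _ "\<lambda>C\<in>S. \<ominus>\<^bsub>N\<^esub> x C"])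
       (auto simp: tensor_group_def tensor_carrier_def PiE_iff fun_eq_iff)
qed (auto simp: tensor_group_def tensor_carrier_def PiE_iff fun_eq_iff extensional_def restrict_def
       N.M.a_ac)

lemma tensor_finsum:
  assumes "finite I" "C \<in> S" "g \<in> I \<rightarrow> tensor_carrier S N"
  shows "finsum (tensor_group S N) g I C = finsum N (\<lambda>i. g i C) I"
proof -
  interpret T: abelian_group "tensor_group S N" by (rule tensor_group_abelian)
  show ?thesis
    using assms(1,3)
  proof (induction I rule: finite_induct)
    case empty
    show ?case unfolding T.finsum_empty N.M.finsum_empty using assms(2) by (simp add: tensor_group_def)
  next
    case (insert i I)
    have 1: "g \<in> I \<rightarrow> carrier (tensor_group S N)" "g i \<in> carrier (tensor_group S N)"
      using insert.prems by (auto simp: tensor_group_def)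
    have 2: "(\<lambda>i. g i C) \<in> I \<rightarrow> carrier N" "g i C \<in> carrier N"
      using insert.prems assms(2) by (auto simp: tensor_carrier_def PiE_iff Pi_iff)
    show ?case
      using insert 1 2 assms(2) by (simp add: T.finsum_insert N.M.finsum_insert) (simp add: tensor_group_def)
  qed
qed

lemma pure_tensor_closed: "v \<in> carrier N \<Longrightarrow> pure_tensor S (TL n \<delta>) N q v \<in> tensor_carrier S N"
  by (simp add: pure_tensor_def tensor_carrier_def kscale_closed)

lemma tensor_finsum_closed:
  assumes "g \<in> I \<rightarrow> tensor_carrier S N"
  shows "finsum (tensor_group S N) g I \<in> tensor_carrier S N"
proof -
  interpret T: abelian_group "tensor_group S N" by (rule tensor_group_abelian)
  show ?thesis using T.finsum_closed[of g I] assms by (simp add: tensor_group_def)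
qed

lemma tensor_expansion:
  assumes S: "finite S" and w: "w \<in> tensor_carrier S N"
  shows "w = finsum (tensor_group S N) (\<lambda>C. pure_tensor S (TL n \<delta>) N (basis_vec C) (w C)) S"
proof -
  have wC: "w C \<in> carrier N" if "C \<in> S" for C
    using w that by (auto simp: tensor_carrier_def)
  show ?thesis
  proof (rule PiE_ext[of _ S "\<lambda>_. carrier N"])
    show "w \<in> S \<rightarrow>\<^sub>E carrier N" using w by (simp add: tensor_carrier_def)
    show "finsum (tensor_group S N) (\<lambda>C. pure_tensor S (TL n \<delta>) N (basis_vec C) (w C)) S
            \<in> S \<rightarrow>\<^sub>E carrier N"
      unfolding tensor_carrier_def[symmetric]
      by (rule tensor_finsum_closed) (auto intro!: pure_tensor_closed wC)
  next
    fix C assume C: "C \<in> S"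
    have "finsum (tensor_group S N) (\<lambda>C. pure_tensor S (TL n \<delta>) N (basis_vec C) (w C)) S C
        = finsum N (\<lambda>B. pure_tensor S (TL n \<delta>) N (basis_vec B) (w B) C) S"
      by (rule tensor_finsum) (use S C in \<open>auto intro!: pure_tensor_closed wC\<close>)
    also have "\<dots> = finsum N (\<lambda>B. if C = B then w B else \<zero>\<^bsub>N\<^esub>) S"
      by (rule N.M.finsum_cong')
         (use C wC in \<open>auto simp: pure_tensor_def basis_vec_def kscale_one kscale_zero\<close>)
    also have "\<dots> = w C"
      using N.M.finsum_singleton[OF C S, of w] wC by (simp add: Pi_iff)
    finally show "w C = finsum (tensor_group S N)
        (\<lambda>C. pure_tensor S (TL n \<delta>) N (basis_vec C) (w C)) S C" ..
  qed
qed

lemma kscale_finsum: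
  assumes "finite I" "v \<in> carrier N"
  shows "finsum N (\<lambda>i. kscale (TL n \<delta>) N (c i) v) I = kscale (TL n \<delta>) N (sum c I) v"
  using assms(1)
  by (induction I rule: finite_induct)
     (simp_all add: assms(2) kscale_zero kscale_add_left kscale_closed)

lemma tensor_op_pure:
  assumes S: "finite S" and f: "Vector_Spaces.linear fscale fscale f"
    and q: "q \<in> free_space S" and a: "a \<in> carrier (TL n \<delta>)" and v: "v \<in> carrier N"
  shows "tensor_op S (TL n \<delta>) N f a (pure_tensor S (TL n \<delta>) N q v)
       = pure_tensor S (TL n \<delta>) N (f q) (a \<odot>\<^bsub>N\<^esub> v)"
proof -
  interpret f: Vector_Spaces.linear fscale fscale f by (rule f)
  have av: "a \<odot>\<^bsub>N\<^esub> v \<in> carrier N" using a v by simp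
  have q_eq: "q = (\<Sum>B\<in>S. fscale (q B) (basis_vec B))"
  proof
    fix x
    have "(\<Sum>B\<in>S. fscale (q B) (basis_vec B)) x = (\<Sum>B\<in>S. if x = B then q B else 0)"
      using S by (induction S rule: finite_induct) (auto simp: fscale_def basis_vec_def)
    also have "\<dots> = q x" using S q by (auto simp: free_space_def)
    finally show "q x = (\<Sum>B\<in>S. fscale (q B) (basis_vec B)) x" ..
  qed
  have fq: "f q C = (\<Sum>B\<in>S. f (basis_vec B) C * q B)" for C
  proof -
    have "f q = (\<Sum>B\<in>S. fscale (q B) (f (basis_vec B)))"
      by (subst q_eq) (simp add: f.sum f.scale)
    moreover have "(\<Sum>B\<in>T. fscale (q B) (f (basis_vec B))) C = (\<Sum>B\<in>T. f (basis_vec B) C * q B)"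
      if "finite T" for T
      using that by (induction T rule: finite_induct) (simp_all add: fscale_def mult.commute)
    ultimately show ?thesis using S by simp
  qed
  have eq: "a \<odot>\<^bsub>N\<^esub> pure_tensor S (TL n \<delta>) N q v B = kscale (TL n \<delta>) N (q B) (a \<odot>\<^bsub>N\<^esub> v)"
    if "B \<in> S" for B
    using that a v by (simp add: pure_tensor_def kscale_act)
  have "tensor_op S (TL n \<delta>) N f a (pure_tensor S (TL n \<delta>) N q v) C
      = pure_tensor S (TL n \<delta>) N (f q) (a \<odot>\<^bsub>N\<^esub> v) C" if C: "C \<in> S" for C
  proof -
    have "tensor_op S (TL n \<delta>) N f a (pure_tensor S (TL n \<delta>) N q v) C
      = finsum N (\<lambda>B. pure_tensor S (TL n \<delta>) N (f (basis_vec B))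
            (a \<odot>\<^bsub>N\<^esub> pure_tensor S (TL n \<delta>) N q v B) C) S"
      unfolding tensor_op_def
      by (rule tensor_finsum) (use S C in \<open>auto simp: eq intro!: pure_tensor_closed kscale_closed av\<close>)
    also have "\<dots> = finsum N (\<lambda>B. kscale (TL n \<delta>) N (f (basis_vec B) C * q B) (a \<odot>\<^bsub>N\<^esub> v)) S"
      by (rule N.M.finsum_cong')
         (use C eq av kscale_closed in \<open>auto simp: pure_tensor_def[of S _ _ "f _"] kscale_kscale\<close>)
    also have "\<dots> = kscale (TL n \<delta>) N (f q C) (a \<odot>\<^bsub>N\<^esub> v)"
      using kscale_finsum[OF S av] by (simp add: fq)
    finally show ?thesis using C by (simp add: pure_tensor_def)
  qed
  moreover have "tensor_op S (TL n \<delta>) N f a (pure_tensor S (TL n \<delta>) N q v) \<in> S \<rightarrow>\<^sub>E carrier N"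
    unfolding tensor_op_def tensor_carrier_def[symmetric]
    by (rule tensor_finsum_closed) (auto simp: eq intro!: pure_tensor_closed kscale_closed av)
  moreover have "pure_tensor S (TL n \<delta>) N (f q) (a \<odot>\<^bsub>N\<^esub> v) \<in> S \<rightarrow>\<^sub>E carrier N"
    using pure_tensor_closed[OF av] by (simp add: tensor_carrier_def)
  ultimately show ?thesis by (intro PiE_ext)
qed

end


subsection \<open>The modules \<open>Q\<^sub>n \<otimes> N\<close>\<close>

definition subsets_n :: "nat \<Rightarrow> nat \<Rightarrow> nat set set" where
  "subsets_n k n = {C. C \<subseteq> {1..k} \<and> card C = n}"

text \<open>\<open>Q\<^sub>n\<close> is \<open>free_space (subsets_n k n)\<close>.\<close>

definition E_op :: "nat set \<Rightarrow> nat set \<Rightarrow> (nat set \<Rightarrow> 'k::field) \<Rightarrow> (nat set \<Rightarrow> 'k)" where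
  "E_op A B q = fscale (q B) (basis_vec A)"

lemma linear_E_op: "Vector_Spaces.linear fscale fscale (E_op A B)"
  by unfold_locales (auto simp: E_op_def fscale_def fun_eq_iff algebra_simps)

definition top_set :: "diagram \<Rightarrow> nat set" where
  "top_set d = {i. Inl i \<in> \<Union> (edges d)}"

definition bot_set :: "diagram \<Rightarrow> nat set" where
  "bot_set d = {i. Inr i \<in> \<Union> (edges d)}"

definition rank_in :: "nat set \<Rightarrow> nat \<Rightarrow> nat" where
  "rank_in A i = card {x \<in> A. x \<le> i}"

text \<open>Delete the isolated vertices and renumber the remaining ones in each row from left to right.\<close>

definition tl_part :: "diagram \<Rightarrow> diagram" where
  "tl_part d = (\<lambda>b. map_sum (rank_in (top_set d)) (rank_in (bot_set d)) ` b) ` edges d"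

text \<open>
  The \<open>X(n)\<close>-module \<open>Q\<^sub>n \<otimes> N\<close>, for a \<open>TL n (\<delta> - 1)\<close>-module \<open>N\<close>: the action is the linear extension
  of letting \<open>bar d\<close> act as \<open>E\<^sub>A\<^sub>,\<^sub>B \<otimes> t\<close>, where \<open>(A, t, B)\<close> is the triple of \<open>d\<close>; that is,
  \<open>x\<close> is expanded in the basis of the \<open>bar d\<close> of \<open>X(n)\<close>.
\<close>

definition Q_tensor ::
    "nat \<Rightarrow> 'k::field \<Rightarrow> nat \<Rightarrow> (diagram \<Rightarrow> 'k, 'm) module \<Rightarrow> (diagram \<Rightarrow> 'k, nat set \<Rightarrow> 'm) module" where
  "Q_tensor k \<delta> n N = ring.extend (tensor_group (subsets_n k n) N)
     \<lparr> smult = (\<lambda>x w. finsum (tensor_group (subsets_n k n) N)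
         (\<lambda>d. tensor_op (subsets_n k n) (TL n (\<delta> - 1)) N
                (E_op (top_set d) (bot_set d))
                (fscale (fvs.representation (bar ` balanced_n k n) x (bar d)) (basis_vec (tl_part d))) w)
         (balanced_n k n)) \<rparr>"

end

theory Submission
  imports Defs
begin

text \<open>
  Expanding \<open>bar d\<^sub>1\<close> and \<open>bar d\<^sub>2\<close> over sets of removed edges turns their product into an alternating
  sum over the edge subsets of the stacked graph. This graph is a union of two matchings, so its
  components are paths and loops, and removing edges affects the composite only through the set of
  components that are hit. Hence each path contributes its two alternatives with opposite signs, each loop a
  factor \<open>\<delta> - 1\<close>, and everything cancels unless the vertices used in the middle row agree. So
  \<open>X(n)\<close> is a matrix algebra over \<open>TL n (\<delta> - 1)\<close> and \<open>PTL k \<delta>\<close> is the direct product of the \<open>X(n)\<close>;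
  the theorem is then Morita theory for matrix units. Associativity of the composition of diagrams, and
  the planarity of composites, are never needed: semisimplicity includes the ring axioms, and these
  transfer between the matrix algebra and its corners.
\<close>

section \<open>Components of unions of two matchings\<close>

text \<open>The shift from \<open>\<delta>\<close> to \<open>\<delta> - 1\<close> is one
  inclusion-exclusion: a loop that keeps all its edges counts \<open>\<delta>\<close>, a loop that
  loses some counts 1, and the signs of the nonempty sets of removed edges of one loop add up to -1.
  For a path the two alternatives, intact or cut, are those that define \<open>bar\<close> of the
  composite, so they reproduce it. The obstacle is that a component usually has many edges; grouping
  the edges by component and keeping one representative of each settles it, and the same device
  merges the two endpoints of a cup in \<open>tilde\<close>. Matchings are symmetric relations, so
  that components are images under \<open>rtrancl\<close>, and the one geometric fact about them is
  that a component with an edge and an end has exactly two ends. On the ring side everything is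
  phrased through left ideals of a plain set with a multiplication, because the Temperley-Lieb
  algebra occurs as the corner \<open>e C e\<close> at a diagonal matrix unit, whose identity is not
  that of \<open>C\<close>.\<close>

definition is_matching :: "('v \<times> 'v) set \<Rightarrow> bool" where
  "is_matching r \<longleftrightarrow> finite r \<and> sym r \<and> irrefl r \<and> single_valued r"

lemma matching_sym: "is_matching r \<Longrightarrow> (x, y) \<in> r \<Longrightarrow> (y, x) \<in> r"
  unfolding is_matching_def by (meson symD)

lemma matching_unique: "is_matching r \<Longrightarrow> (x, y) \<in> r \<Longrightarrow> (x, z) \<in> r \<Longrightarrow> y = z"
  unfolding is_matching_def by (meson single_valuedD)

lemma matching_irrefl: "is_matching r \<Longrightarrow> (x, y) \<in> r \<Longrightarrow> x \<noteq> y"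
  unfolding is_matching_def by (meson irreflD)

text \<open>By induction a walk in \<open>r\<close> that starts at \<open>x\<close> never leaves
  \<open>r'\<close>, so only the vertices reached in the smaller relation have to be
  inspected.\<close>

lemma rtrancl_closed_Image:
  assumes "\<And>y z. (x, y) \<in> r'\<^sup>* \<Longrightarrow> (y, z) \<in> r \<Longrightarrow> (y, z) \<in> r'" and "r' \<subseteq> r"
  shows "r\<^sup>* `` {x} = r'\<^sup>* `` {x}"
proof
  have "(x, y) \<in> r'\<^sup>*" if "(x, y) \<in> r\<^sup>*" for y
    using that
  proof (induction rule: rtrancl_induct)
    case (step y z) then show ?case using assms(1) by (meson rtrancl.rtrancl_into_rtrancl)
  qed simp
  then show "r\<^sup>* `` {x} \<subseteq> r'\<^sup>* `` {x}" by auto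
  show "r'\<^sup>* `` {x} \<subseteq> r\<^sup>* `` {x}" using rtrancl_mono[OF assms(2)] by auto
qed

text \<open>Walk from the end \<open>x\<close>: delete its edge to \<open>x1\<close> and continue from \<open>x1\<close>, which has become an
  end of the smaller graph, with the roles of the two matchings exchanged.\<close>

lemma matching_component_ends:
  assumes "is_matching r1" "is_matching r2" "x \<in> Domain r1" "x \<notin> Domain r2"
  shows "\<exists>y. y \<noteq> x \<and> {z \<in> (r1 \<union> r2)\<^sup>* `` {x}. \<not> (z \<in> Domain r1 \<and> z \<in> Domain r2)} = {x, y}"
  using assms
proof (induction "card r1 + card r2" arbitrary: r1 r2 x rule: less_induct)
  case (less r1 r2 x)
  obtain x1 where x1: "(x, x1) \<in> r1" using less.prems by auto
  have ne: "x \<noteq> x1" using less.prems(1) x1 by (rule matching_irrefl)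
  define r1' where "r1' = r1 - {(x, x1), (x1, x)}"
  have m1': "is_matching r1'"
    using less.prems(1) unfolding r1'_def is_matching_def sym_def irrefl_def single_valued_def by auto
  have sub: "r1' \<subset> r1" using x1 by (auto simp: r1'_def)
  have fin: "finite r1" "finite r2" using less.prems by (auto simp: is_matching_def)
  have card_less: "card r2 + card r1' < card r1 + card r2"
    using psubset_card_mono[OF fin(1) sub] by simp
  have x1': "x1 \<notin> Domain r1'"
    using matching_unique[OF less.prems(1), of x1] matching_sym[OF less.prems(1) x1] by (auto simp: r1'_def)
  have x': "x \<notin> Domain r1'"
    using matching_unique[OF less.prems(1) x1] by (auto simp: r1'_def)
  have dom: "z \<in> Domain r1' \<longleftrightarrow> z \<in> Domain r1" if "z \<noteq> x" "z \<noteq> x1" for z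
    using that by (auto simp: r1'_def)
  have r1_eq: "r1 = r1' \<union> {(x, x1), (x1, x)}"
    using x1 matching_sym[OF less.prems(1) x1] by (auto simp: r1'_def)
  have xr: "x \<notin> Range r2" using less.prems(2,4) matching_sym by fastforce
  have xr': "x \<notin> Range r1'" using m1' x' matching_sym by fastforce
  define C where "C = (r2 \<union> r1')\<^sup>* `` {x1}"
  \<comment> \<open>Without its edge to \<open>x1\<close> the vertex \<open>x\<close> is isolated,
    so no walk from \<open>x1\<close> comes back to it.\<close>
  have xC: "x \<notin> C"
  proof
    assume "x \<in> C"
    then have "(x1, x) \<in> (r2 \<union> r1')\<^sup>*" by (simp add: C_def)
    then show False by (rule rtranclE) (use ne xr xr' in auto)
  qed
  have comp: "(r1 \<union> r2)\<^sup>* `` {x} = insert x C"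
  proof
    have "z \<in> insert x C" if "(x, z) \<in> (r1 \<union> r2)\<^sup>*" for z
      using that
    proof (induction rule: rtrancl_induct)
      case (step y z)
      show ?case
      proof (cases "y = x")
        case True
        then have "z = x1" using step.hyps(2) matching_unique[OF less.prems(1) x1] less.prems(4) by auto
        then show ?thesis by (simp add: C_def)
      next
        case False
        then have y: "(x1, y) \<in> (r2 \<union> r1')\<^sup>*" using step.IH by (simp add: C_def)
        have "z = x \<or> (y, z) \<in> r2 \<union> r1'" using step.hyps(2) False by (subst (asm) r1_eq) auto
        then show ?thesis using y by (auto simp: C_def intro: rtrancl.rtrancl_into_rtrancl)
      qed
    qed simp
    then show "(r1 \<union> r2)\<^sup>* `` {x} \<subseteq> insert x C" by auto
    have "(r2 \<union> r1')\<^sup>* \<subseteq> (r1 \<union> r2)\<^sup>*" using sub by (intro rtrancl_mono) auto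
    moreover have "(x, x1) \<in> (r1 \<union> r2)" using x1 by auto
    ultimately show "insert x C \<subseteq> (r1 \<union> r2)\<^sup>* `` {x}"
      by (auto simp: C_def intro: converse_rtrancl_into_rtrancl)
  qed
  show ?case
  proof (cases "x1 \<in> Domain r2")
    case True
    obtain y where y: "y \<noteq> x1" "{z \<in> C. \<not> (z \<in> Domain r2 \<and> z \<in> Domain r1')} = {x1, y}"
      using less.hyps[OF card_less less.prems(2) m1' True x1'] unfolding C_def by auto
    have yx: "y \<noteq> x" using y xC by auto
    have x1D: "x1 \<in> Domain r1" using matching_sym[OF less.prems(1) x1] by auto
    have "{z \<in> insert x C. \<not> (z \<in> Domain r1 \<and> z \<in> Domain r2)} = {x, y}"
    proof (rule Set.set_eqI)
      fix z
      have "z \<in> C \<and> \<not> (z \<in> Domain r2 \<and> z \<in> Domain r1') \<longleftrightarrow> z = x1 \<or> z = y" using y(2) by auto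
      then show "z \<in> {z \<in> insert x C. \<not> (z \<in> Domain r1 \<and> z \<in> Domain r2)} \<longleftrightarrow> z \<in> {x, y}"
        using less.prems(4) x1D True xC yx y(1) dom[of z] by (cases "z = x"; cases "z = x1") auto
    qed
    then show ?thesis using yx comp by auto
  next
    \<comment> \<open>The path is the single edge from \<open>x\<close> to \<open>x1\<close>, and
      \<open>x1\<close> is the other end.\<close>
    case False
    have "C = {x1}"
    proof -
      have "z = x1" if "(x1, z) \<in> (r2 \<union> r1')\<^sup>*" for z
        using that by (rule converse_rtranclE) (use False x1' in auto)
      then show ?thesis by (auto simp: C_def)
    qed
    then show ?thesis using comp False less.prems(4) ne by (intro exI[of _ x1]) auto
  qed
qed

text \<open>Being connected to a different vertex, \<open>x\<close> has an edge in one of the two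
  matchings, so \<open>matching_component_ends\<close> applies in one of the two orders. Since
  \<open>y\<close> is an end of the same component, it must be the second one.\<close>

lemma matching_component_ends':
  assumes "is_matching r1" "is_matching r2" "\<not> (x \<in> Domain r1 \<and> x \<in> Domain r2)"
    and "(x, y) \<in> (r1 \<union> r2)\<^sup>*" "x \<noteq> y" "\<not> (y \<in> Domain r1 \<and> y \<in> Domain r2)"
  shows "{z \<in> (r1 \<union> r2)\<^sup>* `` {x}. \<not> (z \<in> Domain r1 \<and> z \<in> Domain r2)} = {x, y}"
proof -
  have "x \<in> Domain r1 \<or> x \<in> Domain r2"
    using assms(4,5) by (auto elim: converse_rtranclE)
  then have "\<exists>y'. {z \<in> (r1 \<union> r2)\<^sup>* `` {x}. \<not> (z \<in> Domain r1 \<and> z \<in> Domain r2)} = {x, y'}"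
  proof
    assume "x \<in> Domain r1"
    then show ?thesis using matching_component_ends[OF assms(1,2), of x] assms(3) by blast
  next
    assume "x \<in> Domain r2"
    then show ?thesis
      using matching_component_ends[OF assms(2,1), of x] assms(3) unfolding Un_commute[of r2] by blast
  qed
  then obtain y' where y': "{z \<in> (r1 \<union> r2)\<^sup>* `` {x}. \<not> (z \<in> Domain r1 \<and> z \<in> Domain r2)} = {x, y'}"
    by blast
  moreover have "y \<in> {z \<in> (r1 \<union> r2)\<^sup>* `` {x}. \<not> (z \<in> Domain r1 \<and> z \<in> Domain r2)}" using assms by auto
  ultimately show ?thesis using assms(5) by auto
qed

lemma matching_restrict:
  assumes "is_matching r" "r' \<subseteq> r" "y \<in> Domain r'" "(y, z) \<in> r" shows "(y, z) \<in> r'"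
  using assms matching_unique[OF assms(1)] by (metis DomainE subsetD)

text \<open>A vertex has at most one edge in each matching. If it still has one in the subgraph, it
  is the same edge, so nothing is missing on the component.\<close>

lemma component_untouched:
  assumes "is_matching r1" "is_matching r2" "r1' \<subseteq> r1" "r2' \<subseteq> r2"
    and "\<And>z. (x, z) \<in> (r1' \<union> r2')\<^sup>* \<Longrightarrow>
        (z \<in> Domain r1 \<longrightarrow> z \<in> Domain r1') \<and> (z \<in> Domain r2 \<longrightarrow> z \<in> Domain r2')"
  shows "(r1 \<union> r2)\<^sup>* `` {x} = (r1' \<union> r2')\<^sup>* `` {x}"
proof (rule rtrancl_closed_Image)
  fix y z assume y: "(x, y) \<in> (r1' \<union> r2')\<^sup>*" and z: "(y, z) \<in> r1 \<union> r2"
  then show "(y, z) \<in> r1' \<union> r2'"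
    using matching_restrict[OF assms(1,3), of y z] matching_restrict[OF assms(2,4), of y z] assms(5)[OF y]
    by auto
qed (use assms in auto)

text \<open>Two ends that are connected in the smaller graph are the only ends of their component there, so
  this component has lost no edge.\<close>

lemma matching_subgraph_connected:
  assumes m: "is_matching r1" "is_matching r2" and m': "is_matching r1'" "is_matching r2'"
    and sub: "r1' \<subseteq> r1" "r2' \<subseteq> r2"
    and x: "\<not> (x \<in> Domain r1 \<and> x \<in> Domain r2)" and y: "\<not> (y \<in> Domain r1 \<and> y \<in> Domain r2)"
    and ne: "x \<noteq> y"
  shows "(x, y) \<in> (r1' \<union> r2')\<^sup>* \<longleftrightarrow> (x, y) \<in> (r1 \<union> r2)\<^sup>* \<and>
      (r1 \<union> r2)\<^sup>* `` {x} \<inter> ((Domain r1 - Domain r1') \<union> (Domain r2 - Domain r2')) = {}"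
proof
  assume xy: "(x, y) \<in> (r1' \<union> r2')\<^sup>*"
  have x': "\<not> (x \<in> Domain r1' \<and> x \<in> Domain r2')" and y': "\<not> (y \<in> Domain r1' \<and> y \<in> Domain r2')"
    using x y sub by auto
  have ends: "{z \<in> (r1' \<union> r2')\<^sup>* `` {x}. \<not> (z \<in> Domain r1' \<and> z \<in> Domain r2')} = {x, y}"
    by (rule matching_component_ends'[OF m' x' xy ne y'])
  have xd: "x \<in> Domain r1' \<union> Domain r2'"
    using xy ne by (auto elim: converse_rtranclE)
  have "sym (r1' \<union> r2')" using m' by (auto simp: is_matching_def intro: sym_Un)
  then have "(y, x) \<in> (r1' \<union> r2')\<^sup>*" using xy by (meson sym_rtrancl symD)
  then have yd: "y \<in> Domain r1' \<union> Domain r2'"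
    using ne by (auto elim: converse_rtranclE)
  \<comment> \<open>An end has at most one edge, and being connected to the other end in the smaller
    graph it has kept that edge. An inner vertex is no end of the smaller graph, so both of its
    edges are still there.\<close>
  have keep: "(z \<in> Domain r1 \<longrightarrow> z \<in> Domain r1') \<and> (z \<in> Domain r2 \<longrightarrow> z \<in> Domain r2')"
    if "(x, z) \<in> (r1' \<union> r2')\<^sup>*" for z
  proof (cases "z = x \<or> z = y")
    case True
    then show ?thesis
    proof
      assume "z = x" then show ?thesis using xd x sub Domain_mono[OF sub(1)] Domain_mono[OF sub(2)] by blast
    next
      assume "z = y" then show ?thesis using yd y sub Domain_mono[OF sub(1)] Domain_mono[OF sub(2)] by blast
    qed
  next
    case False
    then show ?thesis using ends that by auto
  qed
  have "(r1 \<union> r2)\<^sup>* `` {x} = (r1' \<union> r2')\<^sup>* `` {x}"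
    by (rule component_untouched[OF m sub keep])
  then show "(x, y) \<in> (r1 \<union> r2)\<^sup>* \<and>
      (r1 \<union> r2)\<^sup>* `` {x} \<inter> ((Domain r1 - Domain r1') \<union> (Domain r2 - Domain r2')) = {}"
    using xy keep by blast
next
  assume R: "(x, y) \<in> (r1 \<union> r2)\<^sup>* \<and>
      (r1 \<union> r2)\<^sup>* `` {x} \<inter> ((Domain r1 - Domain r1') \<union> (Domain r2 - Domain r2')) = {}"
  have "(r1' \<union> r2')\<^sup>* \<subseteq> (r1 \<union> r2)\<^sup>*" using sub by (intro rtrancl_mono) auto
  then have "(r1 \<union> r2)\<^sup>* `` {x} = (r1' \<union> r2')\<^sup>* `` {x}"
    using R by (intro component_untouched[OF m sub]) auto
  then show "(x, y) \<in> (r1' \<union> r2')\<^sup>*" using R by auto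
qed


section \<open>Alternating sums over subsets\<close>

lemma sum_fun_apply: "(\<Sum>i\<in>A. f i) x = (\<Sum>i\<in>A. f i x :: 'b::comm_monoid_add)"
  by (induction A rule: infinite_finite_induct) auto

text \<open>The common shape of \<open>bar\<close>, of \<open>tilde\<close> and of their products:
  \<open>h F\<close> is the contribution after the edges in \<open>F\<close> were removed. The
  values are vectors, so one set of cancellation rules serves all of them.\<close>

definition alt_sum :: "'e set \<Rightarrow> ('e set \<Rightarrow> 'd \<Rightarrow> 'k::field) \<Rightarrow> 'd \<Rightarrow> 'k" where
  "alt_sum E h = (\<Sum>F\<in>Pow E. fscale ((- 1) ^ card F) (h F))"

lemma alt_sum_empty [simp]: "alt_sum {} h = h {}"
  by (simp add: alt_sum_def fscale_def)

lemma alt_sum_cong: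
  "(\<And>F. F \<subseteq> E \<Longrightarrow> h F = h' F) \<Longrightarrow> alt_sum E h = alt_sum E h'"
  unfolding alt_sum_def by (intro sum.cong) auto

lemma alt_sum_insert:
  assumes "finite E" "e \<notin> E"
  shows "alt_sum (insert e E) h = alt_sum E h - alt_sum E (\<lambda>F. h (insert e F))"
proof -
  have inj: "inj_on (insert e) (Pow E)" using assms(2) by (auto simp: inj_on_def)
  have "alt_sum (insert e E) h = alt_sum E h + (\<Sum>F\<in>insert e ` Pow E. fscale ((- 1) ^ card F) (h F))"
    unfolding alt_sum_def Pow_insert by (rule sum.union_disjoint) (use assms in auto)
  also have "(\<Sum>F\<in>insert e ` Pow E. fscale ((- 1) ^ card F) (h F))
      = (\<Sum>F\<in>Pow E. fscale ((- 1) ^ card (insert e F)) (h (insert e F)))"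
    by (simp add: sum.reindex[OF inj])
  also have "\<dots> = (\<Sum>F\<in>Pow E. - fscale ((- 1) ^ card F) (h (insert e F)))"
  proof (intro sum.cong refl)
    fix F assume "F \<in> Pow E"
    then have "finite F" "e \<notin> F" using assms finite_subset by auto
    then show "fscale ((- 1) ^ card (insert e F)) (h (insert e F)) = - fscale ((- 1) ^ card F) (h (insert e F))"
      by (simp add: fscale_def fun_eq_iff)
  qed
  finally show ?thesis by (simp only: sum_negf alt_sum_def diff_conv_add_uminus)
qed

text \<open>Toggling \<open>r\<close> pairs the subsets with equal values and opposite
  signs.\<close>

lemma alt_sum_toggle:
  assumes "finite E" "r \<in> E" "\<And>F. F \<subseteq> E - {r} \<Longrightarrow> h (insert r F) = h F"
  shows "alt_sum E h = 0"
proof -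
  have "alt_sum (insert r (E - {r})) h = alt_sum (E - {r}) h - alt_sum (E - {r}) (\<lambda>F. h (insert r F))"
    by (rule alt_sum_insert) (use assms in auto)
  moreover have "alt_sum (E - {r}) (\<lambda>F. h (insert r F)) = alt_sum (E - {r}) h"
    by (rule alt_sum_cong) (use assms in auto)
  ultimately show ?thesis using assms by (simp add: insert_absorb)
qed

text \<open>The sets containing \<open>e\<close> cancel in pairs by toggling \<open>r\<close>, which
  leaves those that avoid \<open>e\<close>.\<close>

lemma alt_sum_drop:
  assumes "finite E" "e \<in> E" "r \<in> E" "e \<noteq> r"
    and "\<And>F. F \<subseteq> E \<Longrightarrow> e \<in> F \<Longrightarrow> h (insert r F) = h F"
  shows "alt_sum E h = alt_sum (E - {e}) h"
proof -
  have "alt_sum (insert e (E - {e})) h = alt_sum (E - {e}) h - alt_sum (E - {e}) (\<lambda>F. h (insert e F))"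
    by (rule alt_sum_insert) (use assms in auto)
  moreover have "alt_sum (E - {e}) (\<lambda>F. h (insert e F)) = 0"
  proof (rule alt_sum_toggle)
    fix F assume "F \<subseteq> E - {e} - {r}"
    then show "h (insert e (insert r F)) = h (insert e F)"
      using assms(5)[of "insert e F"] assms(2) by (auto simp: insert_commute)
  qed (use assms in auto)
  ultimately show ?thesis using assms by (simp add: insert_absorb)
qed

lemma alt_sum_reindex:
  assumes "inj_on c E"
  shows "alt_sum E (\<lambda>F. g (c ` F)) = alt_sum (c ` E) g"
proof -
  have "(\<Sum>F\<in>Pow E. fscale ((- 1) ^ card F) (g (c ` F)))
      = (\<Sum>F\<in>Pow E. fscale ((- 1) ^ card (c ` F)) (g (c ` F)))"
    by (intro sum.cong refl) (metis PowD assms card_image inj_on_subset)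
  also have "\<dots> = (\<Sum>T\<in>(`) c ` Pow E. fscale ((- 1) ^ card T) (g T))"
    by (subst sum.reindex) (use assms in \<open>auto simp: inj_on_image_Pow\<close>)
  also have "(`) c ` Pow E = Pow (c ` E)" by (rule image_Pow_surj) simp
  finally show ?thesis by (simp add: alt_sum_def)
qed

text \<open>The subsets containing an element other than a chosen representative of its class cancel in
  pairs, by toggling that representative.\<close>

lemma alt_sum_image:
  assumes "finite E"
  shows "alt_sum E (\<lambda>F. g (c ` F)) = alt_sum (c ` E) g"
proof -
  obtain R where R: "R \<subseteq> E" "inj_on c R" "c ` E = c ` R"
    using subset_image_inj[of "c ` E" c E] by auto
  have *: "alt_sum (R \<union> D) (\<lambda>F. g (c ` F)) = alt_sum R (\<lambda>F. g (c ` F))" if "finite D" "D \<subseteq> E - R" for D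
    using that
  proof (induction D rule: finite_induct)
    case (insert e D)
    obtain r where r: "r \<in> R" "c r = c e" using R(3) insert.prems by (metis Diff_iff image_iff insert_subset)
    have "alt_sum (R \<union> insert e D) (\<lambda>F. g (c ` F)) = alt_sum (R \<union> insert e D - {e}) (\<lambda>F. g (c ` F))"
    proof (rule alt_sum_drop)
      show "finite (R \<union> insert e D)" using assms R(1) insert.hyps finite_subset by auto
      fix F assume "e \<in> F"
      then show "g (c ` insert r F) = g (c ` F)" using r by (metis image_insert insert_absorb image_eqI)
    qed (use r insert.prems in auto)
    also have "R \<union> insert e D - {e} = R \<union> D" using insert by auto
    finally show ?case using insert by simp
  qed simp
  have "alt_sum E (\<lambda>F. g (c ` F)) = alt_sum R (\<lambda>F. g (c ` F))"
    using *[of "E - R"] assms R(1) by (simp add: Un_absorb1)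
  also have "\<dots> = alt_sum (c ` R) g" using alt_sum_reindex[OF R(2)] .
  finally show ?thesis using R(3) by simp
qed

lemma sum_alt_const:
  assumes "finite E"
  shows "(\<Sum>F\<in>Pow E. (- 1) ^ card F) = (if E = {} then 1 else 0 :: 'k::field)"
proof (cases "E = {}")
  case False
  then obtain r where "r \<in> E" by auto
  \<comment> \<open>Functions on \<open>unit\<close> are scalars; this turns the vector identity
    into a statement on signs.\<close>
  then have "alt_sum E (\<lambda>_ _. 1) = (0 :: unit \<Rightarrow> 'k)" by (intro alt_sum_toggle[OF assms]) auto
  then have "alt_sum E (\<lambda>_ _. 1) () = (0 :: 'k)" by simp
  then show ?thesis using False by (simp add: alt_sum_def sum_fun_apply fscale_def)
qed simp

text \<open>An element of \<open>A\<close> outside \<open>T\<close> contributes \<open>x\<close>,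
  one inside contributes 1 with a minus sign; the choices are independent, so each element of
  \<open>A\<close> gives a factor \<open>x - 1\<close>. In the application \<open>A\<close> consists
  of the loops, \<open>B\<close> of the paths, and \<open>x\<close> is
  \<open>\<delta>\<close>.\<close>

lemma alt_sum_union:
  assumes "finite A" "finite B" "A \<inter> B = {}"
  shows "alt_sum (A \<union> B) (\<lambda>T. fscale (x ^ (card A - card (T \<inter> A))) (b (T \<inter> B)))
       = fscale ((x - 1) ^ card A) (alt_sum B b)"
  using assms(1,3)
proof (induction A rule: finite_induct)
  case empty
  then show ?case by (simp add: fscale_def) (rule alt_sum_cong, simp add: Int_absorb2)
next
  case (insert e A)
  have fin: "finite (A \<union> B)" "e \<notin> A \<union> B" using insert assms by auto
  have "alt_sum (insert e (A \<union> B)) (\<lambda>T. fscale (x ^ (card (insert e A) - card (T \<inter> insert e A))) (b (T \<inter> B)))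
     = fscale x (alt_sum (A \<union> B) (\<lambda>T. fscale (x ^ (card A - card (T \<inter> A))) (b (T \<inter> B))))
     - alt_sum (A \<union> B) (\<lambda>T. fscale (x ^ (card A - card (T \<inter> A))) (b (T \<inter> B)))"
    unfolding alt_sum_insert[OF fin]
  proof (rule arg_cong2[where f = "(-)"])
    have eq: "fscale (x ^ (card (insert e A) - card (T \<inter> insert e A))) (b (T \<inter> B))
        = fscale x (fscale (x ^ (card A - card (T \<inter> A))) (b (T \<inter> B)))" if "T \<subseteq> A \<union> B" for T
    proof -
      have "T \<inter> insert e A = T \<inter> A" using that fin by auto
      moreover have "card (T \<inter> A) \<le> card A" using insert by (intro card_mono) auto
      ultimately show ?thesis using insert by (simp add: Suc_diff_le fscale_def mult.assoc)
    qed
    show "alt_sum (A \<union> B) (\<lambda>T. fscale (x ^ (card (insert e A) - card (T \<inter> insert e A))) (b (T \<inter> B)))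
        = fscale x (alt_sum (A \<union> B) (\<lambda>T. fscale (x ^ (card A - card (T \<inter> A))) (b (T \<inter> B))))"
      unfolding alt_sum_def fvs.scale_sum_right
      by (intro sum.cong refl) (simp add: eq fvs.scale_left_commute)
    show "alt_sum (A \<union> B) (\<lambda>F. fscale (x ^ (card (insert e A) - card (insert e F \<inter> insert e A))) (b (insert e F \<inter> B)))
        = alt_sum (A \<union> B) (\<lambda>T. fscale (x ^ (card A - card (T \<inter> A))) (b (T \<inter> B)))"
    proof (rule alt_sum_cong)
      fix T assume T: "T \<subseteq> A \<union> B"
      have "insert e T \<inter> insert e A = insert e (T \<inter> A)" by auto
      moreover have "e \<notin> T \<inter> A" "finite (T \<inter> A)" using insert by auto
      moreover have "insert e T \<inter> B = T \<inter> B" using fin by auto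
      ultimately show "fscale (x ^ (card (insert e A) - card (insert e T \<inter> insert e A))) (b (insert e T \<inter> B))
        = fscale (x ^ (card A - card (T \<inter> A))) (b (T \<inter> B))" using insert by simp
    qed
  qed
  also have "\<dots> = fscale ((x - 1) ^ card (insert e A)) (alt_sum B b)"
    using insert by (simp add: fvs.scale_left_diff_distrib mult.commute) (simp add: fscale_def fun_eq_iff algebra_simps)
  finally show ?case by simp
qed


section \<open>Partial Brauer diagrams and their edges\<close>

lemma finite_vertices [simp]: "finite (vertices k)"
  by (simp add: vertices_def)

lemma in_vertices [simp]:
  "Inl i \<in> vertices k \<longleftrightarrow> i \<in> {1..k}" "Inr i \<in> vertices k \<longleftrightarrow> i \<in> {1..k}"
  by (auto simp: vertices_def)

lemma card_vertices: "card (vertices k) = 2 * k"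
proof -
  have "card (vertices k) = card (Inl ` {1..k} :: (nat + nat) set) + card (Inr ` {1..k} :: (nat + nat) set)"
    unfolding vertices_def by (rule card_Un_disjoint) auto
  then show ?thesis by (simp add: card_image)
qed

text \<open>Diagrams are handled through their edges alone: \<open>diag_of\<close> adds the isolated
  vertices back, and removing edges becomes a set difference.\<close>

definition edge_set :: "nat \<Rightarrow> diagram \<Rightarrow> bool" where
  "edge_set k E \<longleftrightarrow> (\<forall>e\<in>E. e \<subseteq> vertices k \<and> card e = 2) \<and> (\<forall>e\<in>E. \<forall>f\<in>E. e \<inter> f \<noteq> {} \<longrightarrow> e = f)"

definition diag_of :: "nat \<Rightarrow> diagram \<Rightarrow> diagram" where
  "diag_of k E = E \<union> {{v} | v. v \<in> vertices k - \<Union> E}"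

lemma edge_set_subset: "edge_set k E \<Longrightarrow> E' \<subseteq> E \<Longrightarrow> edge_set k E'"
  unfolding edge_set_def by blast

lemma edge_set_pairD:
  assumes "edge_set k E" "{a, b} \<in> E"
  shows "a \<noteq> b" "a \<in> vertices k" "b \<in> vertices k"
  using assms by (force simp: edge_set_def)+

lemma edge_set_unique:
  assumes "edge_set k E" "{a, b} \<in> E" "{a, c} \<in> E" shows "b = c"
proof -
  have "{a, b} = {a, c}" using assms unfolding edge_set_def by (metis Int_iff empty_iff insertI1)
  then show ?thesis by (metis doubleton_eq_iff)
qed

lemma edge_set_obtain:
  assumes "edge_set k E" "e \<in> E" obtains a b where "e = {a, b}" "a \<noteq> b"
  using assms unfolding edge_set_def by (meson card_2_iff)

lemma edge_set_other:
  assumes "edge_set k E" "a \<in> \<Union> E" obtains b where "{a, b} \<in> E"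
proof -
  obtain e where e: "e \<in> E" "a \<in> e" using assms(2) by auto
  obtain x y where "e = {x, y}" "x \<noteq> y" using edge_set_obtain[OF assms(1) e(1)] .
  then show ?thesis using e that by (metis insert_commute insertE singletonD)
qed

lemma diag_of_pb: "edge_set k E \<Longrightarrow> diag_of k E \<in> partial_brauer k"
proof -
  assume E: "edge_set k E"
  have "partition_on (vertices k) (diag_of k E)"
  proof (rule partition_onI)
    show "\<Union> (diag_of k E) = vertices k" 
    proof -
      have "\<Union> {{v} | v. v \<in> vertices k - \<Union> E} = vertices k - \<Union> E" by blast
      then have "\<Union> (diag_of k E) = \<Union> E \<union> (vertices k - \<Union> E)" by (simp only: diag_of_def Union_Un_distrib)
      moreover have "\<Union> E \<subseteq> vertices k" using E by (auto simp: edge_set_def)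
      ultimately show ?thesis by blast
    qed
    show "{} \<notin> diag_of k E" using E by (auto simp: edge_set_def diag_of_def)
    fix p q assume "p \<in> diag_of k E" "q \<in> diag_of k E" "p \<noteq> q"
    then consider "p \<in> E" "q \<in> E" | v where "p \<in> E" "q = {v}" "v \<notin> \<Union> E"
      | v where "q \<in> E" "p = {v}" "v \<notin> \<Union> E" | v w where "p = {v}" "q = {w}"
      by (auto simp: diag_of_def)
    then show "disjnt p q"
    proof cases
      case 1
      then have "p \<inter> q = {}" using E \<open>p \<noteq> q\<close> by (meson edge_set_def)
      then show ?thesis by (simp add: disjnt_def)
    qed (use \<open>p \<noteq> q\<close> in \<open>auto simp: disjnt_def\<close>)
  qed
  moreover have "card b \<le> 2" if "b \<in> diag_of k E" for b
    using that E by (auto simp: diag_of_def edge_set_def)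
  ultimately show ?thesis unfolding partial_brauer_def by blast
qed

lemma edges_diag_of [simp]: "edge_set k E \<Longrightarrow> edges (diag_of k E) = E"
  unfolding edges_def diag_of_def edge_set_def by auto

lemma pb_edge_set:
  assumes "d \<in> partial_brauer k" shows "edge_set k (edges d)"
  using assms unfolding partial_brauer_def edges_def edge_set_def partition_on_def disjoint_def by auto

lemma pb_diag_of:
  assumes "d \<in> partial_brauer k" shows "d = diag_of k (edges d)"
proof -
  have part: "partition_on (vertices k) d" and le: "\<And>b. b \<in> d \<Longrightarrow> card b \<le> 2"
    using assms by (auto simp: partial_brauer_def)
  have single: "\<exists>v. b = {v}" if "b \<in> d" "b \<notin> edges d" for b
  proof -
    have "b \<noteq> {}" "finite b"
      using that part finite_subset[OF _ finite_vertices[of k], of b] by (auto simp: partition_on_def)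
    then have "card b \<noteq> 0" by auto
    moreover have "card b \<noteq> 2" using that by (auto simp: edges_def)
    ultimately have "card b = 1" using le[OF that(1)] by linarith
    then show ?thesis by (simp add: card_1_singleton_iff)
  qed
  have uniq: "b = c" if "b \<in> d" "c \<in> d" "v \<in> b" "v \<in> c" for b c v
    using part that unfolding partition_on_def disjoint_def by auto
  have ed: "edges d \<subseteq> d" by (auto simp: edges_def)
  show ?thesis
  proof
    show "d \<subseteq> diag_of k (edges d)"
    proof
      fix b assume b: "b \<in> d"
      show "b \<in> diag_of k (edges d)"
      proof (cases "b \<in> edges d")
        case False
        then obtain v where v: "b = {v}" using single b by auto
        have "v \<in> vertices k" using part b v by (auto simp: partition_on_def)
        moreover have "v \<notin> \<Union> (edges d)" using uniq[OF b, of _ v] v ed False by auto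
        ultimately show ?thesis using v by (auto simp: diag_of_def)
      qed (auto simp: diag_of_def)
    qed
    show "diag_of k (edges d) \<subseteq> d"
    proof
      fix b assume "b \<in> diag_of k (edges d)"
      then consider "b \<in> edges d" | v where "b = {v}" "v \<in> vertices k" "v \<notin> \<Union> (edges d)"
        by (auto simp: diag_of_def)
      then show "b \<in> d"
      proof cases
        case 2
        then obtain c where c: "c \<in> d" "v \<in> c" using part by (auto simp: partition_on_def)
        then show ?thesis using 2 single[OF c(1)] by auto
      qed (use ed in auto)
    qed
  qed
qed

lemma pb_eqI: "d \<in> partial_brauer k \<Longrightarrow> d' \<in> partial_brauer k \<Longrightarrow> edges d = edges d' \<Longrightarrow> d = d'"
  by (metis pb_diag_of)

lemma finite_partial_brauer [simp]: "finite (partial_brauer k)"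
  by (rule finite_subset[of _ "Pow (Pow (vertices k))"]) (auto simp: partial_brauer_def partition_on_def)

lemma finite_edge_set: "edge_set k E \<Longrightarrow> finite E"
  by (rule finite_subset[of _ "Pow (vertices k)"]) (auto simp: edge_set_def)

lemma finite_edges: "d \<in> partial_brauer k \<Longrightarrow> finite (edges d)"
  using finite_edge_set pb_edge_set by blast

text \<open>An edge uses up two of the \<open>2 * k\<close> vertices in one block, so each removed
  edge raises the number of blocks by one. This converts the exponent in \<open>bar\<close> into a
  count of removed edges.\<close>

lemma card_blocks_edges:
  assumes "d \<in> partial_brauer k" shows "card d + card (edges d) = 2 * k"
proof -
  have E: "edge_set k (edges d)" using pb_edge_set[OF assms] .
  let ?U = "\<Union> (edges d)"
  have U: "?U \<subseteq> vertices k" using E by (auto simp: edge_set_def)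
  have cU: "card ?U = 2 * card (edges d)"
  proof -
    have "card ?U = (\<Sum>e\<in>edges d. card e)"
    proof (rule card_Union_disjoint)
      show "pairwise disjnt (edges d)" using E unfolding edge_set_def pairwise_def disjnt_def by blast
      show "\<And>e. e \<in> edges d \<Longrightarrow> finite e"
        using E finite_subset[OF _ finite_vertices[of k]] by (simp add: edge_set_def)
    qed
    also have "\<dots> = (\<Sum>e\<in>edges d. 2)" using E by (intro sum.cong) (auto simp: edge_set_def)
    finally show ?thesis by simp
  qed
  have "card (diag_of k (edges d)) = card (edges d) + card ((\<lambda>v. {v}) ` (vertices k - ?U))"
    unfolding diag_of_def Setcompr_eq_image
    using E finite_edges[OF assms] by (intro card_Un_disjoint) (auto simp: edge_set_def)
  also have "card ((\<lambda>v. {v}) ` (vertices k - ?U)) = 2 * k - 2 * card (edges d)"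
    using U by (simp add: card_image card_Diff_subset finite_subset[OF U] card_vertices cU)
  finally have "card d = card (edges d) + (2 * k - 2 * card (edges d))"
    using pb_diag_of[OF assms] by simp
  moreover have "2 * card (edges d) \<le> 2 * k" using card_mono[OF _ U] by (simp add: cU card_vertices)
  ultimately show ?thesis by simp
qed

lemma remove_edges_diag_of:
  assumes "d \<in> partial_brauer k" "F \<subseteq> edges d"
  shows "remove_edges F d = diag_of k (edges d - F)"
proof -
  have E: "edge_set k (edges d)" using pb_edge_set[OF assms(1)] .
  have 1: "diag_of k (edges d) - F = (edges d - F) \<union> {{v} | v. v \<in> vertices k - \<Union> (edges d)}"
    using assms(2) E unfolding diag_of_def edge_set_def by fastforce
  have 2: "vertices k - \<Union> (edges d - F) = (vertices k - \<Union> (edges d)) \<union> \<Union> F"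
    using assms(2) E unfolding edge_set_def by blast
  have "remove_edges F (diag_of k (edges d)) = diag_of k (edges d - F)"
    unfolding remove_edges_def 1 unfolding diag_of_def 2 by auto
  then show ?thesis using pb_diag_of[OF assms(1)] by simp
qed

lemma remove_edges_pb:
  assumes "d \<in> partial_brauer k" "F \<subseteq> edges d"
  shows "remove_edges F d \<in> partial_brauer k" "edges (remove_edges F d) = edges d - F"
  using edge_set_subset[OF pb_edge_set[OF assms(1)], of "edges d - F"]
  by (auto simp: remove_edges_diag_of[OF assms] diag_of_pb)

lemma remove_edges_empty [simp]: "remove_edges {} d = d"
  by (simp add: remove_edges_def)

lemma diag_le_pb:
  assumes "d \<in> partial_brauer k" "d' \<in> partial_brauer k"
  shows "diag_le d' d \<longleftrightarrow> edges d' \<subseteq> edges d"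
proof
  assume "diag_le d' d"
  then show "edges d' \<subseteq> edges d" using remove_edges_pb(2)[OF assms(1)] by (auto simp: diag_le_def)
next
  assume sub: "edges d' \<subseteq> edges d"
  have "d' = remove_edges (edges d - edges d') d"
  proof (rule pb_eqI[OF assms(2)])
    show "remove_edges (edges d - edges d') d \<in> partial_brauer k" by (rule remove_edges_pb(1)[OF assms(1)]) simp
    have "edges (remove_edges (edges d - edges d') d) = edges d - (edges d - edges d')"
      by (rule remove_edges_pb(2)[OF assms(1)]) simp
    then show "edges d' = edges (remove_edges (edges d - edges d') d)" using sub by blast
  qed
  then show "diag_le d' d" unfolding diag_le_def by blast
qed

lemma inj_on_remove_edges:
  assumes "d \<in> partial_brauer k" shows "inj_on (\<lambda>F. remove_edges F d) (Pow (edges d))"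
proof (rule inj_onI)
  fix F G assume "F \<in> Pow (edges d)" "G \<in> Pow (edges d)" "remove_edges F d = remove_edges G d"
  then have "edges d - F = edges d - G" "F \<subseteq> edges d" "G \<subseteq> edges d"
    using remove_edges_pb(2)[OF assms] by (metis PowD)+
  then show "F = G" by blast
qed

lemma remove_edges_remove_edges:
  assumes "d \<in> partial_brauer k" "F \<subseteq> edges d" "G \<subseteq> edges d - F"
  shows "remove_edges G (remove_edges F d) = remove_edges (F \<union> G) d"
proof (rule pb_eqI)
  note r = remove_edges_pb[OF assms(1,2)]
  show "remove_edges G (remove_edges F d) \<in> partial_brauer k"
    using remove_edges_pb(1)[OF r(1)] assms(3) r(2) by simp
  show "remove_edges (F \<union> G) d \<in> partial_brauer k" using assms by (intro remove_edges_pb(1)) auto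
  show "edges (remove_edges G (remove_edges F d)) = edges (remove_edges (F \<union> G) d)"
    using assms r remove_edges_pb(2)[OF r(1), of G] remove_edges_pb(2)[OF assms(1), of "F \<union> G"] by auto
qed

text \<open>The diagrams below \<open>d\<close> form the Boolean lattice of its edge sets, so the
  sum over them is an inclusion-exclusion over the removed edges.\<close>

lemma bar_alt_sum:
  assumes "d \<in> partial_brauer k"
  shows "bar d = alt_sum (edges d) (\<lambda>F. basis_vec (remove_edges F d) :: diagram \<Rightarrow> 'k::field)"
proof -
  have im: "{d'. diag_le d' d} = (\<lambda>F. remove_edges F d) ` Pow (edges d)"
    by (auto simp: diag_le_def)
  \<comment> \<open>The exponent is minus the number of removed edges, and -1 is its own
    inverse.\<close>
  have sgn: "(- 1) powi (int (card d) - int (card (remove_edges F d))) = ((- 1) ^ card F :: 'k)"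
    if "F \<subseteq> edges d" for F
  proof -
    have "card (edges d) = card (edges d - F) + card F"
      using finite_edges[OF assms] that by (simp add: card_Diff_subset card_mono finite_subset)
    then have "int (card d) - int (card (remove_edges F d)) = - int (card F)"
      using card_blocks_edges[OF assms]
        card_blocks_edges[OF remove_edges_pb(1)[OF assms that], unfolded remove_edges_pb(2)[OF assms that]]
      by linarith
    then have "(- 1) powi (int (card d) - int (card (remove_edges F d))) = inverse ((- 1) ^ card F :: 'k)"
      by (simp only: power_int_minus power_int_of_nat)
    also have "\<dots> = (- 1) ^ card F" by (simp flip: power_inverse)
    finally show ?thesis .
  qed
  show ?thesis
    unfolding bar_def im alt_sum_def sum.reindex[OF inj_on_remove_edges[OF assms]] o_def
    by (intro sum.cong refl) (simp add: sgn)
qed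


subsection \<open>Coordinates with respect to the elements \<open>bar d\<close>\<close>

text \<open>By Moebius inversion over \<^const>\<open>diag_le\<close> the coordinate at \<open>bar d\<close> is a sum over the diagrams
  above \<open>d\<close>.\<close>

definition coef :: "nat \<Rightarrow> diagram \<Rightarrow> (diagram \<Rightarrow> 'k::field) \<Rightarrow> 'k" where
  "coef k d f = (\<Sum>d'\<in>{d' \<in> partial_brauer k. diag_le d d'}. f d')"

lemma coef_linear:
  "coef k d (f + g) = coef k d f + coef k d g" "coef k d (fscale c f) = c * coef k d f"
  "coef k d 0 = 0" "coef k d (- f) = - coef k d f"
  by (simp_all add: coef_def sum.distrib sum_distrib_left fscale_def sum_negf)

lemma coef_sum: "coef k d (\<Sum>i\<in>A. f i) = (\<Sum>i\<in>A. coef k d (f i))"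
  unfolding coef_def sum_fun_apply by (rule sum.swap)

lemma coef_basis_vec:
  assumes "d' \<in> partial_brauer k"
  shows "coef k d (basis_vec d') = (if diag_le d d' then 1 else 0)"
proof -
  have "coef k d (basis_vec d') = (\<Sum>x\<in>{x \<in> partial_brauer k. diag_le d x}. if x = d' then 1 else 0)"
    by (simp add: coef_def basis_vec_def)
  also have "\<dots> = (if diag_le d d' then 1 else 0)" using assms by (subst sum.delta) auto
  finally show ?thesis .
qed

text \<open>The diagrams between \<open>d\<close> and \<open>d'\<close> form a Boolean lattice,
  whose alternating sum vanishes unless it has a single element; if \<open>d\<close> is not below
  \<open>d'\<close>, the sum is empty. Thus the \<open>coef k d\<close> are the coordinate
  functionals dual to the \<open>bar\<close> family.\<close>

lemma coef_bar:
  assumes "d \<in> partial_brauer k" "d' \<in> partial_brauer k"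
  shows "coef k d (bar d' :: diagram \<Rightarrow> 'k::field) = (if d = d' then 1 else 0)"
proof -
  have fin: "finite (edges d')" using finite_edges[OF assms(2)] .
  have "coef k d (bar d' :: diagram \<Rightarrow> 'k)
      = (\<Sum>F\<in>Pow (edges d'). (- 1) ^ card F * (if edges d \<subseteq> edges d' - F then 1 else 0))"
    unfolding bar_alt_sum[OF assms(2)] alt_sum_def coef_sum coef_linear
  proof (intro sum.cong refl)
    fix F assume "F \<in> Pow (edges d')"
    then have r: "remove_edges F d' \<in> partial_brauer k" "edges (remove_edges F d') = edges d' - F"
      using remove_edges_pb[OF assms(2)] by auto
    show "(- 1) ^ card F * coef k d (basis_vec (remove_edges F d'))
       = (- 1) ^ card F * (if edges d \<subseteq> edges d' - F then 1 else 0 :: 'k)"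
      by (simp add: coef_basis_vec[OF r(1)] diag_le_pb[OF r(1) assms(1)] r(2))
  qed
  also have "\<dots> = (\<Sum>F\<in>{F \<in> Pow (edges d'). edges d \<subseteq> edges d' - F}. (- 1) ^ card F)"
    by (subst sum.inter_filter) (use fin in \<open>auto intro!: sum.cong\<close>)
  also have "\<dots> = (if d = d' then 1 else 0)"
  proof (cases "edges d \<subseteq> edges d'")
    case True
    then have "{F \<in> Pow (edges d'). edges d \<subseteq> edges d' - F} = Pow (edges d' - edges d)" by auto
    moreover have "edges d' - edges d = {} \<longleftrightarrow> d = d'" using True pb_eqI[OF assms] by auto
    ultimately show ?thesis using sum_alt_const[of "edges d' - edges d"] fin by simp
  next
    case False
    then have *: "{F \<in> Pow (edges d'). edges d \<subseteq> edges d' - F} = {}" by auto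
    have "d \<noteq> d'" using False by auto
    then show ?thesis unfolding * by simp
  qed
  finally show ?thesis .
qed


section \<open>Composition in terms of edges\<close>

definition upper_matching :: "diagram \<Rightarrow> (stacked \<times> stacked) set" where
  "upper_matching d = {(case_sum Upper Middle a, case_sum Upper Middle b) | a b. {a, b} \<in> edges d}"

definition lower_matching :: "diagram \<Rightarrow> (stacked \<times> stacked) set" where
  "lower_matching d = {(case_sum Middle Lower a, case_sum Middle Lower b) | a b. {a, b} \<in> edges d}"

abbreviation outer :: "nat + nat \<Rightarrow> stacked" where
  "outer \<equiv> case_sum Upper Lower"

lemma inj_case_sums:
  "inj (case_sum Upper Middle)" "inj (case_sum Middle Lower)" "inj outer"
  by (auto simp: inj_def split: sum.splits)

lemma case_sum_image_iff:
  "Upper i \<in> case_sum Upper Middle ` S \<longleftrightarrow> Inl i \<in> S"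
  "Middle i \<in> case_sum Upper Middle ` S \<longleftrightarrow> Inr i \<in> S"
  "Lower i \<notin> case_sum Upper Middle ` S"
  "Middle i \<in> case_sum Middle Lower ` S \<longleftrightarrow> Inl i \<in> S"
  "Lower i \<in> case_sum Middle Lower ` S \<longleftrightarrow> Inr i \<in> S"
  "Upper i \<notin> case_sum Middle Lower ` S"
  using inj_image_mem_iff[OF inj_case_sums(1), of "Inl i" S] inj_image_mem_iff[OF inj_case_sums(1), of "Inr i" S]
    inj_image_mem_iff[OF inj_case_sums(2), of "Inl i" S] inj_image_mem_iff[OF inj_case_sums(2), of "Inr i" S]
  by (simp_all add: image_iff split: sum.splits)

lemma matching_image:
  assumes E: "edge_set k E" and inj: "inj h"
  shows "is_matching {(h a, h b) | a b. {a, b} \<in> E}"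
  unfolding is_matching_def
proof (intro conjI)
  have "{(h a, h b) | a b. {a, b} \<in> E} \<subseteq> (h ` vertices k) \<times> (h ` vertices k)"
    using edge_set_pairD[OF E] by auto
  then show "finite {(h a, h b) | a b. {a, b} \<in> E}" by (rule finite_subset) auto
  show "sym {(h a, h b) | a b. {a, b} \<in> E}" 
    unfolding sym_def by clarify (metis insert_commute)
  show "irrefl {(h a, h b) | a b. {a, b} \<in> E}"
    using edge_set_pairD(1)[OF E] inj by (auto simp: irrefl_def inj_def)
  show "single_valued {(h a, h b) | a b. {a, b} \<in> E}"
    unfolding single_valued_def
  proof clarsimp
    fix a b a' b' assume "{a, b} \<in> E" "h a = h a'" "{a', b'} \<in> E"
    then show "h b = h b'" using edge_set_unique[OF E] injD[OF inj, of a a'] by metis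
  qed
qed

lemma
  assumes "d \<in> partial_brauer k"
  shows upper_is_matching: "is_matching (upper_matching d)"
    and lower_is_matching: "is_matching (lower_matching d)"
  using matching_image[OF pb_edge_set[OF assms]] inj_case_sums
  by (auto simp: upper_matching_def lower_matching_def)

lemma
  assumes "d \<in> partial_brauer k"
  shows Domain_upper_matching: "Domain (upper_matching d) = case_sum Upper Middle ` \<Union> (edges d)"
    and Domain_lower_matching: "Domain (lower_matching d) = case_sum Middle Lower ` \<Union> (edges d)"
proof -
  have *: "Domain {(h a, h b) | a b. {a, b} \<in> edges d} = h ` \<Union> (edges d)" for h :: "nat + nat \<Rightarrow> stacked"
  proof
    show "h ` \<Union> (edges d) \<subseteq> Domain {(h a, h b) | a b. {a, b} \<in> edges d}"
    proof clarify
      fix a e assume "a \<in> e" "e \<in> edges d"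
      then have "a \<in> \<Union> (edges d)" by blast
      then obtain b where "{a, b} \<in> edges d" using edge_set_other[OF pb_edge_set[OF assms]] by metis
      then show "h a \<in> Domain {(h a, h b) | a b. {a, b} \<in> edges d}" by blast
    qed
  qed blast
  show "Domain (upper_matching d) = case_sum Upper Middle ` \<Union> (edges d)"
    "Domain (lower_matching d) = case_sum Middle Lower ` \<Union> (edges d)"
    unfolding upper_matching_def lower_matching_def by (rule *)+
qed

lemma Domain_matching_iff:
  assumes "d \<in> partial_brauer k"
  shows "Upper i \<in> Domain (upper_matching d) \<longleftrightarrow> Inl i \<in> \<Union> (edges d)"
    and "Middle i \<in> Domain (upper_matching d) \<longleftrightarrow> Inr i \<in> \<Union> (edges d)"
    and "Lower i \<notin> Domain (upper_matching d)"
    and "Middle i \<in> Domain (lower_matching d) \<longleftrightarrow> Inl i \<in> \<Union> (edges d)"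
    and "Lower i \<in> Domain (lower_matching d) \<longleftrightarrow> Inr i \<in> \<Union> (edges d)"
    and "Upper i \<notin> Domain (lower_matching d)"
  unfolding Domain_upper_matching[OF assms] Domain_lower_matching[OF assms]
  by (simp_all add: case_sum_image_iff del: Union_iff)

text \<open>Singleton blocks only relate a vertex to itself, which \<open>rtrancl\<close> does
  anyway, so the connectivity of the stacked graph comes from the two matchings formed by the
  edges.\<close>

lemma stack_conn_matchings:
  assumes "d1 \<in> partial_brauer k" "d2 \<in> partial_brauer k"
  shows "stack_conn d1 d2 = (upper_matching d1 \<union> lower_matching d2)\<^sup>*"
proof -
  have blk: "\<exists>a b. x = h a \<and> y = h b \<and> (a = b \<or> {a, b} \<in> edges d)"
    if b: "d \<in> partial_brauer k" "b \<in> d" "x \<in> h ` b" "y \<in> h ` b" for d b x y and h :: "nat + nat \<Rightarrow> stacked"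
  proof -
    obtain u v where uv: "x = h u" "y = h v" "u \<in> b" "v \<in> b" using b(3,4) by blast
    show ?thesis
    proof (cases "b \<in> edges d")
      case True
      then obtain p q where "b = {p, q}" "p \<noteq> q" using edge_set_obtain[OF pb_edge_set[OF b(1)]] by metis
      then show ?thesis using uv True by (metis insert_commute insertE singletonD)
    next
      case False
      then have "\<exists>w. b = {w}" using b pb_diag_of[OF b(1)] unfolding diag_of_def by blast
      then show ?thesis using uv by auto
    qed
  qed
  have ed: "edges d \<subseteq> d" for d by (auto simp: edges_def)
  show ?thesis
    unfolding stack_conn_def
  proof (rule rtrancl_subset)
    show "upper_matching d1 \<union> lower_matching d2 \<subseteq>
      {(x, y). \<exists>b\<in>d1. x \<in> case_sum Upper Middle ` b \<and> y \<in> case_sum Upper Middle ` b} \<union>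
      {(x, y). \<exists>b\<in>d2. x \<in> case_sum Middle Lower ` b \<and> y \<in> case_sum Middle Lower ` b}"
    proof (rule Un_mono; rule subrelI)
      fix x y assume "(x, y) \<in> upper_matching d1"
      then obtain a b where ab: "x = case_sum Upper Middle a" "y = case_sum Upper Middle b" "{a, b} \<in> d1"
        using ed unfolding upper_matching_def by auto
      show "(x, y) \<in> {(x, y). \<exists>b\<in>d1. x \<in> case_sum Upper Middle ` b \<and> y \<in> case_sum Upper Middle ` b}"
        unfolding mem_Collect_eq case_prod_conv by (rule bexI[OF _ ab(3)]) (simp add: ab)
    next
      fix x y assume "(x, y) \<in> lower_matching d2"
      then obtain a b where ab: "x = case_sum Middle Lower a" "y = case_sum Middle Lower b" "{a, b} \<in> d2"
        using ed unfolding lower_matching_def by auto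
      show "(x, y) \<in> {(x, y). \<exists>b\<in>d2. x \<in> case_sum Middle Lower ` b \<and> y \<in> case_sum Middle Lower ` b}"
        unfolding mem_Collect_eq case_prod_conv by (rule bexI[OF _ ab(3)]) (simp add: ab)
    qed
    show "{(x, y). \<exists>b\<in>d1. x \<in> case_sum Upper Middle ` b \<and> y \<in> case_sum Upper Middle ` b} \<union>
      {(x, y). \<exists>b\<in>d2. x \<in> case_sum Middle Lower ` b \<and> y \<in> case_sum Middle Lower ` b}
      \<subseteq> (upper_matching d1 \<union> lower_matching d2)\<^sup>*"
    proof (rule Un_least; rule subrelI; clarify)
      fix x y b assume "b \<in> d1" "x \<in> b" "y \<in> b"
      then show "(case_sum Upper Middle x, case_sum Upper Middle y) \<in> (upper_matching d1 \<union> lower_matching d2)\<^sup>*"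
        using blk[OF assms(1), of b "case_sum Upper Middle x" "case_sum Upper Middle" "case_sum Upper Middle y"]
        by (auto simp: upper_matching_def)
    next
      fix x y b assume "b \<in> d2" "x \<in> b" "y \<in> b"
      then show "(case_sum Middle Lower x, case_sum Middle Lower y) \<in> (upper_matching d1 \<union> lower_matching d2)\<^sup>*"
        using blk[OF assms(2), of b "case_sum Middle Lower x" "case_sum Middle Lower" "case_sum Middle Lower y"]
        by (auto simp: lower_matching_def)
    qed
  qed
qed

lemma sym_stack_conn: "sym (stack_conn d1 d2)"
  unfolding stack_conn_def by (rule sym_rtrancl) (auto simp: sym_def)

lemma stack_conn_refl [simp]: "(x, x) \<in> stack_conn d1 d2"
  by (simp add: stack_conn_def)

lemma stack_conn_trans: "(x, y) \<in> stack_conn d1 d2 \<Longrightarrow> (y, z) \<in> stack_conn d1 d2 \<Longrightarrow> (x, z) \<in> stack_conn d1 d2"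
  unfolding stack_conn_def by (rule rtrancl_trans)

lemma stack_conn_sym: "(x, y) \<in> stack_conn d1 d2 \<Longrightarrow> (y, x) \<in> stack_conn d1 d2"
  using sym_stack_conn by (meson symD)

text \<open>An outer vertex belongs to only one of the two diagrams, hence meets at most one of the
  two matchings.\<close>

lemma outer_is_end:
  assumes "d1 \<in> partial_brauer k" "d2 \<in> partial_brauer k"
  shows "\<not> (outer x \<in> Domain (upper_matching d1) \<and> outer x \<in> Domain (lower_matching d2))"
  using Domain_matching_iff[OF assms(1)] Domain_matching_iff[OF assms(2)] by (cases x) auto

definition comp_edges :: "nat \<Rightarrow> diagram \<Rightarrow> diagram \<Rightarrow> diagram" where
  "comp_edges k d1 d2 =
     {{x, y} | x y. x \<in> vertices k \<and> y \<in> vertices k \<and> x \<noteq> y \<and> (outer x, outer y) \<in> stack_conn d1 d2}"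

text \<open>Outer vertices are ends, and a component has at most two of those. This is why the
  blocks of a composite have at most two elements.\<close>

lemma stack_conn_end_unique:
  assumes d: "d1 \<in> partial_brauer k" "d2 \<in> partial_brauer k"
    and "(outer x, outer y) \<in> stack_conn d1 d2" "x \<noteq> y" "(outer x, outer z) \<in> stack_conn d1 d2" "x \<noteq> z"
  shows "y = z"
proof -
  note m = upper_is_matching[OF d(1)] lower_is_matching[OF d(2)]
  have ne: "outer x \<noteq> outer y" "outer x \<noteq> outer z" using assms inj_case_sums(3) by (auto simp: inj_def)
  note e = matching_component_ends'[OF m outer_is_end[OF d] _ _ outer_is_end[OF d], folded stack_conn_matchings[OF d]]
  have "{outer x, outer y} = {outer x, outer z}" using e[OF assms(3) ne(1)] e[OF assms(5) ne(2)] by simp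
  then have "outer y = outer z" using ne by (auto simp: doubleton_eq_iff)
  then show ?thesis using inj_case_sums(3) by (auto simp: inj_def)
qed

lemma comp_edges_iff:
  "{x, y} \<in> comp_edges k d1 d2 \<longleftrightarrow>
     x \<in> vertices k \<and> y \<in> vertices k \<and> x \<noteq> y \<and> (outer x, outer y) \<in> stack_conn d1 d2"
  unfolding comp_edges_def using stack_conn_sym by (auto simp: doubleton_eq_iff)

lemma comp_edges_edge_set:
  assumes d: "d1 \<in> partial_brauer k" "d2 \<in> partial_brauer k"
  shows "edge_set k (comp_edges k d1 d2)"
  unfolding edge_set_def
proof (intro conjI ballI impI)
  fix e assume "e \<in> comp_edges k d1 d2"
  then show "e \<subseteq> vertices k" "card e = 2" by (auto simp: comp_edges_def)
next
  fix e f assume e: "e \<in> comp_edges k d1 d2" and f: "f \<in> comp_edges k d1 d2" and "e \<inter> f \<noteq> {}"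
  then obtain x where "x \<in> e" "x \<in> f" by auto
  then obtain y z where "e = {x, y}" "f = {x, z}"
    using e f unfolding comp_edges_def by (auto simp: insert_commute)
  then show "e = f" using e f stack_conn_end_unique[OF d] by (auto simp: comp_edges_iff)
qed

text \<open>By \<open>stack_conn_end_unique\<close> a class of connected outer vertices is a
  singleton or one of the pairs in \<open>comp_edges\<close>.\<close>

lemma diag_comp_edges:
  assumes d: "d1 \<in> partial_brauer k" "d2 \<in> partial_brauer k"
  shows "diag_comp k d1 d2 \<in> partial_brauer k" "edges (diag_comp k d1 d2) = comp_edges k d1 d2"
proof -
  let ?r = "{(x, y). x \<in> vertices k \<and> y \<in> vertices k \<and> (outer x, outer y) \<in> stack_conn d1 d2}"
  have blk: "?r `` {x} = insert x {y. {x, y} \<in> comp_edges k d1 d2}" if "x \<in> vertices k" for x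
    using that by (auto simp: comp_edges_iff)
  have "diag_comp k d1 d2 = diag_of k (comp_edges k d1 d2)"
  proof
    show "diag_comp k d1 d2 \<subseteq> diag_of k (comp_edges k d1 d2)"
    proof
      fix b assume "b \<in> diag_comp k d1 d2"
      then obtain x where x: "x \<in> vertices k" "b = insert x {y. {x, y} \<in> comp_edges k d1 d2}"
        unfolding diag_comp_def by (metis (no_types, lifting) quotientE blk)
      show "b \<in> diag_of k (comp_edges k d1 d2)"
      proof (cases "x \<in> \<Union> (comp_edges k d1 d2)")
        case True
        then obtain y where y: "{x, y} \<in> comp_edges k d1 d2"
          using edge_set_other[OF comp_edges_edge_set[OF d]] by metis
        then have "b = {x, y}" using x edge_set_unique[OF comp_edges_edge_set[OF d]] by blast
        then show ?thesis using y by (simp add: diag_of_def)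
      next
        case False
        then have "b = {x}" using x by auto
        then show ?thesis using False x by (auto simp: diag_of_def)
      qed
    qed
    show "diag_of k (comp_edges k d1 d2) \<subseteq> diag_comp k d1 d2"
    proof
      fix b assume b: "b \<in> diag_of k (comp_edges k d1 d2)"
      have "\<exists>x\<in>vertices k. b = ?r `` {x}"
      proof (cases "b \<in> comp_edges k d1 d2")
        case True
        then obtain x y where xy: "b = {x, y}" "x \<in> vertices k" unfolding comp_edges_def by auto
        then have "b = insert x {y. {x, y} \<in> comp_edges k d1 d2}"
          using True edge_set_unique[OF comp_edges_edge_set[OF d]] by blast
        then show ?thesis using blk xy by blast
      next
        case False
        then obtain v where v: "b = {v}" "v \<in> vertices k" "v \<notin> \<Union> (comp_edges k d1 d2)"
          using b by (auto simp: diag_of_def)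
        then have "b = insert v {y. {v, y} \<in> comp_edges k d1 d2}" by auto
        then show ?thesis using blk v by blast
      qed
      then show "b \<in> diag_comp k d1 d2" unfolding diag_comp_def using quotientI[of _ "vertices k" ?r] by blast
    qed
  qed
  then show "diag_comp k d1 d2 \<in> partial_brauer k" "edges (diag_comp k d1 d2) = comp_edges k d1 d2"
    using comp_edges_edge_set[OF d] by (auto simp: diag_of_pb)
qed

section \<open>Paths and loops of the stacked graph after removing edges\<close>

definition stack_component :: "diagram \<Rightarrow> diagram \<Rightarrow> stacked \<Rightarrow> stacked set" where
  "stack_component d1 d2 v = stack_conn d1 d2 `` {v}"

definition loop_set :: "nat \<Rightarrow> diagram \<Rightarrow> diagram \<Rightarrow> stacked set set" where
  "loop_set k d1 d2 = {C. (\<exists>j\<in>{1..k}. C = stack_conn d1 d2 `` {Middle j}) \<and> C \<subseteq> Middle ` {1..k} \<and>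
       (\<forall>i. Middle i \<in> C \<longrightarrow> Inr i \<in> \<Union> (edges d1) \<and> Inl i \<in> \<Union> (edges d2))}"

lemma loops_card: "loops k d1 d2 = card (loop_set k d1 d2)"
  by (simp add: loops_def loop_set_def)

text \<open>Edges of a diagram are disjoint, so the vertices that lose their edge are those covered
  by the removed edges.\<close>

lemma removed_Domain:
  assumes "d \<in> partial_brauer k" "F \<subseteq> edges d"
  shows "Domain (upper_matching d) - Domain (upper_matching (remove_edges F d)) = case_sum Upper Middle ` \<Union> F"
    and "Domain (lower_matching d) - Domain (lower_matching (remove_edges F d)) = case_sum Middle Lower ` \<Union> F"
proof -
  have U: "\<Union> (edges d) - \<Union> (edges d - F) = \<Union> F"
    using pb_edge_set[OF assms(1)] assms(2) unfolding edge_set_def by blast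
  show "Domain (upper_matching d) - Domain (upper_matching (remove_edges F d)) = case_sum Upper Middle ` \<Union> F"
    "Domain (lower_matching d) - Domain (lower_matching (remove_edges F d)) = case_sum Middle Lower ` \<Union> F"
    unfolding Domain_upper_matching[OF assms(1)] Domain_lower_matching[OF assms(1)]
      Domain_upper_matching[OF remove_edges_pb(1)[OF assms]] Domain_lower_matching[OF remove_edges_pb(1)[OF assms]]
      remove_edges_pb(2)[OF assms] image_set_diff[OF inj_case_sums(1), symmetric]
      image_set_diff[OF inj_case_sums(2), symmetric] U by (rule refl)+
qed

lemma matching_mono:
  assumes "d \<in> partial_brauer k" "F \<subseteq> edges d"
  shows "upper_matching (remove_edges F d) \<subseteq> upper_matching d"
    and "lower_matching (remove_edges F d) \<subseteq> lower_matching d"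
  using remove_edges_pb(2)[OF assms] by (auto simp: upper_matching_def lower_matching_def)

context
  fixes k d1 d2 F1 F2
  assumes d: "d1 \<in> partial_brauer k" "d2 \<in> partial_brauer k" and F: "F1 \<subseteq> edges d1" "F2 \<subseteq> edges d2"
begin

text \<open>Outer vertices are ends of the stacked graph, so
  \<open>matching_subgraph_connected\<close> applies and a path survives if and only if its
  component is not hit.\<close>

lemma comp_edges_remove:
  "comp_edges k (remove_edges F1 d1) (remove_edges F2 d2) =
     {{x, y} | x y. {x, y} \<in> comp_edges k d1 d2 \<and> stack_component d1 d2 (outer x) \<inter>
        (case_sum Upper Middle ` \<Union> F1 \<union> case_sum Middle Lower ` \<Union> F2) = {}}"
proof -
  note r = remove_edges_pb(1)[OF d(1) F(1)] remove_edges_pb(1)[OF d(2) F(2)]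
  have "(outer x, outer y) \<in> stack_conn (remove_edges F1 d1) (remove_edges F2 d2) \<longleftrightarrow>
     (outer x, outer y) \<in> stack_conn d1 d2 \<and> stack_component d1 d2 (outer x) \<inter>
        (case_sum Upper Middle ` \<Union> F1 \<union> case_sum Middle Lower ` \<Union> F2) = {}" if "x \<noteq> y" for x y
  proof -
    have "outer x \<noteq> outer y" using that inj_case_sums(3) by (auto simp: inj_def)
    from matching_subgraph_connected[OF upper_is_matching[OF d(1)] lower_is_matching[OF d(2)]
        upper_is_matching[OF r(1)] lower_is_matching[OF r(2)] matching_mono(1)[OF d(1) F(1)]
        matching_mono(2)[OF d(2) F(2)] outer_is_end[OF d] outer_is_end[OF d] this]
    show ?thesis
      unfolding removed_Domain(1)[OF d(1) F(1)] removed_Domain(2)[OF d(2) F(2)]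
        stack_conn_matchings[OF d, symmetric] stack_conn_matchings[OF r, symmetric] stack_component_def .
  qed
  then show ?thesis
    unfolding comp_edges_iff by (subst comp_edges_def) (intro Collect_cong iff_exI, metis)
qed

text \<open>Every vertex of a loop of the smaller graph still has both of its edges, so the loop has
  lost nothing and is a full component of the original graph. Conversely, an original loop missed by
  the removed edges stays as it is.\<close>

lemma loop_set_remove:
  "loop_set k (remove_edges F1 d1) (remove_edges F2 d2) =
     {C \<in> loop_set k d1 d2. C \<inter> (case_sum Upper Middle ` \<Union> F1 \<union> case_sum Middle Lower ` \<Union> F2) = {}}"
  (is "?L = ?R")
proof -
  note r = remove_edges_pb(1)[OF d(1) F(1)] remove_edges_pb(1)[OF d(2) F(2)]
  note er = remove_edges_pb(2)[OF d(1) F(1)] remove_edges_pb(2)[OF d(2) F(2)]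
  let ?T = "case_sum Upper Middle ` \<Union> F1 \<union> case_sum Middle Lower ` \<Union> F2"
  have untouched: "stack_conn d1 d2 `` {v} = stack_conn (remove_edges F1 d1) (remove_edges F2 d2) `` {v}"
    if "stack_conn (remove_edges F1 d1) (remove_edges F2 d2) `` {v} \<inter> ?T = {}" for v
    unfolding stack_conn_matchings[OF d] stack_conn_matchings[OF r]
  proof (rule component_untouched[OF upper_is_matching[OF d(1)] lower_is_matching[OF d(2)]
          matching_mono(1)[OF d(1) F(1)] matching_mono(2)[OF d(2) F(2)]])
    fix z assume "(v, z) \<in> (upper_matching (remove_edges F1 d1) \<union> lower_matching (remove_edges F2 d2))\<^sup>*"
    then have "z \<notin> ?T" using that unfolding stack_conn_matchings[OF r] by blast
    then show "(z \<in> Domain (upper_matching d1) \<longrightarrow> z \<in> Domain (upper_matching (remove_edges F1 d1))) \<and>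
        (z \<in> Domain (lower_matching d2) \<longrightarrow> z \<in> Domain (lower_matching (remove_edges F2 d2)))"
      using removed_Domain(1)[OF d(1) F(1)] removed_Domain(2)[OF d(2) F(2)] by blast
  qed
  have sub: "stack_conn (remove_edges F1 d1) (remove_edges F2 d2) \<subseteq> stack_conn d1 d2"
    unfolding stack_conn_matchings[OF d] stack_conn_matchings[OF r]
    using matching_mono(1)[OF d(1) F(1)] matching_mono(2)[OF d(2) F(2)] by (intro rtrancl_mono) auto
  have U1: "\<Union> (edges d1 - F1) = \<Union> (edges d1) - \<Union> F1"
    using pb_edge_set[OF d(1)] F(1) unfolding edge_set_def by blast
  have U2: "\<Union> (edges d2 - F2) = \<Union> (edges d2) - \<Union> F2"
    using pb_edge_set[OF d(2)] F(2) unfolding edge_set_def by blast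
  have mT: "Middle i \<in> ?T \<longleftrightarrow> Inr i \<in> \<Union> F1 \<or> Inl i \<in> \<Union> F2" for i
    by (simp add: case_sum_image_iff del: Union_iff)
  show ?thesis
  proof (intro subset_antisym subsetI)
    fix C assume "C \<in> ?L"
    then obtain j where C: "j \<in> {1..k}" "C = stack_conn (remove_edges F1 d1) (remove_edges F2 d2) `` {Middle j}"
      "C \<subseteq> Middle ` {1..k}"
      "\<And>i. Middle i \<in> C \<Longrightarrow> Inr i \<in> \<Union> (edges d1) - \<Union> F1 \<and> Inl i \<in> \<Union> (edges d2) - \<Union> F2"
      unfolding loop_set_def er U1 U2 by blast
    have disj: "C \<inter> ?T = {}"
    proof (rule ccontr)
      assume "C \<inter> ?T \<noteq> {}"
      then obtain z where z: "z \<in> C" "z \<in> ?T" by blast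
      moreover obtain i where "z = Middle i" using z(1) C(3) by blast
      ultimately have "Middle i \<in> C" "Middle i \<in> ?T" by simp_all
      then show False using C(4)[of i] mT[of i] by blast
    qed
    then have "C = stack_conn d1 d2 `` {Middle j}" using C(2) untouched[of "Middle j"] by simp
    then show "C \<in> ?R" using C disj unfolding loop_set_def by blast
  next
    fix C assume "C \<in> ?R"
    then obtain j where C: "j \<in> {1..k}" "C = stack_conn d1 d2 `` {Middle j}" "C \<subseteq> Middle ` {1..k}"
      "\<And>i. Middle i \<in> C \<Longrightarrow> Inr i \<in> \<Union> (edges d1) \<and> Inl i \<in> \<Union> (edges d2)" and disj: "C \<inter> ?T = {}"
      unfolding loop_set_def by blast
    have "C = stack_conn (remove_edges F1 d1) (remove_edges F2 d2) `` {Middle j}"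
      using C(2) disj sub untouched[of "Middle j"] by blast
    moreover have "Inr i \<in> \<Union> (edges d1) - \<Union> F1 \<and> Inl i \<in> \<Union> (edges d2) - \<Union> F2" if "Middle i \<in> C" for i
      using C(4)[OF that] mT[of i] disj that by blast
    ultimately show "C \<in> ?L" using C(1,3) unfolding loop_set_def er U1 U2 by blast
  qed
qed

end


section \<open>The product of two elements \<open>bar d\<close>\<close>

lemma diagram_algebra_simps:
  "carrier (diagram_algebra D k \<delta>) = free_space D" "zero (diagram_algebra D k \<delta>) = 0"
  "add (diagram_algebra D k \<delta>) = (+)" "one (diagram_algebra D k \<delta>) = basis_vec (id_diag k)"
  "mult (diagram_algebra D k \<delta>) = (\<lambda>f g. \<Sum>d1\<in>D. \<Sum>d2\<in>D.
         fscale (f d1 * g d2 * \<delta> ^ loops k d1 d2) (basis_vec (diag_comp k d1 d2)))"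
  by (simp_all add: diagram_algebra_def)

lemma diagram_mult_bilinear:
  fixes \<delta> :: "'k::field"
  shows "(f + f') \<otimes>\<^bsub>diagram_algebra D k \<delta>\<^esub> g = f \<otimes>\<^bsub>diagram_algebra D k \<delta>\<^esub> g + f' \<otimes>\<^bsub>diagram_algebra D k \<delta>\<^esub> g"
    and "f \<otimes>\<^bsub>diagram_algebra D k \<delta>\<^esub> (g + g') = f \<otimes>\<^bsub>diagram_algebra D k \<delta>\<^esub> g + f \<otimes>\<^bsub>diagram_algebra D k \<delta>\<^esub> g'"
    and "fscale c f \<otimes>\<^bsub>diagram_algebra D k \<delta>\<^esub> g = fscale c (f \<otimes>\<^bsub>diagram_algebra D k \<delta>\<^esub> g)"
    and "f \<otimes>\<^bsub>diagram_algebra D k \<delta>\<^esub> fscale c g = fscale c (f \<otimes>\<^bsub>diagram_algebra D k \<delta>\<^esub> g)"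
    and "0 \<otimes>\<^bsub>diagram_algebra D k \<delta>\<^esub> g = 0" and "f \<otimes>\<^bsub>diagram_algebra D k \<delta>\<^esub> 0 = 0"
    and "(f - f') \<otimes>\<^bsub>diagram_algebra D k \<delta>\<^esub> g = f \<otimes>\<^bsub>diagram_algebra D k \<delta>\<^esub> g - f' \<otimes>\<^bsub>diagram_algebra D k \<delta>\<^esub> g"
    and "f \<otimes>\<^bsub>diagram_algebra D k \<delta>\<^esub> (g - g') = f \<otimes>\<^bsub>diagram_algebra D k \<delta>\<^esub> g - f \<otimes>\<^bsub>diagram_algebra D k \<delta>\<^esub> g'"
  unfolding diagram_algebra_simps
  by (simp_all only: plus_fun_apply zero_fun_apply minus_apply sum.distrib[symmetric] sum_subtractf[symmetric]
      distrib_right distrib_left left_diff_distrib right_diff_distrib fvs.scale_left_distrib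
      fvs.scale_left_diff_distrib fvs.scale_sum_right mult_zero_left mult_zero_right fvs.scale_zero_left
      sum.neutral_const fvs.scale_scale)
     (intro sum.cong refl; simp add: fscale_def fun_eq_iff mult_ac)+

lemma diagram_mult_sum:
  fixes \<delta> :: "'k::field"
  shows "(\<Sum>i\<in>I. f i) \<otimes>\<^bsub>diagram_algebra D k \<delta>\<^esub> g = (\<Sum>i\<in>I. f i \<otimes>\<^bsub>diagram_algebra D k \<delta>\<^esub> g)"
    and "g \<otimes>\<^bsub>diagram_algebra D k \<delta>\<^esub> (\<Sum>i\<in>I. f i) = (\<Sum>i\<in>I. g \<otimes>\<^bsub>diagram_algebra D k \<delta>\<^esub> f i)"
  by (induction I rule: infinite_finite_induct)
     (simp_all only: sum.infinite sum.empty sum.insert diagram_mult_bilinear not_False_eq_True)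

lemma diagram_mult_basis:
  assumes "finite D" "d1 \<in> D" "d2 \<in> D"
  shows "basis_vec d1 \<otimes>\<^bsub>diagram_algebra D k \<delta>\<^esub> basis_vec d2
       = fscale (\<delta> ^ loops k d1 d2) (basis_vec (diag_comp k d1 d2))"
proof -
  have "basis_vec d1 \<otimes>\<^bsub>diagram_algebra D k \<delta>\<^esub> basis_vec d2
      = (\<Sum>x\<in>D. if x = d1 then (\<Sum>y\<in>D. if y = d2
           then fscale (\<delta> ^ loops k x y) (basis_vec (diag_comp k x y)) else 0) else 0)"
    unfolding diagram_algebra_simps
    by (intro sum.cong refl) (auto simp: basis_vec_def fscale_def fun_eq_iff sum_fun_apply intro!: sum.cong sum.neutral)
  then show ?thesis using assms by (simp only: sum.delta if_True)
qed

lemma motzkin_pb: "d \<in> motzkin k \<Longrightarrow> d \<in> partial_brauer k"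
  by (simp add: motzkin_def)

lemma finite_motzkin [simp]: "finite (motzkin k)"
  by (rule finite_subset[of _ "partial_brauer k"]) (auto simp: motzkin_def)

lemma motzkin_remove_edges:
  assumes "d \<in> motzkin k" "F \<subseteq> edges d" shows "remove_edges F d \<in> motzkin k"
  using assms remove_edges_pb[OF motzkin_pb[OF assms(1)] assms(2)]
  unfolding motzkin_def noncrossing_def by blast

lemma stack_conn_upper:
  "e \<in> edges d1 \<Longrightarrow> a \<in> e \<Longrightarrow> b \<in> e \<Longrightarrow> (case_sum Upper Middle a, case_sum Upper Middle b) \<in> stack_conn d1 d2"
  unfolding stack_conn_def edges_def by (intro r_into_rtrancl) blast

lemma stack_conn_lower:
  "e \<in> edges d2 \<Longrightarrow> a \<in> e \<Longrightarrow> b \<in> e \<Longrightarrow> (case_sum Middle Lower a, case_sum Middle Lower b) \<in> stack_conn d1 d2"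
  unfolding stack_conn_def edges_def by (intro r_into_rtrancl) blast

text \<open>An edge ending at a middle vertex that is isolated on the other side carries neither a loop
  nor a path between outer vertices.\<close>

lemma dangling_edge:
  assumes d: "d1 \<in> partial_brauer k" "d2 \<in> partial_brauer k"
    and F: "F1 \<subseteq> edges d1" "F2 \<subseteq> edges d2"
    and ends: "\<not> (Middle j \<in> Domain (upper_matching d1) \<and> Middle j \<in> Domain (lower_matching d2))"
    and conn: "\<And>z. z \<in> case_sum Upper Middle ` \<Union> F1 \<union> case_sum Middle Lower ` \<Union> F2
        \<Longrightarrow> (z, Middle j) \<in> stack_conn d1 d2"
  shows "comp_edges k (remove_edges F1 d1) (remove_edges F2 d2) = comp_edges k d1 d2"
    and "loop_set k (remove_edges F1 d1) (remove_edges F2 d2) = loop_set k d1 d2"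
proof -
  let ?T = "case_sum Upper Middle ` \<Union> F1 \<union> case_sum Middle Lower ` \<Union> F2"
  have 1: "stack_component d1 d2 (outer x) \<inter> ?T = {}" if xy: "{x, y} \<in> comp_edges k d1 d2" for x y
  proof (rule ccontr)
    assume "\<not> ?thesis"
    then obtain z where "(outer x, z) \<in> stack_conn d1 d2" "z \<in> ?T" unfolding stack_component_def by blast
    then have m: "(outer x, Middle j) \<in> stack_conn d1 d2" using conn stack_conn_trans by blast
    have c: "(outer x, outer y) \<in> stack_conn d1 d2" and ne: "outer x \<noteq> outer y"
      using xy inj_case_sums(3) by (auto simp: comp_edges_iff inj_def)
    have "{z \<in> stack_conn d1 d2 `` {outer x}. \<not> (z \<in> Domain (upper_matching d1) \<and> z \<in> Domain (lower_matching d2))}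
        = {outer x, outer y}"
      using matching_component_ends'[OF upper_is_matching[OF d(1)] lower_is_matching[OF d(2)]
          outer_is_end[OF d] _ ne outer_is_end[OF d]] c
      unfolding stack_conn_matchings[OF d] by blast
    \<comment> \<open>The dangling end \<open>Middle j\<close> would be a third end of a component
      that already has the ends \<open>outer x\<close> and \<open>outer y\<close>.\<close>
    then have "Middle j = outer x \<or> Middle j = outer y" using m ends by blast
    then show False by (auto split: sum.splits)
  qed
  show "comp_edges k (remove_edges F1 d1) (remove_edges F2 d2) = comp_edges k d1 d2"
    unfolding comp_edges_remove[OF d F]
  proof (intro subset_antisym subsetI)
    fix e assume e: "e \<in> comp_edges k d1 d2"
    then obtain x y where "e = {x, y}" unfolding comp_edges_def by blast
    then show "e \<in> {{x, y} | x y. {x, y} \<in> comp_edges k d1 d2 \<and> stack_component d1 d2 (outer x) \<inter> ?T = {}}"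
      using e 1 by blast
  qed blast
  have "C \<inter> ?T = {}" if C: "C \<in> loop_set k d1 d2" for C
  proof (rule ccontr)
    assume "\<not> ?thesis"
    then obtain z where z: "z \<in> C" "z \<in> ?T" by blast
    obtain i where "C = stack_conn d1 d2 `` {Middle i}" using C by (auto simp: loop_set_def)
    then have "Middle j \<in> C" using z conn stack_conn_trans by blast
    then have "Inr j \<in> \<Union> (edges d1)" "Inl j \<in> \<Union> (edges d2)" using C by (auto simp: loop_set_def)
    then show False using ends Domain_matching_iff(2)[OF d(1)] Domain_matching_iff(4)[OF d(2)] by blast
  qed
  then show "loop_set k (remove_edges F1 d1) (remove_edges F2 d2) = loop_set k d1 d2"
    unfolding loop_set_remove[OF d F] by blast
qed

definition comp_term :: "nat \<Rightarrow> 'k::field \<Rightarrow> diagram \<Rightarrow> diagram \<Rightarrow> (diagram \<Rightarrow> 'k)" where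
  "comp_term k \<delta> d1 d2 = fscale (\<delta> ^ loops k d1 d2) (basis_vec (diag_comp k d1 d2))"

lemma comp_term_cong:
  assumes "d1 \<in> partial_brauer k" "d2 \<in> partial_brauer k" "d1' \<in> partial_brauer k" "d2' \<in> partial_brauer k"
    and "comp_edges k d1 d2 = comp_edges k d1' d2'" "loop_set k d1 d2 = loop_set k d1' d2'"
  shows "comp_term k \<delta> d1 d2 = comp_term k \<delta> d1' d2'"
proof -
  have "diag_comp k d1 d2 = diag_comp k d1' d2'"
    using diag_comp_edges[OF assms(1,2)] diag_comp_edges[OF assms(3,4)] assms(5) by (metis pb_eqI)
  then show ?thesis by (simp add: comp_term_def loops_card assms(6))
qed

text \<open>The two diagrams may share an edge as a set; the tagged union keeps the copies apart.
  Signs multiply because the cardinalities of the two parts add up, so a product of alternating sums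
  is again a single one.\<close>

lemma alt_sum_mult:
  fixes \<delta> :: "'k::field"
  assumes "finite E1" "finite E2"
  shows "alt_sum E1 h1 \<otimes>\<^bsub>diagram_algebra D k \<delta>\<^esub> alt_sum E2 h2
       = alt_sum (E1 <+> E2) (\<lambda>F. h1 (Inl -` F) \<otimes>\<^bsub>diagram_algebra D k \<delta>\<^esub> h2 (Inr -` F))"
proof -
  let ?m = "\<lambda>F1 F2. h1 F1 \<otimes>\<^bsub>diagram_algebra D k \<delta>\<^esub> h2 F2"
  have "alt_sum E1 h1 \<otimes>\<^bsub>diagram_algebra D k \<delta>\<^esub> alt_sum E2 h2
      = (\<Sum>F1\<in>Pow E1. \<Sum>F2\<in>Pow E2. fscale ((- 1) ^ card F1) (fscale ((- 1) ^ card F2) (?m F1 F2)))"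
    unfolding alt_sum_def diagram_mult_sum diagram_mult_bilinear fvs.scale_sum_right
    by (subst sum.swap) (intro sum.cong refl fvs.scale_left_commute)
  also have "\<dots> = (\<Sum>p\<in>Pow E1 \<times> Pow E2. fscale ((- 1) ^ card (fst p <+> snd p)) (?m (fst p) (snd p)))"
    unfolding sum.cartesian_product
  proof (intro sum.cong refl, clarsimp)
    fix F1 F2 assume "F1 \<subseteq> E1" "F2 \<subseteq> E2"
    then have "finite F1" "finite F2" using assms finite_subset by blast+
    then show "(- 1) ^ card F1 * (- 1) ^ card F2 = ((- 1) ^ card (F1 <+> F2) :: 'k)"
      by (simp add: card_Plus power_add)
  qed
  also have "\<dots> = (\<Sum>F\<in>Pow (E1 <+> E2). fscale ((- 1) ^ card F) (?m (Inl -` F) (Inr -` F)))"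
  proof (rule sum.reindex_bij_witness[of _ "\<lambda>F. (Inl -` F, Inr -` F)" "\<lambda>p. fst p <+> snd p"])
    show "fst (Inl -` F, Inr -` F) <+> snd (Inl -` F, Inr -` F) = F" for F :: "('a + 'b) set"
    proof (rule Set.set_eqI)
      show "x \<in> fst (Inl -` F, Inr -` F) <+> snd (Inl -` F, Inr -` F) \<longleftrightarrow> x \<in> F" for x
        by (cases x) auto
    qed
    have *: "Inl -` (A <+> B) = A" "Inr -` (A <+> B) = B" for A :: "'a set" and B :: "'b set" by auto
    show "(Inl -` (fst p <+> snd p), Inr -` (fst p <+> snd p)) = p" for p :: "'a set \<times> 'b set"
      by (simp add: *)
    fix p assume "p \<in> Pow E1 \<times> Pow E2"
    then show "fst p <+> snd p \<in> Pow (E1 <+> E2)" by auto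
    show "fscale ((- 1) ^ card (fst p <+> snd p)) (?m (Inl -` (fst p <+> snd p)) (Inr -` (fst p <+> snd p)))
        = fscale ((- 1) ^ card (fst p <+> snd p)) (?m (fst p) (snd p))" by (simp add: *)
  next
    fix F assume "F \<in> Pow (E1 <+> E2)"
    then show "(Inl -` F, Inr -` F) \<in> Pow E1 \<times> Pow E2" by auto
  qed
  finally show ?thesis by (simp add: alt_sum_def)
qed

lemma bar_mult_expand:
  fixes \<delta> :: "'k::field"
  assumes "d1 \<in> motzkin k" "d2 \<in> motzkin k"
  shows "bar d1 \<otimes>\<^bsub>motzkin_algebra k \<delta>\<^esub> bar d2
    = alt_sum (edges d1 <+> edges d2) (\<lambda>F. comp_term k \<delta> (remove_edges (Inl -` F) d1) (remove_edges (Inr -` F) d2))"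
  unfolding bar_alt_sum[OF motzkin_pb[OF assms(1)]] bar_alt_sum[OF motzkin_pb[OF assms(2)]] motzkin_algebra_def
    alt_sum_mult[OF finite_edges[OF motzkin_pb[OF assms(1)]] finite_edges[OF motzkin_pb[OF assms(2)]]]
proof (rule alt_sum_cong)
  fix F assume "F \<subseteq> edges d1 <+> edges d2"
  then have "Inl -` F \<subseteq> edges d1" "Inr -` F \<subseteq> edges d2" by auto
  then show "basis_vec (remove_edges (Inl -` F) d1) \<otimes>\<^bsub>diagram_algebra (motzkin k) k \<delta>\<^esub> basis_vec (remove_edges (Inr -` F) d2)
      = comp_term k \<delta> (remove_edges (Inl -` F) d1) (remove_edges (Inr -` F) d2)"
    unfolding comp_term_def
    by (intro diagram_mult_basis finite_motzkin motzkin_remove_edges assms)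
qed

text \<open>Some middle vertex carries an edge on one side only. Neither the composite nor the
  number of loops depends on whether this dangling edge is removed, so toggling it kills the
  sum.\<close>

lemma bar_mult_mismatch:
  fixes \<delta> :: "'k::field"
  assumes d: "d1 \<in> motzkin k" "d2 \<in> motzkin k" and ne: "bot_set d1 \<noteq> top_set d2"
  shows "bar d1 \<otimes>\<^bsub>motzkin_algebra k \<delta>\<^esub> bar d2 = 0"
proof -
  note pb = motzkin_pb[OF d(1)] motzkin_pb[OF d(2)]
  let ?h = "\<lambda>F. comp_term k \<delta> (remove_edges (Inl -` F) d1) (remove_edges (Inr -` F) d2)"
  consider j e where "e \<in> edges d1" "Inr j \<in> e" "Inl j \<notin> \<Union> (edges d2)"
    | j e where "e \<in> edges d2" "Inl j \<in> e" "Inr j \<notin> \<Union> (edges d1)"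
    using ne unfolding bot_set_def top_set_def by blast
  then have "\<exists>r \<in> edges d1 <+> edges d2. \<forall>F. F \<subseteq> (edges d1 <+> edges d2) - {r} \<longrightarrow> ?h (insert r F) = ?h F"
  proof cases
    case 1
    have "?h (insert (Inl e) F) = ?h F" if "F \<subseteq> (edges d1 <+> edges d2) - {Inl e}" for F
    proof -
      have F: "Inl -` F \<subseteq> edges d1" "Inr -` F \<subseteq> edges d2" "{e} \<subseteq> edges d1 - Inl -` F" using that 1 by auto
      \<comment> \<open>The toggle has to be invisible whatever other edges are gone, so the
        comparison takes place in the diagrams from which \<open>F\<close> has already been
        removed.\<close>
      define D1 where "D1 = remove_edges (Inl -` F) d1"
      define D2 where "D2 = remove_edges (Inr -` F) d2"
      have D: "D1 \<in> partial_brauer k" "D2 \<in> partial_brauer k" "edges D1 = edges d1 - Inl -` F" "edges D2 = edges d2 - Inr -` F"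
        using remove_edges_pb[OF pb(1) F(1)] remove_edges_pb[OF pb(2) F(2)] by (simp_all add: D1_def D2_def)
      have e: "e \<in> edges D1" using D(3) F(3) by blast
      have ins: "remove_edges (Inl -` insert (Inl e) F) d1 = remove_edges {e} D1"
      proof -
        have "Inl -` insert (Inl e) F = Inl -` F \<union> {e}" by auto
        then show ?thesis unfolding D1_def using remove_edges_remove_edges[OF pb(1) F(1,3)] by simp
      qed
      have ins2: "remove_edges (Inr -` insert (Inl e) F) d2 = D2" unfolding D2_def by (simp add: vimage_def)
      have ends: "\<not> (Middle j \<in> Domain (upper_matching D1) \<and> Middle j \<in> Domain (lower_matching D2))"
        using 1(3) unfolding Domain_matching_iff(4)[OF D(2)] D(4) by blast
      have conn: "(z, Middle j) \<in> stack_conn D1 D2"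
        if "z \<in> case_sum Upper Middle ` \<Union> {e} \<union> case_sum Middle Lower ` \<Union> {}" for z
        using that stack_conn_upper[OF e _ 1(2)] by auto
      have "comp_term k \<delta> (remove_edges {e} D1) (remove_edges {} D2) = comp_term k \<delta> D1 D2"
        by (rule comp_term_cong[OF remove_edges_pb(1)[OF D(1)] remove_edges_pb(1)[OF D(2)] D(1,2)
              dangling_edge[OF D(1,2) _ _ ends conn]]) (use e in auto)
      then show ?thesis unfolding ins ins2 by (simp add: D1_def D2_def)
    qed
    then show ?thesis using 1(1) by (intro bexI[of _ "Inl e"]) auto
  next
    case 2
    have "?h (insert (Inr e) F) = ?h F" if "F \<subseteq> (edges d1 <+> edges d2) - {Inr e}" for F
    proof -
      have F: "Inl -` F \<subseteq> edges d1" "Inr -` F \<subseteq> edges d2" "{e} \<subseteq> edges d2 - Inr -` F" using that 2 by auto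
      define D1 where "D1 = remove_edges (Inl -` F) d1"
      define D2 where "D2 = remove_edges (Inr -` F) d2"
      have D: "D1 \<in> partial_brauer k" "D2 \<in> partial_brauer k" "edges D1 = edges d1 - Inl -` F" "edges D2 = edges d2 - Inr -` F"
        using remove_edges_pb[OF pb(1) F(1)] remove_edges_pb[OF pb(2) F(2)] by (simp_all add: D1_def D2_def)
      have e: "e \<in> edges D2" using D(4) F(3) by blast
      have ins: "remove_edges (Inr -` insert (Inr e) F) d2 = remove_edges {e} D2"
      proof -
        have "Inr -` insert (Inr e) F = Inr -` F \<union> {e}" by auto
        then show ?thesis unfolding D2_def using remove_edges_remove_edges[OF pb(2) F(2,3)] by simp
      qed
      have ins2: "remove_edges (Inl -` insert (Inr e) F) d1 = D1" unfolding D1_def by (simp add: vimage_def)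
      have ends: "\<not> (Middle j \<in> Domain (upper_matching D1) \<and> Middle j \<in> Domain (lower_matching D2))"
        using 2(3) unfolding Domain_matching_iff(2)[OF D(1)] D(3) by blast
      have conn: "(z, Middle j) \<in> stack_conn D1 D2"
        if "z \<in> case_sum Upper Middle ` \<Union> {} \<union> case_sum Middle Lower ` \<Union> {e}" for z
        using that stack_conn_lower[OF e _ 2(2)] by auto
      have "comp_term k \<delta> (remove_edges {} D1) (remove_edges {e} D2) = comp_term k \<delta> D1 D2"
        by (rule comp_term_cong[OF remove_edges_pb(1)[OF D(1)] remove_edges_pb(1)[OF D(2)] D(1,2)
              dangling_edge[OF D(1,2) _ _ ends conn]]) (use e in auto)
      then show ?thesis unfolding ins ins2 by (simp add: D1_def D2_def)
    qed
    then show ?thesis using 2(1) by (intro bexI[of _ "Inr e"]) auto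
  qed
  then obtain r where "r \<in> edges d1 <+> edges d2"
    "\<And>F. F \<subseteq> (edges d1 <+> edges d2) - {r} \<Longrightarrow> ?h (insert r F) = ?h F" by blast
  then show ?thesis
    unfolding bar_mult_expand[OF d] using finite_edges[OF pb(1)] finite_edges[OF pb(2)]
    by (intro alt_sum_toggle) auto
qed

text \<open>\<open>Inl\<close> and \<open>Inr\<close> tag the edges of the upper and of the lower diagram.\<close>

definition edge_component :: "diagram \<Rightarrow> diagram \<Rightarrow> (nat + nat) set + (nat + nat) set \<Rightarrow> stacked set" where
  "edge_component d1 d2 s =
     stack_conn d1 d2 `` (case_sum ((`) (case_sum Upper Middle)) ((`) (case_sum Middle Lower)) s)"

definition path_component :: "diagram \<Rightarrow> diagram \<Rightarrow> (nat + nat) set \<Rightarrow> stacked set" where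
  "path_component d1 d2 e = stack_conn d1 d2 `` (outer ` e)"

lemma stack_component_eq:
  "(v, w) \<in> stack_conn d1 d2 \<Longrightarrow> stack_conn d1 d2 `` {v} = stack_conn d1 d2 `` {w}"
  using stack_conn_trans stack_conn_sym by blast

lemma edge_component_eq:
  assumes "s \<in> edges d1 <+> edges d2"
    and "v \<in> case_sum ((`) (case_sum Upper Middle)) ((`) (case_sum Middle Lower)) s"
  shows "edge_component d1 d2 s = stack_conn d1 d2 `` {v}"
proof -
  have "stack_conn d1 d2 `` {w} = stack_conn d1 d2 `` {v}"
    if "w \<in> case_sum ((`) (case_sum Upper Middle)) ((`) (case_sum Middle Lower)) s" for w
    using that assms by (intro stack_component_eq) (auto intro: stack_conn_upper stack_conn_lower)
  then show ?thesis using assms(2) unfolding edge_component_def by blast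
qed

lemma path_component_eq:
  assumes "{x, y} \<in> comp_edges k d1 d2"
  shows "path_component d1 d2 {x, y} = stack_conn d1 d2 `` {outer x}"
  using stack_component_eq[of "outer x" "outer y"] assms
  unfolding path_component_def comp_edges_iff by blast

text \<open>An edge lies in one component, so a component is hit exactly if it is the component of
  some removed edge. Hence only the image of \<open>F\<close> under
  \<open>edge_component d1 d2\<close> matters, which is the form required by
  \<open>alt_sum_image\<close>.\<close>

lemma component_untouched_iff:
  assumes F: "Inl -` F \<subseteq> edges d1" "Inr -` F \<subseteq> edges d2" and d: "d1 \<in> partial_brauer k" "d2 \<in> partial_brauer k"
  shows "stack_conn d1 d2 `` {v} \<inter> (case_sum Upper Middle ` \<Union> (Inl -` F) \<union> case_sum Middle Lower ` \<Union> (Inr -` F)) = {}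
     \<longleftrightarrow> stack_conn d1 d2 `` {v} \<notin> edge_component d1 d2 ` F"
proof
  let ?h = "case_sum ((`) (case_sum Upper Middle)) ((`) (case_sum Middle Lower))"
  let ?T = "case_sum Upper Middle ` \<Union> (Inl -` F) \<union> case_sum Middle Lower ` \<Union> (Inr -` F)"
  have mem: "s \<in> edges d1 <+> edges d2" if "s \<in> F" for s using that F by (cases s) auto
  have T: "z \<in> ?T \<longleftrightarrow> (\<exists>s\<in>F. z \<in> ?h s)" for z
  proof
    assume "z \<in> ?T"
    then consider a e where "Inl e \<in> F" "a \<in> e" "z = case_sum Upper Middle a"
      | a e where "Inr e \<in> F" "a \<in> e" "z = case_sum Middle Lower a" by auto
    then show "\<exists>s\<in>F. z \<in> ?h s"
    proof cases
      case 1 then show ?thesis by (intro bexI[of _ "Inl e"]) auto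
    next
      case 2 then show ?thesis by (intro bexI[of _ "Inr e"]) auto
    qed
  next
    assume "\<exists>s\<in>F. z \<in> ?h s"
    then obtain s where "s \<in> F" "z \<in> ?h s" by auto
    then show "z \<in> ?T" by (cases s) (simp_all, blast+)
  qed
  {
    assume disj: "stack_conn d1 d2 `` {v} \<inter> ?T = {}"
    show "stack_conn d1 d2 `` {v} \<notin> edge_component d1 d2 ` F"
    proof
      assume "stack_conn d1 d2 `` {v} \<in> edge_component d1 d2 ` F"
      then obtain s where s: "s \<in> F" "stack_conn d1 d2 `` {v} = edge_component d1 d2 s" by auto
      have "?h s \<noteq> {}"
        using mem[OF s(1)] pb_edge_set[OF d(1)] pb_edge_set[OF d(2)] unfolding edge_set_def by fastforce
      then obtain w where w: "w \<in> ?h s" by auto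
      have "w \<in> edge_component d1 d2 s"
        using w stack_conn_refl[of w] unfolding edge_component_def by (rule ImageI[rotated])
      moreover have "w \<in> ?T" unfolding T using s(1) w by (rule bexI[rotated])
      ultimately show False using disj unfolding s(2) by (simp only: disjoint_iff not_True_eq_False)
    qed
  }
  {
    assume ne: "stack_conn d1 d2 `` {v} \<notin> edge_component d1 d2 ` F"
    show "stack_conn d1 d2 `` {v} \<inter> ?T = {}"
    proof (rule ccontr)
      assume "\<not> ?thesis"
      then obtain z where zT: "(v, z) \<in> stack_conn d1 d2" "z \<in> ?T" by blast
      then obtain s where z: "(v, z) \<in> stack_conn d1 d2" "s \<in> F" "z \<in> ?h s" unfolding T by blast
      then have "stack_conn d1 d2 `` {v} = edge_component d1 d2 s"
        using edge_component_eq[OF mem[OF z(2)] z(3)] stack_component_eq[OF z(1)] by simp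
      then show False using ne z(2) by blast
    qed
  }
qed

text \<open>The component of a path contains exactly two outer vertices, and these are the endpoints
  of the edge.\<close>

lemma inj_on_path_component:
  assumes d: "d1 \<in> partial_brauer k" "d2 \<in> partial_brauer k"
  shows "inj_on (path_component d1 d2) (comp_edges k d1 d2)"
proof (rule inj_onI)
  fix e f assume e: "e \<in> comp_edges k d1 d2" and f: "f \<in> comp_edges k d1 d2"
    and eq: "path_component d1 d2 e = path_component d1 d2 f"
  obtain x y where xy: "e = {x, y}" using e unfolding comp_edges_def by blast
  obtain u v where uv: "f = {u, v}" using f unfolding comp_edges_def by blast
  have exy: "x \<noteq> y" "(outer x, outer y) \<in> stack_conn d1 d2" using e unfolding xy comp_edges_iff by auto
  have fuv: "u \<noteq> v" using f unfolding uv comp_edges_iff by auto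
  have "w \<in> {x, y}" if "w \<in> {u, v}" for w
  proof -
    have "outer w \<in> path_component d1 d2 f"
      using that uv stack_conn_refl unfolding path_component_def by blast
    then have "(outer x, outer w) \<in> stack_conn d1 d2"
      using eq path_component_eq[of x y k d1 d2] e xy by auto
    then show ?thesis using stack_conn_end_unique[OF d exy(2,1)] by blast
  qed
  then show "e = f" using fuv xy uv by auto
qed

context
  fixes k d1 d2
  assumes d: "d1 \<in> partial_brauer k" "d2 \<in> partial_brauer k" and match: "bot_set d1 = top_set d2"
begin

lemma middle_both: "Middle j \<in> Domain (upper_matching d1) \<longleftrightarrow> Middle j \<in> Domain (lower_matching d2)"
proof -
  have "Inr j \<in> \<Union> (edges d1) \<longleftrightarrow> Inl j \<in> \<Union> (edges d2)"
    using match by (auto simp: bot_set_def top_set_def)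
  then show ?thesis unfolding Domain_matching_iff(2)[OF d(1)] Domain_matching_iff(4)[OF d(2)] .
qed

lemma Domain_cases:
  assumes "z \<in> Domain (upper_matching d1) \<union> Domain (lower_matching d2)"
  obtains s where "s \<in> edges d1 <+> edges d2"
    "z \<in> case_sum ((`) (case_sum Upper Middle)) ((`) (case_sum Middle Lower)) s"
proof -
  from assms consider a e where "e \<in> edges d1" "a \<in> e" "z = case_sum Upper Middle a"
    | a e where "e \<in> edges d2" "a \<in> e" "z = case_sum Middle Lower a"
    unfolding Domain_upper_matching[OF d(1)] Domain_lower_matching[OF d(2)] by blast
  then show thesis by cases (auto intro: that[of "Inl _"] that[of "Inr _"])
qed

lemma component_Domain:
  assumes "v \<in> Domain (upper_matching d1) \<union> Domain (lower_matching d2)" "(v, w) \<in> stack_conn d1 d2"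
  shows "w \<in> Domain (upper_matching d1) \<union> Domain (lower_matching d2)"
proof (cases "w = v")
  case False
  have "(w, v) \<in> (upper_matching d1 \<union> lower_matching d2)\<^sup>*"
    using stack_conn_sym[OF assms(2)] unfolding stack_conn_matchings[OF d] .
  then show ?thesis using False by (auto elim: converse_rtranclE)
qed (use assms in simp)

lemma outer_in_Domain_vertices:
  assumes "outer x \<in> Domain (upper_matching d1) \<union> Domain (lower_matching d2)"
  shows "x \<in> vertices k"
proof (cases x)
  case (Inl i)
  then have "Inl i \<in> \<Union> (edges d1)"
    using assms Domain_matching_iff(1)[OF d(1), of i] Domain_matching_iff(6)[OF d(2), of i] by (simp del: Union_iff)
  then show ?thesis using pb_edge_set[OF d(1)] Inl unfolding edge_set_def by blast
next
  case (Inr i)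
  then have "Inr i \<in> \<Union> (edges d2)"
    using assms Domain_matching_iff(3)[OF d(1), of i] Domain_matching_iff(5)[OF d(2), of i] by (simp del: Union_iff)
  then show ?thesis using pb_edge_set[OF d(2)] Inr unfolding edge_set_def by blast
qed

text \<open>The component of \<open>outer x\<close> has a second end. It cannot lie in the middle
  row: with \<open>bot_set d1 = top_set d2\<close> a middle vertex that meets one matching meets
  both.\<close>

lemma outer_partner:
  assumes x: "outer x \<in> Domain (upper_matching d1) \<union> Domain (lower_matching d2)"
  obtains y where "{x, y} \<in> comp_edges k d1 d2"
proof -
  note m = upper_is_matching[OF d(1)] lower_is_matching[OF d(2)]
  let ?E = "{z \<in> (upper_matching d1 \<union> lower_matching d2)\<^sup>* `` {outer x}.
       \<not> (z \<in> Domain (upper_matching d1) \<and> z \<in> Domain (lower_matching d2))}"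
  have "\<exists>z. z \<noteq> outer x \<and> ?E = {outer x, z}"
  proof (cases "outer x \<in> Domain (upper_matching d1)")
    case True
    then show ?thesis using matching_component_ends[OF m True] outer_is_end[OF d] by blast
  next
    case False
    then show ?thesis using matching_component_ends[OF m(2,1) _ False] x
      unfolding Un_commute[of "lower_matching d2"] by blast
  qed
  then obtain z where z: "z \<noteq> outer x" "z \<in> ?E" by blast
  then have c: "(outer x, z) \<in> stack_conn d1 d2" unfolding stack_conn_matchings[OF d] by blast
  have zD: "z \<in> Domain (upper_matching d1) \<union> Domain (lower_matching d2)" by (rule component_Domain[OF x c])
  have "\<exists>y. z = outer y"
  proof (cases z)
    case (Upper i) then show ?thesis by (intro exI[of _ "Inl i"]) simp
  next
    case (Middle j) then show ?thesis using z(2) zD middle_both[of j] by blast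
  next
    case (Lower i) then show ?thesis by (intro exI[of _ "Inr i"]) simp
  qed
  then obtain y where y: "z = outer y" by blast
  have "{x, y} \<in> comp_edges k d1 d2"
    unfolding comp_edges_iff using outer_in_Domain_vertices[OF x] outer_in_Domain_vertices[of y] zD c z(1) y by blast
  then show thesis by (rule that)
qed

text \<open>A component with an edge that reaches an outer vertex is a path by
  \<open>outer_partner\<close>; one that stays in the middle row has both edges at every vertex and
  is a loop. Dangling pieces do not occur.\<close>

lemma edge_components:
  "edge_component d1 d2 ` (edges d1 <+> edges d2) = loop_set k d1 d2 \<union> path_component d1 d2 ` comp_edges k d1 d2"
proof (intro subset_antisym subsetI)
  fix C assume "C \<in> edge_component d1 d2 ` (edges d1 <+> edges d2)"
  then obtain s where s: "s \<in> edges d1 <+> edges d2" "C = edge_component d1 d2 s" by auto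
  obtain v where v: "C = stack_conn d1 d2 `` {v}" "v \<in> Domain (upper_matching d1) \<union> Domain (lower_matching d2)"
  proof (cases s)
    case (Inl e)
    then obtain a where a: "a \<in> e" "e \<in> edges d1" using s(1) pb_edge_set[OF d(1)] unfolding edge_set_def by fastforce
    show ?thesis
    proof (rule that[of "case_sum Upper Middle a"])
      show "C = stack_conn d1 d2 `` {case_sum Upper Middle a}"
        unfolding s(2) by (rule edge_component_eq[OF s(1)]) (use a Inl in auto)
      show "case_sum Upper Middle a \<in> Domain (upper_matching d1) \<union> Domain (lower_matching d2)"
        unfolding Domain_upper_matching[OF d(1)] using a by blast
    qed
  next
    case (Inr e)
    then obtain a where a: "a \<in> e" "e \<in> edges d2" using s(1) pb_edge_set[OF d(2)] unfolding edge_set_def by fastforce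
    show ?thesis
    proof (rule that[of "case_sum Middle Lower a"])
      show "C = stack_conn d1 d2 `` {case_sum Middle Lower a}"
        unfolding s(2) by (rule edge_component_eq[OF s(1)]) (use a Inr in auto)
      show "case_sum Middle Lower a \<in> Domain (upper_matching d1) \<union> Domain (lower_matching d2)"
        unfolding Domain_lower_matching[OF d(2)] using a by blast
    qed
  qed
  have dom: "w \<in> Domain (upper_matching d1) \<union> Domain (lower_matching d2)" if "w \<in> C" for w
    using component_Domain[OF v(2)] that v(1) by blast
  show "C \<in> loop_set k d1 d2 \<union> path_component d1 d2 ` comp_edges k d1 d2"
  proof (cases "\<exists>x. outer x \<in> C")
    case True
    then obtain x where x: "outer x \<in> C" by blast
    obtain y where y: "{x, y} \<in> comp_edges k d1 d2" using outer_partner[OF dom[OF x]] .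
    have "C = stack_conn d1 d2 `` {outer x}" using x stack_component_eq[of v "outer x"] v(1) by blast
    then have "C = path_component d1 d2 {x, y}" using path_component_eq[OF y] by simp
    then show ?thesis using y by blast
  next
    case False
    have mid: "\<exists>i. w = Middle i" if "w \<in> C" for w
      using False that by (cases w) (metis sum.case(1), blast, metis sum.case(2))
    have both: "Inr i \<in> \<Union> (edges d1) \<and> Inl i \<in> \<Union> (edges d2)" if "Middle i \<in> C" for i
      using dom[OF that] middle_both[of i] Domain_matching_iff(2)[OF d(1), of i] Domain_matching_iff(4)[OF d(2), of i]
      by blast
    have range: "i \<in> {1..k}" if "Middle i \<in> C" for i
      using both[OF that] pb_edge_set[OF d(1)] in_vertices(2)[of i k] unfolding edge_set_def by blast
    have "v \<in> C" using v(1) by simp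
    then obtain j where j: "v = Middle j" using mid by blast
    have "C \<subseteq> Middle ` {1..k}" using mid range by blast
    moreover have "j \<in> {1..k}" using range j \<open>v \<in> C\<close> by blast
    ultimately show ?thesis using v(1) j both unfolding loop_set_def by blast
  qed
next
  fix C assume "C \<in> loop_set k d1 d2 \<union> path_component d1 d2 ` comp_edges k d1 d2"
  then have "\<exists>v. C = stack_conn d1 d2 `` {v} \<and> v \<in> Domain (upper_matching d1) \<union> Domain (lower_matching d2)"
  proof
    assume "C \<in> loop_set k d1 d2"
    then obtain j where j: "C = stack_conn d1 d2 `` {Middle j}"
        "\<And>i. Middle i \<in> C \<Longrightarrow> Inr i \<in> \<Union> (edges d1) \<and> Inl i \<in> \<Union> (edges d2)" by (auto simp: loop_set_def)
    have "Middle j \<in> C" unfolding j(1) by simp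
    then have "Middle j \<in> Domain (upper_matching d1)" using j(2) Domain_matching_iff(2)[OF d(1)] by blast
    then show ?thesis using j(1) by blast
  next
    assume "C \<in> path_component d1 d2 ` comp_edges k d1 d2"
    then obtain e where e: "e \<in> comp_edges k d1 d2" "C = path_component d1 d2 e" by blast
    obtain x y where xy: "e = {x, y}" using e(1) unfolding comp_edges_def by blast
    have c: "(outer x, outer y) \<in> stack_conn d1 d2" "outer x \<noteq> outer y"
      using e(1) xy inj_case_sums(3) by (auto simp: comp_edges_iff inj_def)
    then have "outer x \<in> Domain (upper_matching d1) \<union> Domain (lower_matching d2)"
      unfolding stack_conn_matchings[OF d] by (auto elim: converse_rtranclE)
    then show ?thesis using path_component_eq[of x y k d1 d2] e xy by blast
  qed
  then obtain v where v: "C = stack_conn d1 d2 `` {v}" "v \<in> Domain (upper_matching d1) \<union> Domain (lower_matching d2)" by blast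
  obtain s where s: "s \<in> edges d1 <+> edges d2"
    "v \<in> case_sum ((`) (case_sum Upper Middle)) ((`) (case_sum Middle Lower)) s" using Domain_cases[OF v(2)] .
  have "C = edge_component d1 d2 s" unfolding v(1) edge_component_eq[OF s] ..
  then show "C \<in> edge_component d1 d2 ` (edges d1 <+> edges d2)" using s(1) by blast
qed

end

lemma loops_paths_disjoint: "loop_set k d1 d2 \<inter> path_component d1 d2 ` comp_edges k d1 d2 = {}"
proof -
  have "\<exists>x. outer x \<in> C" if "C \<in> path_component d1 d2 ` comp_edges k d1 d2" for C
  proof -
    obtain e where e: "e \<in> comp_edges k d1 d2" "C = path_component d1 d2 e" using \<open>C \<in> _\<close> by blast
    obtain x y where xy: "e = {x, y}" using e(1) unfolding comp_edges_def by blast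
    have "outer x \<in> C" using e xy unfolding path_component_eq[OF e(1)[unfolded xy], folded xy] by simp
    then show ?thesis by blast
  qed
  moreover have "outer x \<notin> C" if "C \<in> loop_set k d1 d2" for C x
    using that unfolding loop_set_def by (cases x) auto
  ultimately show ?thesis by blast
qed

text \<open>The contribution of a set \<open>F\<close> of removed edges depends only on the set of
  components it hits. \<open>alt_sum_image\<close> therefore replaces the edges by the components;
  the loops split off as powers of \<open>\<delta> - 1\<close> by \<open>alt_sum_union\<close>, and
  the remaining alternating sum over the paths is the one that defines \<open>bar\<close> of the
  composite.\<close>

lemma bar_mult_match:
  fixes \<delta> :: "'k::field"
  assumes d: "d1 \<in> motzkin k" "d2 \<in> motzkin k" and match: "bot_set d1 = top_set d2"
  shows "bar d1 \<otimes>\<^bsub>motzkin_algebra k \<delta>\<^esub> bar d2 = fscale ((\<delta> - 1) ^ loops k d1 d2) (bar (diag_comp k d1 d2))"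
proof -
  note pb = motzkin_pb[OF d(1)] motzkin_pb[OF d(2)]
  let ?E = "edges d1 <+> edges d2" and ?L = "loop_set k d1 d2" and ?P = "path_component d1 d2"
    and ?C = "comp_edges k d1 d2"
  \<comment> \<open>\<open>T\<close> stands for the set of components that are hit:
    \<open>b T\<close> keeps the paths outside \<open>T\<close>, and \<open>g T\<close> adds a
    factor \<open>\<delta>\<close> for each loop outside \<open>T\<close>.\<close>
  define b :: "stacked set set \<Rightarrow> diagram \<Rightarrow> 'k"
    where "b T = basis_vec (diag_of k {e \<in> ?C. ?P e \<notin> T})" for T
  define g where "g T = fscale (\<delta> ^ (card ?L - card (T \<inter> ?L))) (b (T \<inter> ?P ` ?C))" for T
  have finE: "finite ?E" using finite_edges[OF pb(1)] finite_edges[OF pb(2)] by simp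
  have finC: "finite ?C" using finite_edge_set comp_edges_edge_set[OF pb] by blast
  have finL: "finite ?L"
  proof (rule finite_subset)
    show "?L \<subseteq> Pow (Middle ` {1..k})" by (auto simp: loop_set_def)
  qed simp
  have terms: "comp_term k \<delta> (remove_edges (Inl -` F) d1) (remove_edges (Inr -` F) d2) = g (edge_component d1 d2 ` F)"
    if "F \<subseteq> ?E" for F
  proof -
    have F: "Inl -` F \<subseteq> edges d1" "Inr -` F \<subseteq> edges d2" using that by auto
    note r = remove_edges_pb(1)[OF pb(1) F(1)] remove_edges_pb(1)[OF pb(2) F(2)]
    let ?T = "edge_component d1 d2 ` F"
    have L: "loop_set k (remove_edges (Inl -` F) d1) (remove_edges (Inr -` F) d2) = ?L - ?T \<inter> ?L"
    proof -
      have "C \<inter> (case_sum Upper Middle ` \<Union> (Inl -` F) \<union> case_sum Middle Lower ` \<Union> (Inr -` F)) = {} \<longleftrightarrow> C \<notin> ?T"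
        if "C \<in> ?L" for C
      proof -
        obtain j where "C = stack_conn d1 d2 `` {Middle j}" using \<open>C \<in> ?L\<close> by (auto simp: loop_set_def)
        then show ?thesis by (simp only: component_untouched_iff[OF F pb])
      qed
      moreover have "{C \<in> L. Q C} = L - T \<inter> L" if "\<And>C. C \<in> L \<Longrightarrow> Q C \<longleftrightarrow> C \<notin> T" for L T :: "stacked set set" and Q
        using that by blast
      ultimately show ?thesis unfolding loop_set_remove[OF pb F] by simp
    qed
    have C: "comp_edges k (remove_edges (Inl -` F) d1) (remove_edges (Inr -` F) d2)
        = {e \<in> ?C. ?P e \<notin> ?T \<inter> ?P ` ?C}"
    proof -
      have *: "stack_component d1 d2 (outer x) \<inter>
          (case_sum Upper Middle ` \<Union> (Inl -` F) \<union> case_sum Middle Lower ` \<Union> (Inr -` F)) = {} \<longleftrightarrow> ?P {x, y} \<notin> ?T"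
        if "{x, y} \<in> ?C" for x y
        unfolding path_component_eq[OF that] stack_component_def component_untouched_iff[OF F pb] ..
      have "{{x, y} | x y. {x, y} \<in> A \<and> Q x} = {e \<in> A. f e \<notin> T \<inter> f ` A}"
        if t: "\<And>x y. {x, y} \<in> A \<Longrightarrow> Q x \<longleftrightarrow> f {x, y} \<notin> T" and t2: "\<And>e. e \<in> A \<Longrightarrow> \<exists>x y. e = {x, y}"
        for A :: diagram and Q and f :: "(nat + nat) set \<Rightarrow> stacked set" and T
      proof (intro subset_antisym subsetI)
        fix e assume "e \<in> {e \<in> A. f e \<notin> T \<inter> f ` A}"
        then have e: "e \<in> A" "f e \<notin> T" by auto
        obtain x y where "e = {x, y}" using t2[OF e(1)] by auto
        then show "e \<in> {{x, y} | x y. {x, y} \<in> A \<and> Q x}" using t[of x y] e by auto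
      qed (use t in auto)
      note aux = this
      show ?thesis
        unfolding comp_edges_remove[OF pb F]
      proof (rule aux)
        show "\<exists>x y. e = {x, y}" if "e \<in> ?C" for e using that unfolding comp_edges_def by blast
      qed (rule *)
    qed
    have "diag_comp k (remove_edges (Inl -` F) d1) (remove_edges (Inr -` F) d2)
        = diag_of k {e \<in> ?C. ?P e \<notin> ?T \<inter> ?P ` ?C}"
      using pb_diag_of[OF diag_comp_edges(1)[OF r]] diag_comp_edges(2)[OF r] C by simp
    moreover have "loops k (remove_edges (Inl -` F) d1) (remove_edges (Inr -` F) d2) = card ?L - card (?T \<inter> ?L)"
      unfolding loops_card L using finL by (intro card_Diff_subset) auto
    ultimately show ?thesis by (simp add: comp_term_def g_def b_def)
  qed
  have "bar d1 \<otimes>\<^bsub>motzkin_algebra k \<delta>\<^esub> bar d2 = alt_sum ?E (\<lambda>F. g (edge_component d1 d2 ` F))"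
    unfolding bar_mult_expand[OF d] by (rule alt_sum_cong) (rule terms)
  also have "\<dots> = alt_sum (?L \<union> ?P ` ?C) g"
    unfolding alt_sum_image[OF finE] edge_components[OF pb match] ..
  also have "\<dots> = fscale ((\<delta> - 1) ^ card ?L) (alt_sum (?P ` ?C) b)"
    unfolding g_def by (rule alt_sum_union[OF finL _ loops_paths_disjoint]) (use finC in simp)
  also have "alt_sum (?P ` ?C) b = alt_sum ?C (\<lambda>F. b (?P ` F))"
    by (rule alt_sum_reindex[OF inj_on_path_component[OF pb], symmetric])
  also have "\<dots> = bar (diag_comp k d1 d2)"
    unfolding bar_alt_sum[OF diag_comp_edges(1)[OF pb]] diag_comp_edges(2)[OF pb]
  proof (rule alt_sum_cong)
    fix F assume F: "F \<subseteq> ?C"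
    have "{e \<in> ?C. ?P e \<notin> ?P ` F} = ?C - F"
      using inj_on_path_component[OF pb] F by (auto simp: inj_on_def)
    then show "b (?P ` F) = basis_vec (remove_edges F (diag_comp k d1 d2))"
      unfolding b_def using remove_edges_diag_of[OF diag_comp_edges(1)[OF pb], of F] diag_comp_edges(2)[OF pb] F
      by simp
  qed
  finally show ?thesis by (simp add: loops_card)
qed


section \<open>Diagrams as triples\<close>

definition nth_elem :: "nat set \<Rightarrow> nat \<Rightarrow> nat" where
  "nth_elem A = inv_into A (rank_in A)"

lemma rank_in_less:
  assumes "finite A" "j \<in> A" "i < j" shows "rank_in A i < rank_in A j"
  unfolding rank_in_def
proof (rule psubset_card_mono)
  have "j \<in> {x \<in> A. x \<le> j}" "j \<notin> {x \<in> A. x \<le> i}" using assms by auto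
  moreover have "{x \<in> A. x \<le> i} \<subseteq> {x \<in> A. x \<le> j}" using assms(3) by auto
  ultimately show "{x \<in> A. x \<le> i} \<subset> {x \<in> A. x \<le> j}" by blast
qed (use assms(1) in simp)

lemma bij_betw_rank_in:
  assumes "finite A" shows "bij_betw (rank_in A) A {1..card A}"
proof -
  have inj: "inj_on (rank_in A) A"
  proof (rule inj_onI)
    fix i j assume "i \<in> A" "j \<in> A" "rank_in A i = rank_in A j"
    then show "i = j" using rank_in_less[OF assms, of j i] rank_in_less[OF assms, of i j]
      by (metis less_irrefl linorder_neqE_nat)
  qed
  have "rank_in A ` A \<subseteq> {1..card A}"
  proof clarify
    fix i assume "i \<in> A"
    then have "{x \<in> A. x \<le> i} \<noteq> {}" by auto
    then have "0 < rank_in A i" unfolding rank_in_def using assms by (simp add: card_gt_0_iff)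
    moreover have "rank_in A i \<le> card A" unfolding rank_in_def by (rule card_mono) (use assms in auto)
    ultimately show "rank_in A i \<in> {1..card A}" by simp
  qed
  then have "rank_in A ` A = {1..card A}" by (intro card_subset_eq) (simp_all add: card_image[OF inj])
  then show ?thesis using inj by (simp add: bij_betw_def)
qed

lemma bij_betw_nth_elem:
  assumes "finite A" shows "bij_betw (nth_elem A) {1..card A} A"
  unfolding nth_elem_def by (rule bij_betw_inv_into[OF bij_betw_rank_in[OF assms]])

lemma nth_elem_mem: "finite A \<Longrightarrow> i \<in> {1..card A} \<Longrightarrow> nth_elem A i \<in> A"
  using bij_betw_nth_elem[of A] by (auto simp: bij_betw_def)

lemma rank_in_nth_elem: "finite A \<Longrightarrow> i \<in> {1..card A} \<Longrightarrow> rank_in A (nth_elem A i) = i"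
  unfolding nth_elem_def using bij_betw_rank_in[of A] by (metis bij_betw_inv_into_right)

lemma nth_elem_rank_in: "finite A \<Longrightarrow> i \<in> A \<Longrightarrow> nth_elem A (rank_in A i) = i"
  unfolding nth_elem_def using bij_betw_rank_in[of A] by (metis bij_betw_inv_into_left)

lemma nth_elem_less_iff:
  assumes "finite A" "i \<in> {1..card A}" "j \<in> {1..card A}"
  shows "nth_elem A i < nth_elem A j \<longleftrightarrow> i < j"
proof -
  have *: "i < j" if "i \<in> {1..card A}" "j \<in> {1..card A}" "nth_elem A i < nth_elem A j" for i j
    using rank_in_less[OF assms(1) nth_elem_mem[OF assms(1) that(2)] that(3)] that
    by (simp add: rank_in_nth_elem[OF assms(1)])
  show ?thesis
  proof
    assume "i < j"
    then have "nth_elem A i \<noteq> nth_elem A j"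
      using rank_in_nth_elem[OF assms(1,2)] rank_in_nth_elem[OF assms(1,3)] by auto
    moreover have "\<not> nth_elem A j < nth_elem A i" using *[OF assms(3,2)] \<open>i < j\<close> by auto
    ultimately show "nth_elem A i < nth_elem A j" by linarith
  qed (rule *[OF assms(2,3)])
qed

lemma subsets_nD:
  assumes "A \<in> subsets_n k n" shows "finite A" "card A = n" "A \<subseteq> {1..k}"
  using assms finite_subset[of A "{1..k}"] by (auto simp: subsets_n_def)

lemma finite_subsets_n [simp]: "finite (subsets_n k n)"
  by (rule finite_subset[of _ "Pow {1..k}"]) (auto simp: subsets_n_def)

definition relabel :: "nat set \<Rightarrow> nat set \<Rightarrow> nat + nat \<Rightarrow> nat + nat" where
  "relabel A B = map_sum (nth_elem A) (nth_elem B)"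

lemma relabel_simps [simp]:
  "relabel A B (Inl i) = Inl (nth_elem A i)" "relabel A B (Inr i) = Inr (nth_elem B i)"
  by (simp_all add: relabel_def)

text \<open>\<open>tl_diagrams\<close> without planarity. Composition visibly preserves this larger
  set; that products stay planar is drawn from the ring axioms instead.\<close>

definition perfect :: "nat \<Rightarrow> diagram set" where
  "perfect n = {t \<in> partial_brauer n. \<forall>b\<in>t. card b = 2}"

text \<open>Inverse of the decomposition of a diagram into \<open>top_set\<close>,
  \<open>tl_part\<close> and \<open>bot_set\<close>.\<close>

definition place :: "nat \<Rightarrow> nat set \<Rightarrow> nat set \<Rightarrow> diagram \<Rightarrow> diagram" where
  "place k A B t = diag_of k ((`) (relabel A B) ` edges t)"

lemma perfect_pb: "t \<in> perfect n \<Longrightarrow> t \<in> partial_brauer n"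
  by (simp add: perfect_def)

lemma finite_perfect [simp]: "finite (perfect n)"
  by (rule finite_subset[of _ "partial_brauer n"]) (auto simp: perfect_def)

lemma perfect_edges: "t \<in> perfect n \<Longrightarrow> edges t = t"
  by (auto simp: perfect_def edges_def)

lemma perfect_Union:
  assumes "t \<in> perfect n" shows "\<Union> (edges t) = vertices n"
  using assms perfect_edges[OF assms] by (auto simp: perfect_def partial_brauer_def partition_on_def)

lemma perfectI:
  assumes "t \<in> partial_brauer n" "vertices n \<subseteq> \<Union> (edges t)" shows "t \<in> perfect n"
proof -
  have "vertices n - \<Union> (edges t) = {}" using assms(2) by blast
  then have "diag_of n (edges t) = edges t" unfolding diag_of_def by blast
  then have "t = edges t" using pb_diag_of[OF assms(1)] by simp
  then show ?thesis using assms(1) by (auto simp: perfect_def edges_def)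
qed

lemma tl_diagrams_perfect: "tl_diagrams n = {t \<in> perfect n. noncrossing n t}"
  by (auto simp: tl_diagrams_def perfect_def motzkin_def)

lemma finite_tl_diagrams [simp]: "finite (tl_diagrams n)"
  by (simp add: tl_diagrams_perfect)

lemma top_bot_set: "Inl i \<in> \<Union> (edges d) \<longleftrightarrow> i \<in> top_set d" "Inr i \<in> \<Union> (edges d) \<longleftrightarrow> i \<in> bot_set d"
  by (simp_all add: top_set_def bot_set_def)

lemma top_bot_perfect:
  assumes "t \<in> perfect n" shows "top_set t = {1..n}" "bot_set t = {1..n}"
  unfolding top_set_def bot_set_def perfect_Union[OF assms] by auto

context
  fixes k n A B
  assumes A: "A \<in> subsets_n k n" and B: "B \<in> subsets_n k n"
begin

lemma relabel_image: "relabel A B ` vertices n = Inl ` A \<union> Inr ` B"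
proof -
  have "nth_elem A ` {1..n} = A" "nth_elem B ` {1..n} = B"
    using bij_betw_nth_elem[OF subsets_nD(1)[OF A]] bij_betw_nth_elem[OF subsets_nD(1)[OF B]]
      subsets_nD(2)[OF A] subsets_nD(2)[OF B] by (simp_all add: bij_betw_def)
  then have "Inl ` A \<union> Inr ` B = Inl ` nth_elem A ` {1..n} \<union> Inr ` nth_elem B ` {1..n}" by simp
  then show ?thesis by (simp only: vertices_def image_Un image_image relabel_simps)
qed

lemma relabel_vertices: "v \<in> vertices n \<Longrightarrow> relabel A B v \<in> vertices k"
proof -
  assume "v \<in> vertices n"
  then have "relabel A B v \<in> Inl ` A \<union> Inr ` B" unfolding relabel_image[symmetric] by (rule imageI)
  then show ?thesis using subsets_nD(3)[OF A] subsets_nD(3)[OF B] unfolding vertices_def by blast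
qed

lemma rank_relabel: "v \<in> vertices n \<Longrightarrow> map_sum (rank_in A) (rank_in B) (relabel A B v) = v"
  using rank_in_nth_elem[OF subsets_nD(1)[OF A]] rank_in_nth_elem[OF subsets_nD(1)[OF B]]
    subsets_nD(2)[OF A] subsets_nD(2)[OF B]
  by (cases v) auto

lemma inj_on_relabel: "inj_on (relabel A B) (vertices n)"
  by (rule inj_on_inverseI[of _ "map_sum (rank_in A) (rank_in B)"]) (rule rank_relabel)

lemma relabel_edge_set:
  assumes E: "edge_set n E" shows "edge_set k ((`) (relabel A B) ` E)"
proof -
  have sub: "e \<subseteq> vertices n" if "e \<in> E" for e using E that by (auto simp: edge_set_def)
  show ?thesis
    unfolding edge_set_def
  proof (intro conjI ballI impI)
    fix e assume "e \<in> (`) (relabel A B) ` E"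
    then obtain e' where e': "e' \<in> E" "e = relabel A B ` e'" by auto
    show "e \<subseteq> vertices k" using relabel_vertices sub[OF e'(1)] e'(2) by auto
    have "card e = card e'" unfolding e'(2) by (rule card_image[OF inj_on_subset[OF inj_on_relabel sub[OF e'(1)]]])
    then show "card e = 2" using E e'(1) by (simp add: edge_set_def)
  next
    fix e f assume "e \<in> (`) (relabel A B) ` E" "f \<in> (`) (relabel A B) ` E" "e \<inter> f \<noteq> {}"
    then obtain e' f' where ef: "e' \<in> E" "e = relabel A B ` e'" "f' \<in> E" "f = relabel A B ` f'" by auto
    have "e' \<inter> f' \<noteq> {}"
      using \<open>e \<inter> f \<noteq> {}\<close> inj_on_image_Int[OF inj_on_relabel sub[OF ef(1)] sub[OF ef(3)]] ef by auto
    then show "e = f" using E ef unfolding edge_set_def by metis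
  qed
qed

lemma place_pb:
  assumes "t \<in> partial_brauer n"
  shows "place k A B t \<in> partial_brauer k" "edges (place k A B t) = (`) (relabel A B) ` edges t"
  unfolding place_def using relabel_edge_set[OF pb_edge_set[OF assms]] by (auto simp: diag_of_pb)

lemma place_top_bot:
  assumes t: "t \<in> perfect n"
  shows "top_set (place k A B t) = A" "bot_set (place k A B t) = B"
proof -
  have "\<Union> (edges (place k A B t)) = relabel A B ` \<Union> (edges t)"
    unfolding place_pb(2)[OF perfect_pb[OF t]] by auto
  then have "\<Union> (edges (place k A B t)) = Inl ` A \<union> Inr ` B"
    unfolding perfect_Union[OF t] relabel_image .
  then show "top_set (place k A B t) = A" "bot_set (place k A B t) = B"
    by (auto simp: top_set_def bot_set_def)
qed

lemma tl_part_place: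
  assumes t: "t \<in> perfect n" shows "tl_part (place k A B t) = t"
proof -
  have "map_sum (rank_in A) (rank_in B) ` relabel A B ` b = b" if "b \<in> t" for b
  proof -
    have "b \<subseteq> vertices n" using t that by (auto simp: perfect_def partial_brauer_def partition_on_def)
    then show ?thesis unfolding image_image using rank_relabel by (auto simp: subset_iff image_iff)
  qed
  then show ?thesis
    unfolding tl_part_def place_top_bot[OF t] place_pb(2)[OF perfect_pb[OF t]] image_image perfect_edges[OF t]
    by simp
qed

text \<open>Renumbering is increasing in each row, the bottom row is traversed backwards in both
  rectangles, and every top position precedes every bottom one. So the boundary order is preserved,
  and with it the absence of crossings.\<close>

lemma boundary_pos_relabel:
  assumes "a \<in> vertices n" "b \<in> vertices n"
  shows "boundary_pos k (relabel A B a) < boundary_pos k (relabel A B b) \<longleftrightarrow> boundary_pos n a < boundary_pos n b"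
proof -
  have le: "nth_elem A i \<le> k" "nth_elem B i \<le> k" "0 < nth_elem B i" if "i \<in> {1..n}" for i
    using nth_elem_mem[OF subsets_nD(1)[OF A], of i] nth_elem_mem[OF subsets_nD(1)[OF B], of i]
      subsets_nD[OF A] subsets_nD[OF B] that by force+
  note ls = nth_elem_less_iff[OF subsets_nD(1)[OF A]] nth_elem_less_iff[OF subsets_nD(1)[OF B]]
  show ?thesis
  proof (cases a; cases b)
    fix i j assume "a = Inl i" "b = Inl j"
    then show ?thesis using assms ls(1)[of i j] subsets_nD[OF A] by (simp add: boundary_pos_def)
  next
    fix i j assume ij: "a = Inl i" "b = Inr j"
    then have "i \<in> {1..n}" "j \<in> {1..n}" using assms by auto
    then show ?thesis using ij le(1)[of i] le(2)[of j] by (auto simp: boundary_pos_def)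
  next
    fix i j assume ij: "a = Inr i" "b = Inl j"
    then have "i \<in> {1..n}" "j \<in> {1..n}" using assms by auto
    then show ?thesis using ij le(1)[of j] le(2)[of i] by (auto simp: boundary_pos_def)
  next
    fix i j assume ij: "a = Inr i" "b = Inr j"
    then have m: "i \<in> {1..n}" "j \<in> {1..n}" using assms by auto
    then have "nth_elem B j < nth_elem B i \<longleftrightarrow> j < i" using ls(2)[of j i] subsets_nD[OF B] by simp
    then show ?thesis using ij m le(2)[OF m(1)] le(2)[OF m(2)] by (auto simp: boundary_pos_def)
  qed
qed

text \<open>Lets the ordered pairs \<open>a\<close>, \<open>b\<close> with \<open>{a, b}\<close> an
  edge, on which \<open>noncrossing\<close> and the matchings are built, pass through
  \<open>relabel\<close>.\<close>

lemma relabel_pair: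
  assumes "edge_set n E"
  shows "{a', b'} \<in> (`) (relabel A B) ` E \<longleftrightarrow> (\<exists>a b. {a, b} \<in> E \<and> a' = relabel A B a \<and> b' = relabel A B b)"
proof
  assume "{a', b'} \<in> (`) (relabel A B) ` E"
  then obtain e where e: "e \<in> E" "{a', b'} = relabel A B ` e" by auto
  obtain p q where pq: "e = {p, q}" "p \<noteq> q" using edge_set_obtain[OF assms e(1)] .
  then have "{a', b'} = {relabel A B p, relabel A B q}" using e by simp
  then have "a' = relabel A B p \<and> b' = relabel A B q \<or> a' = relabel A B q \<and> b' = relabel A B p"
    by (simp add: doubleton_eq_iff)
  then show "\<exists>a b. {a, b} \<in> E \<and> a' = relabel A B a \<and> b' = relabel A B b"
    using e(1) pq(1) by (metis insert_commute)
next
  assume "\<exists>a b. {a, b} \<in> E \<and> a' = relabel A B a \<and> b' = relabel A B b"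
  then obtain a b where "{a, b} \<in> E" "a' = relabel A B a" "b' = relabel A B b" by auto
  then show "{a', b'} \<in> (`) (relabel A B) ` E" by (intro image_eqI[of _ _ "{a, b}"]) auto
qed

lemma noncrossing_place:
  assumes t: "t \<in> partial_brauer n"
  shows "noncrossing k (place k A B t) \<longleftrightarrow> noncrossing n t"
proof -
  note E = pb_edge_set[OF t]
  have v: "a \<in> vertices n" "b \<in> vertices n" if "{a, b} \<in> edges t" for a b using edge_set_pairD[OF E that] by auto
  show ?thesis
  proof
    assume nc: "noncrossing k (place k A B t)"
    show "noncrossing n t"
      unfolding noncrossing_def
    proof (intro notI, elim exE conjE)
      fix a b u w
      assume ab: "{a, b} \<in> edges t" and uw: "{u, w} \<in> edges t"
        and l: "boundary_pos n a < boundary_pos n u" "boundary_pos n u < boundary_pos n b" "boundary_pos n b < boundary_pos n w"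
      let ?f = "relabel A B"
      have "{?f a, ?f b} \<in> edges (place k A B t)" "{?f u, ?f w} \<in> edges (place k A B t)"
        unfolding place_pb(2)[OF t] relabel_pair[OF E] using ab uw by blast+
      moreover have "boundary_pos k (?f a) < boundary_pos k (?f u)" "boundary_pos k (?f u) < boundary_pos k (?f b)"
        "boundary_pos k (?f b) < boundary_pos k (?f w)"
        using l v[OF ab] v[OF uw] by (simp_all add: boundary_pos_relabel)
      ultimately show False using nc unfolding noncrossing_def by blast
    qed
  next
    assume nc: "noncrossing n t"
    show "noncrossing k (place k A B t)"
      unfolding noncrossing_def place_pb(2)[OF t] relabel_pair[OF E]
    proof (intro notI, elim exE conjE)
      fix a' b' u' w' a b u w
      assume ab: "{a, b} \<in> edges t" "a' = relabel A B a" "b' = relabel A B b"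
        and uw: "{u, w} \<in> edges t" "u' = relabel A B u" "w' = relabel A B w"
        and l: "boundary_pos k a' < boundary_pos k u'" "boundary_pos k u' < boundary_pos k b'" "boundary_pos k b' < boundary_pos k w'"
      have "boundary_pos n a < boundary_pos n u" "boundary_pos n u < boundary_pos n b" "boundary_pos n b < boundary_pos n w"
        using l v[OF ab(1)] v[OF uw(1)] unfolding ab(2,3) uw(2,3) by (simp_all add: boundary_pos_relabel)
      then show False using nc ab(1) uw(1) unfolding noncrossing_def by blast
    qed
  qed
qed

end

section \<open>Counting cups, caps and vertical edges\<close>

definition verticals :: "diagram \<Rightarrow> diagram" where
  "verticals d = edges d - (cups d \<union> caps d)"

lemma edge_kinds:
  assumes d: "d \<in> partial_brauer k" and e: "e \<in> edges d"
  shows "card (e \<inter> range Inl) = (if e \<in> cups d then 2 else if e \<in> caps d then 0 else 1)"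
    and "card (e \<inter> range Inr) = (if e \<in> caps d then 2 else if e \<in> cups d then 0 else 1)"
proof -
  obtain a b where ab: "e = {a, b}" "a \<noteq> b" using edge_set_obtain[OF pb_edge_set[OF d] e] .
  have "card (e \<inter> range Inl) = (if e \<in> cups d then 2 else if e \<in> caps d then 0 else 1) \<and>
    card (e \<inter> range Inr) = (if e \<in> caps d then 2 else if e \<in> cups d then 0 else 1)"
    using e ab unfolding cups_def caps_def by (cases a; cases b) (auto simp: insert_commute Int_insert_left)
  then show "card (e \<inter> range Inl) = (if e \<in> cups d then 2 else if e \<in> caps d then 0 else 1)"
    "card (e \<inter> range Inr) = (if e \<in> caps d then 2 else if e \<in> cups d then 0 else 1)" by auto
qed

lemma cups_caps_disjoint:
  assumes d: "d \<in> partial_brauer k" shows "cups d \<inter> caps d = {}"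
proof -
  have False if "e \<in> cups d" "e \<in> caps d" for e
  proof -
    have "e \<in> edges d" "e \<inter> range Inl = {}" using that by (auto simp: cups_def caps_def)
    then show False using edge_kinds(1)[OF d, of e] that(1) by simp
  qed
  then show ?thesis by blast
qed

text \<open>Count endpoints row by row: a cup has two in the top row, a cap none and a vertical edge
  one, and dually below.\<close>

lemma top_bot_card:
  assumes d: "d \<in> partial_brauer k"
  shows "card (top_set d) = 2 * card (cups d) + card (verticals d)"
    and "card (bot_set d) = 2 * card (caps d) + card (verticals d)"
    and "card (edges d) = card (cups d) + card (caps d) + card (verticals d)"
proof -
  note E = pb_edge_set[OF d] and fin = finite_edges[OF d] and disj = cups_caps_disjoint[OF d]
  have finc: "finite (cups d)" "finite (caps d)" "finite (verticals d)"
    using fin by (auto simp: cups_def caps_def verticals_def)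
  have split: "edges d = cups d \<union> (caps d \<union> verticals d)" "cups d \<inter> (caps d \<union> verticals d) = {}"
    "caps d \<inter> verticals d = {}"
    using disj by (auto simp: verticals_def cups_def caps_def)
  have sum3: "sum f (edges d) = sum f (cups d) + (sum f (caps d) + sum f (verticals d))" for f :: "_ \<Rightarrow> nat"
    unfolding split(1) using finc split(2,3) by (simp add: sum.union_disjoint)
  have part: "card (\<Union> (edges d) \<inter> R) = (\<Sum>e\<in>edges d. card (e \<inter> R))" for R
  proof -
    have "card (\<Union>e\<in>edges d. e \<inter> R) = (\<Sum>e\<in>edges d. card (e \<inter> R))"
    proof (rule card_UN_disjoint[OF fin])
      show "\<forall>e\<in>edges d. finite (e \<inter> R)"
        using E finite_subset[OF _ finite_vertices[of k]] by (simp add: edge_set_def)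
      show "\<forall>e\<in>edges d. \<forall>f\<in>edges d. e \<noteq> f \<longrightarrow> e \<inter> R \<inter> (f \<inter> R) = {}"
        using E unfolding edge_set_def by (metis (no_types, lifting) Int_assoc Int_empty_left Int_left_commute)
    qed
    moreover have "(\<Union>e\<in>edges d. e \<inter> R) = \<Union> (edges d) \<inter> R" by auto
    ultimately show ?thesis by simp
  qed
  have vert: "e \<notin> cups d" "e \<notin> caps d" "e \<in> edges d" if "e \<in> verticals d" for e using that by (auto simp: verticals_def)
  have cu: "e \<notin> caps d" "e \<in> edges d" if "e \<in> cups d" for e using that disj by (auto simp: cups_def)
  have ca: "e \<notin> cups d" "e \<in> edges d" if "e \<in> caps d" for e using that disj by (auto simp: caps_def)
  have "Inl ` top_set d = \<Union> (edges d) \<inter> range Inl" by (auto simp: top_set_def)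
  then have "card (top_set d) = (\<Sum>e\<in>edges d. card (e \<inter> range Inl))"
    using part[of "range Inl"] card_image[of Inl "top_set d"] by (metis inj_Inl)
  also have "\<dots> = (\<Sum>e\<in>cups d. 2) + ((\<Sum>e\<in>caps d. 0) + (\<Sum>e\<in>verticals d. 1))"
    unfolding sum3 by (intro arg_cong2[where f = "(+)"] sum.cong refl) (simp_all add: edge_kinds(1)[OF d] cu ca vert)
  finally show "card (top_set d) = 2 * card (cups d) + card (verticals d)" by simp
  have "Inr ` bot_set d = \<Union> (edges d) \<inter> range Inr" by (auto simp: bot_set_def)
  then have "card (bot_set d) = (\<Sum>e\<in>edges d. card (e \<inter> range Inr))"
    using part[of "range Inr"] card_image[of Inr "bot_set d"] by (metis inj_Inr)
  also have "\<dots> = (\<Sum>e\<in>cups d. 0) + ((\<Sum>e\<in>caps d. 2) + (\<Sum>e\<in>verticals d. 1))"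
    unfolding sum3 by (intro arg_cong2[where f = "(+)"] sum.cong refl) (simp_all add: edge_kinds(2)[OF d] cu ca vert)
  finally show "card (bot_set d) = 2 * card (caps d) + card (verticals d)" by simp
  show "card (edges d) = card (cups d) + card (caps d) + card (verticals d)"
    using sum3[of "\<lambda>_. 1"] by simp
qed

text \<open>Every vertical edge has one endpoint in each row, so equally many used vertices in both
  rows means equally many cups and caps; the common number is then the number of edges.\<close>

lemma balanced_n_iff:
  "d \<in> balanced_n k n \<longleftrightarrow> d \<in> motzkin k \<and> card (top_set d) = n \<and> card (bot_set d) = n"
  using top_bot_card[OF motzkin_pb, of d k] by (auto simp: balanced_n_def balanced_def)

lemma top_bot_subset:
  assumes "d \<in> partial_brauer k" shows "top_set d \<subseteq> {1..k}" "bot_set d \<subseteq> {1..k}"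
proof -
  have "\<Union> (edges d) \<subseteq> vertices k" using pb_edge_set[OF assms] by (auto simp: edge_set_def)
  then show "top_set d \<subseteq> {1..k}" "bot_set d \<subseteq> {1..k}"
    using in_vertices[of _ k] by (auto simp: top_set_def bot_set_def)
qed

text \<open>\<open>rank_in\<close> and \<open>nth_elem\<close> are mutually inverse on the used
  vertices of each row, so placing undoes the renumbering.\<close>

lemma tl_part_perfect:
  assumes d: "d \<in> partial_brauer k" and n: "card (top_set d) = n" "card (bot_set d) = n"
  shows "tl_part d \<in> perfect n" "place k (top_set d) (bot_set d) (tl_part d) = d"
proof -
  let ?A = "top_set d" and ?B = "bot_set d"
  note E = pb_edge_set[OF d]
  have AB: "?A \<in> subsets_n k n" "?B \<in> subsets_n k n" using top_bot_subset[OF d] n by (auto simp: subsets_n_def)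
  let ?r = "map_sum (rank_in ?A) (rank_in ?B)"
  have U: "\<Union> (edges d) = Inl ` ?A \<union> Inr ` ?B"
  proof (rule Set.set_eqI)
    show "v \<in> \<Union> (edges d) \<longleftrightarrow> v \<in> Inl ` ?A \<union> Inr ` ?B" for v
      using top_bot_set[of _ d] by (cases v) auto
  qed
  have inv: "relabel ?A ?B (?r v) = v" if "v \<in> \<Union> (edges d)" for v
    using that nth_elem_rank_in[OF subsets_nD(1)[OF AB(1)]] nth_elem_rank_in[OF subsets_nD(1)[OF AB(2)]]
    unfolding U by auto
  have im: "?r ` \<Union> (edges d) = vertices n"
    using bij_betw_rank_in[OF subsets_nD(1)[OF AB(1)]] bij_betw_rank_in[OF subsets_nD(1)[OF AB(2)]] n
    unfolding U by (auto simp: bij_betw_def image_Un image_image vertices_def)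
  have inj: "inj_on ?r (\<Union> (edges d))" by (rule inj_on_inverseI[of _ "relabel ?A ?B"]) (rule inv)
  let ?t = "(`) ?r ` edges d"
  have t: "edge_set n ?t"
    unfolding edge_set_def
  proof (intro conjI ballI impI)
    fix e assume "e \<in> ?t"
    then obtain e' where e': "e' \<in> edges d" "e = ?r ` e'" by auto
    then show "e \<subseteq> vertices n" using im by blast
    have "card e = card e'" unfolding e'(2) by (rule card_image[OF inj_on_subset[OF inj]]) (use e' in auto)
    then show "card e = 2" using E e'(1) by (simp add: edge_set_def)
  next
    fix e f assume "e \<in> ?t" "f \<in> ?t" "e \<inter> f \<noteq> {}"
    then obtain e' f' where ef: "e' \<in> edges d" "e = ?r ` e'" "f' \<in> edges d" "f = ?r ` f'" by auto
    have sub: "e' \<subseteq> \<Union> (edges d)" "f' \<subseteq> \<Union> (edges d)" using ef by auto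
    have "e' \<inter> f' \<noteq> {}"
      using \<open>e \<inter> f \<noteq> {}\<close> inj_on_image_Int[OF inj sub] ef by auto
    then show "e = f" using E ef unfolding edge_set_def by metis
  qed
  have "\<Union> ?t = vertices n" unfolding im[symmetric] by blast
  then have "diag_of n ?t = ?t" by (auto simp: diag_of_def)
  moreover have "tl_part d = ?t" by (simp add: tl_part_def)
  ultimately have pb: "tl_part d \<in> partial_brauer n" "edges (tl_part d) = ?t"
    using diag_of_pb[OF t] edges_diag_of[OF t] by simp_all
  then show "tl_part d \<in> perfect n" using \<open>\<Union> ?t = vertices n\<close> by (intro perfectI) auto
  have "relabel ?A ?B ` ?r ` e = e" if "e \<in> edges d" for e
  proof -
    have "relabel ?A ?B (?r v) = v" if "v \<in> e" for v using that \<open>e \<in> edges d\<close> by (intro inv) auto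
    then show ?thesis unfolding image_image by simp
  qed
  then have "(`) (relabel ?A ?B) ` ?t = edges d" unfolding image_image by simp
  then show "place k ?A ?B (tl_part d) = d"
    unfolding place_def pb(2) using pb_diag_of[OF d] by simp
qed

lemma place_balanced_n:
  assumes "A \<in> subsets_n k n" "B \<in> subsets_n k n" "t \<in> perfect n"
  shows "place k A B t \<in> balanced_n k n \<longleftrightarrow> t \<in> tl_diagrams n"
  unfolding balanced_n_iff motzkin_def tl_diagrams_perfect
  using place_pb[OF assms(1,2) perfect_pb[OF assms(3)]] noncrossing_place[OF assms(1,2) perfect_pb[OF assms(3)]]
    place_top_bot[OF assms] subsets_nD(2)[OF assms(1)] subsets_nD(2)[OF assms(2)] assms(3) by auto

lemma balanced_n_place:
  assumes "d \<in> balanced_n k n"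
  shows "top_set d \<in> subsets_n k n" "bot_set d \<in> subsets_n k n" "tl_part d \<in> tl_diagrams n"
    "place k (top_set d) (bot_set d) (tl_part d) = d"
proof -
  have d: "d \<in> partial_brauer k" "card (top_set d) = n" "card (bot_set d) = n"
    using assms motzkin_pb by (auto simp: balanced_n_iff)
  show AB: "top_set d \<in> subsets_n k n" "bot_set d \<in> subsets_n k n"
    using top_bot_subset[OF d(1)] d by (auto simp: subsets_n_def)
  show pl: "place k (top_set d) (bot_set d) (tl_part d) = d" using tl_part_perfect(2)[OF d] .
  show "tl_part d \<in> tl_diagrams n"
    using place_balanced_n[OF AB tl_part_perfect(1)[OF d]] pl assms by simp
qed

lemma balanced_n_subset: "balanced_n k n \<subseteq> motzkin k"
  by (auto simp: balanced_n_iff)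


subsection \<open>Composition of placed diagrams\<close>

text \<open>Injectivity of \<open>f\<close> on \<open>U\<close> forces a step of the image graph
  that starts at \<open>f y\<close> to come from a step that starts at \<open>y\<close>.\<close>

lemma rtrancl_image_inj:
  assumes inj: "inj_on f U" and r: "r \<subseteq> U \<times> U" and x: "x \<in> U"
  shows "(map_prod f f ` r)\<^sup>* `` {f x} = f ` (r\<^sup>* `` {x})"
proof (intro subset_antisym subsetI)
  fix z assume "z \<in> (map_prod f f ` r)\<^sup>* `` {f x}"
  then have "(f x, z) \<in> (map_prod f f ` r)\<^sup>*" by simp
  then have "\<exists>y. y \<in> U \<and> (x, y) \<in> r\<^sup>* \<and> z = f y"
  proof (induction rule: rtrancl_induct)
    case (step y z)
    then obtain y' where y': "y' \<in> U" "(x, y') \<in> r\<^sup>*" "y = f y'" by auto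
    obtain u v where uv: "(u, v) \<in> r" "y = f u" "z = f v" using step.hyps(2) by auto
    have "u = y'" using inj uv(1,2) y'(1,3) r by (auto simp: inj_on_def)
    then show ?case using uv y' r by (auto intro!: exI[of _ v] intro: rtrancl.rtrancl_into_rtrancl)
  qed (use x in auto)
  then show "z \<in> f ` (r\<^sup>* `` {x})" by auto
next
  fix z assume "z \<in> f ` (r\<^sup>* `` {x})"
  then obtain y where "(x, y) \<in> r\<^sup>*" "z = f y" by auto
  from this(1) have "(f x, f y) \<in> (map_prod f f ` r)\<^sup>*"
  proof (induction rule: rtrancl_induct)
    case (step y z)
    have "(f y, f z) \<in> map_prod f f ` r" using step.hyps(2) by (intro image_eqI[of _ _ "(y, z)"]) auto
    then show ?case using step.IH by (rule rtrancl.rtrancl_into_rtrancl[rotated])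
  qed simp
  then show "z \<in> (map_prod f f ` r)\<^sup>* `` {f x}" using \<open>z = f y\<close> by simp
qed

text \<open>When both diagrams use exactly the middle vertices in \<open>B\<close>, having two edges
  at a middle vertex just means lying in \<open>B\<close>. In this form loops can be transported by
  \<open>stack_relabel\<close>.\<close>

lemma loop_set_match:
  assumes "d1 \<in> partial_brauer k" "bot_set d1 = B" "top_set d2 = B"
  shows "loop_set k d1 d2 = {C. (\<exists>j\<in>B. C = stack_conn d1 d2 `` {Middle j}) \<and> C \<subseteq> Middle ` B}"
proof -
  have B: "B \<subseteq> {1..k}" using top_bot_subset(2)[OF assms(1)] assms(2) by simp
  show ?thesis
    unfolding loop_set_def top_bot_set assms(2,3)
  proof (intro subset_antisym subsetI)
    fix C assume "C \<in> {C. (\<exists>j\<in>{1..k}. C = stack_conn d1 d2 `` {Middle j}) \<and> C \<subseteq> Middle ` {1..k} \<and>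
      (\<forall>i. Middle i \<in> C \<longrightarrow> i \<in> B \<and> i \<in> B)}"
    then obtain j where j: "C = stack_conn d1 d2 `` {Middle j}" "C \<subseteq> Middle ` {1..k}" "\<And>i. Middle i \<in> C \<Longrightarrow> i \<in> B"
      by blast
    have "Middle j \<in> C" unfolding j(1) by simp
    moreover have "C \<subseteq> Middle ` B" using j(2,3) by blast
    ultimately show "C \<in> {C. (\<exists>j\<in>B. C = stack_conn d1 d2 `` {Middle j}) \<and> C \<subseteq> Middle ` B}" using j by blast
  next
    fix C assume "C \<in> {C. (\<exists>j\<in>B. C = stack_conn d1 d2 `` {Middle j}) \<and> C \<subseteq> Middle ` B}"
    then obtain j where j: "C = stack_conn d1 d2 `` {Middle j}" "C \<subseteq> Middle ` B" "j \<in> B" by blast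
    have "i \<in> B" if "Middle i \<in> C" for i using that j(2) by auto
    moreover have "C \<subseteq> Middle ` {1..k}" using j(2) B by blast
    ultimately show "C \<in> {C. (\<exists>j\<in>{1..k}. C = stack_conn d1 d2 `` {Middle j}) \<and> C \<subseteq> Middle ` {1..k} \<and>
      (\<forall>i. Middle i \<in> C \<longrightarrow> i \<in> B \<and> i \<in> B)}" using j B by blast
  qed
qed

text \<open>Every middle vertex has both of its edges, so the path starting at any outer vertex ends
  at another outer one.\<close>

lemma perfect_comp:
  assumes t: "t \<in> perfect n" and s: "s \<in> perfect n" shows "diag_comp n t s \<in> perfect n"
proof (rule perfectI)
  note pb = perfect_pb[OF t] perfect_pb[OF s]
  show "diag_comp n t s \<in> partial_brauer n" by (rule diag_comp_edges(1)[OF pb])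
  show "vertices n \<subseteq> \<Union> (edges (diag_comp n t s))"
  proof
    fix x assume "x \<in> vertices n"
    then have "outer x \<in> Domain (upper_matching t) \<union> Domain (lower_matching s)"
      using Domain_matching_iff(1)[OF pb(1)] Domain_matching_iff(5)[OF pb(2)]
      unfolding perfect_Union[OF t] perfect_Union[OF s] by (cases x) auto
    then obtain y where "{x, y} \<in> comp_edges n t s"
      using outer_partner[OF pb] top_bot_perfect[OF t] top_bot_perfect[OF s] by metis
    then show "x \<in> \<Union> (edges (diag_comp n t s))" unfolding diag_comp_edges(2)[OF pb] by blast
  qed
qed

definition stack_verts :: "nat \<Rightarrow> stacked set" where
  "stack_verts n = Upper ` {1..n} \<union> Middle ` {1..n} \<union> Lower ` {1..n}"

lemma case_sum_stack_verts:
  assumes "v \<in> vertices n"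
  shows "case_sum Upper Middle v \<in> stack_verts n" "case_sum Middle Lower v \<in> stack_verts n" "outer v \<in> stack_verts n"
  using assms by (cases v; auto simp: stack_verts_def)+

definition stack_relabel :: "nat set \<Rightarrow> nat set \<Rightarrow> nat set \<Rightarrow> stacked \<Rightarrow> stacked" where
  "stack_relabel A B C v =
     (case v of Upper i \<Rightarrow> Upper (nth_elem A i) | Middle i \<Rightarrow> Middle (nth_elem B i) | Lower i \<Rightarrow> Lower (nth_elem C i))"

lemma stack_relabel_simps:
  "stack_relabel A B C (Upper i) = Upper (nth_elem A i)"
  "stack_relabel A B C (Middle i) = Middle (nth_elem B i)"
  "stack_relabel A B C (Lower i) = Lower (nth_elem C i)"
  "stack_relabel A B C (case_sum Upper Middle v) = case_sum Upper Middle (relabel A B v)"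
  "stack_relabel A B C (case_sum Middle Lower v) = case_sum Middle Lower (relabel B C v)"
  "stack_relabel A B C (outer v) = outer (relabel A C v)"
  by (simp_all add: stack_relabel_def split: sum.splits)

context
  fixes k n A B C t s
  assumes A: "A \<in> subsets_n k n" and B: "B \<in> subsets_n k n" and C: "C \<in> subsets_n k n"
    and t: "t \<in> perfect n" and s: "s \<in> perfect n"
begin

lemma inj_on_stack_relabel: "inj_on (stack_relabel A B C) (stack_verts n)"
proof -
  have inj: "inj_on (nth_elem X) {1..n}" if "X \<in> subsets_n k n" for X
    using bij_betw_nth_elem[OF subsets_nD(1)[OF that]] subsets_nD(2)[OF that] by (simp add: bij_betw_def)
  show ?thesis
  proof (rule inj_onI)
    fix v w assume "v \<in> stack_verts n" "w \<in> stack_verts n" "stack_relabel A B C v = stack_relabel A B C w"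
    then show "v = w"
      by (auto simp: stack_verts_def stack_relabel_simps inj_on_eq_iff[OF inj[OF A]]
          inj_on_eq_iff[OF inj[OF B]] inj_on_eq_iff[OF inj[OF C]])
  qed
qed

lemma matchings_place:
  "upper_matching (place k A B t) \<union> lower_matching (place k B C s)
     = map_prod (stack_relabel A B C) (stack_relabel A B C) ` (upper_matching t \<union> lower_matching s)"
proof -
  have *: "{(h' a', h' b') | a' b'. \<exists>a b. {a, b} \<in> E \<and> a' = g a \<and> b' = g b}
      = map_prod f f ` {(h a, h b) | a b. {a, b} \<in> E}"
    if "\<And>v. f (h v) = h' (g v)" for f :: "stacked \<Rightarrow> stacked" and g h h' and E :: diagram
  proof (intro subset_antisym subsetI)
    fix z assume "z \<in> {(h' a', h' b') | a' b'. \<exists>a b. {a, b} \<in> E \<and> a' = g a \<and> b' = g b}"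
    then obtain a b where ab: "{a, b} \<in> E" "z = (h' (g a), h' (g b))" by blast
    have "z = map_prod f f (h a, h b)" by (simp add: ab that)
    then show "z \<in> map_prod f f ` {(h a, h b) | a b. {a, b} \<in> E}" using ab(1) by blast
  next
    fix z assume "z \<in> map_prod f f ` {(h a, h b) | a b. {a, b} \<in> E}"
    then obtain a b where ab: "{a, b} \<in> E" "z = map_prod f f (h a, h b)" by (elim imageE CollectE exE conjE) simp
    have "z = (h' (g a), h' (g b))" by (simp add: ab that)
    then show "z \<in> {(h' a', h' b') | a' b'. \<exists>a b. {a, b} \<in> E \<and> a' = g a \<and> b' = g b}" using ab(1) by blast
  qed
  have "upper_matching (place k A B t) = map_prod (stack_relabel A B C) (stack_relabel A B C) ` upper_matching t"
    unfolding upper_matching_def place_pb(2)[OF A B perfect_pb[OF t]] relabel_pair[OF A B pb_edge_set[OF perfect_pb[OF t]]]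
    by (rule *) (rule stack_relabel_simps)
  moreover have "lower_matching (place k B C s) = map_prod (stack_relabel A B C) (stack_relabel A B C) ` lower_matching s"
    unfolding lower_matching_def place_pb(2)[OF B C perfect_pb[OF s]] relabel_pair[OF B C pb_edge_set[OF perfect_pb[OF s]]]
    by (rule *) (rule stack_relabel_simps)
  ultimately show ?thesis by (simp add: image_Un)
qed

lemma matchings_stack_verts: "upper_matching t \<union> lower_matching s \<subseteq> stack_verts n \<times> stack_verts n"
  using edge_set_pairD[OF pb_edge_set[OF perfect_pb[OF t]]] edge_set_pairD[OF pb_edge_set[OF perfect_pb[OF s]]]
    case_sum_stack_verts
  unfolding upper_matching_def lower_matching_def by blast

lemma component_place:
  assumes "v \<in> stack_verts n"
  shows "stack_conn (place k A B t) (place k B C s) `` {stack_relabel A B C v} = stack_relabel A B C ` (stack_conn t s `` {v})"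
  unfolding stack_conn_matchings[OF place_pb(1)[OF A B perfect_pb[OF t]] place_pb(1)[OF B C perfect_pb[OF s]]]
    stack_conn_matchings[OF perfect_pb[OF t] perfect_pb[OF s]] matchings_place
  by (rule rtrancl_image_inj[OF inj_on_stack_relabel matchings_stack_verts assms])

lemma component_stack_verts:
  assumes "v \<in> stack_verts n" shows "stack_conn t s `` {v} \<subseteq> stack_verts n"
proof clarify
  fix w assume "(v, w) \<in> stack_conn t s"
  then show "w \<in> stack_verts n"
    unfolding stack_conn_matchings[OF perfect_pb[OF t] perfect_pb[OF s]]
    by (induction rule: rtrancl_induct) (use assms matchings_stack_verts in auto)
qed

text \<open>Apart from isolated vertices, the stacked graph of the placed diagrams is the image of
  the original one under the injection \<open>stack_relabel\<close>; the middle row is renumbered by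
  the same set \<open>B\<close> from both sides.\<close>

lemma diag_comp_place: "diag_comp k (place k A B t) (place k B C s) = place k A C (diag_comp n t s)"
proof -
  note pt = perfect_pb[OF t] and ps = perfect_pb[OF s]
  note q = place_pb(1)[OF A B pt] place_pb(1)[OF B C ps]
  note c = diag_comp_edges[OF pt ps]
  have inj: "inj_on (relabel A C) (vertices n)" by (rule inj_on_relabel[OF A C])
  have conn: "(outer (relabel A C u), outer (relabel A C v)) \<in> stack_conn (place k A B t) (place k B C s)
      \<longleftrightarrow> (outer u, outer v) \<in> stack_conn t s" if uv: "u \<in> vertices n" "v \<in> vertices n" for u v
  proof -
    have "outer (relabel A C v) \<in> stack_conn (place k A B t) (place k B C s) `` {outer (relabel A C u)}
      \<longleftrightarrow> stack_relabel A B C (outer v) \<in> stack_relabel A B C ` (stack_conn t s `` {outer u})"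
      unfolding stack_relabel_simps(6)[of A B C, symmetric] component_place[OF case_sum_stack_verts(3)[OF uv(1)]] ..
    also have "\<dots> \<longleftrightarrow> outer v \<in> stack_conn t s `` {outer u}"
      by (rule inj_on_image_mem_iff[OF inj_on_stack_relabel case_sum_stack_verts(3)[OF uv(2)]
            component_stack_verts[OF case_sum_stack_verts(3)[OF uv(1)]]])
    finally show ?thesis by simp
  qed
  have "comp_edges k (place k A B t) (place k B C s) = (`) (relabel A C) ` comp_edges n t s"
  proof (intro subset_antisym subsetI)
    fix e assume e: "e \<in> comp_edges k (place k A B t) (place k B C s)"
    obtain x y where xy: "e = {x, y}" using e unfolding comp_edges_def by blast
    have cxy: "(outer x, outer y) \<in> stack_conn (place k A B t) (place k B C s)" "x \<noteq> y"
      using e unfolding xy comp_edges_iff by auto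
    \<comment> \<open>A vertex connected to a different one has an edge, and all edges come from the
      original graph.\<close>
    have "\<exists>w\<in>vertices n. z = relabel A C w"
      if "(outer z, outer z') \<in> stack_conn (place k A B t) (place k B C s)" "z \<noteq> z'" for z z'
    proof -
      have "outer z \<noteq> outer z'" using that(2) inj_case_sums(3) by (auto simp: inj_def)
      then have "outer z \<in> Domain (upper_matching (place k A B t) \<union> lower_matching (place k B C s))"
        using that(1) unfolding stack_conn_matchings[OF q] by (auto elim: converse_rtranclE)
      then obtain w where w: "w \<in> stack_verts n" "outer z = stack_relabel A B C w"
        using matchings_stack_verts unfolding matchings_place by auto
      show ?thesis
      proof (cases z)
        case (Inl i)
        \<comment> \<open>\<open>stack_relabel\<close> preserves the rows, so \<open>w\<close> has
          the form \<open>Upper j\<close>, and the incomplete case expression returns this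
          \<open>j\<close>.\<close>
        then show ?thesis using w by (intro bexI[of _ "Inl (case w of Upper j \<Rightarrow> j)"])
            (auto simp: stack_verts_def stack_relabel_simps)
      next
        case (Inr i)
        then show ?thesis using w by (intro bexI[of _ "Inr (case w of Lower j \<Rightarrow> j)"])
            (auto simp: stack_verts_def stack_relabel_simps)
      qed
    qed
    then obtain u v where uv: "u \<in> vertices n" "v \<in> vertices n" "x = relabel A C u" "y = relabel A C v"
      using cxy stack_conn_sym[OF cxy(1)] by metis
    then have "{u, v} \<in> comp_edges n t s"
      using cxy conn[OF uv(1,2)] by (auto simp: comp_edges_iff)
    then show "e \<in> (`) (relabel A C) ` comp_edges n t s"
      using uv xy by (intro image_eqI[of _ _ "{u, v}"]) auto
  next
    fix e assume "e \<in> (`) (relabel A C) ` comp_edges n t s"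
    then obtain e' where e': "e' \<in> comp_edges n t s" "e = relabel A C ` e'" by auto
    obtain u v where uv: "e' = {u, v}" using e'(1) unfolding comp_edges_def by blast
    then have uv': "u \<in> vertices n" "v \<in> vertices n" "u \<noteq> v" "(outer u, outer v) \<in> stack_conn t s"
      using e'(1) by (auto simp: comp_edges_iff)
    have "relabel A C u \<noteq> relabel A C v" using inj uv' by (auto simp: inj_on_def)
    then have "{relabel A C u, relabel A C v} \<in> comp_edges k (place k A B t) (place k B C s)"
      unfolding comp_edges_iff using conn[OF uv'(1,2)] uv' relabel_vertices[OF A C] by auto
    then show "e \<in> comp_edges k (place k A B t) (place k B C s)" using e'(2) uv by simp
  qed
  then show ?thesis
    using pb_diag_of[OF diag_comp_edges(1)[OF q]] diag_comp_edges(2)[OF q] c(2) by (simp add: place_def)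
qed

lemma loops_place: "loops k (place k A B t) (place k B C s) = loops n t s"
proof -
  note pt = perfect_pb[OF t] and ps = perfect_pb[OF s]
  have mid: "Middle j \<in> stack_verts n" if "j \<in> {1..n}" for j using that by (simp add: stack_verts_def)
  have B_eq: "B = nth_elem B ` {1..n}"
    using bij_betw_nth_elem[OF subsets_nD(1)[OF B]] subsets_nD(2)[OF B] by (simp add: bij_betw_def)
  have MB: "Middle ` B = stack_relabel A B C ` Middle ` {1..n}"
    unfolding image_image stack_relabel_simps using B_eq by (metis image_image)
  have sub: "X \<subseteq> Middle ` {1..n} \<longleftrightarrow> stack_relabel A B C ` X \<subseteq> Middle ` B" if "X \<subseteq> stack_verts n" for X
  proof
    assume *: "stack_relabel A B C ` X \<subseteq> Middle ` B"
    show "X \<subseteq> Middle ` {1..n}"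
    proof
      fix v assume "v \<in> X"
      then have "v \<in> stack_verts n" "stack_relabel A B C v \<in> stack_relabel A B C ` Middle ` {1..n}"
        using * that MB by auto
      then show "v \<in> Middle ` {1..n}"
        using inj_on_image_mem_iff[OF inj_on_stack_relabel, of v "Middle ` {1..n}"]
        by (auto simp: stack_verts_def)
    qed
  qed (simp add: MB image_mono)
  have "loop_set k (place k A B t) (place k B C s) = (`) (stack_relabel A B C) ` loop_set n t s"
    unfolding loop_set_match[OF place_pb(1)[OF A B pt] place_top_bot(2)[OF A B t] place_top_bot(1)[OF B C s]]
      loop_set_match[OF pt top_bot_perfect(2)[OF t] top_bot_perfect(1)[OF s]]
  proof (intro subset_antisym subsetI)
    fix X assume "X \<in> {X. (\<exists>j\<in>B. X = stack_conn (place k A B t) (place k B C s) `` {Middle j}) \<and> X \<subseteq> Middle ` B}"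
    then obtain j where j: "j \<in> B" "X = stack_conn (place k A B t) (place k B C s) `` {Middle j}" "X \<subseteq> Middle ` B" by auto
    obtain i where i: "i \<in> {1..n}" "j = nth_elem B i" using j(1) by (subst (asm) B_eq) blast
    have X: "X = stack_relabel A B C ` (stack_conn t s `` {Middle i})"
      using component_place[OF mid[OF i(1)]] j(2) i(2) by (simp add: stack_relabel_simps)
    then have "stack_conn t s `` {Middle i} \<subseteq> Middle ` {1..n}"
      using sub[OF component_stack_verts[OF mid[OF i(1)]]] j(3) by simp
    then show "X \<in> (`) (stack_relabel A B C) ` {X. (\<exists>j\<in>{1..n}. X = stack_conn t s `` {Middle j}) \<and> X \<subseteq> Middle ` {1..n}}"
      using X i(1) by blast
  next
    fix X assume "X \<in> (`) (stack_relabel A B C) ` {X. (\<exists>j\<in>{1..n}. X = stack_conn t s `` {Middle j}) \<and> X \<subseteq> Middle ` {1..n}}"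
    then obtain i where i: "i \<in> {1..n}" "X = stack_relabel A B C ` (stack_conn t s `` {Middle i})"
      "stack_conn t s `` {Middle i} \<subseteq> Middle ` {1..n}" by auto
    have X: "X = stack_conn (place k A B t) (place k B C s) `` {Middle (nth_elem B i)}"
      using component_place[OF mid[OF i(1)]] i(2) by (simp add: stack_relabel_simps)
    have "X \<subseteq> Middle ` B" using sub[OF component_stack_verts[OF mid[OF i(1)]]] i by simp
    moreover have "nth_elem B i \<in> B" using nth_elem_mem[OF subsets_nD(1)[OF B]] subsets_nD(2)[OF B] i(1) by simp
    ultimately show "X \<in> {X. (\<exists>j\<in>B. X = stack_conn (place k A B t) (place k B C s) `` {Middle j}) \<and> X \<subseteq> Middle ` B}"
      using X by blast
  qed
  moreover have "inj_on ((`) (stack_relabel A B C)) (loop_set n t s)"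
  proof (rule inj_on_subset[OF inj_on_image_Pow[OF inj_on_stack_relabel]])
    show "loop_set n t s \<subseteq> Pow (stack_verts n)" by (auto simp: loop_set_def stack_verts_def)
  qed
  ultimately show ?thesis by (simp add: loops_card card_image)
qed

end


section \<open>The idempotents \<open>p\<close> and the two bases\<close>

lemma free_space_expand:
  assumes "finite S" "f \<in> free_space S"
  shows "f = (\<Sum>x\<in>S. fscale (f x) (basis_vec x))"
proof
  fix y
  have "(\<Sum>x\<in>S. fscale (f x) (basis_vec x)) y = (\<Sum>x\<in>S. if y = x then f x else 0)"
    unfolding sum_fun_apply by (intro sum.cong) (auto simp: fscale_def basis_vec_def)
  also have "\<dots> = f y" using assms by (auto simp: free_space_def)
  finally show "f y = (\<Sum>x\<in>S. fscale (f x) (basis_vec x)) y" ..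
qed

text \<open>The product of the idempotents \<open>p_diag k i\<close> over \<open>i\<close> in
  \<open>S\<close>; the empty set gives the identity diagram. Having all of them in one family makes
  the expansion of a product of factors \<open>1 - p_i\<close> a single alternating sum.\<close>

definition p_set :: "nat \<Rightarrow> nat set \<Rightarrow> diagram" where
  "p_set k S = diag_of k ((\<lambda>i. {Inl i, Inr i}) ` ({1..k} - S))"

lemma p_set_pb: "p_set k S \<in> partial_brauer k" "edges (p_set k S) = (\<lambda>i. {Inl i, Inr i}) ` ({1..k} - S)"
proof -
  have "edge_set k ((\<lambda>i. {Inl i, Inr i}) ` ({1..k} - S))" by (auto simp: edge_set_def)
  then show "p_set k S \<in> partial_brauer k" "edges (p_set k S) = (\<lambda>i. {Inl i, Inr i}) ` ({1..k} - S)"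
    by (simp_all add: p_set_def diag_of_pb)
qed

lemma id_diag_p_set: "id_diag k = p_set k {}"
proof -
  have *: "vertices k - \<Union> ((\<lambda>i. {Inl i, Inr i}) ` {1..k}) = {}" by (auto simp: vertices_def)
  have "p_set k {} = (\<lambda>i. {Inl i, Inr i}) ` {1..k}" unfolding p_set_def diag_of_def Diff_empty * by blast
  then show ?thesis by (auto simp: id_diag_def)
qed

lemma p_diag_p_set:
  assumes "j \<in> {1..k}" shows "p_diag k j = p_set k {j}"
proof -
  have *: "vertices k - \<Union> ((\<lambda>i. {Inl i, Inr i}) ` ({1..k} - {j})) = {Inl j, Inr j}"
    using assms by (auto simp: vertices_def)
  have "p_set k {j} = (\<lambda>i. {Inl i, Inr i}) ` ({1..k} - {j}) \<union> {{v} | v. v \<in> {Inl j, Inr j}}"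
    unfolding p_set_def diag_of_def * ..
  also have "\<dots> = p_diag k j" by (auto simp: p_diag_def)
  finally show ?thesis ..
qed

lemma p_set_motzkin: "p_set k S \<in> motzkin k"
proof -
  have "noncrossing k (p_set k S)"
    unfolding noncrossing_def p_set_pb(2)
    by (auto simp: boundary_pos_def doubleton_eq_iff split: sum.splits)
  then show ?thesis using p_set_pb(1) by (simp add: motzkin_def)
qed

lemma id_diag_motzkin: "id_diag k \<in> motzkin k"
  by (simp add: id_diag_p_set p_set_motzkin)

lemma id_diag_tl: "id_diag n \<in> tl_diagrams n"
  using id_diag_motzkin by (auto simp: tl_diagrams_def id_diag_def)

lemma p_set_conn:
  assumes "i \<in> {1..k} - S"
  shows "(Upper i, Middle i) \<in> stack_conn (p_set k S) d" "(Middle i, Lower i) \<in> stack_conn d (p_set k S)"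
  using assms stack_conn_upper[of "{Inl i, Inr i}" "p_set k S" "Inl i" "Inr i" d]
    stack_conn_lower[of "{Inl i, Inr i}" "p_set k S" "Inl i" "Inr i" d]
  by (auto simp: p_set_pb)

text \<open>In the graph stacking \<open>p_set k S\<close> on \<open>d\<close> (or below it) the two vertices of a vertical edge
  of \<open>p_set k S\<close> can be identified, which collapses the graph to \<open>d\<close>.\<close>

lemma collapse_stack:
  assumes d: "d \<in> partial_brauer k"
    and m: "\<And>v w. (v, w) \<in> r1 \<Longrightarrow> \<pi> v = \<pi> w" "\<And>v w. (v, w) \<in> r2 \<Longrightarrow> {\<pi> v, \<pi> w} \<in> edges d"
    and vw: "(v, w) \<in> (r1 \<union> r2)\<^sup>*"
  shows "\<pi> v = \<pi> w \<or> {\<pi> v, \<pi> w} \<in> edges d"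
  using vw
proof (induction rule: rtrancl_induct)
  case (step y z)
  show ?case
  proof (cases "(y, z) \<in> r1")
    case True then show ?thesis using step.IH m(1) by metis
  next
    case False
    then have e: "{\<pi> y, \<pi> z} \<in> edges d" using step.hyps m(2) by blast
    show ?thesis
    proof (cases "\<pi> v = \<pi> y")
      case False
      then have "{\<pi> y, \<pi> v} \<in> edges d" using step.IH by (simp add: insert_commute)
      then show ?thesis using edge_set_unique[OF pb_edge_set[OF d] _ e] by blast
    qed (use e in simp)
  qed
qed simp

lemma diag_comp_remove:
  assumes "d1 \<in> partial_brauer k" "d2 \<in> partial_brauer k" "d \<in> partial_brauer k"
    and c: "comp_edges k d1 d2 = {e \<in> edges d. e \<inter> X = {}}"
  shows "diag_comp k d1 d2 = remove_edges {e \<in> edges d. e \<inter> X \<noteq> {}} d"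
proof (rule pb_eqI[OF diag_comp_edges(1)[OF assms(1,2)]])
  have sub: "{e \<in> edges d. e \<inter> X \<noteq> {}} \<subseteq> edges d" by blast
  show "remove_edges {e \<in> edges d. e \<inter> X \<noteq> {}} d \<in> partial_brauer k"
    by (rule remove_edges_pb(1)[OF assms(3) sub])
  show "edges (diag_comp k d1 d2) = edges (remove_edges {e \<in> edges d. e \<inter> X \<noteq> {}} d)"
    unfolding diag_comp_edges(2)[OF assms(1,2)] remove_edges_pb(2)[OF assms(3) sub] c by blast
qed

lemma p_set_comp_left:
  assumes d: "d \<in> partial_brauer k"
  shows "diag_comp k (p_set k S) d = remove_edges {e \<in> edges d. e \<inter> Inl ` S \<noteq> {}} d"
    and "loops k (p_set k S) d = 0"
proof -
  note pb = p_set_pb(1)[of k S] d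
  \<comment> \<open>\<open>\<pi>\<close> shrinks the edges of \<open>p_set k S\<close>: the upper
    and the middle vertex \<open>i\<close> both become the top vertex \<open>i\<close> of
    \<open>d\<close>.\<close>
  define \<pi> :: "stacked \<Rightarrow> nat + nat" where
    "\<pi> v = (case v of Upper i \<Rightarrow> Inl i | Middle i \<Rightarrow> Inl i | Lower i \<Rightarrow> Inr i)" for v
  have \<pi>_outer: "\<pi> (outer x) = x" for x by (cases x) (simp_all add: \<pi>_def)
  have col: "{x, y} \<in> edges d" if "(outer x, outer y) \<in> stack_conn (p_set k S) d" "x \<noteq> y" for x y
  proof -
    have "\<pi> v = \<pi> w" if "(v, w) \<in> upper_matching (p_set k S)" for v w
      using that unfolding upper_matching_def p_set_pb by (auto simp: \<pi>_def doubleton_eq_iff)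
    moreover have "{\<pi> v, \<pi> w} \<in> edges d" if "(v, w) \<in> lower_matching d" for v w
    proof -
      have "\<pi> (case_sum Middle Lower a) = a" for a by (cases a) (simp_all add: \<pi>_def)
      then show ?thesis using that unfolding lower_matching_def by auto
    qed
    ultimately have "\<pi> (outer x) = \<pi> (outer y) \<or> {\<pi> (outer x), \<pi> (outer y)} \<in> edges d"
      using that(1) unfolding stack_conn_matchings[OF pb] by (rule collapse_stack[OF d])
    then show ?thesis using that(2) by (simp add: \<pi>_outer)
  qed
  have iso: "x \<notin> Inl ` S" if "(outer x, outer y) \<in> stack_conn (p_set k S) d" "x \<noteq> y" for x y
  proof
    assume "x \<in> Inl ` S"
    then obtain s where s: "s \<in> S" "x = Inl s" by auto
    have ne: "Upper s \<noteq> outer y" using that(2) s(2) by (cases y) auto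
    have "(Upper s, outer y) \<in> (upper_matching (p_set k S) \<union> lower_matching d)\<^sup>*"
      using that(1) s(2) unfolding stack_conn_matchings[OF pb] by simp
    then have "Upper s \<in> Domain (upper_matching (p_set k S)) \<union> Domain (lower_matching d)"
      using ne by (auto elim: converse_rtranclE)
    then have "Inl s \<in> \<Union> (edges (p_set k S))"
      using Domain_matching_iff(1)[OF pb(1)] Domain_matching_iff(6)[OF d] by blast
    then show False using s(1) by (auto simp: p_set_pb)
  qed
  have down: "(outer x, case_sum Middle Lower x) \<in> stack_conn (p_set k S) d"
    if "x \<in> vertices k" "x \<notin> Inl ` S" for x
    using that p_set_conn(1)[of _ k S d] by (cases x) auto
  have "comp_edges k (p_set k S) d = {e \<in> edges d. e \<inter> Inl ` S = {}}"
  proof (intro subset_antisym subsetI)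
    fix e assume e: "e \<in> comp_edges k (p_set k S) d"
    obtain x y where xy: "e = {x, y}" using e unfolding comp_edges_def by blast
    have c: "(outer x, outer y) \<in> stack_conn (p_set k S) d" "x \<noteq> y" using e xy by (auto simp: comp_edges_iff)
    show "e \<in> {e \<in> edges d. e \<inter> Inl ` S = {}}"
      using col[OF c] iso[OF c] iso[OF stack_conn_sym[OF c(1)]] c(2) xy by auto
  next
    fix e assume "e \<in> {e \<in> edges d. e \<inter> Inl ` S = {}}"
    then have e: "e \<in> edges d" "e \<inter> Inl ` S = {}" by auto
    obtain x y where xy: "e = {x, y}" "x \<noteq> y" using edge_set_obtain[OF pb_edge_set[OF d] e(1)] .
    have v: "x \<in> vertices k" "y \<in> vertices k" using edge_set_pairD[OF pb_edge_set[OF d]] e(1) xy(1) by auto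
    have "(case_sum Middle Lower x, case_sum Middle Lower y) \<in> stack_conn (p_set k S) d"
      by (rule stack_conn_lower[OF e(1)]) (simp_all add: xy)
    moreover have "x \<notin> Inl ` S" "y \<notin> Inl ` S" using e(2) xy(1) by blast+
    ultimately have "(outer x, outer y) \<in> stack_conn (p_set k S) d"
      using down[OF v(1)] down[OF v(2)] by (meson stack_conn_trans stack_conn_sym)
    then show "e \<in> comp_edges k (p_set k S) d" using v xy by (simp add: comp_edges_iff)
  qed
  then show "diag_comp k (p_set k S) d = remove_edges {e \<in> edges d. e \<inter> Inl ` S \<noteq> {}} d"
    by (rule diag_comp_remove[OF pb d])
  \<comment> \<open>A middle vertex of a loop needs its edge of \<open>p_set k S\<close>, but this
    edge leads up to the top row and out of the loop.\<close>
  have "loop_set k (p_set k S) d = {}"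
  proof -
    have False if C: "C \<in> loop_set k (p_set k S) d" for C
    proof -
      obtain j where j: "C = stack_conn (p_set k S) d `` {Middle j}" "C \<subseteq> Middle ` {1..k}"
          "\<And>i. Middle i \<in> C \<Longrightarrow> Inr i \<in> \<Union> (edges (p_set k S))"
        using C unfolding loop_set_def by blast
      have "Middle j \<in> C" unfolding j(1) by simp
      then have "j \<in> {1..k} - S" using j(3)[of j] by (auto simp: p_set_pb)
      then have "Upper j \<in> C" unfolding j(1) using stack_conn_sym[OF p_set_conn(1)] by blast
      then show False using j(2) by auto
    qed
    then show ?thesis by blast
  qed
  then show "loops k (p_set k S) d = 0" by (simp add: loops_card)
qed

lemma p_set_comp_right:
  assumes d: "d \<in> partial_brauer k"
  shows "diag_comp k d (p_set k S) = remove_edges {e \<in> edges d. e \<inter> Inr ` S \<noteq> {}} d"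
    and "loops k d (p_set k S) = 0"
proof -
  note pb = d p_set_pb(1)[of k S]
  define \<pi> :: "stacked \<Rightarrow> nat + nat" where
    "\<pi> v = (case v of Upper i \<Rightarrow> Inl i | Middle i \<Rightarrow> Inr i | Lower i \<Rightarrow> Inr i)" for v
  have \<pi>_outer: "\<pi> (outer x) = x" for x by (cases x) (simp_all add: \<pi>_def)
  have col: "{x, y} \<in> edges d" if "(outer x, outer y) \<in> stack_conn d (p_set k S)" "x \<noteq> y" for x y
  proof -
    have "\<pi> v = \<pi> w" if "(v, w) \<in> lower_matching (p_set k S)" for v w
      using that unfolding lower_matching_def p_set_pb by (auto simp: \<pi>_def doubleton_eq_iff)
    moreover have "{\<pi> v, \<pi> w} \<in> edges d" if "(v, w) \<in> upper_matching d" for v w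
    proof -
      have "\<pi> (case_sum Upper Middle a) = a" for a by (cases a) (simp_all add: \<pi>_def)
      then show ?thesis using that unfolding upper_matching_def by auto
    qed
    ultimately have "\<pi> (outer x) = \<pi> (outer y) \<or> {\<pi> (outer x), \<pi> (outer y)} \<in> edges d"
      using that(1) unfolding stack_conn_matchings[OF pb] Un_commute[of "upper_matching d"]
      by (rule collapse_stack[OF d])
    then show ?thesis using that(2) by (simp add: \<pi>_outer)
  qed
  have iso: "x \<notin> Inr ` S" if "(outer x, outer y) \<in> stack_conn d (p_set k S)" "x \<noteq> y" for x y
  proof
    assume "x \<in> Inr ` S"
    then obtain s where s: "s \<in> S" "x = Inr s" by auto
    have ne: "Lower s \<noteq> outer y" using that(2) s(2) by (cases y) auto
    have "(Lower s, outer y) \<in> (upper_matching d \<union> lower_matching (p_set k S))\<^sup>*"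
      using that(1) s(2) unfolding stack_conn_matchings[OF pb] by simp
    then have "Lower s \<in> Domain (upper_matching d) \<union> Domain (lower_matching (p_set k S))"
      using ne by (auto elim: converse_rtranclE)
    then have "Inr s \<in> \<Union> (edges (p_set k S))"
      using Domain_matching_iff(5)[OF pb(2)] Domain_matching_iff(3)[OF d] by blast
    then show False using s(1) by (auto simp: p_set_pb)
  qed
  have up: "(outer x, case_sum Upper Middle x) \<in> stack_conn d (p_set k S)"
    if "x \<in> vertices k" "x \<notin> Inr ` S" for x
    using that stack_conn_sym[OF p_set_conn(2)[of _ k S d]] by (cases x) auto
  have "comp_edges k d (p_set k S) = {e \<in> edges d. e \<inter> Inr ` S = {}}"
  proof (intro subset_antisym subsetI)
    fix e assume e: "e \<in> comp_edges k d (p_set k S)"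
    obtain x y where xy: "e = {x, y}" using e unfolding comp_edges_def by blast
    have c: "(outer x, outer y) \<in> stack_conn d (p_set k S)" "x \<noteq> y" using e xy by (auto simp: comp_edges_iff)
    show "e \<in> {e \<in> edges d. e \<inter> Inr ` S = {}}"
      using col[OF c] iso[OF c] iso[OF stack_conn_sym[OF c(1)]] c(2) xy by auto
  next
    fix e assume "e \<in> {e \<in> edges d. e \<inter> Inr ` S = {}}"
    then have e: "e \<in> edges d" "e \<inter> Inr ` S = {}" by auto
    obtain x y where xy: "e = {x, y}" "x \<noteq> y" using edge_set_obtain[OF pb_edge_set[OF d] e(1)] .
    have v: "x \<in> vertices k" "y \<in> vertices k" using edge_set_pairD[OF pb_edge_set[OF d]] e(1) xy(1) by auto
    have "(case_sum Upper Middle x, case_sum Upper Middle y) \<in> stack_conn d (p_set k S)"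
      by (rule stack_conn_upper[OF e(1)]) (simp_all add: xy)
    moreover have "x \<notin> Inr ` S" "y \<notin> Inr ` S" using e(2) xy(1) by blast+
    ultimately have "(outer x, outer y) \<in> stack_conn d (p_set k S)"
      using up[OF v(1)] up[OF v(2)] by (meson stack_conn_trans stack_conn_sym)
    then show "e \<in> comp_edges k d (p_set k S)" using v xy by (simp add: comp_edges_iff)
  qed
  then show "diag_comp k d (p_set k S) = remove_edges {e \<in> edges d. e \<inter> Inr ` S \<noteq> {}} d"
    by (rule diag_comp_remove[OF pb d])
  have "loop_set k d (p_set k S) = {}"
  proof -
    have False if C: "C \<in> loop_set k d (p_set k S)" for C
    proof -
      obtain j where j: "C = stack_conn d (p_set k S) `` {Middle j}" "C \<subseteq> Middle ` {1..k}"
          "\<And>i. Middle i \<in> C \<Longrightarrow> Inl i \<in> \<Union> (edges (p_set k S))"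
        using C unfolding loop_set_def by blast
      have "Middle j \<in> C" unfolding j(1) by simp
      then have "j \<in> {1..k} - S" using j(3)[of j] by (auto simp: p_set_pb)
      then have "Lower j \<in> C" unfolding j(1) using p_set_conn(2) by blast
      then show False using j(2) by auto
    qed
    then show ?thesis by blast
  qed
  then show "loops k d (p_set k S) = 0" by (simp add: loops_card)
qed

lemma diagram_algebra_unit:
  fixes \<delta> :: "'k::field"
  assumes D: "finite D" "D \<subseteq> partial_brauer k" "id_diag k \<in> D" and f: "f \<in> free_space D"
  shows "basis_vec (id_diag k) \<otimes>\<^bsub>diagram_algebra D k \<delta>\<^esub> f = f"
    and "f \<otimes>\<^bsub>diagram_algebra D k \<delta>\<^esub> basis_vec (id_diag k) = f"
proof -
  have "basis_vec (id_diag k) \<otimes>\<^bsub>diagram_algebra D k \<delta>\<^esub> basis_vec d = basis_vec d"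
    "basis_vec d \<otimes>\<^bsub>diagram_algebra D k \<delta>\<^esub> basis_vec (id_diag k) = basis_vec d" if "d \<in> D" for d
    using that D p_set_comp_left[of d k "{}"] p_set_comp_right[of d k "{}"]
    by (auto simp: diagram_mult_basis id_diag_p_set subset_iff)
  then have *: "basis_vec (id_diag k) \<otimes>\<^bsub>diagram_algebra D k \<delta>\<^esub> (\<Sum>d\<in>D. fscale (f d) (basis_vec d)) = (\<Sum>d\<in>D. fscale (f d) (basis_vec d))"
     "(\<Sum>d\<in>D. fscale (f d) (basis_vec d)) \<otimes>\<^bsub>diagram_algebra D k \<delta>\<^esub> basis_vec (id_diag k) = (\<Sum>d\<in>D. fscale (f d) (basis_vec d))"
    unfolding diagram_mult_sum diagram_mult_bilinear by (auto intro!: sum.cong)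
  show "basis_vec (id_diag k) \<otimes>\<^bsub>diagram_algebra D k \<delta>\<^esub> f = f" "f \<otimes>\<^bsub>diagram_algebra D k \<delta>\<^esub> basis_vec (id_diag k) = f"
    using * unfolding free_space_expand[OF D(1) f, symmetric] by auto
qed

lemma motzkin_mult_basis:
  fixes \<delta> :: "'k::field"
  assumes "d1 \<in> motzkin k" "d2 \<in> motzkin k"
  shows "basis_vec d1 \<otimes>\<^bsub>motzkin_algebra k \<delta>\<^esub> basis_vec d2 = fscale (\<delta> ^ loops k d1 d2) (basis_vec (diag_comp k d1 d2))"
  unfolding motzkin_algebra_def using assms by (intro diagram_mult_basis) auto

lemma mult_p_set:
  fixes \<delta> :: "'k::field"
  assumes "d \<in> motzkin k"
  shows "basis_vec (p_set k S) \<otimes>\<^bsub>motzkin_algebra k \<delta>\<^esub> basis_vec d = basis_vec (remove_edges {e \<in> edges d. e \<inter> Inl ` S \<noteq> {}} d)"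
    and "basis_vec d \<otimes>\<^bsub>motzkin_algebra k \<delta>\<^esub> basis_vec (p_set k S) = basis_vec (remove_edges {e \<in> edges d. e \<inter> Inr ` S \<noteq> {}} d)"
  unfolding motzkin_mult_basis[OF p_set_motzkin assms] motzkin_mult_basis[OF assms p_set_motzkin]
  using p_set_comp_left[OF motzkin_pb[OF assms], of S] p_set_comp_right[OF motzkin_pb[OF assms], of S]
  by (simp_all add: fscale_def)

lemma remove_edges_p_set:
  assumes "S' \<subseteq> {1..k}"
  shows "remove_edges {e \<in> edges (p_set k S). e \<inter> Inl ` S' \<noteq> {}} (p_set k S) = p_set k (S' \<union> S)"
proof (rule pb_eqI)
  have F: "{e \<in> edges (p_set k S). e \<inter> Inl ` S' \<noteq> {}} \<subseteq> edges (p_set k S)" by auto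
  show "remove_edges {e \<in> edges (p_set k S). e \<inter> Inl ` S' \<noteq> {}} (p_set k S) \<in> partial_brauer k"
    by (rule remove_edges_pb(1)[OF p_set_pb(1) F])
  have "edges (p_set k S) - {e \<in> edges (p_set k S). e \<inter> Inl ` S' \<noteq> {}} = edges (p_set k (S' \<union> S))"
    unfolding p_set_pb(2) by (auto simp: image_iff)
  then show "edges (remove_edges {e \<in> edges (p_set k S). e \<inter> Inl ` S' \<noteq> {}} (p_set k S)) = edges (p_set k (S' \<union> S))"
    unfolding remove_edges_pb(2)[OF p_set_pb(1) F] .
qed (rule p_set_pb)

section \<open>The elements \<open>tilde d\<close> and their span\<close>

lemma one_minus_p_prod_alt_sum:
  fixes \<delta> :: "'k::field"
  assumes "J \<subseteq> {1..k}"
  shows "one_minus_p_prod k \<delta> J = alt_sum J (\<lambda>S. basis_vec (p_set k S))"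
proof -
  have one: "\<one>\<^bsub>motzkin_algebra k \<delta>\<^esub> = basis_vec (p_set k {})"
    by (simp add: motzkin_algebra_def diagram_algebra_simps id_diag_p_set)
  have *: "foldr (\<lambda>i f. (\<one>\<^bsub>motzkin_algebra k \<delta>\<^esub> - basis_vec (p_diag k i)) \<otimes>\<^bsub>motzkin_algebra k \<delta>\<^esub> f) xs \<one>\<^bsub>motzkin_algebra k \<delta>\<^esub>
      = alt_sum (set xs) (\<lambda>S. basis_vec (p_set k S))" if "distinct xs" "set xs \<subseteq> {1..k}" for xs
    using that
  proof (induction xs)
    case Nil
    then show ?case by (simp only: foldr_Nil id_apply list.set alt_sum_empty one)
  next
    case (Cons i xs)
    let ?h = "\<lambda>S. basis_vec (p_set k S) :: diagram \<Rightarrow> 'k"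
    \<comment> \<open>Multiplication by \<open>p_set k S'\<close> only enlarges the index set, so
      the two terms of a factor \<open>1 - p_i\<close> are the two choices of leaving
      \<open>i\<close> out or putting it in, the latter with a sign.\<close>
    have mul: "?h S' \<otimes>\<^bsub>motzkin_algebra k \<delta>\<^esub> alt_sum (set xs) ?h = alt_sum (set xs) (\<lambda>S. ?h (S' \<union> S))"
      if "S' \<subseteq> {1..k}" for S'
      unfolding alt_sum_def motzkin_algebra_def diagram_mult_sum diagram_mult_bilinear
      unfolding motzkin_algebra_def[symmetric] mult_p_set(1)[OF p_set_motzkin] remove_edges_p_set[OF that] ..
    have i: "i \<in> {1..k}" "i \<notin> set xs" using Cons.prems by auto
    have "(\<one>\<^bsub>motzkin_algebra k \<delta>\<^esub> - basis_vec (p_diag k i)) \<otimes>\<^bsub>motzkin_algebra k \<delta>\<^esub> alt_sum (set xs) ?h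
        = ?h {} \<otimes>\<^bsub>motzkin_algebra k \<delta>\<^esub> alt_sum (set xs) ?h - ?h {i} \<otimes>\<^bsub>motzkin_algebra k \<delta>\<^esub> alt_sum (set xs) ?h"
      unfolding one p_diag_p_set[OF i(1)] by (simp only: motzkin_algebra_def diagram_mult_bilinear)
    also have "\<dots> = alt_sum (set xs) ?h - alt_sum (set xs) (\<lambda>S. ?h (insert i S))"
      using mul[of "{}"] mul[of "{i}"] i(1) by simp
    also have "\<dots> = alt_sum (insert i (set xs)) ?h" by (rule alt_sum_insert[symmetric]) (use i(2) in auto)
    finally have eq: "(\<one>\<^bsub>motzkin_algebra k \<delta>\<^esub> - basis_vec (p_diag k i)) \<otimes>\<^bsub>motzkin_algebra k \<delta>\<^esub> alt_sum (set xs) ?h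
        = alt_sum (insert i (set xs)) ?h" .
    have "distinct xs" "set xs \<subseteq> {1..k}" using Cons.prems by auto
    from Cons.IH[OF this] show ?case by (simp only: foldr_Cons comp_apply list.set eq)
  qed
  have "finite J" using assms finite_subset by auto
  then show ?thesis unfolding one_minus_p_prod_def using *[of "sorted_list_of_set J"] assms by simp
qed

lemma cups_caps_remove:
  assumes d: "d \<in> partial_brauer k" and V: "V \<subseteq> verticals d"
  shows "cups (remove_edges V d) = cups d" "caps (remove_edges V d) = caps d"
    "verticals (remove_edges V d) = verticals d - V"
proof -
  have "V \<subseteq> edges d" using V by (auto simp: verticals_def)
  from remove_edges_pb(2)[OF d this] V
  show "cups (remove_edges V d) = cups d" "caps (remove_edges V d) = caps d"
    "verticals (remove_edges V d) = verticals d - V"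
    unfolding cups_def caps_def verticals_def by auto
qed

text \<open>A factor \<open>1 - p_i\<close> cuts the horizontal edge through \<open>i\<close>, and
  both endpoints of that edge provide such a factor. A set of endpoints acts only through the set of
  edges it meets, so \<open>alt_sum_image\<close> merges the two endpoints into one choice per
  edge.\<close>

lemma tilde_alt_sum:
  fixes \<delta> :: "'k::field"
  assumes d: "d \<in> motzkin k"
  shows "tilde k \<delta> d = alt_sum (cups d \<union> caps d) (\<lambda>H. basis_vec (remove_edges H d))"
proof -
  note pb = motzkin_pb[OF d] and E = pb_edge_set[OF motzkin_pb[OF d]]
  let ?I = "{i. Inl i \<in> \<Union> (cups d)}" and ?J = "{j. Inr j \<in> \<Union> (caps d)}"
  have V: "\<Union> (cups d) \<subseteq> vertices k" "\<Union> (caps d) \<subseteq> vertices k"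
    using E unfolding edge_set_def cups_def caps_def by blast+
  have I: "?I \<subseteq> {1..k}" and J: "?J \<subseteq> {1..k}"
    using V in_vertices[of _ k] by auto
  have fin: "finite ?I" "finite ?J" using I J finite_subset by blast+
  let ?cI = "\<lambda>S. {e \<in> edges d. e \<inter> Inl ` S \<noteq> {}}" and ?cJ = "\<lambda>T. {e \<in> edges d. e \<inter> Inr ` T \<noteq> {}}"
  \<comment> \<open>\<open>c\<close> sends a vertex to the edge through it; \<open>Inl\<close> tags
    the top endpoints of cups and \<open>Inr\<close> the bottom endpoints of caps.\<close>
  define c where "c = case_sum (\<lambda>i. THE e. e \<in> edges d \<and> Inl i \<in> e) (\<lambda>j. THE e. e \<in> edges d \<and> Inr j \<in> e)"
  have the: "(THE e. e \<in> edges d \<and> v \<in> e) = e" if "e \<in> edges d" "v \<in> e" for e v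
    using that E unfolding edge_set_def by (intro the_equality) blast+
  have cI: "c (Inl i) = e" if "e \<in> edges d" "Inl i \<in> e" for e i unfolding c_def using the[OF that] by simp
  have cJ: "c (Inr j) = e" if "e \<in> edges d" "Inr j \<in> e" for e j unfolding c_def using the[OF that] by simp
  have ced: "e \<in> edges d" "e \<subseteq> range Inl" if "e \<in> cups d" for e using that by (auto simp: cups_def)
  have aed: "e \<in> edges d" "e \<subseteq> range Inr" if "e \<in> caps d" for e using that by (auto simp: caps_def)
  have nonempty: "e \<noteq> {}" if "e \<in> edges d" for e using that E by (auto simp: edge_set_def)
  have cF: "c ` F = ?cI (Inl -` F) \<union> ?cJ (Inr -` F)" if F: "F \<subseteq> ?I <+> ?J" for F
  proof (intro subset_antisym subsetI)
    fix e assume "e \<in> c ` F"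
    then obtain s where s: "s \<in> F" "e = c s" by auto
    show "e \<in> ?cI (Inl -` F) \<union> ?cJ (Inr -` F)"
    proof (cases s)
      case (Inl i)
      then obtain e' where e': "e' \<in> cups d" "Inl i \<in> e'" using s(1) F by auto
      then have "e = e'" using cI ced(1) s(2) Inl by metis
      then show ?thesis using e' ced(1) s(1) Inl by blast
    next
      case (Inr j)
      then obtain e' where e': "e' \<in> caps d" "Inr j \<in> e'" using s(1) F by auto
      then have "e = e'" using cJ aed(1) s(2) Inr by metis
      then show ?thesis using e' aed(1) s(1) Inr by blast
    qed
  next
    fix e assume "e \<in> ?cI (Inl -` F) \<union> ?cJ (Inr -` F)"
    then consider i where "e \<in> edges d" "Inl i \<in> e" "Inl i \<in> F" | j where "e \<in> edges d" "Inr j \<in> e" "Inr j \<in> F"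
      by blast
    then show "e \<in> c ` F" by cases (metis cI imageI, metis cJ imageI)
  qed
  have cE: "c ` (?I <+> ?J) = cups d \<union> caps d"
  proof (intro subset_antisym subsetI)
    fix e assume "e \<in> c ` (?I <+> ?J)"
    then obtain s where s: "s \<in> ?I <+> ?J" "e = c s" by auto
    then show "e \<in> cups d \<union> caps d"
      by (cases s) (auto simp: cI[OF ced(1)] cJ[OF aed(1)])
  next
    fix e assume "e \<in> cups d \<union> caps d"
    then show "e \<in> c ` (?I <+> ?J)"
    proof
      assume e: "e \<in> cups d"
      then obtain i where i: "Inl i \<in> e" using ced[OF e] nonempty[of e] by blast
      then have "c (Inl i) = e" using cI ced(1)[OF e] by blast
      then show ?thesis using i e by (intro image_eqI[of _ _ "Inl i"]) auto
    next
      assume e: "e \<in> caps d"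
      then obtain j where j: "Inr j \<in> e" using aed[OF e] nonempty[of e] by blast
      then have "c (Inr j) = e" using cJ aed(1)[OF e] by blast
      then show ?thesis using j e by (intro image_eqI[of _ _ "Inr j"]) auto
    qed
  qed
  have sub: "?cI S \<subseteq> edges d" for S by auto
  have left: "alt_sum ?I (\<lambda>S. basis_vec (p_set k S)) \<otimes>\<^bsub>motzkin_algebra k \<delta>\<^esub> basis_vec d
      = alt_sum ?I (\<lambda>S. basis_vec (remove_edges (?cI S) d))"
    unfolding alt_sum_def motzkin_algebra_def diagram_mult_sum diagram_mult_bilinear
    unfolding motzkin_algebra_def[symmetric] mult_p_set(1)[OF d] ..
  \<comment> \<open>Edges already cut from above are no longer there to be cut from below, so only
    the union of both sets counts.\<close>
  have right: "basis_vec (remove_edges (?cI S) d) \<otimes>\<^bsub>motzkin_algebra k \<delta>\<^esub> basis_vec (p_set k T)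
      = basis_vec (remove_edges (?cI S \<union> ?cJ T) d)" for S T
  proof -
    have "remove_edges {e \<in> edges (remove_edges (?cI S) d). e \<inter> Inr ` T \<noteq> {}} (remove_edges (?cI S) d)
        = remove_edges (?cI S \<union> (?cJ T - ?cI S)) d"
    proof -
      have "{e \<in> edges (remove_edges (?cI S) d). e \<inter> Inr ` T \<noteq> {}} = ?cJ T - ?cI S"
        unfolding remove_edges_pb(2)[OF pb sub] by auto
      moreover have "?cJ T - ?cI S \<subseteq> edges d - ?cI S" by auto
      ultimately show ?thesis using remove_edges_remove_edges[OF pb sub, of "?cJ T - ?cI S" S] by simp
    qed
    then show ?thesis unfolding mult_p_set(2)[OF motzkin_remove_edges[OF d sub]] by (simp only: Un_Diff_cancel)
  qed
  have "tilde k \<delta> d = alt_sum (?I <+> ?J) (\<lambda>F. basis_vec (remove_edges (c ` F) d))"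
    unfolding tilde_def one_minus_p_prod_alt_sum[OF I] one_minus_p_prod_alt_sum[OF J] left
    unfolding motzkin_algebra_def alt_sum_mult[OF fin]
    unfolding motzkin_algebra_def[symmetric] right
    by (rule alt_sum_cong) (simp only: cF)
  also have "\<dots> = alt_sum (cups d \<union> caps d) (\<lambda>H. basis_vec (remove_edges H d))"
    using alt_sum_image[of "?I <+> ?J" "\<lambda>H. basis_vec (remove_edges H d)" c] fin cE by simp
  finally show ?thesis .
qed

lemma alt_sum_nested:
  assumes "finite A" "finite B" "A \<inter> B = {}"
  shows "alt_sum (A \<union> B) h = alt_sum A (\<lambda>F. alt_sum B (\<lambda>G. h (F \<union> G)))"
  using assms(1,3)
proof (induction A arbitrary: h rule: finite_induct)
  case empty
  then show ?case by simp
next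
  case (insert e A)
  have "alt_sum (insert e (A \<union> B)) h = alt_sum (A \<union> B) h - alt_sum (A \<union> B) (\<lambda>F. h (insert e F))"
    by (rule alt_sum_insert) (use insert assms in auto)
  then show ?case using insert by (simp add: alt_sum_insert)
qed

text \<open>Sum over the removed horizontal edges first: the inner sums are the \<open>tilde\<close>
  of \<open>d\<close> with some vertical edges deleted.\<close>

lemma bar_tilde:
  fixes \<delta> :: "'k::field"
  assumes d: "d \<in> motzkin k"
  shows "bar d = alt_sum (verticals d) (\<lambda>V. tilde k \<delta> (remove_edges V d))"
proof -
  note pb = motzkin_pb[OF d]
  have ed: "edges d = verticals d \<union> (cups d \<union> caps d)" "verticals d \<inter> (cups d \<union> caps d) = {}"
    by (auto simp: verticals_def cups_def caps_def)
  have fin: "finite (verticals d)" "finite (cups d \<union> caps d)" using finite_edges[OF pb] ed(1) by auto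
  have "bar d = alt_sum (verticals d) (\<lambda>V. alt_sum (cups d \<union> caps d) (\<lambda>H. basis_vec (remove_edges (V \<union> H) d)) :: diagram \<Rightarrow> 'k)"
    unfolding bar_alt_sum[OF pb] by (subst ed(1)) (rule alt_sum_nested[OF fin ed(2)])
  also have "\<dots> = alt_sum (verticals d) (\<lambda>V. tilde k \<delta> (remove_edges V d))"
  proof (rule alt_sum_cong)
    fix V assume V: "V \<subseteq> verticals d"
    then have V': "V \<subseteq> edges d" using ed(1) by auto
    have "alt_sum (cups d \<union> caps d) (\<lambda>H. basis_vec (remove_edges (V \<union> H) d))
        = (alt_sum (cups d \<union> caps d) (\<lambda>H. basis_vec (remove_edges H (remove_edges V d))) :: diagram \<Rightarrow> 'k)"
    proof (rule alt_sum_cong)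
      fix H assume "H \<subseteq> cups d \<union> caps d"
      then have "H \<subseteq> edges d - V" using ed V by blast
      then show "basis_vec (remove_edges (V \<union> H) d) = (basis_vec (remove_edges H (remove_edges V d)) :: diagram \<Rightarrow> 'k)"
        using remove_edges_remove_edges[OF pb V'] by simp
    qed
    then show "alt_sum (cups d \<union> caps d) (\<lambda>H. basis_vec (remove_edges (V \<union> H) d)) = tilde k \<delta> (remove_edges V d)"
      unfolding tilde_alt_sum[OF motzkin_remove_edges[OF d V']] cups_caps_remove(1,2)[OF pb V] .
  qed
  finally show ?thesis .
qed

lemma alt_sum_span:
  "(\<And>F. F \<subseteq> E \<Longrightarrow> h F \<in> fvs.span B) \<Longrightarrow> alt_sum E h \<in> fvs.span B"
  unfolding alt_sum_def by (intro fvs.span_sum fvs.span_scale) auto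

lemma balanced_remove:
  assumes "d \<in> balanced k" "V \<subseteq> verticals d" shows "remove_edges V d \<in> balanced k"
proof -
  have d: "d \<in> motzkin k" using assms(1) by (simp add: balanced_def)
  have "V \<subseteq> edges d" using assms(2) by (auto simp: verticals_def)
  then show ?thesis
    using assms(1) motzkin_remove_edges[OF d] cups_caps_remove[OF motzkin_pb[OF d] assms(2)]
    by (simp add: balanced_def)
qed

text \<open>By \<open>bar_tilde\<close> the change between the two families is unitriangular with
  respect to the number of edges. Removing vertical edges keeps cups and caps, hence stays among the
  balanced diagrams.\<close>

lemma span_tilde:
  fixes \<delta> :: "'k::field"
  shows "fvs.span (tilde k \<delta> ` balanced k) = fvs.span (bar ` balanced k)"
proof (rule subset_antisym)
  have mz: "d \<in> motzkin k" if "d \<in> balanced k" for d using that by (simp add: balanced_def)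
  show "fvs.span (bar ` balanced k) \<subseteq> fvs.span (tilde k \<delta> ` balanced k)"
  proof (rule fvs.span_minimal[OF _ fvs.subspace_span], clarify)
    fix d assume d: "d \<in> balanced k"
    show "bar d \<in> fvs.span (tilde k \<delta> ` balanced k)"
      unfolding bar_tilde[OF mz[OF d], of \<delta>]
      by (rule alt_sum_span) (use balanced_remove[OF d] in \<open>auto intro: fvs.span_base\<close>)
  qed
  have "tilde k \<delta> d \<in> fvs.span (bar ` balanced k)" if "d \<in> balanced k" for d
    using that
  proof (induction "card (edges d)" arbitrary: d rule: less_induct)
    case (less d)
    note d = mz[OF less.prems] and pb = motzkin_pb[OF mz[OF less.prems]]
    have fin: "finite (verticals d)" using finite_edges[OF pb] by (simp add: verticals_def)
    let ?g = "\<lambda>V. fscale ((- 1) ^ card V) (tilde k \<delta> (remove_edges V d))"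
    have "bar d = ?g {} + (\<Sum>V\<in>Pow (verticals d) - {{}}. ?g V)"
      unfolding bar_tilde[OF d, of \<delta>] alt_sum_def by (rule sum.remove) (use fin in auto)
    moreover have "?g {} = tilde k \<delta> d" by (simp add: fscale_def)
    ultimately have "bar d = tilde k \<delta> d + (\<Sum>V\<in>Pow (verticals d) - {{}}. ?g V)" by (simp only:)
    then have "tilde k \<delta> d = bar d - (\<Sum>V\<in>Pow (verticals d) - {{}}. ?g V)" by (simp only: add_diff_cancel_right')
    moreover have "?g V \<in> fvs.span (bar ` balanced k)" if V: "V \<in> Pow (verticals d) - {{}}" for V
    proof (rule fvs.span_scale, rule less.hyps)
      have V': "V \<subseteq> edges d" "V \<noteq> {}" using V by (auto simp: verticals_def)
      show "remove_edges V d \<in> balanced k" using balanced_remove[OF less.prems] V by auto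
      show "card (edges (remove_edges V d)) < card (edges d)"
        unfolding remove_edges_pb(2)[OF pb V'(1)] using V' finite_edges[OF pb] by (intro psubset_card_mono) auto
    qed
    ultimately show ?case using less.prems by (simp only: fvs.span_diff fvs.span_sum fvs.span_base imageI)
  qed
  then show "fvs.span (tilde k \<delta> ` balanced k) \<subseteq> fvs.span (bar ` balanced k)"
    by (intro fvs.span_minimal fvs.subspace_span) auto
qed


section \<open>Semisimplicity and matrix units\<close>

text \<open>Stated for a bare set with a multiplication, so that it applies to corners as well as to
  whole algebras. Closure under differences packs the subgroup axioms, the addition being that of
  the type.\<close>

definition left_ideal :: "'a::ab_group_add set \<Rightarrow> ('a \<Rightarrow> 'a \<Rightarrow> 'a) \<Rightarrow> 'a set \<Rightarrow> bool" where
  "left_ideal C mul H \<longleftrightarrow> H \<subseteq> C \<and> 0 \<in> H \<and> (\<forall>x\<in>H. \<forall>y\<in>H. x - y \<in> H) \<and> (\<forall>c\<in>C. \<forall>x\<in>H. mul c x \<in> H)"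

definition left_semisimple :: "'a::ab_group_add set \<Rightarrow> ('a \<Rightarrow> 'a \<Rightarrow> 'a) \<Rightarrow> bool" where
  "left_semisimple C mul \<longleftrightarrow> (\<forall>H. left_ideal C mul H \<longrightarrow>
     (\<exists>K. left_ideal C mul K \<and> H \<inter> K = {0} \<and> (\<forall>c\<in>C. \<exists>h\<in>H. c - h \<in> K)))"

lemma left_idealD:
  assumes "left_ideal C mul H"
  shows "x \<in> H \<Longrightarrow> x \<in> C" "0 \<in> H" "x \<in> H \<Longrightarrow> y \<in> H \<Longrightarrow> x - y \<in> H" "x \<in> H \<Longrightarrow> y \<in> H \<Longrightarrow> x + y \<in> H"
    "c \<in> C \<Longrightarrow> x \<in> H \<Longrightarrow> mul c x \<in> H"
proof -
  show "x \<in> H \<Longrightarrow> x \<in> C" "0 \<in> H" and minus: "x \<in> H \<Longrightarrow> y \<in> H \<Longrightarrow> x - y \<in> H" for x y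
    using assms by (auto simp: left_ideal_def)
  show "c \<in> C \<Longrightarrow> x \<in> H \<Longrightarrow> mul c x \<in> H" using assms by (auto simp: left_ideal_def)
  assume "x \<in> H" "y \<in> H"
  then have "x - (0 - y) \<in> H" using minus \<open>0 \<in> H\<close> by blast
  then show "x + y \<in> H" by simp
qed

lemma left_ideal_sum:
  assumes "left_ideal C mul H" "\<And>i. i \<in> A \<Longrightarrow> f i \<in> H" shows "sum f A \<in> H"
  using assms(2) by (induction A rule: infinite_finite_induct) (auto intro: left_idealD(2,4)[OF assms(1)])

lemma left_semisimple_iso:
  assumes bij: "bij_betw f C C'" and minus: "\<And>x y. x \<in> C \<Longrightarrow> y \<in> C \<Longrightarrow> f (x - y) = f x - f y"
    and mult: "\<And>x y. x \<in> C \<Longrightarrow> y \<in> C \<Longrightarrow> f (mul x y) = mul' (f x) (f y)"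
    and closed: "\<And>x y. x \<in> C \<Longrightarrow> y \<in> C \<Longrightarrow> x - y \<in> C" "\<And>x y. x \<in> C \<Longrightarrow> y \<in> C \<Longrightarrow> mul x y \<in> C"
    and zero: "0 \<in> C"
    and ss: "left_semisimple C mul"
  shows "left_semisimple C' mul'"
  unfolding left_semisimple_def
proof (intro allI impI)
  fix H assume H: "left_ideal C' mul' H"
  have f0: "f 0 = 0" using minus[OF zero zero] by simp
  have inj: "x = y" if "f x = f y" "x \<in> C" "y \<in> C" for x y using bij that by (auto simp: bij_betw_def inj_on_def)
  have surj: "\<exists>x\<in>C. f x = y" if "y \<in> C'" for y using bij that by (auto simp: bij_betw_def)
  have fC: "f x \<in> C'" if "x \<in> C" for x using bij that by (auto simp: bij_betw_def)
  have "left_ideal C mul {x \<in> C. f x \<in> H}"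
    unfolding left_ideal_def using left_idealD[OF H] f0 zero closed fC by (auto simp: minus mult)
  then obtain K where K: "left_ideal C mul K" "{x \<in> C. f x \<in> H} \<inter> K = {0}"
      "\<And>c. c \<in> C \<Longrightarrow> \<exists>h\<in>{x \<in> C. f x \<in> H}. c - h \<in> K"
    using ss unfolding left_semisimple_def by meson
  note KD = left_idealD[OF K(1)]
  show "\<exists>K. left_ideal C' mul' K \<and> H \<inter> K = {0} \<and> (\<forall>c\<in>C'. \<exists>h\<in>H. c - h \<in> K)"
  proof (intro exI conjI ballI)
    show "left_ideal C' mul' (f ` K)"
      unfolding left_ideal_def
    proof (intro conjI ballI)
      show "f ` K \<subseteq> C'" using KD(1) fC by auto
      show "0 \<in> f ` K" using KD(2) f0 by force
      fix y z assume "y \<in> f ` K" "z \<in> f ` K"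
      then obtain a b where "a \<in> K" "b \<in> K" "y = f a" "z = f b" by auto
      then show "y - z \<in> f ` K" using KD(1,3) minus by (intro image_eqI[of _ _ "a - b"]) simp_all
    next
      fix c y assume "c \<in> C'" "y \<in> f ` K"
      then obtain a x where "a \<in> C" "x \<in> K" "c = f a" "y = f x" using surj by blast
      then show "mul' c y \<in> f ` K" using KD(1,5) mult by (intro image_eqI[of _ _ "mul a x"]) simp_all
    qed
    show "H \<inter> f ` K = {0}"
    proof (intro subset_antisym subsetI)
      fix y assume "y \<in> H \<inter> f ` K"
      then obtain x where "x \<in> K" "y = f x" "f x \<in> H" by auto
      then have "x \<in> {0}" unfolding K(2)[symmetric] using KD(1) by blast
      then show "y \<in> {0}" using \<open>y = f x\<close> f0 by simp
    next
      fix y :: 'b assume "y \<in> {0}"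
      then show "y \<in> H \<inter> f ` K" using left_idealD(2)[OF H] KD(2) f0 by force
    qed
    fix c assume "c \<in> C'"
    then obtain x where x: "x \<in> C" "f x = c" using surj by blast
    then obtain h where h: "h \<in> C" "f h \<in> H" "x - h \<in> K" using K(3) by blast
    have "f (x - h) \<in> f ` K" using h(3) by (rule imageI)
    then show "\<exists>h\<in>H. c - h \<in> f ` K" unfolding minus[OF x(1) h(1)] x(2) by (rule bexI[OF _ h(2)])
  qed
qed

text \<open>Submodules of the regular module are left ideals once the additive structure of the
  record is that of the type. This moves semisimplicity from records to plain sets, where an algebra
  can be compared with its corners.\<close>

lemma semisimple_ring_iff:
  fixes R :: "('a::ab_group_add, 'r) ring_scheme"
  assumes R: "ring R" and add: "add R = (+)" and zero: "zero R = 0"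
  shows "semisimple_ring R \<longleftrightarrow> left_semisimple (carrier R) (mult R)"
proof -
  interpret R: ring R by (rule R)
  have "left_module R (regular_module R)"
  proof -
    have "abelian_group (regular_module R)"
    proof (rule abelian_groupI)
      fix x assume "x \<in> carrier (regular_module R)"
      then show "\<exists>y\<in>carrier (regular_module R). y \<oplus>\<^bsub>regular_module R\<^esub> x = \<zero>\<^bsub>regular_module R\<^esub>"
        using R.l_neg by (intro bexI[of _ "\<ominus>\<^bsub>R\<^esub> x"]) (auto simp: regular_module_def)
    qed (auto simp: regular_module_def R.a_ac)
    then show ?thesis
      by (intro left_module.intro left_module_axioms.intro R)
         (auto simp: regular_module_def R.l_distr R.r_distr R.m_assoc)
  qed
  moreover have sub: "submodule H R (regular_module R) \<longleftrightarrow> left_ideal (carrier R) (mult R) H" for H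
  proof
    have neg: "inv\<^bsub>add_monoid (regular_module R)\<^esub> x = - x" if "x \<in> carrier R" for x
    proof -
      have "\<ominus>\<^bsub>R\<^esub> x + x = 0" using R.l_neg[OF that] by (simp add: add zero)
      then have "\<ominus>\<^bsub>R\<^esub> x = - x" by (simp add: eq_neg_iff_add_eq_0)
      moreover have "inv\<^bsub>add_monoid (regular_module R)\<^esub> x = \<ominus>\<^bsub>R\<^esub> x"
        by (simp add: a_inv_def m_inv_def regular_module_def)
      ultimately show ?thesis by simp
    qed
    {
      assume "submodule H R (regular_module R)"
      then interpret H: submodule H R "regular_module R" .
      have HC: "H \<subseteq> carrier R" using H.subset by (simp add: regular_module_def)
      have "x - y \<in> H" if "x \<in> H" "y \<in> H" for x y
      proof -
        have "y \<in> carrier R" using that(2) HC by blast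
        then have "- y \<in> H" using H.m_inv_closed[OF that(2)] by (simp only: neg)
        then show ?thesis using H.m_closed[OF that(1), of "- y"] by (simp add: regular_module_def add)
      qed
      then show "left_ideal (carrier R) (mult R) H"
        using HC H.one_closed H.smult_closed by (auto simp: left_ideal_def regular_module_def zero)
    }
    {
      assume H: "left_ideal (carrier R) (mult R) H"
      note HD = left_idealD[OF H]
      show "submodule H R (regular_module R)"
      proof (intro submodule.intro subgroup.intro submodule_axioms.intro)
        show "H \<subseteq> carrier (add_monoid (regular_module R))" using HD(1) by (auto simp: regular_module_def)
        fix x assume "x \<in> H"
        then show "inv\<^bsub>add_monoid (regular_module R)\<^esub> x \<in> H"
          using neg[OF HD(1)] HD(3)[OF HD(2), of x] by simp
      qed (use HD in \<open>auto simp: regular_module_def add zero\<close>)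
    }
  qed
  moreover have "(H \<inter> K = {\<zero>\<^bsub>regular_module R\<^esub>} \<and> H <+>\<^bsub>regular_module R\<^esub> K = carrier (regular_module R))
      \<longleftrightarrow> (H \<inter> K = {0} \<and> (\<forall>c\<in>carrier R. \<exists>h\<in>H. c - h \<in> K))"
    if H: "left_ideal (carrier R) (mult R) H" and K: "left_ideal (carrier R) (mult R) K" for H K
  proof -
    have "H <+>\<^bsub>regular_module R\<^esub> K = {h + k | h k. h \<in> H \<and> k \<in> K}"
      by (auto simp: set_add_def' regular_module_def add)
    moreover have "{h + k | h k. h \<in> H \<and> k \<in> K} = carrier R \<longleftrightarrow> (\<forall>c\<in>carrier R. \<exists>h\<in>H. c - h \<in> K)"
    proof
      assume eq: "{h + k | h k. h \<in> H \<and> k \<in> K} = carrier R"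
      show "\<forall>c\<in>carrier R. \<exists>h\<in>H. c - h \<in> K"
      proof
        fix c assume "c \<in> carrier R"
        then obtain h k where "c = h + k" "h \<in> H" "k \<in> K" using eq by blast
        then show "\<exists>h\<in>H. c - h \<in> K" by (intro bexI[of _ h]) auto
      qed
    next
      assume cov: "\<forall>c\<in>carrier R. \<exists>h\<in>H. c - h \<in> K"
      show "{h + k | h k. h \<in> H \<and> k \<in> K} = carrier R"
      proof (intro subset_antisym subsetI)
        fix c assume "c \<in> carrier R"
        then obtain h where "h \<in> H" "c - h \<in> K" using cov by blast
        moreover have "c = h + (c - h)" by simp
        ultimately show "c \<in> {h + k | h k. h \<in> H \<and> k \<in> K}" by blast
      next
        fix c assume "c \<in> {h + k | h k. h \<in> H \<and> k \<in> K}"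
        then obtain h k where "c = h + k" "h \<in> H" "k \<in> K" by blast
        then show "c \<in> carrier R" using left_idealD(1)[OF H] left_idealD(1)[OF K] R.a_closed[of h k] by (simp add: add)
      qed
    qed
    ultimately show ?thesis by (simp add: regular_module_def zero)
  qed
  ultimately show ?thesis
    unfolding semisimple_ring_def semisimple_module_def left_semisimple_def sub by (simp cong: conj_cong)
qed

lemma semisimple_ring_is_ring: "semisimple_ring R \<Longrightarrow> ring R"
  unfolding semisimple_ring_def semisimple_module_def left_module_def by blast

text \<open>The elements \<open>E i j\<close>, defined when \<open>\<nu> i = \<nu> j\<close>, are matrix units; the blocks are the classes
  of \<open>\<nu>\<close>.\<close>

locale matrix_units =
  fixes C :: "'a::ab_group_add set" and mul :: "'a \<Rightarrow> 'a \<Rightarrow> 'a" (infixl "\<cdot>" 70)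
    and I :: "'i set" and \<nu> :: "'i \<Rightarrow> 'n" and E :: "'i \<Rightarrow> 'i \<Rightarrow> 'a"
  assumes zero: "0 \<in> C"
    and minus: "x \<in> C \<Longrightarrow> y \<in> C \<Longrightarrow> x - y \<in> C"
    and mul_closed: "x \<in> C \<Longrightarrow> y \<in> C \<Longrightarrow> x \<cdot> y \<in> C"
    and assoc: "x \<in> C \<Longrightarrow> y \<in> C \<Longrightarrow> z \<in> C \<Longrightarrow> (x \<cdot> y) \<cdot> z = x \<cdot> (y \<cdot> z)"
    and mul_minus: "x \<cdot> (y - z) = x \<cdot> y - x \<cdot> z" "(y - z) \<cdot> x = y \<cdot> x - z \<cdot> x"
    and finite_I: "finite I"
    and E_closed: "i \<in> I \<Longrightarrow> j \<in> I \<Longrightarrow> \<nu> i = \<nu> j \<Longrightarrow> E i j \<in> C"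
    and E_mult: "i \<in> I \<Longrightarrow> j \<in> I \<Longrightarrow> l \<in> I \<Longrightarrow> m \<in> I \<Longrightarrow> \<nu> i = \<nu> j \<Longrightarrow> \<nu> l = \<nu> m \<Longrightarrow>
        E i j \<cdot> E l m = (if j = l then E i m else 0)"
    and E_unit: "x \<in> C \<Longrightarrow> (\<Sum>i\<in>I. E i i) \<cdot> x = x" "x \<in> C \<Longrightarrow> x \<cdot> (\<Sum>i\<in>I. E i i) = x"
    and E_block: "i \<in> I \<Longrightarrow> j \<in> I \<Longrightarrow> \<nu> i \<noteq> \<nu> j \<Longrightarrow> x \<in> C \<Longrightarrow> E i i \<cdot> (x \<cdot> E j j) = 0"
begin

lemma mul_zero [simp]: "x \<cdot> 0 = 0" "0 \<cdot> x = 0"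
  using mul_minus(1)[of x 0 0] mul_minus(2)[of 0 0 x] by simp_all

lemma mul_add: "x \<cdot> (y + z) = x \<cdot> y + x \<cdot> z" "(y + z) \<cdot> x = y \<cdot> x + z \<cdot> x"
  using mul_minus(1)[of x y "0 - z"] mul_minus(2)[of y "0 - z" x] mul_minus(1)[of x 0 z] mul_minus(2)[of 0 z x]
  by simp_all

lemma mul_sum: "x \<cdot> sum f A = (\<Sum>i\<in>A. x \<cdot> f i)" "sum f A \<cdot> x = (\<Sum>i\<in>A. f i \<cdot> x)"
  by (induction A rule: infinite_finite_induct) (simp_all add: mul_add)

lemma left_ideal_C: "left_ideal C mul C"
  using zero minus mul_closed by (simp add: left_ideal_def)

lemmas sum_closed = left_ideal_sum[OF left_ideal_C]

text \<open>The Peirce corner \<open>e C e\<close> at the idempotent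
  \<open>e = E i i\<close>.\<close>

definition corner :: "'i \<Rightarrow> 'a set" where
  "corner i = {x \<in> C. E i i \<cdot> x = x \<and> x \<cdot> E i i = x}"

definition column :: "'i set \<Rightarrow> 'a set" where
  "column J = {x \<in> C. x \<cdot> (\<Sum>j\<in>J. E j j) = x}"

definition block :: "'i \<Rightarrow> 'i set" where
  "block i = {j \<in> I. \<nu> j = \<nu> i}"

text \<open>The left ideal of the column \<open>C e\<close>, with \<open>e = E i i\<close>, that
  corresponds to a left ideal \<open>L\<close> of the corner \<open>e C e\<close> under Morita
  equivalence: \<open>E i j\<close> moves the entry of \<open>y\<close> in row \<open>j\<close> into
  the corner.\<close>

definition spread :: "'i \<Rightarrow> 'a set \<Rightarrow> 'a set" where
  "spread i L = {y \<in> C. y \<cdot> E i i = y \<and> (\<forall>j\<in>block i. E i j \<cdot> y \<in> L)}"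

lemma E_idem: "i \<in> I \<Longrightarrow> E i i \<in> C" "i \<in> I \<Longrightarrow> E i i \<cdot> E i i = E i i"
  using E_closed E_mult by auto

lemma block_E:
  assumes "i \<in> I" "j \<in> block i" shows "E i j \<in> C" "E j i \<in> C" "j \<in> I" "\<nu> j = \<nu> i"
  using assms E_closed by (auto simp: block_def)

text \<open>Write the identity as the sum of the \<open>E j j\<close> on the left. Rows outside the
  block of \<open>i\<close> vanish by \<open>E_block\<close>, and inside it \<open>E j j\<close>
  factors through \<open>i\<close>.\<close>

lemma column_expand:
  assumes i: "i \<in> I" and x: "x \<in> C" "x \<cdot> E i i = x"
  shows "x = (\<Sum>j\<in>block i. E j i \<cdot> (E i j \<cdot> x))"
proof -
  have "x = (\<Sum>j\<in>I. E j j \<cdot> x)" using E_unit(1)[OF x(1)] by (simp add: mul_sum)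
  also have "\<dots> = (\<Sum>j\<in>block i. E j j \<cdot> x)"
  proof (rule sum.mono_neutral_right[OF finite_I])
    show "\<forall>j\<in>I - block i. E j j \<cdot> x = 0" using E_block[OF _ i _ x(1)] x(2) by (auto simp: block_def)
  qed (auto simp: block_def)
  also have "\<dots> = (\<Sum>j\<in>block i. E j i \<cdot> (E i j \<cdot> x))"
  proof (rule sum.cong[OF refl])
    fix j assume j: "j \<in> block i"
    have "E j i \<cdot> E i j = E j j" using block_E[OF i j] i E_mult by simp
    then show "E j j \<cdot> x = E j i \<cdot> (E i j \<cdot> x)" using assoc[OF block_E(2,1)[OF i j] x(1)] by simp
  qed
  finally show ?thesis .
qed

lemma corner_mult:
  assumes i: "i \<in> I" and j: "j \<in> block i" and l: "l \<in> block i" and c: "c \<in> C"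
  shows "E i j \<cdot> (c \<cdot> E l i) \<in> corner i"
proof -
  note jE = block_E[OF i j] and lE = block_E[OF i l]
  have "E i i \<cdot> E i j = E i j" "E l i \<cdot> E i i = E l i" using E_mult i jE lE by simp_all
  then show ?thesis
    using assoc[OF E_idem(1)[OF i] jE(1) mul_closed[OF c lE(2)]] assoc[OF c lE(2) E_idem(1)[OF i]]
      assoc[OF jE(1) mul_closed[OF c lE(2)] E_idem(1)[OF i]] mul_closed jE lE c
    by (simp add: corner_def)
qed

text \<open>Matrix multiplication: an entry of \<open>c \<cdot> y\<close> is a sum of corner
  elements times entries of \<open>y\<close>, and the latter lie in the left ideal
  \<open>L\<close>.\<close>

lemma left_ideal_spread:
  assumes i: "i \<in> I" and L: "left_ideal (corner i) mul L"
  shows "left_ideal C mul (spread i L)"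
  unfolding left_ideal_def
proof (intro conjI ballI)
  note LD = left_idealD[OF L]
  show "spread i L \<subseteq> C" by (auto simp: spread_def)
  show "0 \<in> spread i L" using LD(2) zero by (simp add: spread_def)
  show "x - y \<in> spread i L" if "x \<in> spread i L" "y \<in> spread i L" for x y
    using that LD(3) minus by (simp add: spread_def mul_minus)
  fix c y assume c: "c \<in> C" and y: "y \<in> spread i L"
  then have yC: "y \<in> C" "y \<cdot> E i i = y" and yL: "\<And>j. j \<in> block i \<Longrightarrow> E i j \<cdot> y \<in> L" by (auto simp: spread_def)
  have "E i j \<cdot> (c \<cdot> y) \<in> L" if j: "j \<in> block i" for j
  proof -
    note jE = block_E[OF i j]
    have "E i j \<cdot> (c \<cdot> y) = E i j \<cdot> (c \<cdot> (\<Sum>l\<in>block i. E l i \<cdot> (E i l \<cdot> y)))"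
      using column_expand[OF i yC] by simp
    also have "\<dots> = (\<Sum>l\<in>block i. (E i j \<cdot> (c \<cdot> E l i)) \<cdot> (E i l \<cdot> y))"
      unfolding mul_sum
    proof (rule sum.cong[OF refl])
      fix l assume l: "l \<in> block i"
      note lE = block_E[OF i l]
      show "E i j \<cdot> (c \<cdot> (E l i \<cdot> (E i l \<cdot> y))) = (E i j \<cdot> (c \<cdot> E l i)) \<cdot> (E i l \<cdot> y)"
        using assoc[OF c lE(2) mul_closed[OF lE(1) yC(1)]]
          assoc[OF jE(1) mul_closed[OF c lE(2)] mul_closed[OF lE(1) yC(1)]] by simp
    qed
    also have "\<dots> \<in> L"
      by (rule left_ideal_sum[OF L], rule LD(5)[OF corner_mult[OF i j _ c] yL])
    finally show ?thesis .
  qed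
  then show "c \<cdot> y \<in> spread i L"
    using mul_closed[OF c yC(1)] assoc[OF c yC(1) E_idem(1)[OF i]] yC(2) by (simp add: spread_def)
qed

text \<open>An element of the corner has its only nonzero entry in row \<open>i\<close>, so
  spreading does not change what is seen in the corner.\<close>

lemma spread_corner:
  assumes i: "i \<in> I" and L: "left_ideal (corner i) mul L"
  shows "L \<subseteq> spread i L" "spread i L \<inter> corner i \<subseteq> L"
proof -
  note LD = left_idealD[OF L]
  have ii: "i \<in> block i" using i by (simp add: block_def)
  show "spread i L \<inter> corner i \<subseteq> L"
    using ii by (auto simp: spread_def corner_def)
  show "L \<subseteq> spread i L"
  proof
    fix y assume y: "y \<in> L"
    then have yc: "y \<in> C" "E i i \<cdot> y = y" "y \<cdot> E i i = y" using LD(1) by (auto simp: corner_def)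
    have "E i j \<cdot> y \<in> L" if j: "j \<in> block i" for j
    proof -
      note jE = block_E[OF i j]
      have "E i j \<cdot> y = (E i j \<cdot> E i i) \<cdot> y" using assoc[OF jE(1) E_idem(1)[OF i] yc(1)] yc(2) by simp
      also have "\<dots> = (if j = i then y else 0)" using E_mult[of i j i i] i jE yc(2) by simp
      finally show ?thesis using y LD(2) by simp
    qed
    then show "y \<in> spread i L" using yc by (simp add: spread_def)
  qed
qed

lemma left_ideal_corner:
  assumes i: "i \<in> I" and H: "left_ideal C mul H"
  shows "left_ideal (corner i) mul (H \<inter> corner i)"
proof -
  note HD = left_idealD[OF H]
  have "c \<cdot> x \<in> corner i" if "c \<in> corner i" "x \<in> corner i" for c x
    using that assoc[of "E i i" c x] assoc[of c x "E i i"] E_idem(1)[OF i] mul_closed by (simp add: corner_def)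
  moreover have "x - y \<in> corner i" if "x \<in> corner i" "y \<in> corner i" for x y
    using that minus by (simp add: corner_def mul_minus)
  moreover have "0 \<in> corner i" using zero by (simp add: corner_def)
  ultimately show ?thesis using HD by (auto simp: left_ideal_def corner_def)
qed

text \<open>A complement of \<open>spread i L\<close> in \<open>C\<close> meets the corner in a
  complement of \<open>L\<close>.\<close>

lemma corner_left_semisimple:
  assumes i: "i \<in> I" and ss: "left_semisimple C mul"
  shows "left_semisimple (corner i) mul"
  unfolding left_semisimple_def
proof (intro allI impI)
  fix L assume L: "left_ideal (corner i) mul L"
  obtain K where K: "left_ideal C mul K" "spread i L \<inter> K = {0}" "\<And>c. c \<in> C \<Longrightarrow> \<exists>h\<in>spread i L. c - h \<in> K"
    using ss left_ideal_spread[OF i L] unfolding left_semisimple_def by meson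
  have ii: "i \<in> block i" using i by (simp add: block_def)
  show "\<exists>K. left_ideal (corner i) mul K \<and> L \<inter> K = {0} \<and> (\<forall>c\<in>corner i. \<exists>h\<in>L. c - h \<in> K)"
  proof (intro exI conjI ballI)
    show K': "left_ideal (corner i) mul (K \<inter> corner i)" by (rule left_ideal_corner[OF i K(1)])
    show "L \<inter> (K \<inter> corner i) = {0}"
      using spread_corner(1)[OF i L] K(2) left_idealD(2)[OF L] left_idealD(2)[OF K'] by blast
    fix z assume z: "z \<in> corner i"
    then have zc: "z \<in> C" "E i i \<cdot> z = z" "z \<cdot> E i i = z" by (auto simp: corner_def)
    obtain y where y: "y \<in> spread i L" "z - y \<in> K" using K(3)[OF zc(1)] by blast
    have yc: "y \<in> C" "y \<cdot> E i i = y" "E i i \<cdot> y \<in> L" using y(1) ii by (auto simp: spread_def)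
    \<comment> \<open>Left multiplication by \<open>E i i\<close> fixes \<open>z\<close> and pushes
      its decomposition into the corner.\<close>
    have "z - E i i \<cdot> y = E i i \<cdot> (z - y)" by (simp add: mul_minus zc)
    moreover have "E i i \<cdot> (z - y) \<in> K" using left_idealD(5)[OF K(1) E_idem(1)[OF i] y(2)] .
    moreover have "z - E i i \<cdot> y \<in> corner i"
      using left_idealD(1)[OF L yc(3)] z minus by (simp add: corner_def mul_minus)
    ultimately show "\<exists>h\<in>L. z - h \<in> K \<inter> corner i" by (intro bexI[OF _ yc(3)]) auto
  qed
qed

text \<open>A left ideal inside one column is determined by its part in the corner, because
  \<open>E i j\<close> carries row \<open>j\<close> into the corner and \<open>E j i\<close> carries
  it back. So a complement in the corner spreads to one in the column.\<close>

lemma column_complement: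
  assumes i: "i \<in> I" and ss: "left_semisimple (corner i) mul"
    and H: "left_ideal C mul H" "H \<subseteq> column {i}"
  shows "\<exists>K. left_ideal C mul K \<and> K \<subseteq> column {i} \<and> H \<inter> K = {0} \<and> (\<forall>c\<in>column {i}. \<exists>h\<in>H. c - h \<in> K)"
proof -
  obtain L where L: "left_ideal (corner i) mul L" "(H \<inter> corner i) \<inter> L = {0}"
    "\<And>c. c \<in> corner i \<Longrightarrow> \<exists>h\<in>H \<inter> corner i. c - h \<in> L"
    using ss left_ideal_corner[OF i H(1)] unfolding left_semisimple_def by meson
  note K = left_ideal_spread[OF i L(1)]
  have cor: "E i j \<cdot> y \<in> corner i" if "j \<in> block i" "y \<in> C" "y \<cdot> E i i = y" for j y
    using corner_mult[OF i that(1) _ that(2), of i] i that(3) by (simp add: block_def)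
  show ?thesis
  proof (intro exI conjI ballI)
    show "left_ideal C mul (spread i L)" by (rule K)
    show "spread i L \<subseteq> column {i}" by (auto simp: spread_def column_def)
    show "H \<inter> spread i L = {0}"
    proof (intro subset_antisym subsetI)
      fix y assume y: "y \<in> H \<inter> spread i L"
      then have yc: "y \<in> C" "y \<cdot> E i i = y" by (auto simp: spread_def)
      have "E i j \<cdot> y = 0" if j: "j \<in> block i" for j
      proof -
        have "E i j \<cdot> y \<in> H" using left_idealD(5)[OF H(1) block_E(1)[OF i j]] y by blast
        moreover have "E i j \<cdot> y \<in> L" using y j by (simp add: spread_def)
        ultimately have "E i j \<cdot> y \<in> (H \<inter> corner i) \<inter> L" using cor[OF j yc] by blast
        then show ?thesis using L(2) by simp
      qed
      then have "y = 0" by (subst column_expand[OF i yc]) simp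
      then show "y \<in> {0}" by simp
    qed (use left_idealD(2)[OF H(1)] left_idealD(2)[OF K] in auto)
    fix c assume "c \<in> column {i}"
    then have c: "c \<in> C" "c \<cdot> E i i = c" by (auto simp: column_def)
    \<comment> \<open>Decompose each entry in the corner and reassemble the pieces as in
      \<open>column_expand\<close>.\<close>
    have "\<forall>j\<in>block i. \<exists>h. h \<in> H \<inter> corner i \<and> E i j \<cdot> c - h \<in> L" using L(3)[OF cor[OF _ c]] by blast
    then obtain h where h: "\<And>j. j \<in> block i \<Longrightarrow> h j \<in> H \<inter> corner i \<and> E i j \<cdot> c - h j \<in> L" by metis
    have "(\<Sum>j\<in>block i. E j i \<cdot> h j) \<in> H"
      by (rule left_ideal_sum[OF H(1)]) (use h block_E(2)[OF i] left_idealD(5)[OF H(1)] in blast)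
    moreover have "c - (\<Sum>j\<in>block i. E j i \<cdot> h j) = (\<Sum>j\<in>block i. E j i \<cdot> (E i j \<cdot> c - h j))"
      by (subst (1) column_expand[OF i c]) (simp add: mul_minus sum_subtractf)
    moreover have "(\<Sum>j\<in>block i. E j i \<cdot> (E i j \<cdot> c - h j)) \<in> spread i L"
      by (rule left_ideal_sum[OF K])
         (use h block_E(2)[OF i] left_idealD(5)[OF K] spread_corner(1)[OF i L(1)] in blast)
    ultimately show "\<exists>h\<in>H. c - h \<in> spread i L" by metis
  qed
qed

lemma left_ideal_column: "left_ideal C mul (column J)" if J: "J \<subseteq> I" for J
proof -
  have "(\<Sum>j\<in>J. E j j) \<in> C" using sum_closed E_idem(1) J by (meson subsetD)
  then show ?thesis using zero minus mul_closed assoc by (auto simp: left_ideal_def column_def mul_minus)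
qed

text \<open>Adding one column is an extension argument: right multiplication by the sum of the old
  idempotents maps \<open>H\<close> into the old columns, with kernel in the new one. Complements of
  the kernel and of the image add up to a complement of \<open>H\<close>.\<close>

lemma columns_complement:
  assumes ss: "\<And>i. i \<in> I \<Longrightarrow> left_semisimple (corner i) mul"
    and J: "finite J" "J \<subseteq> I" and H: "left_ideal C mul H" "H \<subseteq> column J"
  shows "\<exists>K. left_ideal C mul K \<and> K \<subseteq> column J \<and> H \<inter> K = {0} \<and> (\<forall>c\<in>column J. \<exists>h\<in>H. c - h \<in> K)"
  using J H
proof (induction J arbitrary: H rule: finite_induct)
  case empty
  have "column {} = {0}" using zero by (auto simp: column_def)
  then show ?case using empty left_idealD(2)[OF empty(2)] left_ideal_column[of "{}"]
    by (intro exI[of _ "{0}"]) auto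
next
  case (insert i J)
  note HD = left_idealD[OF insert.prems(2)]
  let ?e = "E i i" and ?f = "\<Sum>j\<in>J. E j j"
  have i: "i \<in> I" and J: "J \<subseteq> I" using insert.prems by auto
  have f: "?f \<in> C" using sum_closed E_idem(1) J by (meson subsetD)
  note e = E_idem[OF i]
  have ef: "?e \<cdot> ?f = 0"
    unfolding mul_sum using E_mult[OF i i] insert.hyps(2) J by (intro sum.neutral) auto
  have fe: "?f \<cdot> ?e = 0"
    unfolding mul_sum using E_mult[OF _ _ i i] insert.hyps(2) J by (intro sum.neutral) auto
  have ff: "?f \<cdot> ?f = ?f"
  proof -
    have "E j j \<cdot> ?f = E j j" if "j \<in> J" for j
    proof -
      have "E j j \<cdot> ?f = (\<Sum>l\<in>J. if l = j then E j j else 0)"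
        unfolding mul_sum
      proof (rule sum.cong[OF refl])
        fix l assume "l \<in> J"
        then have "j \<in> I" "l \<in> I" using that J by auto
        then show "E j j \<cdot> E l l = (if l = j then E j j else 0)" using E_mult[of j j l l] by auto
      qed
      then show ?thesis using insert.hyps(1) that by (simp add: sum.delta)
    qed
    then have "(\<Sum>j\<in>J. E j j \<cdot> ?f) = ?f" by (intro sum.cong) auto
    then show ?thesis by (simp only: mul_sum(2))
  qed
  have col: "x \<in> column (insert i J) \<longleftrightarrow> x \<in> C \<and> x \<cdot> ?e + x \<cdot> ?f = x" for x
    using insert.hyps by (simp add: column_def mul_add)
  have coli: "x \<in> column {i} \<longleftrightarrow> x \<in> C \<and> x \<cdot> ?e = x" for x by (simp add: column_def)
  have colf: "x \<in> column J \<longleftrightarrow> x \<in> C \<and> x \<cdot> ?f = x" for x by (simp add: column_def)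
  have i0: "x \<cdot> ?f = 0" if "x \<in> column {i}" for x
    using that assoc[of x ?e ?f] e f ef by (simp add: coli)
  have j0: "x \<cdot> ?e = 0" if "x \<in> column J" for x
    using that assoc[of x ?f ?e] e f fe by (simp add: colf)
  have mf: "x \<cdot> ?f \<in> column J" if "x \<in> C" for x
    using that assoc[of x ?f ?f] f ff mul_closed by (simp add: colf)
  have "left_ideal C mul (H \<inter> column {i})"
    using HD left_idealD[OF left_ideal_column[of "{i}"]] i by (auto simp: left_ideal_def)
  then obtain K1 where K1: "left_ideal C mul K1" "K1 \<subseteq> column {i}" "(H \<inter> column {i}) \<inter> K1 = {0}"
    "\<And>c. c \<in> column {i} \<Longrightarrow> \<exists>h\<in>H \<inter> column {i}. c - h \<in> K1"
    using column_complement[OF i ss[OF i], of "H \<inter> column {i}"] by auto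
  have "left_ideal C mul ((\<lambda>x. x \<cdot> ?f) ` H)"
    unfolding left_ideal_def
  proof (intro conjI ballI)
    show "(\<lambda>x. x \<cdot> ?f) ` H \<subseteq> C" using HD(1) mul_closed f by auto
    show "0 \<in> (\<lambda>x. x \<cdot> ?f) ` H" using HD(2) by (intro image_eqI[of _ _ 0]) simp_all
    fix y z assume "y \<in> (\<lambda>x. x \<cdot> ?f) ` H" "z \<in> (\<lambda>x. x \<cdot> ?f) ` H"
    then obtain a b where "a \<in> H" "b \<in> H" "y = a \<cdot> ?f" "z = b \<cdot> ?f" by auto
    then show "y - z \<in> (\<lambda>x. x \<cdot> ?f) ` H" using HD(3) by (intro image_eqI[of _ _ "a - b"]) (simp_all add: mul_minus)
  next
    fix c y assume "c \<in> C" "y \<in> (\<lambda>x. x \<cdot> ?f) ` H"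
    then obtain a where "a \<in> H" "y = a \<cdot> ?f" by auto
    then show "c \<cdot> y \<in> (\<lambda>x. x \<cdot> ?f) ` H"
      using HD(1,5) \<open>c \<in> C\<close> assoc[OF \<open>c \<in> C\<close> _ f] by (intro image_eqI[of _ _ "c \<cdot> a"]) simp_all
  qed
  moreover have "(\<lambda>x. x \<cdot> ?f) ` H \<subseteq> column J" using mf HD(1) by auto
  ultimately have "\<exists>K. left_ideal C mul K \<and> K \<subseteq> column J \<and> (\<lambda>x. x \<cdot> ?f) ` H \<inter> K = {0} \<and>
      (\<forall>c\<in>column J. \<exists>h\<in>(\<lambda>x. x \<cdot> ?f) ` H. c - h \<in> K)"
    by (rule insert.IH[OF J])
  then obtain K2 where K2: "left_ideal C mul K2" "K2 \<subseteq> column J" "(\<lambda>x. x \<cdot> ?f) ` H \<inter> K2 = {0}"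
    "\<forall>c\<in>column J. \<exists>h\<in>(\<lambda>x. x \<cdot> ?f) ` H. c - h \<in> K2"
    by (elim exE conjE)
  note K1D = left_idealD[OF K1(1)] and K2D = left_idealD[OF K2(1)]
  let ?K = "{a + b | a b. a \<in> K1 \<and> b \<in> K2}"
  have sub: "x \<in> column (insert i J)" if "x \<in> column {i} \<or> x \<in> column J" for x
    using that i0[of x] j0[of x] by (auto simp: col coli colf)
  note colD = left_idealD[OF left_ideal_column[OF insert.prems(1)]]
  show ?case
  proof (intro exI conjI ballI)
    show "left_ideal C mul ?K"
      unfolding left_ideal_def
    proof (intro conjI ballI)
      show "?K \<subseteq> C" using K1D(1) K2D(1) left_idealD(4)[OF left_ideal_C] by auto
      show "0 \<in> ?K" using K1D(2) K2D(2) by force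
      fix x y assume "x \<in> ?K" "y \<in> ?K"
      then obtain a b a' b' where ab: "a \<in> K1" "b \<in> K2" "x = a + b" "a' \<in> K1" "b' \<in> K2" "y = a' + b'" by auto
      then have "x - y = (a - a') + (b - b')" by simp
      then show "x - y \<in> ?K" using K1D(3)[OF ab(1,4)] K2D(3)[OF ab(2,5)] by blast
    next
      fix c x assume c: "c \<in> C" and "x \<in> ?K"
      then obtain a b where ab: "a \<in> K1" "b \<in> K2" "x = a + b" by auto
      then show "c \<cdot> x \<in> ?K" using K1D(5)[OF c ab(1)] K2D(5)[OF c ab(2)] by (auto simp: mul_add)
    qed
    show "?K \<subseteq> column (insert i J)" using sub K1(2) K2(2) colD(4) by blast
    show "H \<inter> ?K = {0}"
    proof (intro subset_antisym subsetI)
      fix x assume "x \<in> H \<inter> ?K"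
      then obtain a b where ab: "x \<in> H" "a \<in> K1" "b \<in> K2" "x = a + b" by auto
      \<comment> \<open>Right multiplication by \<open>?f\<close> kills the summand in column
        \<open>i\<close> and fixes the one in the old columns.\<close>
      have "x \<cdot> ?f = b" using ab i0[of a] K1(2) K2(2) colf[of b] by (auto simp: mul_add)
      then have "b \<in> (\<lambda>x. x \<cdot> ?f) ` H \<inter> K2" using ab by blast
      then have "b = 0" using K2(3) by simp
      then have "x \<in> (H \<inter> column {i}) \<inter> K1" using ab K1(2) by auto
      then show "x \<in> {0}" using K1(3) by simp
    next
      fix x :: 'a assume "x \<in> {0}"
      then show "x \<in> H \<inter> ?K" using HD(2) K1D(2) K2D(2) by force
    qed
    fix c assume c: "c \<in> column (insert i J)"
    then have cC: "c \<in> C" using col by blast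
    obtain h where h: "h \<in> H" "c \<cdot> ?f - h \<cdot> ?f \<in> K2" using bspec[OF K2(4) mf[OF cC]] by auto
    \<comment> \<open>\<open>b\<close> is the part of \<open>c - h\<close> in the old columns; what
      remains, \<open>d\<close>, is killed by right multiplication with \<open>?f\<close> and
      therefore lies in column \<open>i\<close>.\<close>
    define b where "b = c \<cdot> ?f - h \<cdot> ?f"
    define d where "d = c - h - b"
    have b: "b \<in> K2" "b \<in> column J" using h(2) K2(2) by (auto simp: b_def)
    have dcol: "d \<in> column (insert i J)"
      unfolding d_def using c h(1) insert.prems(3) sub[of b] b(2) colD(3) by blast
    have "d \<cdot> ?f = 0" unfolding d_def using b(2) by (simp add: mul_minus colf) (simp add: b_def)
    then have "d \<in> column {i}" using dcol by (simp add: col coli)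
    then obtain h1 where h1: "h1 \<in> H" "d - h1 \<in> K1" using K1(4) by blast
    have "c - (h + h1) = (d - h1) + b" by (simp add: d_def)
    then have "c - (h + h1) \<in> ?K" using h1(2) b(1) by blast
    then show "\<exists>h\<in>H. c - h \<in> ?K" using HD(4)[OF h(1) h1(1)] by blast
  qed
qed

lemma left_semisimple_if_corners:
  assumes "\<And>i. i \<in> I \<Longrightarrow> left_semisimple (corner i) mul"
  shows "left_semisimple C mul"
proof -
  have "column I = C" using E_unit(2) by (auto simp: column_def)
  then show ?thesis
    unfolding left_semisimple_def using columns_complement[OF assms finite_I subset_refl] left_idealD(1)
    by (metis subsetI)
qed

end


section \<open>The algebras as matrix algebras over Temperley--Lieb algebras\<close>

lemma ring_plus:
  fixes R :: "('a::ab_group_add, 'r) ring_scheme"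
  assumes add: "add R = (+)" and zero: "zero R = 0"
    and "0 \<in> carrier R" "\<And>x y. x \<in> carrier R \<Longrightarrow> y \<in> carrier R \<Longrightarrow> x - y \<in> carrier R"
    and "\<And>x y. x \<in> carrier R \<Longrightarrow> y \<in> carrier R \<Longrightarrow> x \<otimes>\<^bsub>R\<^esub> y \<in> carrier R"
    and "\<And>x y z. x \<in> carrier R \<Longrightarrow> y \<in> carrier R \<Longrightarrow> z \<in> carrier R \<Longrightarrow> (x \<otimes>\<^bsub>R\<^esub> y) \<otimes>\<^bsub>R\<^esub> z = x \<otimes>\<^bsub>R\<^esub> (y \<otimes>\<^bsub>R\<^esub> z)"
    and "\<one>\<^bsub>R\<^esub> \<in> carrier R" "\<And>x. x \<in> carrier R \<Longrightarrow> \<one>\<^bsub>R\<^esub> \<otimes>\<^bsub>R\<^esub> x = x" "\<And>x. x \<in> carrier R \<Longrightarrow> x \<otimes>\<^bsub>R\<^esub> \<one>\<^bsub>R\<^esub> = x"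
    and "\<And>x y z. (x + y) \<otimes>\<^bsub>R\<^esub> z = x \<otimes>\<^bsub>R\<^esub> z + y \<otimes>\<^bsub>R\<^esub> z" "\<And>x y z. z \<otimes>\<^bsub>R\<^esub> (x + y) = z \<otimes>\<^bsub>R\<^esub> x + z \<otimes>\<^bsub>R\<^esub> y"
  shows "ring R"
proof (rule ringI)
  have neg: "- x \<in> carrier R" if "x \<in> carrier R" for x using assms(4)[OF assms(3) that] by simp
  show "abelian_group R"
  proof (rule abelian_groupI)
    fix x assume x: "x \<in> carrier R"
    then show "\<exists>y\<in>carrier R. y \<oplus>\<^bsub>R\<^esub> x = \<zero>\<^bsub>R\<^esub>" using neg by (intro bexI[of _ "- x"]) (simp_all add: add zero)
    fix y assume y: "y \<in> carrier R"
    show "x \<oplus>\<^bsub>R\<^esub> y \<in> carrier R" using assms(4)[OF x neg[OF y]] by (simp add: add)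
  qed (simp_all add: add zero assms(3) add_ac)
  show "monoid R" by (rule monoidI) (use assms in auto)
qed (use assms in \<open>simp_all add: add\<close>)

lemma subspace_free_space: "fvs.subspace (free_space S)"
  by (auto simp: fvs.subspace_def free_space_def fscale_def)

lemma basis_vec_free: "d \<in> S \<Longrightarrow> basis_vec d \<in> free_space S"
  by (auto simp: free_space_def basis_vec_def)

lemma TL_diagram_algebra: "TL n \<delta> = diagram_algebra (tl_diagrams n) n \<delta>"
  by (simp add: TL_def)

lemma TL_one: "\<one>\<^bsub>TL n \<delta>\<^esub> = basis_vec (id_diag n)"
  by (simp add: TL_def diagram_algebra_simps)

lemma tl_diagrams_pb: "tl_diagrams n \<subseteq> partial_brauer n"
  using perfect_pb by (auto simp: tl_diagrams_perfect)

lemma TL_one_unit: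
  fixes \<delta> :: "'k::field"
  assumes "f \<in> free_space (tl_diagrams n)"
  shows "\<one>\<^bsub>TL n \<delta>\<^esub> \<otimes>\<^bsub>TL n \<delta>\<^esub> f = f" "f \<otimes>\<^bsub>TL n \<delta>\<^esub> \<one>\<^bsub>TL n \<delta>\<^esub> = f"
  unfolding TL_one unfolding TL_diagram_algebra
  using diagram_algebra_unit[OF finite_tl_diagrams tl_diagrams_pb id_diag_tl assms] by auto

lemma TL_one_closed: "\<one>\<^bsub>TL n \<delta>\<^esub> \<in> free_space (tl_diagrams n)"
  unfolding TL_one by (rule basis_vec_free[OF id_diag_tl])

text \<open>Composites are known to be perfect before they are known to be planar, so this is what
  can be said about products while \<open>TL n \<delta>\<close> is not yet known to be a
  ring.\<close>

lemma TL_mult_perfect: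
  fixes \<delta> :: "'k::field"
  shows "f \<otimes>\<^bsub>TL n \<delta>\<^esub> g \<in> free_space (perfect n)"
proof -
  have "basis_vec (diag_comp n t s) \<in> free_space (perfect n)" if "t \<in> tl_diagrams n" "s \<in> tl_diagrams n" for t s
    using that perfect_comp by (intro basis_vec_free) (auto simp: tl_diagrams_perfect)
  then show ?thesis
    unfolding TL_simps by (intro fvs.subspace_sum[OF subspace_free_space] fvs.subspace_scale[OF subspace_free_space])
qed

lemmas TL_bilinear = diagram_mult_bilinear[where D = "tl_diagrams n" and k = n for n, folded TL_diagram_algebra]
lemmas motzkin_bilinear = diagram_mult_bilinear[where D = "motzkin k" and k = k for k, folded motzkin_algebra_def]
lemmas motzkin_mult_sum = diagram_mult_sum[where D = "motzkin k" and k = k for k, folded motzkin_algebra_def]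

text \<open>The tensor of the elementary matrix at (\<open>A\<close>, \<open>B\<close>) with
  \<open>f\<close>. The sum runs over all perfect diagrams and not only the planar ones, so that
  nothing is lost of a product in \<open>TL\<close> whose planarity is still open.\<close>

definition embed :: "nat \<Rightarrow> nat set \<Rightarrow> nat set \<Rightarrow> (diagram \<Rightarrow> 'k::field) \<Rightarrow> (diagram \<Rightarrow> 'k)" where
  "embed k A B f = (\<Sum>t\<in>perfect (card A). fscale (f t) (bar (place k A B t)))"

text \<open>The Temperley-Lieb coefficient at position (\<open>A\<close>, \<open>B\<close>), read
  off by the dual functionals \<open>coef\<close> and cut down to planar diagrams.\<close>

definition entry :: "nat \<Rightarrow> nat set \<Rightarrow> nat set \<Rightarrow> (diagram \<Rightarrow> 'k::field) \<Rightarrow> (diagram \<Rightarrow> 'k)" where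
  "entry k A B x = (\<lambda>t. if t \<in> tl_diagrams (card A) then coef k (place k A B t) x else 0)"

lemma embed_linear:
  "embed k A B (f + g) = embed k A B f + embed k A B g" "embed k A B (fscale c f) = fscale c (embed k A B f)"
  "embed k A B 0 = 0" "embed k A B (f - g) = embed k A B f - embed k A B g"
  unfolding embed_def
  by (simp_all only: plus_fun_apply minus_apply zero_fun_apply fvs.scale_left_distrib fvs.scale_left_diff_distrib
      sum.distrib sum_subtractf fvs.scale_sum_right fvs.scale_zero_left sum.neutral_const fvs.scale_scale)
     (simp add: fscale_def)

lemma embed_sum: "embed k A B (sum f S) = (\<Sum>i\<in>S. embed k A B (f i))"
  by (induction S rule: infinite_finite_induct)
     (simp_all only: sum.infinite sum.empty sum.insert embed_linear not_False_eq_True)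

lemma embed_basis_vec:
  assumes "t \<in> perfect (card A)" shows "embed k A B (basis_vec t) = bar (place k A B t)"
proof -
  have "embed k A B (basis_vec t) = (\<Sum>s\<in>perfect (card A). if s = t then bar (place k A B s) else 0)"
    unfolding embed_def by (intro sum.cong refl) (auto simp: basis_vec_def)
  then show ?thesis using assms by (simp only: sum.delta finite_perfect if_True)
qed

lemma embed_tl:
  assumes "f \<in> free_space (tl_diagrams (card A))"
  shows "embed k A B f = (\<Sum>t\<in>tl_diagrams (card A). fscale (f t) (bar (place k A B t)))"
  unfolding embed_def
proof (rule sum.mono_neutral_right)
  show "\<forall>t\<in>perfect (card A) - tl_diagrams (card A). fscale (f t) (bar (place k A B t)) = 0"
    using assms by (auto simp: free_space_def fscale_def)
qed (auto simp: tl_diagrams_perfect)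

lemma entry_linear:
  "entry k A B (x + y) = entry k A B x + entry k A B y" "entry k A B (fscale c x) = fscale c (entry k A B x)"
  "entry k A B 0 = 0" "entry k A B (x - y) = entry k A B x - entry k A B y"
proof -
  show 1: "entry k A B (x + y) = entry k A B x + entry k A B y" for x y
    unfolding entry_def by (rule ext) (simp add: coef_linear(1)[unfolded plus_fun_def] plus_fun_def)
  show 2: "entry k A B (fscale c x) = fscale c (entry k A B x)" for c x
    unfolding entry_def by (rule ext) (simp add: coef_linear(2)[unfolded fscale_def] fscale_def)
  show "entry k A B 0 = 0" using 2[of 0 0] by (simp only: fvs.scale_zero_left)
  have eq: "x - y = x + fscale (- 1) y" for x y :: "diagram \<Rightarrow> 'a" by (simp add: fscale_def fun_eq_iff)
  show "entry k A B (x - y) = entry k A B x - entry k A B y" by (simp only: eq 1 2)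
qed

lemma entry_closed: "entry k A B x \<in> free_space (tl_diagrams (card A))"
  by (auto simp: entry_def free_space_def)

lemma subsets_nI: "A \<subseteq> {1..k} \<Longrightarrow> card A = n \<Longrightarrow> A \<in> subsets_n k n"
  by (simp add: subsets_n_def)

lemma place_motzkin:
  assumes "A \<in> subsets_n k n" "B \<in> subsets_n k n" "t \<in> tl_diagrams n"
  shows "place k A B t \<in> motzkin k"
  using place_balanced_n[OF assms(1,2), of t] assms(3) balanced_n_subset by (auto simp: tl_diagrams_perfect)

lemma coef_embed:
  assumes "A \<in> subsets_n k n" "B \<in> subsets_n k n" "A' \<in> subsets_n k m" "B' \<in> subsets_n k m" "t \<in> perfect m"
    and f: "f \<in> free_space (perfect n)"
  shows "coef k (place k A' B' t) (embed k A B f) = (if A' = A \<and> B' = B then f t else (0 :: 'k::field))"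
proof -
  have n: "card A = n" using subsets_nD(2)[OF assms(1)] .
  have "coef k (place k A' B' t) (embed k A B f)
      = (\<Sum>s\<in>perfect n. f s * (if place k A' B' t = place k A B s then 1 else 0))"
    unfolding embed_def coef_sum coef_linear n
    by (intro sum.cong refl)
       (simp add: coef_bar[OF place_pb(1)[OF assms(3,4) perfect_pb[OF assms(5)]] place_pb(1)[OF assms(1,2) perfect_pb]])
  also have "\<dots> = (\<Sum>s\<in>perfect n. if s = t then (if A' = A \<and> B' = B then f s else 0) else 0)"
  proof (intro sum.cong refl)
    fix s assume s: "s \<in> perfect n"
    have "place k A' B' t = place k A B s \<longleftrightarrow> A' = A \<and> B' = B \<and> s = t"
      using place_top_bot[OF assms(3-5)] place_top_bot[OF assms(1,2) s] tl_part_place[OF assms(3-5)]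
        tl_part_place[OF assms(1,2) s] by metis
    then show "f s * (if place k A' B' t = place k A B s then 1 else 0)
        = (if s = t then (if A' = A \<and> B' = B then f s else 0) else 0)" by auto
  qed
  also have "\<dots> = (if A' = A \<and> B' = B then f t else 0)"
  proof (cases "t \<in> perfect n")
    case True then show ?thesis by (simp add: sum.delta)
  next
    case False
    then have "f t = 0" using f by (simp add: free_space_def)
    then show ?thesis using False by (auto intro!: sum.neutral)
  qed
  finally show ?thesis .
qed

lemma free_space_tl_perfect: "f \<in> free_space (tl_diagrams n) \<Longrightarrow> f \<in> free_space (perfect n)"
  by (auto simp: free_space_def tl_diagrams_perfect)

lemma entry_embed:
  assumes "A \<in> subsets_n k n" "B \<in> subsets_n k n" "A' \<in> subsets_n k m" "B' \<in> subsets_n k m"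
    and f: "f \<in> free_space (tl_diagrams n)"
  shows "entry k A' B' (embed k A B f) = (if A' = A \<and> B' = B then f else (0 :: diagram \<Rightarrow> 'k::field))"
proof
  fix t
  have m: "card A' = m" using subsets_nD(2)[OF assms(3)] .
  show "entry k A' B' (embed k A B f) t = (if A' = A \<and> B' = B then f else 0) t"
  proof (cases "t \<in> tl_diagrams m")
    case True
    then have "t \<in> perfect m" by (simp add: tl_diagrams_perfect)
    then show ?thesis
      using True m coef_embed[OF assms(1-4) _ free_space_tl_perfect[OF f]] by (simp add: entry_def)
  next
    case False
    then have "f t = 0" if "A' = A" using that f subsets_nD(2)[OF assms(1)] m by (auto simp: free_space_def)
    then show ?thesis using False m by (auto simp: entry_def)
  qed
qed

text \<open>\<open>bar_mult_match\<close>, \<open>bar_mult_mismatch\<close> and the compatibility of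
  composition with \<open>place\<close> say together that positions multiply like elementary
  matrices and coefficients like elements of \<open>TL n (\<delta> - 1)\<close>. The formula holds
  before the product of \<open>f\<close> and \<open>g\<close> is known to be planar.\<close>

lemma embed_mult:
  fixes \<delta> :: "'k::field"
  assumes A: "A \<in> subsets_n k n" and B: "B \<in> subsets_n k n" and C: "C \<in> subsets_n k m" and D: "D \<in> subsets_n k m"
    and f: "f \<in> free_space (tl_diagrams n)" and g: "g \<in> free_space (tl_diagrams m)"
  shows "embed k A B f \<otimes>\<^bsub>motzkin_algebra k \<delta>\<^esub> embed k C D g
       = (if B = C then embed k A D (f \<otimes>\<^bsub>TL n (\<delta> - 1)\<^esub> g) else 0)"
proof -
  have cA: "card A = n" "card C = m" using subsets_nD(2)[OF A] subsets_nD(2)[OF C] by auto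
  have tp: "t \<in> perfect j" if "t \<in> tl_diagrams j" for t j using that by (simp add: tl_diagrams_perfect)
  have prod: "embed k A B f \<otimes>\<^bsub>motzkin_algebra k \<delta>\<^esub> embed k C D g
     = (\<Sum>t\<in>tl_diagrams n. \<Sum>s\<in>tl_diagrams m. fscale (f t * g s)
          (bar (place k A B t) \<otimes>\<^bsub>motzkin_algebra k \<delta>\<^esub> bar (place k C D s)))"
    unfolding embed_tl[OF f[folded cA(1)], unfolded cA(1)] embed_tl[OF g[folded cA(2)], unfolded cA(2)]
      motzkin_mult_sum motzkin_bilinear fvs.scale_sum_right fvs.scale_scale
    by (subst sum.swap) (intro sum.cong refl, simp only: mult.commute)
  show ?thesis
  proof (cases "B = C")
    case True
    then have nm: "n = m" using subsets_nD(2)[OF B] subsets_nD(2)[OF C] by simp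
    have "embed k A B f \<otimes>\<^bsub>motzkin_algebra k \<delta>\<^esub> embed k C D g
      = (\<Sum>t\<in>tl_diagrams n. \<Sum>s\<in>tl_diagrams n. embed k A D
           (fscale (f t * g s * (\<delta> - 1) ^ loops n t s) (basis_vec (diag_comp n t s))))"
      unfolding prod nm[symmetric]
    proof (intro sum.cong refl)
      fix t s assume t: "t \<in> tl_diagrams n" and s: "s \<in> tl_diagrams n"
      note D' = D[folded nm]
      have "bar (place k A B t) \<otimes>\<^bsub>motzkin_algebra k \<delta>\<^esub> bar (place k C D s)
          = fscale ((\<delta> - 1) ^ loops n t s) (bar (place k A D (diag_comp n t s)))"
        unfolding True[symmetric]
        using bar_mult_match[OF place_motzkin[OF A B t] place_motzkin[OF B D' s], of \<delta>]
          place_top_bot(2)[OF A B tp[OF t]] place_top_bot(1)[OF B D' tp[OF s]]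
          diag_comp_place[OF A B D' tp[OF t] tp[OF s]] loops_place[OF A B D' tp[OF t] tp[OF s]] by simp
      moreover have "embed k A D (basis_vec (diag_comp n t s)) = (bar (place k A D (diag_comp n t s)) :: diagram \<Rightarrow> 'k)"
        by (rule embed_basis_vec) (use perfect_comp[OF tp[OF t] tp[OF s]] cA in simp)
      ultimately show "fscale (f t * g s) (bar (place k A B t) \<otimes>\<^bsub>motzkin_algebra k \<delta>\<^esub> bar (place k C D s))
        = embed k A D (fscale (f t * g s * (\<delta> - 1) ^ loops n t s) (basis_vec (diag_comp n t s)))"
        by (simp only: embed_linear fvs.scale_scale)
    qed
    also have "\<dots> = embed k A D (f \<otimes>\<^bsub>TL n (\<delta> - 1)\<^esub> g)"
      unfolding TL_simps embed_sum ..
    finally show ?thesis using True by simp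
  next
    case False
    have "bar (place k A B t) \<otimes>\<^bsub>motzkin_algebra k \<delta>\<^esub> bar (place k C D s) = 0"
      if t: "t \<in> tl_diagrams n" and s: "s \<in> tl_diagrams m" for t s
      using bar_mult_mismatch[OF place_motzkin[OF A B t] place_motzkin[OF C D s], of \<delta>]
        place_top_bot(2)[OF A B tp[OF t]] place_top_bot(1)[OF C D tp[OF s]] False by simp
    then show ?thesis unfolding prod using False by (simp only: fvs.scale_zero_right sum.neutral_const if_False cong: sum.cong)
  qed
qed

text \<open>For a set \<open>I\<close> of subsets of \<open>{1..k}\<close> the \<open>bar d\<close> with both vertex sets in \<open>I\<close> span a matrix
  algebra; \<open>X(n)\<close> and \<open>PTL k \<delta>\<close> are the cases of the \<open>n\<close>-element subsets and of all subsets.\<close>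

definition block_diagrams :: "nat \<Rightarrow> nat set set \<Rightarrow> diagram set" where
  "block_diagrams k I = {d \<in> motzkin k. top_set d \<in> I \<and> bot_set d \<in> I \<and> card (top_set d) = card (bot_set d)}"

abbreviation block_space :: "nat \<Rightarrow> nat set set \<Rightarrow> (diagram \<Rightarrow> 'k::field) set" where
  "block_space k I \<equiv> fvs.span (bar ` block_diagrams k I)"

definition matrix_unit :: "nat \<Rightarrow> nat set \<Rightarrow> nat set \<Rightarrow> (diagram \<Rightarrow> 'k::field)" where
  "matrix_unit k A B = embed k A B (basis_vec (id_diag (card A)))"

lemma subspace_eq_linear:
  assumes "h1 0 = h2 0" "\<And>x y. h1 (x + y) = h1 x + h1 y" "\<And>x y. h2 (x + y) = h2 x + h2 y"
    "\<And>c x. h1 (fscale c x) = fscale c (h1 x)" "\<And>c x. h2 (fscale c x) = fscale c (h2 x)"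
  shows "fvs.subspace {x. h1 x = h2 x}"
  using assms by (simp add: fvs.subspace_def)

context
  fixes k :: nat and \<delta> :: "'k::field" and I :: "nat set set"
  assumes I: "I \<subseteq> Pow {1..k}"
begin

lemma finite_index: "finite I"
  using I by (rule finite_subset) simp

lemma index_subsets_n: "A \<in> I \<Longrightarrow> A \<in> subsets_n k (card A)" "A \<in> I \<Longrightarrow> B \<in> I \<Longrightarrow> card A = card B \<Longrightarrow> B \<in> subsets_n k (card A)"
  using I by (blast intro: subsets_nI, metis subsets_nI PowD subsetD)

lemma bar_block:
  assumes "d \<in> block_diagrams k I"
  obtains A B t where "A \<in> I" "B \<in> I" "card A = card B" "t \<in> tl_diagrams (card A)"
    "bar d = (embed k A B (basis_vec t) :: diagram \<Rightarrow> 'k)" "d = place k A B t"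
proof -
  have d: "top_set d \<in> I" "bot_set d \<in> I" "card (top_set d) = card (bot_set d)" "d \<in> balanced_n k (card (top_set d))"
    using assms by (auto simp: block_diagrams_def balanced_n_iff)
  note b = balanced_n_place[OF d(4)]
  have "bar d = (embed k (top_set d) (bot_set d) (basis_vec (tl_part d)) :: diagram \<Rightarrow> 'k)"
    using b(3,4) by (subst embed_basis_vec) (simp_all add: tl_diagrams_perfect)
  then show thesis using that[OF d(1-3) b(3)] b(4) by simp
qed

text \<open>Reduces a linear statement to elements with a single matrix entry. Letting
  \<open>t\<close> be any vector of the Temperley-Lieb space makes the base case accessible to
  \<open>embed_mult\<close>.\<close>

lemma block_induct [consumes 1, case_names embed subspace]:
  assumes "x \<in> block_space k I"
    and "\<And>A B t. A \<in> I \<Longrightarrow> B \<in> I \<Longrightarrow> card A = card B \<Longrightarrow> t \<in> free_space (tl_diagrams (card A)) \<Longrightarrow> P (embed k A B t :: diagram \<Rightarrow> 'k)"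
    and "fvs.subspace {x. P x}"
  shows "P x"
  using assms(1)
proof (rule fvs.span_induct)
  fix x :: "diagram \<Rightarrow> 'k" assume "x \<in> bar ` block_diagrams k I"
  then obtain d where d: "d \<in> block_diagrams k I" "x = bar d" by auto
  obtain A B t where "A \<in> I" "B \<in> I" "card A = card B" "t \<in> tl_diagrams (card A)"
    "bar d = (embed k A B (basis_vec t) :: diagram \<Rightarrow> 'k)" using bar_block[OF d(1)] .
  then show "P x" using assms(2) basis_vec_free d(2) by metis
qed (rule assms(3))

lemma embed_block:
  assumes "A \<in> I" "B \<in> I" "card A = card B" "f \<in> free_space (tl_diagrams (card A))"
  shows "embed k A B f \<in> (block_space k I :: (diagram \<Rightarrow> 'k) set)"
  unfolding embed_tl[OF assms(4)]
proof (intro fvs.span_sum fvs.span_scale fvs.span_base imageI)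
  fix t assume t: "t \<in> tl_diagrams (card A)"
  note AB = index_subsets_n(1)[OF assms(1)] index_subsets_n(2)[OF assms(1-3)]
  have "t \<in> perfect (card A)" using t by (simp add: tl_diagrams_perfect)
  then show "place k A B t \<in> block_diagrams k I"
    using place_motzkin[OF AB t] place_top_bot[OF AB] assms by (simp add: block_diagrams_def)
qed

lemma matrix_unit_mult:
  assumes "A \<in> I" "B \<in> I" "card A = card B" "C \<in> I" "D \<in> I" "card C = card D" "f \<in> free_space (tl_diagrams (card C))"
  shows "matrix_unit k A B \<otimes>\<^bsub>motzkin_algebra k \<delta>\<^esub> embed k C D f = (if B = C then embed k A D f else 0)"
    and "embed k C D f \<otimes>\<^bsub>motzkin_algebra k \<delta>\<^esub> matrix_unit k A B = (if D = A then embed k C B f else 0)"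
proof -
  note AB = index_subsets_n(1)[OF assms(1)] index_subsets_n(2)[OF assms(1-3)]
  note CD = index_subsets_n(1)[OF assms(4)] index_subsets_n(2)[OF assms(4-6)]
  note o = TL_one_closed[unfolded TL_one, of "card A"]
  show "matrix_unit k A B \<otimes>\<^bsub>motzkin_algebra k \<delta>\<^esub> embed k C D f = (if B = C then embed k A D f else 0)"
    unfolding matrix_unit_def embed_mult[OF AB CD o assms(7)]
    using TL_one_unit(1)[OF assms(7), of "\<delta> - 1"] assms(3) by (auto simp: TL_one)
  show "embed k C D f \<otimes>\<^bsub>motzkin_algebra k \<delta>\<^esub> matrix_unit k A B = (if D = A then embed k C B f else 0)"
    unfolding matrix_unit_def embed_mult[OF CD AB assms(7) o]
    using TL_one_unit(2)[OF assms(7), of "\<delta> - 1"] assms(6) by (auto simp: TL_one)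
qed

lemma matrix_unit_closed:
  assumes "A \<in> I" "B \<in> I" "card A = card B" shows "matrix_unit k A B \<in> (block_space k I :: (diagram \<Rightarrow> 'k) set)"
  unfolding matrix_unit_def using TL_one_closed[unfolded TL_one] by (rule embed_block[OF assms])

lemma block_unit:
  assumes x: "x \<in> (block_space k I :: (diagram \<Rightarrow> 'k) set)"
  shows "(\<Sum>A\<in>I. matrix_unit k A A) \<otimes>\<^bsub>motzkin_algebra k \<delta>\<^esub> x = x"
    and "x \<otimes>\<^bsub>motzkin_algebra k \<delta>\<^esub> (\<Sum>A\<in>I. matrix_unit k A A) = x"
proof -
  show "(\<Sum>A\<in>I. matrix_unit k A A) \<otimes>\<^bsub>motzkin_algebra k \<delta>\<^esub> x = x"
    using x
  proof (induction rule: block_induct)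
    case (embed A B f)
    have "(\<Sum>C\<in>I. matrix_unit k C C) \<otimes>\<^bsub>motzkin_algebra k \<delta>\<^esub> embed k A B f
        = (\<Sum>C\<in>I. if C = A then embed k C B f else 0)"
      unfolding motzkin_mult_sum by (intro sum.cong refl matrix_unit_mult(1)[OF _ _ refl embed])
    then show ?case using embed(1) finite_index by (simp only: sum.delta if_True)
  next
    case subspace
    show ?case by (rule subspace_eq_linear) (simp_all only: motzkin_bilinear)
  qed
  show "x \<otimes>\<^bsub>motzkin_algebra k \<delta>\<^esub> (\<Sum>A\<in>I. matrix_unit k A A) = x"
    using x
  proof (induction rule: block_induct)
    case (embed A B f)
    have "embed k A B f \<otimes>\<^bsub>motzkin_algebra k \<delta>\<^esub> (\<Sum>C\<in>I. matrix_unit k C C)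
        = (\<Sum>C\<in>I. if B = C then embed k A C f else 0)"
      unfolding motzkin_mult_sum by (intro sum.cong refl matrix_unit_mult(2)[OF _ _ refl embed])
    then show ?case using embed(2) finite_index by (simp only: sum.delta' if_True)
  next
    case subspace
    show ?case by (rule subspace_eq_linear) (simp_all only: motzkin_bilinear)
  qed
qed

text \<open>Matrix units on both sides cut out the entry at (\<open>C\<close>, \<open>D\<close>) and
  move it to (\<open>A\<close>, \<open>B\<close>). Sets of different sizes are never joined by a
  block diagram, whence the zero. The formula yields both the axiom \<open>E_block\<close> and the
  description of the corners.\<close>

lemma block_corner:
  assumes "x \<in> (block_space k I :: (diagram \<Rightarrow> 'k) set)" and A: "A \<in> I" "C \<in> I" "D \<in> I" "B \<in> I" "card A = card C" "card B = card D"
  shows "matrix_unit k A C \<otimes>\<^bsub>motzkin_algebra k \<delta>\<^esub> (x \<otimes>\<^bsub>motzkin_algebra k \<delta>\<^esub> matrix_unit k D B)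
     = (if card C = card D then embed k A B (entry k C D x) else 0)"
  using assms(1)
proof (induction rule: block_induct)
  case (embed A' B' f)
  note AB = index_subsets_n(1)[OF embed(1)] index_subsets_n(2)[OF embed(1-3)]
  have 1: "embed k A' B' f \<otimes>\<^bsub>motzkin_algebra k \<delta>\<^esub> matrix_unit k D B = (if B' = D then embed k A' B f else 0)"
    by (rule matrix_unit_mult(2)[OF A(3,4) A(6)[symmetric] embed])
  have 2: "matrix_unit k A C \<otimes>\<^bsub>motzkin_algebra k \<delta>\<^esub> embed k A' B f = (if C = A' then embed k A B f else 0)" if "B' = D"
    by (rule matrix_unit_mult(1)[OF A(1,2,5) embed(1) A(4) _ embed(4)]) (use that embed(3) A(6) in simp)
  show ?case
  proof (cases "card C = card D")
    case True
    have "entry k C D (embed k A' B' f) = (if C = A' \<and> B' = D then f else 0)"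
      using entry_embed[OF AB index_subsets_n(1)[OF A(2)] index_subsets_n(2)[OF A(2,3) True] embed(4)]
      by (simp only: eq_commute[of D])
    then show ?thesis unfolding 1 using 2 True
      by (cases "B' = D"; cases "C = A'") (simp_all only: if_True if_False embed_linear motzkin_bilinear simp_thms)
  next
    case False
    then have "\<not> (B' = D \<and> C = A')" using embed(3) by auto
    then show ?thesis unfolding 1 using 2 False
      by (cases "B' = D"; cases "C = A'") (simp_all only: if_True if_False motzkin_bilinear simp_thms)
  qed
next
  case subspace
  show ?case
  proof (cases "card C = card D")
    case True
    show ?thesis
      by (rule subspace_eq_linear) (simp_all only: True if_True motzkin_bilinear embed_linear entry_linear simp_thms)
  next
    case False
    show ?thesis
      by (rule subspace_eq_linear) (simp_all only: False if_False motzkin_bilinear fvs.scale_zero_right add_0_right simp_thms)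
  qed
qed

section \<open>Transfer of ring axioms and semisimplicity between a block algebra and its
  corners\<close>

context
  fixes Y :: "(diagram \<Rightarrow> 'k, 'r) ring_scheme"
  assumes Y: "carrier Y = block_space k I" "mult Y = mult (motzkin_algebra k \<delta>)" "add Y = (+)" "zero Y = 0"
    "one Y = (\<Sum>A\<in>I. matrix_unit k A A)"
begin

text \<open>Since \<open>Y\<close> is closed under multiplication, the embedded product has
  coordinate zero at every non-planar diagram, and by \<open>coef_embed\<close> this coordinate is
  the coefficient of the product in \<open>TL\<close>. So \<open>TL\<close> is closed; associativity
  is pulled back along the injection \<open>embed\<close>.\<close>

lemma ring_TL_of_block:
  assumes ring: "ring Y" and A: "A \<in> I" shows "ring (TL (card A) (\<delta> - 1))"
proof -
  interpret Y: ring Y by (rule ring)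
  let ?n = "card A"
  let ?T = "TL ?n (\<delta> - 1)"
  note AA = index_subsets_n(1)[OF A]
  have em: "embed k A A f \<otimes>\<^bsub>Y\<^esub> embed k A A g = embed k A A (f \<otimes>\<^bsub>?T\<^esub> g)"
    if "f \<in> free_space (tl_diagrams ?n)" "g \<in> free_space (tl_diagrams ?n)" for f g
    unfolding Y(2) embed_mult[OF AA AA AA AA that] by simp
  have eY: "embed k A A f \<in> carrier Y" if "f \<in> free_space (tl_diagrams ?n)" for f :: "diagram \<Rightarrow> 'k"
    unfolding Y(1) by (rule embed_block[OF A A refl that])
  have closed: "f \<otimes>\<^bsub>?T\<^esub> g \<in> free_space (tl_diagrams ?n)"
    if f: "f \<in> free_space (tl_diagrams ?n)" and g: "g \<in> free_space (tl_diagrams ?n)" for f g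
  proof -
    have y: "embed k A A (f \<otimes>\<^bsub>?T\<^esub> g) \<in> block_space k I"
      using Y.m_closed[OF eY[OF f] eY[OF g]] unfolding em[OF f g] Y(1) .
    have "(f \<otimes>\<^bsub>?T\<^esub> g) t = 0" if t: "t \<notin> tl_diagrams ?n" for t
    proof (cases "t \<in> perfect ?n")
      case True
      \<comment> \<open>The space is spanned by \<open>bar\<close> of Motzkin diagrams, so it has no
        component at a diagram with crossings.\<close>
      have "coef k (place k A A t) x = 0" if "x \<in> block_space k I" for x :: "diagram \<Rightarrow> 'k"
        using that
      proof (rule fvs.span_induct)
        show "fvs.subspace {x :: diagram \<Rightarrow> 'k. coef k (place k A A t) x = 0}"
          unfolding fvs.subspace_def by (simp only: mem_Collect_eq coef_linear) simp
        fix x :: "diagram \<Rightarrow> 'k" assume "x \<in> bar ` block_diagrams k I"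
        then obtain d where d: "d \<in> motzkin k" "x = bar d" by (auto simp: block_diagrams_def)
        have "place k A A t \<notin> motzkin k"
          using t True noncrossing_place[OF AA AA perfect_pb[OF True]] by (simp add: motzkin_def tl_diagrams_perfect)
        then show "coef k (place k A A t) x = 0"
          using d(1) unfolding d(2) coef_bar[OF place_pb(1)[OF AA AA perfect_pb[OF True]] motzkin_pb[OF d(1)]]
          by (metis (full_types))
      qed
      from this[OF y] show ?thesis
        using coef_embed[OF AA AA AA AA True TL_mult_perfect[of ?n "\<delta> - 1" f g]] by simp
    next
      case False
      then show ?thesis using TL_mult_perfect[of ?n "\<delta> - 1" f g] by (simp add: free_space_def)
    qed
    then show ?thesis by (simp add: free_space_def)
  qed
  have inj: "f = g" if "embed k A A f = embed k A A g" "f \<in> free_space (tl_diagrams ?n)" "g \<in> free_space (tl_diagrams ?n)"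
    for f g :: "diagram \<Rightarrow> 'k"
    using arg_cong[OF that(1), of "entry k A A"] entry_embed[OF AA AA AA AA that(2)] entry_embed[OF AA AA AA AA that(3)] by simp
  show ?thesis
  proof (rule ring_plus)
    fix x y z assume "x \<in> carrier ?T" "y \<in> carrier ?T" "z \<in> carrier ?T"
    then have xyz: "x \<in> free_space (tl_diagrams ?n)" "y \<in> free_space (tl_diagrams ?n)" "z \<in> free_space (tl_diagrams ?n)"
      by (simp_all add: TL_simps)
    show "x \<otimes>\<^bsub>?T\<^esub> y \<otimes>\<^bsub>?T\<^esub> z = x \<otimes>\<^bsub>?T\<^esub> (y \<otimes>\<^bsub>?T\<^esub> z)"
    proof (rule inj)
      show "embed k A A (x \<otimes>\<^bsub>?T\<^esub> y \<otimes>\<^bsub>?T\<^esub> z) = embed k A A (x \<otimes>\<^bsub>?T\<^esub> (y \<otimes>\<^bsub>?T\<^esub> z))"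
        using Y.m_assoc[OF eY[OF xyz(1)] eY[OF xyz(2)] eY[OF xyz(3)]]
        unfolding em[OF xyz(1,2)] em[OF xyz(2,3)] em[OF closed[OF xyz(1,2)] xyz(3)] em[OF xyz(1) closed[OF xyz(2,3)]] .
    qed (intro closed xyz)+
  qed (use TL_bilinear(1,2) closed TL_one_closed TL_one_unit fvs.subspace_diff[OF subspace_free_space]
       fvs.subspace_0[OF subspace_free_space] in \<open>simp_all only: TL_simps(1-3)\<close>)
qed

text \<open>By linearity it suffices to check closure and associativity on single matrix entries,
  where \<open>embed_mult\<close> reduces them to those of the Temperley-Lieb algebras.\<close>

lemma ring_block_of_TL:
  assumes ring: "\<And>A. A \<in> I \<Longrightarrow> ring (TL (card A) (\<delta> - 1))"
  shows "ring Y"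
proof -
  have Tclosed: "f \<otimes>\<^bsub>TL (card A) (\<delta> - 1)\<^esub> g \<in> free_space (tl_diagrams (card A))"
    if "A \<in> I" "f \<in> free_space (tl_diagrams (card A))" "g \<in> free_space (tl_diagrams (card A))" for f g A
    using ring.ring_simprules(5)[OF ring[OF that(1)]] that(2,3) by (simp only: TL_simps(1))
  have mult_embed: "embed k A B f \<otimes>\<^bsub>motzkin_algebra k \<delta>\<^esub> embed k C D g
       = (if B = C then embed k A D (f \<otimes>\<^bsub>TL (card A) (\<delta> - 1)\<^esub> g) else 0)"
    if "A \<in> I" "B \<in> I" "card A = card B" "C \<in> I" "D \<in> I" "card C = card D"
      "f \<in> free_space (tl_diagrams (card A))" "g \<in> free_space (tl_diagrams (card C))" for A B C D f g
    by (rule embed_mult[OF index_subsets_n(1)[OF that(1)] index_subsets_n(2)[OF that(1-3)]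
          index_subsets_n(1)[OF that(4)] index_subsets_n(2)[OF that(4-6)] that(7,8)])
  have closed: "x \<otimes>\<^bsub>motzkin_algebra k \<delta>\<^esub> y \<in> block_space k I" if x: "x \<in> block_space k I" and y: "y \<in> block_space k I" for x y
    using x
  proof (induction rule: block_induct)
    case (embed A B f)
    show ?case using y
    proof (induction rule: block_induct)
      case e: (embed C D g)
      have "B = C \<Longrightarrow> embed k A D (f \<otimes>\<^bsub>TL (card A) (\<delta> - 1)\<^esub> g) \<in> block_space k I"
        using e embed Tclosed by (intro embed_block) auto
      then show ?case unfolding mult_embed[OF embed(1-3) e(1-3) embed(4) e(4)] by (simp add: fvs.span_zero)
    next
      case subspace
      show ?case unfolding fvs.subspace_def
        by (simp only: mem_Collect_eq motzkin_bilinear) (blast intro: fvs.span_zero fvs.span_add fvs.span_scale)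
    qed
  next
    case subspace
    show ?case unfolding fvs.subspace_def
      by (simp only: mem_Collect_eq motzkin_bilinear) (blast intro: fvs.span_zero fvs.span_add fvs.span_scale)
  qed
  have assoc: "(x \<otimes>\<^bsub>motzkin_algebra k \<delta>\<^esub> y) \<otimes>\<^bsub>motzkin_algebra k \<delta>\<^esub> z = x \<otimes>\<^bsub>motzkin_algebra k \<delta>\<^esub> (y \<otimes>\<^bsub>motzkin_algebra k \<delta>\<^esub> z)"
    if x: "x \<in> block_space k I" and y: "y \<in> block_space k I" and z: "z \<in> block_space k I" for x y z
    using x
  proof (induction rule: block_induct)
    case (embed A B f)
    show ?case using y
    proof (induction rule: block_induct)
      case e: (embed C D g)
      show ?case using z
      proof (induction rule: block_induct)
        case e': (embed E F h)
        let ?T = "\<lambda>n. TL n (\<delta> - 1)"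
        note 1 = mult_embed[OF embed(1-3) e(1-3) embed(4) e(4)] and 2 = mult_embed[OF e(1-3) e'(1-3) e(4) e'(4)]
        have 3: "embed k A D (f \<otimes>\<^bsub>?T (card A)\<^esub> g) \<otimes>\<^bsub>motzkin_algebra k \<delta>\<^esub> embed k E F h
            = (if D = E then embed k A F (f \<otimes>\<^bsub>?T (card A)\<^esub> g \<otimes>\<^bsub>?T (card A)\<^esub> h) else 0)" if "B = C"
        proof (rule mult_embed[OF embed(1) e(2) _ e'(1-3) Tclosed[OF embed(1,4)] e'(4)])
          show "card A = card D" using that embed(3) e(3) by simp
          show "g \<in> free_space (tl_diagrams (card A))" using that embed(3) e(4) by simp
        qed
        have 4: "embed k A B f \<otimes>\<^bsub>motzkin_algebra k \<delta>\<^esub> embed k C F (g \<otimes>\<^bsub>?T (card C)\<^esub> h)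
            = (if B = C then embed k A F (f \<otimes>\<^bsub>?T (card A)\<^esub> (g \<otimes>\<^bsub>?T (card C)\<^esub> h)) else 0)" if "D = E"
        proof (rule mult_embed[OF embed(1-3) e(1) e'(2) _ embed(4) Tclosed[OF e(1,4)]])
          show "card C = card F" using that e(3) e'(3) by simp
          show "h \<in> free_space (tl_diagrams (card C))" using that e(3) e'(4) by simp
        qed
        have 5: "f \<otimes>\<^bsub>?T (card A)\<^esub> g \<otimes>\<^bsub>?T (card A)\<^esub> h = f \<otimes>\<^bsub>?T (card A)\<^esub> (g \<otimes>\<^bsub>?T (card C)\<^esub> h)"
          if "B = C" "D = E"
        proof -
          have c: "card C = card A" "card E = card A" using that embed(3) e(3) by simp_all
          have "g \<in> free_space (tl_diagrams (card A))" "h \<in> free_space (tl_diagrams (card A))" using e(4) e'(4) c by simp_all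
          then show ?thesis unfolding c(1)
            using ring.ring_simprules(11)[OF ring[OF embed(1)], of f g h] embed(4) by (simp only: TL_simps(1))
        qed
        show ?case
        proof (cases "B = C")
          case BC: True
          show ?thesis
          proof (cases "D = E")
            case DE: True
            show ?thesis
              unfolding 1[unfolded if_P[OF BC]] 2[unfolded if_P[OF DE]] 3[OF BC, unfolded if_P[OF DE]]
                4[OF DE, unfolded if_P[OF BC]] 5[OF BC DE] ..
          next
            case DE: False
            show ?thesis
              unfolding 1[unfolded if_P[OF BC]] 2[unfolded if_not_P[OF DE]] 3[OF BC, unfolded if_not_P[OF DE]]
              by (simp only: motzkin_bilinear)
          qed
        next
          case BC: False
          show ?thesis
          proof (cases "D = E")
            case DE: True
            show ?thesis
              unfolding 1[unfolded if_not_P[OF BC]] 2[unfolded if_P[OF DE]] 4[OF DE, unfolded if_not_P[OF BC]]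
              by (simp only: motzkin_bilinear)
          next
            case DE: False
            show ?thesis
              unfolding 1[unfolded if_not_P[OF BC]] 2[unfolded if_not_P[OF DE]] by (simp only: motzkin_bilinear)
          qed
        qed
      next
        case subspace
        show ?case by (rule subspace_eq_linear) (simp_all only: motzkin_bilinear)
      qed
    next
      case subspace
      show ?case by (rule subspace_eq_linear) (simp_all only: motzkin_bilinear)
    qed
  next
    case subspace
    show ?case by (rule subspace_eq_linear) (simp_all only: motzkin_bilinear)
  qed
  show ?thesis
  proof (rule ring_plus)
    show "\<one>\<^bsub>Y\<^esub> \<in> carrier Y" unfolding Y by (intro fvs.span_sum matrix_unit_closed) auto
  qed (use closed assoc block_unit motzkin_bilinear(1,2) fvs.span_zero fvs.span_diff in \<open>simp_all only: Y\<close>)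
qed

lemma block_matrix_units:
  assumes ring: "ring Y"
  shows "matrix_units (block_space k I) (mult (motzkin_algebra k \<delta>)) I card (matrix_unit k)"
proof -
  interpret Y: ring Y by (rule ring)
  show ?thesis
  proof
    show "x \<in> block_space k I \<Longrightarrow> y \<in> block_space k I \<Longrightarrow> x \<otimes>\<^bsub>motzkin_algebra k \<delta>\<^esub> y \<in> block_space k I" for x y
      using Y.m_closed[of x y] by (simp only: Y)
    show "x \<in> block_space k I \<Longrightarrow> y \<in> block_space k I \<Longrightarrow> z \<in> block_space k I \<Longrightarrow>
        x \<otimes>\<^bsub>motzkin_algebra k \<delta>\<^esub> y \<otimes>\<^bsub>motzkin_algebra k \<delta>\<^esub> z = x \<otimes>\<^bsub>motzkin_algebra k \<delta>\<^esub> (y \<otimes>\<^bsub>motzkin_algebra k \<delta>\<^esub> z)" for x y z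
      using Y.m_assoc[of x y z] by (simp only: Y)
    fix i j l m assume h: "i \<in> I" "j \<in> I" "l \<in> I" "m \<in> I" "card i = card j" "card l = card m"
    show "matrix_unit k i j \<otimes>\<^bsub>motzkin_algebra k \<delta>\<^esub> matrix_unit k l m = (if j = l then matrix_unit k i m else 0)"
      unfolding matrix_unit_def[of k l m] matrix_unit_mult(1)[OF h(1,2,5) h(3,4,6) basis_vec_free[OF id_diag_tl]]
      using h(5) by (simp add: matrix_unit_def)
  next
    fix i j x assume "i \<in> I" "j \<in> I" "card i \<noteq> card j" "x \<in> (block_space k I :: (diagram \<Rightarrow> 'k) set)"
    then show "matrix_unit k i i \<otimes>\<^bsub>motzkin_algebra k \<delta>\<^esub> (x \<otimes>\<^bsub>motzkin_algebra k \<delta>\<^esub> matrix_unit k j j) = 0"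
      using block_corner[of x i i j j] by simp
  qed (use fvs.span_zero fvs.span_diff motzkin_bilinear(7,8)[where \<delta> = \<delta>] finite_index matrix_unit_closed block_unit in simp_all)
qed

text \<open>The corner at \<open>A\<close> is a copy of the Temperley-Lieb algebra on
  \<open>card A\<close> points. Each of the two mutually inverse maps carries one direction of the
  semisimplicity transfer.\<close>

lemma block_corner_bij:
  assumes ring: "ring Y" and A: "A \<in> I"
  shows "bij_betw (embed k A A) (free_space (tl_diagrams (card A)) :: (diagram \<Rightarrow> 'k) set)
      (matrix_units.corner (block_space k I) (mult (motzkin_algebra k \<delta>)) (matrix_unit k) A)"
    and "bij_betw (entry k A A) (matrix_units.corner (block_space k I) (mult (motzkin_algebra k \<delta>)) (matrix_unit k) A)
      (free_space (tl_diagrams (card A)))"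
proof -
  interpret mu: matrix_units "block_space k I :: (diagram \<Rightarrow> 'k) set" "mult (motzkin_algebra k \<delta>)" I card "matrix_unit k"
    by (rule block_matrix_units[OF ring])
  note AA = index_subsets_n(1)[OF A]
  have 1: "entry k A A (embed k A A f) = f" if "f \<in> free_space (tl_diagrams (card A))" for f :: "diagram \<Rightarrow> 'k"
    using entry_embed[OF AA AA AA AA that] by simp
  have 2: "embed k A A (entry k A A y) = y" if "y \<in> mu.corner A" for y
  proof -
    have y: "y \<in> block_space k I" "matrix_unit k A A \<otimes>\<^bsub>motzkin_algebra k \<delta>\<^esub> y = y" "y \<otimes>\<^bsub>motzkin_algebra k \<delta>\<^esub> matrix_unit k A A = y"
      using that unfolding mu.corner_def by auto
    show ?thesis using block_corner[OF y(1) A A A A refl refl] unfolding y(3) y(2) by simp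
  qed
  have 3: "embed k A A f \<in> mu.corner A" if "f \<in> free_space (tl_diagrams (card A))" for f
    unfolding mu.corner_def
    using embed_block[OF A A refl that] matrix_unit_mult[OF A A refl A A refl that] by simp
  show "bij_betw (embed k A A) (free_space (tl_diagrams (card A))) (mu.corner A)"
    by (rule bij_betw_byWitness[of _ "entry k A A"]) (use 1 2 3 entry_closed in auto)
  show "bij_betw (entry k A A) (mu.corner A) (free_space (tl_diagrams (card A)))"
    by (rule bij_betw_byWitness[of _ "embed k A A"]) (use 1 2 3 entry_closed in auto)
qed

lemma TL_semisimple_of_block:
  assumes ss: "semisimple_ring Y" and A: "A \<in> I" shows "semisimple_ring (TL (card A) (\<delta> - 1))"
proof -
  note ring = semisimple_ring_is_ring[OF ss]
  interpret mu: matrix_units "block_space k I :: (diagram \<Rightarrow> 'k) set" "mult (motzkin_algebra k \<delta>)" I card "matrix_unit k"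
    by (rule block_matrix_units[OF ring])
  interpret Y: ring Y by (rule ring)
  note ringT = ring_TL_of_block[OF ring A] and AA = index_subsets_n(1)[OF A]
  interpret T: ring "TL (card A) (\<delta> - 1)" by (rule ringT)
  note bij = block_corner_bij[OF ring A]
  have ent: "entry k A A (embed k A A f) = f" if "f \<in> free_space (tl_diagrams (card A))" for f :: "diagram \<Rightarrow> 'k"
    using entry_embed[OF AA AA AA AA that] by simp
  have "left_semisimple (block_space k I) (mult (motzkin_algebra k \<delta>))"
    using ss unfolding semisimple_ring_iff[OF ring Y(3,4)] Y(1,2) .
  then have "left_semisimple (mu.corner A) (mult (motzkin_algebra k \<delta>))" by (rule mu.corner_left_semisimple[OF A])
  \<comment> \<open>\<open>entry\<close> is multiplicative here because elements of the corner can
    be written as values of \<open>embed\<close>; on the whole algebra it obeys the matrix product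
    rule.\<close>
  moreover have "entry k A A (x \<otimes>\<^bsub>motzkin_algebra k \<delta>\<^esub> y) = entry k A A x \<otimes>\<^bsub>TL (card A) (\<delta> - 1)\<^esub> entry k A A y"
    if xy: "x \<in> mu.corner A" "y \<in> mu.corner A" for x y
  proof -
    obtain f g where fg: "f \<in> free_space (tl_diagrams (card A))" "x = embed k A A f" "g \<in> free_space (tl_diagrams (card A))" "y = embed k A A g"
      using xy unfolding bij_betw_imp_surj_on[OF bij(1), symmetric] by (elim imageE)
    have "f \<otimes>\<^bsub>TL (card A) (\<delta> - 1)\<^esub> g \<in> free_space (tl_diagrams (card A))"
      using T.m_closed[of f g] fg(1,3) by (simp only: TL_simps(1))
    then show ?thesis
      unfolding fg(2,4) embed_mult[OF AA AA AA AA fg(1,3)] if_P[OF refl[of A]] ent[OF fg(1)] ent[OF fg(3)] by (rule ent)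
  qed
  moreover have l: "left_ideal (mu.corner A) (mult (motzkin_algebra k \<delta>)) (mu.corner A)"
  proof -
    have "block_space k I \<inter> mu.corner A = mu.corner A" unfolding mu.corner_def by blast
    then show ?thesis using mu.left_ideal_corner[OF A mu.left_ideal_C] by (simp only:)
  qed
  ultimately have "left_semisimple (free_space (tl_diagrams (card A))) (mult (TL (card A) (\<delta> - 1)))"
    by (intro left_semisimple_iso[OF bij(2) entry_linear(4) _ left_idealD(3)[OF l] left_idealD(5)[OF l] left_idealD(2)[OF l]])
  then show ?thesis unfolding semisimple_ring_iff[OF ringT TL_simps(3,2)] TL_simps(1) .
qed

lemma block_semisimple_of_TL:
  assumes ss: "\<And>A. A \<in> I \<Longrightarrow> semisimple_ring (TL (card A) (\<delta> - 1))" shows "semisimple_ring Y"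
proof -
  have ring: "ring Y" by (rule ring_block_of_TL) (rule semisimple_ring_is_ring[OF ss])
  interpret mu: matrix_units "block_space k I :: (diagram \<Rightarrow> 'k) set" "mult (motzkin_algebra k \<delta>)" I card "matrix_unit k"
    by (rule block_matrix_units[OF ring])
  have "left_semisimple (mu.corner A) (mult (motzkin_algebra k \<delta>))" if A: "A \<in> I" for A
  proof -
    note ringT = semisimple_ring_is_ring[OF ss[OF A]] and AA = index_subsets_n(1)[OF A]
    interpret T: ring "TL (card A) (\<delta> - 1)" by (rule ringT)
    have "left_semisimple (free_space (tl_diagrams (card A))) (mult (TL (card A) (\<delta> - 1)))"
      using ss[OF A] unfolding semisimple_ring_iff[OF ringT TL_simps(3,2)] TL_simps(1) .
    moreover have "embed k A A (x \<otimes>\<^bsub>TL (card A) (\<delta> - 1)\<^esub> y) = embed k A A x \<otimes>\<^bsub>motzkin_algebra k \<delta>\<^esub> embed k A A y"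
      if "x \<in> free_space (tl_diagrams (card A))" "y \<in> free_space (tl_diagrams (card A))" for x y
      using embed_mult[OF AA AA AA AA that, of \<delta>] by simp
    moreover have "x \<otimes>\<^bsub>TL (card A) (\<delta> - 1)\<^esub> y \<in> free_space (tl_diagrams (card A))"
      if "x \<in> free_space (tl_diagrams (card A))" "y \<in> free_space (tl_diagrams (card A))" for x y
      using T.m_closed[of x y] that by (simp only: TL_simps(1))
    ultimately show ?thesis
      by (intro left_semisimple_iso[OF block_corner_bij(1)[OF ring A] embed_linear(4) _ fvs.subspace_diff[OF subspace_free_space]
            _ fvs.subspace_0[OF subspace_free_space]])
  qed
  then have "left_semisimple (block_space k I) (mult (motzkin_algebra k \<delta>))" by (rule mu.left_semisimple_if_corners)
  then show ?thesis unfolding semisimple_ring_iff[OF ring Y(3,4)] Y(1,2) .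
qed

end

end

section \<open>\<open>X(n)\<close> and \<open>PTL k \<delta>\<close> as block algebras\<close>

lemma subsets_n_index: "subsets_n k n \<subseteq> Pow {1..k}"
  by (auto simp: subsets_n_def)

lemma balanced_n_block: "balanced_n k n = block_diagrams k (subsets_n k n)"
proof -
  have "d \<in> balanced_n k n \<longleftrightarrow> d \<in> block_diagrams k (subsets_n k n)" for d
    using top_bot_subset[OF motzkin_pb, of d k]
    by (cases "d \<in> motzkin k") (auto simp only: balanced_n_iff block_diagrams_def subsets_n_def mem_Collect_eq)
  then show ?thesis by blast
qed

lemma balanced_block: "balanced k = block_diagrams k (Pow {1..k})"
proof -
  have "card (cups d) = card (caps d) \<longleftrightarrow> card (top_set d) = card (bot_set d)" if "d \<in> motzkin k" for d
    using top_bot_card[OF motzkin_pb[OF that]] by simp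
  then have "d \<in> balanced k \<longleftrightarrow> d \<in> block_diagrams k (Pow {1..k})" for d
    using top_bot_subset[OF motzkin_pb, of d k]
    by (cases "d \<in> motzkin k") (simp_all only: balanced_def block_diagrams_def mem_Collect_eq Pow_iff simp_thms)
  then show ?thesis by blast
qed

text \<open>Two identities of one algebra coincide, so the definite description in
  \<open>X_alg\<close> picks the sum of the diagonal matrix units.\<close>

lemma X_alg_simps:
  fixes \<delta> :: "'k::field"
  shows "carrier (X_alg k \<delta> n) = block_space k (subsets_n k n)" "mult (X_alg k \<delta> n) = mult (motzkin_algebra k \<delta>)"
    "add (X_alg k \<delta> n) = (+)" "zero (X_alg k \<delta> n) = 0" "one (X_alg k \<delta> n) = (\<Sum>A\<in>subsets_n k n. matrix_unit k A A)"
proof -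
  show "carrier (X_alg k \<delta> n) = block_space k (subsets_n k n)" by (simp add: X_alg_def X_space_def balanced_n_block)
  show "mult (X_alg k \<delta> n) = mult (motzkin_algebra k \<delta>)" "add (X_alg k \<delta> n) = (+)" "zero (X_alg k \<delta> n) = 0"
    by (simp_all add: X_alg_def PTL_def motzkin_algebra_def diagram_algebra_simps)
  have mPTL: "mult (PTL k \<delta>) = mult (motzkin_algebra k \<delta>)" by (simp add: PTL_def)
  let ?u = "\<Sum>A\<in>subsets_n k n. matrix_unit k A A"
  note unit = block_unit[OF subsets_n_index, of _ k n \<delta>]
  have u: "?u \<in> block_space k (subsets_n k n)"
    by (intro fvs.span_sum matrix_unit_closed[OF subsets_n_index]) auto
  have "one (X_alg k \<delta> n) = (THE e. e \<in> block_space k (subsets_n k n) \<and> (\<forall>x\<in>block_space k (subsets_n k n).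
        e \<otimes>\<^bsub>motzkin_algebra k \<delta>\<^esub> x = x \<and> x \<otimes>\<^bsub>motzkin_algebra k \<delta>\<^esub> e = x))"
    by (simp add: X_alg_def mPTL X_space_def balanced_n_block)
  also have "\<dots> = ?u"
  proof (rule the_equality)
    show "?u \<in> block_space k (subsets_n k n) \<and> (\<forall>x\<in>block_space k (subsets_n k n).
        ?u \<otimes>\<^bsub>motzkin_algebra k \<delta>\<^esub> x = x \<and> x \<otimes>\<^bsub>motzkin_algebra k \<delta>\<^esub> ?u = x)" using u unit by blast
    fix e assume e: "e \<in> block_space k (subsets_n k n) \<and> (\<forall>x\<in>block_space k (subsets_n k n).
        e \<otimes>\<^bsub>motzkin_algebra k \<delta>\<^esub> x = x \<and> x \<otimes>\<^bsub>motzkin_algebra k \<delta>\<^esub> e = x)"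
    then have "e \<otimes>\<^bsub>motzkin_algebra k \<delta>\<^esub> ?u = ?u" using u by blast
    then show "e = ?u" using unit(2)[of e] e by simp
  qed
  finally show "one (X_alg k \<delta> n) = ?u" .
qed

text \<open>The identity is inherited from the Motzkin algebra. The identity diagram has no
  horizontal edges, so it equals its own \<open>tilde\<close> and lies in the span, where it has to
  agree with the sum of the diagonal matrix units.\<close>

lemma PTL_simps:
  fixes \<delta> :: "'k::field"
  shows "carrier (PTL k \<delta>) = block_space k (Pow {1..k})" "mult (PTL k \<delta>) = mult (motzkin_algebra k \<delta>)"
    "add (PTL k \<delta>) = (+)" "zero (PTL k \<delta>) = 0" "one (PTL k \<delta>) = (\<Sum>A\<in>Pow {1..k}. matrix_unit k A A)"
proof -
  have "carrier (PTL k \<delta>) = fvs.span (tilde k \<delta> ` balanced k)" by (simp add: PTL_def)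
  then show "carrier (PTL k \<delta>) = block_space k (Pow {1..k})" unfolding span_tilde unfolding balanced_block .
  show "mult (PTL k \<delta>) = mult (motzkin_algebra k \<delta>)" "add (PTL k \<delta>) = (+)" "zero (PTL k \<delta>) = 0"
    by (simp_all add: PTL_def motzkin_algebra_def diagram_algebra_simps)
  let ?u = "\<Sum>A\<in>Pow {1..k}. matrix_unit k A A :: diagram \<Rightarrow> 'k" and ?i = "basis_vec (id_diag k) :: diagram \<Rightarrow> 'k"
  note unit = block_unit[OF subset_refl, of _ k \<delta>]
  have u: "?u \<in> block_space k (Pow {1..k})"
    by (intro fvs.span_sum matrix_unit_closed[OF subset_refl]) auto
  have "block_space k (Pow {1..k}) \<subseteq> (free_space (motzkin k) :: (diagram \<Rightarrow> 'k) set)"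
  proof (rule fvs.span_minimal[OF _ subspace_free_space], clarify)
    fix d assume "d \<in> block_diagrams k (Pow {1..k})"
    then have d: "d \<in> motzkin k" by (simp add: block_diagrams_def)
    show "bar d \<in> (free_space (motzkin k) :: (diagram \<Rightarrow> 'k) set)"
      unfolding bar_alt_sum[OF motzkin_pb[OF d]] alt_sum_def
      by (intro fvs.subspace_sum[OF subspace_free_space] fvs.subspace_scale[OF subspace_free_space] basis_vec_free
          motzkin_remove_edges[OF d]) auto
  qed
  then have iu: "?i \<otimes>\<^bsub>motzkin_algebra k \<delta>\<^esub> ?u = ?u"
    unfolding motzkin_algebra_def using u motzkin_pb
    by (intro diagram_algebra_unit(1)[OF finite_motzkin _ id_diag_motzkin]) auto
  have "id_diag k \<in> balanced k"
  proof -
    have "cups (id_diag k) = {}" "caps (id_diag k) = {}"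
      unfolding id_diag_p_set cups_def caps_def p_set_pb(2) by auto
    then show ?thesis using id_diag_motzkin by (simp add: balanced_def)
  qed
  moreover have "tilde k \<delta> (id_diag k) = ?i"
  proof -
    have "cups (id_diag k) \<union> caps (id_diag k) = {}"
      unfolding id_diag_p_set cups_def caps_def p_set_pb(2) by auto
    then show ?thesis unfolding tilde_alt_sum[OF id_diag_motzkin] by simp
  qed
  ultimately have "?i \<in> block_space k (Pow {1..k})"
    unfolding balanced_block[symmetric] span_tilde[of k \<delta>, symmetric] by (metis fvs.span_base imageI)
  then have "?i = ?u" using unit(2)[of ?i] iu by simp
  then show "one (PTL k \<delta>) = ?u" by (simp add: PTL_def motzkin_algebra_def diagram_algebra_simps)
qed

lemma ring_X_alg_iff:
  fixes \<delta> :: "'k::field"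
  assumes "n \<le> k" shows "ring (X_alg k \<delta> n) \<longleftrightarrow> ring (TL n (\<delta> - 1))"
proof -
  \<comment> \<open>\<open>n \<le> k\<close> provides at least one corner; a zero algebra
    \<open>X(n)\<close> would carry no information about \<open>TL\<close>.\<close>
  have A: "{1..n} \<in> subsets_n k n" using assms by (simp add: subsets_n_def)
  have "ring (X_alg k \<delta> n)" if "ring (TL n (\<delta> - 1))"
    by (rule ring_block_of_TL[OF subsets_n_index X_alg_simps]) (simp only: subsets_nD(2) that)
  then show ?thesis
    using ring_TL_of_block[OF subsets_n_index X_alg_simps _ A] unfolding subsets_nD(2)[OF A] by blast
qed

lemma semisimple_X_alg_iff:
  fixes \<delta> :: "'k::field"
  assumes "n \<le> k" shows "semisimple_ring (X_alg k \<delta> n) \<longleftrightarrow> semisimple_ring (TL n (\<delta> - 1))"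
proof -
  have A: "{1..n} \<in> subsets_n k n" using assms by (simp add: subsets_n_def)
  have "semisimple_ring (X_alg k \<delta> n)" if "semisimple_ring (TL n (\<delta> - 1))"
    by (rule block_semisimple_of_TL[OF subsets_n_index X_alg_simps]) (simp only: subsets_nD(2) that)
  then show ?thesis
    using TL_semisimple_of_block[OF subsets_n_index X_alg_simps _ A] unfolding subsets_nD(2)[OF A] by blast
qed

text \<open>With all subsets of \<open>{1..k}\<close> as indices the blocks of all sizes are treated
  at once; the corner at \<open>A\<close> is a Temperley-Lieb algebra on
  \<open>card A \<le> k\<close> points.\<close>

lemma semisimple_PTL:
  fixes \<delta> :: "'k::field"
  assumes "\<And>m. m \<le> k \<Longrightarrow> semisimple_ring (TL m (\<delta> - 1))" shows "semisimple_ring (PTL k \<delta>)"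
proof (rule block_semisimple_of_TL[OF subset_refl PTL_simps])
  fix A assume "A \<in> Pow {1..k}"
  then have "card A \<le> k" using card_mono[of "{1..k}" A] by auto
  then show "semisimple_ring (TL (card A) (\<delta> - 1))" by (rule assms)
qed


section \<open>Modules\<close>

context left_module
begin

lemma smult_r_null: "a \<in> carrier R \<Longrightarrow> a \<odot>\<^bsub>M\<^esub> \<zero>\<^bsub>M\<^esub> = \<zero>\<^bsub>M\<^esub>"
  using smult_r_distr[of a "\<zero>\<^bsub>M\<^esub>" "\<zero>\<^bsub>M\<^esub>"] by (metis M.add.l_cancel_one' M.zero_closed M.l_zero smult_closed)

lemma smult_l_null: "x \<in> carrier M \<Longrightarrow> \<zero>\<^bsub>R\<^esub> \<odot>\<^bsub>M\<^esub> x = \<zero>\<^bsub>M\<^esub>"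
  using smult_l_distr[of "\<zero>\<^bsub>R\<^esub>" "\<zero>\<^bsub>R\<^esub>" x] by (metis M.add.l_cancel_one' R.zero_closed R.l_zero smult_closed)

lemma smult_uminus_one: "x \<in> carrier M \<Longrightarrow> (\<ominus>\<^bsub>R\<^esub> \<one>\<^bsub>R\<^esub>) \<odot>\<^bsub>M\<^esub> x = \<ominus>\<^bsub>M\<^esub> x"
proof -
  assume x: "x \<in> carrier M"
  have "(\<ominus>\<^bsub>R\<^esub> \<one>\<^bsub>R\<^esub>) \<odot>\<^bsub>M\<^esub> x \<oplus>\<^bsub>M\<^esub> x = \<zero>\<^bsub>M\<^esub>"
    using smult_l_distr[of "\<ominus>\<^bsub>R\<^esub> \<one>\<^bsub>R\<^esub>" "\<one>\<^bsub>R\<^esub>" x] x by (simp add: R.l_neg smult_l_null)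
  then show ?thesis using x by (metis M.minus_equality R.a_inv_closed R.one_closed smult_closed)
qed

text \<open>Negatives come for free as multiples by the negative of the identity.\<close>

lemma submodule_intro:
  assumes "H \<subseteq> carrier M" "\<zero>\<^bsub>M\<^esub> \<in> H" "\<And>x y. x \<in> H \<Longrightarrow> y \<in> H \<Longrightarrow> x \<oplus>\<^bsub>M\<^esub> y \<in> H"
    and smult: "\<And>a x. a \<in> carrier R \<Longrightarrow> x \<in> H \<Longrightarrow> a \<odot>\<^bsub>M\<^esub> x \<in> H"
  shows "submodule H R M"
proof (intro submodule.intro subgroup.intro submodule_axioms.intro)
  fix x assume x: "x \<in> H"
  have "(\<ominus>\<^bsub>R\<^esub> \<one>\<^bsub>R\<^esub>) \<odot>\<^bsub>M\<^esub> x \<in> H" using x by (intro smult) simp_all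
  then show "inv\<^bsub>add_monoid M\<^esub> x \<in> H" using smult_uminus_one[of x] x assms(1) by (auto simp: a_inv_def)
qed (use assms in simp_all)

lemma smult_finsum:
  assumes "finite I" "a \<in> carrier R" "f \<in> I \<rightarrow> carrier M"
  shows "a \<odot>\<^bsub>M\<^esub> finsum M f I = finsum M (\<lambda>i. a \<odot>\<^bsub>M\<^esub> f i) I"
  using assms(1,3)
proof (induction I rule: finite_induct)
  case empty
  show ?case unfolding M.finsum_empty by (rule smult_r_null[OF assms(2)])
next
  case (insert i I)
  then have f: "f i \<in> carrier M" "f \<in> I \<rightarrow> carrier M" by auto
  then have "(\<lambda>i. a \<odot>\<^bsub>M\<^esub> f i) \<in> I \<rightarrow> carrier M" using assms(2) by auto
  then show ?case using insert f assms(2) by (simp add: M.finsum_insert smult_r_distr)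
qed

end

lemma submoduleD:
  assumes "submodule H R M"
  shows "H \<subseteq> carrier M" "\<zero>\<^bsub>M\<^esub> \<in> H" "x \<in> H \<Longrightarrow> y \<in> H \<Longrightarrow> x \<oplus>\<^bsub>M\<^esub> y \<in> H"
    "a \<in> carrier R \<Longrightarrow> x \<in> H \<Longrightarrow> a \<odot>\<^bsub>M\<^esub> x \<in> H"
proof -
  interpret submodule H R M by (rule assms)
  show "H \<subseteq> carrier M" "\<zero>\<^bsub>M\<^esub> \<in> H" "x \<in> H \<Longrightarrow> y \<in> H \<Longrightarrow> x \<oplus>\<^bsub>M\<^esub> y \<in> H"
    "a \<in> carrier R \<Longrightarrow> x \<in> H \<Longrightarrow> a \<odot>\<^bsub>M\<^esub> x \<in> H"
    using subset one_closed m_closed smult_closed by auto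
qed

text \<open>Ring elements are added by \<open>sum\<close> and module elements by
  \<open>finsum\<close>; closure of the partial sums is carried along for the induction.\<close>

lemma sum_smult:
  fixes R :: "('a::ab_group_add, 'r) ring_scheme"
  assumes M: "left_module R M" and R: "add R = (+)" "zero R = 0"
    and "finite I" "\<And>i. i \<in> I \<Longrightarrow> a i \<in> carrier R" "x \<in> carrier M"
  shows "sum a I \<in> carrier R \<and> sum a I \<odot>\<^bsub>M\<^esub> x = finsum M (\<lambda>i. a i \<odot>\<^bsub>M\<^esub> x) I"
proof -
  interpret left_module R M by (rule M)
  show ?thesis
    using assms(4,5)
  proof (induction I rule: finite_induct)
    case empty
    show ?case using smult_l_null[OF assms(6)] R.zero_closed by (simp add: R)
  next
    case (insert i I)
    then have "a i \<in> carrier R" "sum a I \<in> carrier R" and c: "(\<lambda>i. a i \<odot>\<^bsub>M\<^esub> x) \<in> I \<rightarrow> carrier M"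
      using assms(6) by auto
    then show ?case
      using insert smult_l_distr[of "a i" "sum a I" x] R.a_closed[of "a i" "sum a I"] assms(6)
      by (simp add: M.finsum_insert R)
  qed
qed

lemma (in abelian_monoid) finsum_swap:
  assumes "finite I" "finite J" "\<And>i j. i \<in> I \<Longrightarrow> j \<in> J \<Longrightarrow> f i j \<in> carrier G"
  shows "finsum G (\<lambda>i. finsum G (f i) J) I = finsum G (\<lambda>j. finsum G (\<lambda>i. f i j) I) J"
  using assms(1,3)
proof (induction I rule: finite_induct)
  case empty
  then show ?case by simp
next
  case (insert i I)
  have 1: "f i \<in> J \<rightarrow> carrier G" "(\<lambda>j. finsum G (\<lambda>i. f i j) I) \<in> J \<rightarrow> carrier G"
    "(\<lambda>i. finsum G (f i) J) \<in> I \<rightarrow> carrier G"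
    using insert.prems by (auto intro!: finsum_closed)
  have "finsum G (\<lambda>i. finsum G (f i) J) (insert i I) = finsum G (f i) J \<oplus> finsum G (\<lambda>j. finsum G (\<lambda>i. f i j) I) J"
    using insert 1 by (simp add: finsum_insert)
  also have "\<dots> = finsum G (\<lambda>j. f i j \<oplus> finsum G (\<lambda>i. f i j) I) J"
    using finsum_addf[OF 1(1,2)] by simp
  also have "\<dots> = finsum G (\<lambda>j. finsum G (\<lambda>i. f i j) (insert i I)) J"
  proof (rule finsum_cong'[OF refl])
    show "(\<lambda>j. finsum G (\<lambda>i. f i j) (insert i I)) \<in> J \<rightarrow> carrier G"
      using insert.prems by (intro Pi_I finsum_closed) auto
    fix j assume "j \<in> J"
    then have "(\<lambda>i. f i j) \<in> I \<rightarrow> carrier G" "f i j \<in> carrier G" using insert.prems by auto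
    then show "f i j \<oplus> finsum G (\<lambda>i. f i j) I = finsum G (\<lambda>i. f i j) (insert i I)"
      using insert.hyps by (simp add: finsum_insert)
  qed
  finally show ?case .
qed

lemma (in abelian_monoid) finsum_delta:
  assumes "finite I" "j \<in> I" "x \<in> carrier G"
  shows "finsum G (\<lambda>i. if i = j then x else \<zero>) I = x"
proof -
  have "finsum G (\<lambda>i. if i = j then x else \<zero>) I = finsum G (\<lambda>i. if j = i then x else \<zero>) I"
    using assms(3) by (intro finsum_cong') auto
  then show ?thesis using finsum_singleton[OF assms(2,1), of "\<lambda>_. x"] assms(3) by simp
qed

section \<open>The action on \<open>Q_tensor\<close> in matrix form\<close>

lemma independent_bar:
  assumes D: "finite D" "D \<subseteq> partial_brauer k"
  shows "fvs.independent (bar ` D :: (diagram \<Rightarrow> 'k::field) set)" "inj_on (bar :: diagram \<Rightarrow> diagram \<Rightarrow> 'k) D"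
proof -
  show inj: "inj_on (bar :: diagram \<Rightarrow> diagram \<Rightarrow> 'k) D"
  proof (rule inj_onI)
    fix d d' assume "d \<in> D" "d' \<in> D" and eq: "bar d = (bar d' :: diagram \<Rightarrow> 'k)"
    then have d: "d \<in> partial_brauer k" "d' \<in> partial_brauer k" using D(2) by auto
    show "d = d'"
    proof (rule ccontr)
      assume "d \<noteq> d'"
      then show False
        using arg_cong[OF eq, of "coef k d"] unfolding coef_bar[OF d(1,1)] coef_bar[OF d] by simp
    qed
  qed
  show "fvs.independent (bar ` D :: (diagram \<Rightarrow> 'k) set)"
    unfolding fvs.dependent_finite[OF finite_imageI[OF D(1)]]
  proof
    assume "\<exists>u :: (diagram \<Rightarrow> 'k) \<Rightarrow> 'k. (\<exists>v\<in>bar ` D. u v \<noteq> 0) \<and> (\<Sum>v\<in>bar ` D. fscale (u v) v) = 0"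
    then obtain u :: "(diagram \<Rightarrow> 'k) \<Rightarrow> 'k" and d where d: "d \<in> D" "u (bar d) \<noteq> 0" and 0: "(\<Sum>v\<in>bar ` D. fscale (u v) v) = 0"
      by auto
    have "0 = coef k d (\<Sum>d'\<in>D. fscale (u (bar d')) (bar d'))"
      using 0 unfolding sum.reindex[OF inj] o_def by (simp only: coef_linear)
    also have "\<dots> = (\<Sum>d'\<in>D. if d = d' then u (bar d) else 0)"
      unfolding coef_sum coef_linear using D(2) d(1) by (intro sum.cong refl) (auto simp: coef_bar subset_iff)
    also have "\<dots> = u (bar d)" using D(1) d(1) by simp
    finally show False using d(2) by simp
  qed
qed

text \<open>\<open>Q_tensor\<close> expands its scalars by \<open>fvs.representation\<close>; this
  replaces it by the explicit functional \<open>coef\<close>, on which \<open>entry\<close> is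
  built.\<close>

lemma representation_bar:
  assumes D: "finite D" "D \<subseteq> partial_brauer k" and x: "x \<in> fvs.span (bar ` D)" and d: "d \<in> D"
  shows "fvs.representation (bar ` D) x (bar d) = (coef k d x :: 'k::field)"
proof -
  let ?r = "fvs.representation (bar ` D) x :: (diagram \<Rightarrow> 'k) \<Rightarrow> 'k"
  note inj = independent_bar(2)[OF D, where 'k = 'k]
  have "coef k d x = coef k d (\<Sum>v\<in>bar ` D. fscale (?r v) v)"
    using fvs.sum_representation_eq[OF independent_bar(1)[OF D] x finite_imageI[OF D(1)] subset_refl] by simp
  also have "\<dots> = (\<Sum>d'\<in>D. if d = d' then ?r (bar d) else 0)"
    unfolding sum.reindex[OF inj] o_def coef_sum coef_linear
    using D(2) d by (intro sum.cong refl) (auto simp: coef_bar subset_iff)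
  also have "\<dots> = ?r (bar d)" using D(1) d by simp
  finally show ?thesis ..
qed

lemma entry_sum: "entry k A B (sum f S) = (\<Sum>i\<in>S. entry k A B (f i))"
  by (induction S rule: infinite_finite_induct)
     (simp_all only: sum.infinite sum.empty sum.insert entry_linear not_False_eq_True)

lemma Q_tensor_simps:
  "carrier (Q_tensor k \<delta> n N) = (subsets_n k n \<rightarrow>\<^sub>E carrier N)"
  "zero (Q_tensor k \<delta> n N) = (\<lambda>C\<in>subsets_n k n. \<zero>\<^bsub>N\<^esub>)"
  "add (Q_tensor k \<delta> n N) = (\<lambda>w w'. \<lambda>C\<in>subsets_n k n. w C \<oplus>\<^bsub>N\<^esub> w' C)"
  by (simp_all add: Q_tensor_def tensor_group_def tensor_carrier_def ring.defs)

text \<open>A matrix with entries in \<open>TL\<close> acts on a column vector: each diagram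
  \<open>d\<close> contributes only to the entry at its two vertex sets, and collecting the diagrams
  with the same sets gives \<open>entry\<close>.\<close>

lemma Q_smult:
  fixes \<delta> :: "'k::field"
  assumes N: "left_module (TL n (\<delta> - 1)) N" and x: "x \<in> carrier (X_alg k \<delta> n)" and w: "w \<in> carrier (Q_tensor k \<delta> n N)"
  shows "x \<odot>\<^bsub>Q_tensor k \<delta> n N\<^esub> w = (\<lambda>C\<in>subsets_n k n. finsum N (\<lambda>B. entry k C B x \<odot>\<^bsub>N\<^esub> w B) (subsets_n k n))"
proof -
  let ?S = "subsets_n k n" and ?T = "TL n (\<delta> - 1)"
  interpret N: left_module ?T N by (rule N)
  have wN: "w B \<in> carrier N" if "B \<in> ?S" for B using w that by (auto simp: Q_tensor_simps)
  have fin: "finite (balanced_n k n)" by (rule finite_subset[OF balanced_n_subset finite_motzkin])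
  have pb: "balanced_n k n \<subseteq> partial_brauer k" using balanced_n_subset motzkin_pb by blast
  have xs: "x \<in> fvs.span (bar ` balanced_n k n)" using x by (simp only: X_alg_simps balanced_n_block)
  define a where "a d = fscale (coef k d x) (basis_vec (tl_part d))" for d
  \<comment> \<open>The contribution of the single diagram \<open>d\<close> to the entry at
    (\<open>C\<close>, \<open>B\<close>).\<close>
  define b where "b d C B = (if top_set d = C \<and> bot_set d = B then a d else 0)" for d C B
  have aT: "a d \<in> carrier ?T" if "d \<in> balanced_n k n" for d
    unfolding a_def TL_simps(1) by (intro fscale_free basis_vec_free balanced_n_place(3)[OF that])
  have bT: "b d C B \<in> carrier ?T" if "d \<in> balanced_n k n" for d C B
    unfolding b_def using aT[OF that] N.R.zero_closed by (simp add: TL_simps(2))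
  define op where "op d = tensor_op ?S ?T N (E_op (top_set d) (bot_set d)) (a d) w" for d
  have pure: "(\<lambda>B. pure_tensor ?S ?T N (E_op (top_set d) (bot_set d) (basis_vec B)) (a d \<odot>\<^bsub>N\<^esub> w B)) \<in> ?S \<rightarrow> tensor_carrier ?S N"
    if "d \<in> balanced_n k n" for d
    using aT[OF that] wN by (intro Pi_I pure_tensor_closed[OF N]) auto
  have op_closed: "op d \<in> tensor_carrier ?S N" if "d \<in> balanced_n k n" for d
    unfolding op_def tensor_op_def by (rule tensor_finsum_closed[OF N pure[OF that]])
  have op_C: "op d C = finsum N (\<lambda>B. b d C B \<odot>\<^bsub>N\<^esub> w B) ?S" if d: "d \<in> balanced_n k n" and C: "C \<in> ?S" for d C
  proof -
    have "op d C = finsum N (\<lambda>B. pure_tensor ?S ?T N (E_op (top_set d) (bot_set d) (basis_vec B)) (a d \<odot>\<^bsub>N\<^esub> w B) C) ?S"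
      unfolding op_def tensor_op_def by (rule tensor_finsum[OF N finite_subsets_n C pure[OF d]])
    also have "\<dots> = finsum N (\<lambda>B. b d C B \<odot>\<^bsub>N\<^esub> w B) ?S"
    proof (rule N.M.finsum_cong'[OF refl])
      show "(\<lambda>B. b d C B \<odot>\<^bsub>N\<^esub> w B) \<in> ?S \<rightarrow> carrier N" using bT[OF d] wN by auto
      fix B assume B: "B \<in> ?S"
      have "fscale (E_op (top_set d) (bot_set d) (basis_vec B) C) (a d) = b d C B"
        by (auto simp: E_op_def basis_vec_def fscale_def b_def)
      then show "pure_tensor ?S ?T N (E_op (top_set d) (bot_set d) (basis_vec B)) (a d \<odot>\<^bsub>N\<^esub> w B) C = b d C B \<odot>\<^bsub>N\<^esub> w B"
        using C kscale_act(1)[OF N aT[OF d] wN[OF B]] by (simp add: pure_tensor_def)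
    qed
    finally show ?thesis .
  qed
  \<comment> \<open>Given \<open>C\<close>, \<open>B\<close> and a planar \<open>t\<close>, exactly
    one diagram has these data, namely \<open>place k C B t\<close>.\<close>
  have sum_b: "(\<Sum>d\<in>balanced_n k n. b d C B) = entry k C B x" if C: "C \<in> ?S" and B: "B \<in> ?S" for C B
  proof
    fix t
    have "(\<Sum>d\<in>balanced_n k n. b d C B) t = (\<Sum>d\<in>balanced_n k n. if top_set d = C \<and> bot_set d = B \<and> tl_part d = t then coef k d x else 0)"
      unfolding sum_fun_apply by (intro sum.cong refl) (auto simp: b_def a_def fscale_def basis_vec_def)
    also have "\<dots> = entry k C B x t"
    proof (cases "t \<in> tl_diagrams n")
      case True
      then have t: "t \<in> perfect n" by (simp add: tl_diagrams_perfect)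
      have pl: "place k C B t \<in> balanced_n k n" using place_balanced_n[OF C B t] True by simp
      have "(\<Sum>d\<in>balanced_n k n. if top_set d = C \<and> bot_set d = B \<and> tl_part d = t then coef k d x else 0)
          = (\<Sum>d\<in>balanced_n k n. if d = place k C B t then coef k d x else 0)"
      proof (intro sum.cong refl)
        fix d assume "d \<in> balanced_n k n"
        then have "top_set d = C \<and> bot_set d = B \<and> tl_part d = t \<longleftrightarrow> d = place k C B t"
          using balanced_n_place(4) place_top_bot[OF C B t] tl_part_place[OF C B t] by metis
        then show "(if top_set d = C \<and> bot_set d = B \<and> tl_part d = t then coef k d x else 0) = (if d = place k C B t then coef k d x else 0)"
          by simp
      qed
      then show ?thesis using fin pl True subsets_nD(2)[OF C] by (simp add: entry_def)
    next
      case False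
      then have "(\<Sum>d\<in>balanced_n k n. if top_set d = C \<and> bot_set d = B \<and> tl_part d = t then coef k d x else 0) = 0"
        using balanced_n_place(3) by (intro sum.neutral) auto
      then show ?thesis using False subsets_nD(2)[OF C] by (simp add: entry_def)
    qed
    finally show "(\<Sum>d\<in>balanced_n k n. b d C B) t = entry k C B x t" .
  qed
  interpret TG: abelian_group "tensor_group ?S N" by (rule tensor_group_abelian[OF N])
  have smult_eq: "x \<odot>\<^bsub>Q_tensor k \<delta> n N\<^esub> w = finsum (tensor_group ?S N) op (balanced_n k n)"
  proof -
    have "x \<odot>\<^bsub>Q_tensor k \<delta> n N\<^esub> w = finsum (tensor_group ?S N) (\<lambda>d. tensor_op ?S ?T N (E_op (top_set d) (bot_set d))
         (fscale (fvs.representation (bar ` balanced_n k n) x (bar d)) (basis_vec (tl_part d))) w) (balanced_n k n)"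
      by (simp add: Q_tensor_def ring.defs)
    also have "\<dots> = finsum (tensor_group ?S N) op (balanced_n k n)"
    proof (rule TG.finsum_cong'[OF refl])
      show "op \<in> balanced_n k n \<rightarrow> carrier (tensor_group ?S N)" using op_closed by (auto simp: tensor_group_def)
      fix d assume "d \<in> balanced_n k n"
      then show "tensor_op ?S ?T N (E_op (top_set d) (bot_set d))
         (fscale (fvs.representation (bar ` balanced_n k n) x (bar d)) (basis_vec (tl_part d))) w = op d"
        unfolding op_def a_def by (simp only: representation_bar[OF fin pb xs])
    qed
    finally show ?thesis .
  qed
  show ?thesis
  proof (rule PiE_ext[of _ ?S "\<lambda>_. carrier N"])
    show "x \<odot>\<^bsub>Q_tensor k \<delta> n N\<^esub> w \<in> ?S \<rightarrow>\<^sub>E carrier N"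
      unfolding smult_eq tensor_carrier_def[symmetric] by (rule tensor_finsum_closed[OF N]) (use op_closed in auto)
    have entT: "entry k C B x \<in> carrier ?T" if "C \<in> ?S" for C B
      using entry_closed[of k C B x] subsets_nD(2)[OF that] by (simp add: TL_simps)
    then show "(\<lambda>C\<in>?S. finsum N (\<lambda>B. entry k C B x \<odot>\<^bsub>N\<^esub> w B) ?S) \<in> ?S \<rightarrow>\<^sub>E carrier N"
      using wN by (intro restrict_PiE_iff[THEN iffD2] ballI N.M.finsum_closed) auto
    fix C assume C: "C \<in> ?S"
    have "(x \<odot>\<^bsub>Q_tensor k \<delta> n N\<^esub> w) C = finsum N (\<lambda>d. op d C) (balanced_n k n)"
      unfolding smult_eq by (rule tensor_finsum[OF N fin C]) (use op_closed in auto)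
    also have "\<dots> = finsum N (\<lambda>d. finsum N (\<lambda>B. b d C B \<odot>\<^bsub>N\<^esub> w B) ?S) (balanced_n k n)"
      by (rule N.M.finsum_cong'[OF refl _ op_C[OF _ C]]) (use bT wN in \<open>auto intro!: N.M.finsum_closed\<close>)
    also have "\<dots> = finsum N (\<lambda>B. finsum N (\<lambda>d. b d C B \<odot>\<^bsub>N\<^esub> w B) (balanced_n k n)) ?S"
      by (rule N.M.finsum_swap[OF fin finite_subsets_n]) (use bT wN in auto)
    also have "\<dots> = finsum N (\<lambda>B. entry k C B x \<odot>\<^bsub>N\<^esub> w B) ?S"
    proof (rule N.M.finsum_cong'[OF refl])
      show "(\<lambda>B. entry k C B x \<odot>\<^bsub>N\<^esub> w B) \<in> ?S \<rightarrow> carrier N" using entT[OF C] wN by auto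
      fix B assume B: "B \<in> ?S"
      show "finsum N (\<lambda>d. b d C B \<odot>\<^bsub>N\<^esub> w B) (balanced_n k n) = entry k C B x \<odot>\<^bsub>N\<^esub> w B"
        using sum_smult[OF N TL_simps(3,2) fin bT wN[OF B], of "\<lambda>d. d" "\<lambda>_. C" "\<lambda>_. B"] unfolding sum_b[OF C B] by simp
    qed
    finally show "(x \<odot>\<^bsub>Q_tensor k \<delta> n N\<^esub> w) C = (\<lambda>C\<in>?S. finsum N (\<lambda>B. entry k C B x \<odot>\<^bsub>N\<^esub> w B) ?S) C"
      using C by simp
  qed
qed

section \<open>Modules over \<open>X(n)\<close> and over the Temperley-Lieb algebra\<close>

context
  fixes k n :: nat and \<delta> :: "'k::field"
  assumes nk: "n \<le> k" and ringX: "ring (X_alg k \<delta> n)"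
begin

interpretation X: ring "X_alg k \<delta> n" by (rule ringX)

lemma ringT: "ring (TL n (\<delta> - 1))"
  using ringX by (simp add: ring_X_alg_iff[OF nk])

interpretation T: ring "TL n (\<delta> - 1)" by (rule ringT)

lemma card_S: "A \<in> subsets_n k n \<Longrightarrow> card A = n"
  by (rule subsets_nD(2))

lemma entry_in_TL: "A \<in> subsets_n k n \<Longrightarrow> entry k A B x \<in> carrier (TL n (\<delta> - 1))"
  using entry_closed[of k A B x] card_S by (simp add: TL_simps)

lemma embed_in_X:
  "A \<in> subsets_n k n \<Longrightarrow> B \<in> subsets_n k n \<Longrightarrow> f \<in> carrier (TL n (\<delta> - 1)) \<Longrightarrow> embed k A B f \<in> carrier (X_alg k \<delta> n)"
  unfolding X_alg_simps by (rule embed_block[OF subsets_n_index]) (simp_all add: card_S TL_simps)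

lemma unit_in_X: "A \<in> subsets_n k n \<Longrightarrow> B \<in> subsets_n k n \<Longrightarrow> matrix_unit k A B \<in> carrier (X_alg k \<delta> n)"
  unfolding X_alg_simps by (rule matrix_unit_closed[OF subsets_n_index]) (simp_all add: card_S)

lemma X_embed_mult:
  assumes "A \<in> subsets_n k n" "B \<in> subsets_n k n" "C \<in> subsets_n k n" "D \<in> subsets_n k n"
    "f \<in> carrier (TL n (\<delta> - 1))" "g \<in> carrier (TL n (\<delta> - 1))"
  shows "embed k A B f \<otimes>\<^bsub>X_alg k \<delta> n\<^esub> embed k C D g = (if B = C then embed k A D (f \<otimes>\<^bsub>TL n (\<delta> - 1)\<^esub> g) else 0)"
  unfolding X_alg_simps by (rule embed_mult[OF assms(1-4) assms(5,6)[unfolded TL_simps(1)]])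

lemma X_unit_mult:
  assumes "A \<in> subsets_n k n" "B \<in> subsets_n k n" "C \<in> subsets_n k n" "D \<in> subsets_n k n"
    "f \<in> carrier (TL n (\<delta> - 1))"
  shows "matrix_unit k A B \<otimes>\<^bsub>X_alg k \<delta> n\<^esub> embed k C D f = (if B = C then embed k A D f else 0)"
  unfolding X_alg_simps using assms
  by (intro matrix_unit_mult(1)[OF subsets_n_index]) (simp_all add: card_S TL_simps)

lemma matrix_unit_embed: "A \<in> subsets_n k n \<Longrightarrow> matrix_unit k A B = embed k A B \<one>\<^bsub>TL n (\<delta> - 1)\<^esub>"
  by (simp add: matrix_unit_def card_S TL_one)

lemma X_unit_unit:
  assumes "A \<in> subsets_n k n" "B \<in> subsets_n k n" "C \<in> subsets_n k n" "D \<in> subsets_n k n"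
  shows "matrix_unit k A B \<otimes>\<^bsub>X_alg k \<delta> n\<^esub> matrix_unit k C D = (if B = C then matrix_unit k A D else (0 :: diagram \<Rightarrow> 'k))"
  using X_unit_mult[OF assms T.one_closed] by (simp add: matrix_unit_embed assms)

lemma X_corner:
  assumes "A \<in> subsets_n k n" "B \<in> subsets_n k n" "C \<in> subsets_n k n" "D \<in> subsets_n k n" "x \<in> carrier (X_alg k \<delta> n)"
  shows "matrix_unit k A C \<otimes>\<^bsub>X_alg k \<delta> n\<^esub> (x \<otimes>\<^bsub>X_alg k \<delta> n\<^esub> matrix_unit k D B) = embed k A B (entry k C D x)"
  using block_corner[OF subsets_n_index assms(5)[unfolded X_alg_simps] assms(1,3,4,2), of \<delta>] assms
  by (simp add: card_S X_alg_simps)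

text \<open>The product shifts column \<open>B\<close> of \<open>x\<close> to column
  \<open>D\<close>; inserting the identity on the left splits it into rows.\<close>

lemma X_mult_unit:
  assumes "B \<in> subsets_n k n" "D \<in> subsets_n k n" "x \<in> carrier (X_alg k \<delta> n)"
  shows "x \<otimes>\<^bsub>X_alg k \<delta> n\<^esub> matrix_unit k B D = (\<Sum>C\<in>subsets_n k n. embed k C D (entry k C B x))"
proof -
  let ?y = "x \<otimes>\<^bsub>X_alg k \<delta> n\<^esub> matrix_unit k B D"
  have "?y \<in> carrier (X_alg k \<delta> n)" using assms unit_in_X by simp
  then have "?y = (\<Sum>C\<in>subsets_n k n. matrix_unit k C C) \<otimes>\<^bsub>X_alg k \<delta> n\<^esub> ?y"
    using X.l_one[of ?y] unfolding X_alg_simps(5) by simp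
  also have "\<dots> = (\<Sum>C\<in>subsets_n k n. matrix_unit k C C \<otimes>\<^bsub>X_alg k \<delta> n\<^esub> ?y)"
    unfolding X_alg_simps(2) motzkin_mult_sum ..
  also have "\<dots> = (\<Sum>C\<in>subsets_n k n. embed k C D (entry k C B x))"
    using assms by (intro sum.cong refl X_corner) auto
  finally show ?thesis .
qed

text \<open>The rule for products of matrices. Right multiplication by the unit at
  (\<open>D\<close>, \<open>D\<close>) isolates column \<open>D\<close>, where
  \<open>X_mult_unit\<close> and the associativity of \<open>X(n)\<close> expand both
  factors.\<close>

lemma entry_mult:
  assumes "A \<in> subsets_n k n" "D \<in> subsets_n k n" "x \<in> carrier (X_alg k \<delta> n)" "y \<in> carrier (X_alg k \<delta> n)"
  shows "entry k A D (x \<otimes>\<^bsub>X_alg k \<delta> n\<^esub> y) = (\<Sum>B\<in>subsets_n k n. entry k A B x \<otimes>\<^bsub>TL n (\<delta> - 1)\<^esub> entry k B D y)"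
proof -
  let ?S = "subsets_n k n"
  have entD: "entry k A D (\<Sum>C\<in>?S. embed k C D (g C)) = g A" if "\<And>C. C \<in> ?S \<Longrightarrow> g C \<in> carrier (TL n (\<delta> - 1))" for g
  proof -
    have "entry k A D (\<Sum>C\<in>?S. embed k C D (g C)) = (\<Sum>C\<in>?S. if A = C then g C else 0)"
      unfolding entry_sum
    proof (intro sum.cong refl)
      fix C assume C: "C \<in> ?S"
      show "entry k A D (embed k C D (g C)) = (if A = C then g C else 0)"
        using entry_embed[OF C assms(2) assms(1,2) that[OF C, unfolded TL_simps(1)]] by simp
    qed
    then show ?thesis using assms(1) by (simp only: sum.delta' finite_subsets_n if_True)
  qed
  have entE: "entry k A D z = entry k A D (z \<otimes>\<^bsub>X_alg k \<delta> n\<^esub> matrix_unit k D D)" if "z \<in> carrier (X_alg k \<delta> n)" for z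
    unfolding X_mult_unit[OF assms(2,2) that] using entD[of "\<lambda>C. entry k C D z"] entry_in_TL by simp
  have "x \<otimes>\<^bsub>X_alg k \<delta> n\<^esub> y \<otimes>\<^bsub>X_alg k \<delta> n\<^esub> matrix_unit k D D = x \<otimes>\<^bsub>X_alg k \<delta> n\<^esub> (\<Sum>B\<in>?S. embed k B D (entry k B D y))"
    using X.m_assoc[OF assms(3,4) unit_in_X[OF assms(2,2)]] X_mult_unit[OF assms(2,2,4)] by simp
  also have "\<dots> = (\<Sum>B\<in>?S. x \<otimes>\<^bsub>X_alg k \<delta> n\<^esub> (matrix_unit k B B \<otimes>\<^bsub>X_alg k \<delta> n\<^esub> embed k B D (entry k B D y)))"
    unfolding X_alg_simps(2) motzkin_mult_sum unfolding X_alg_simps(2)[symmetric, of k \<delta> n]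
    using assms(2) by (intro sum.cong refl) (simp add: X_unit_mult entry_in_TL)
  also have "\<dots> = (\<Sum>B\<in>?S. \<Sum>C\<in>?S. embed k C D (entry k C B x \<otimes>\<^bsub>TL n (\<delta> - 1)\<^esub> entry k B D y))"
  proof (intro sum.cong refl)
    fix B assume B: "B \<in> ?S"
    have "x \<otimes>\<^bsub>X_alg k \<delta> n\<^esub> (matrix_unit k B B \<otimes>\<^bsub>X_alg k \<delta> n\<^esub> embed k B D (entry k B D y))
        = (\<Sum>C\<in>?S. embed k C B (entry k C B x)) \<otimes>\<^bsub>X_alg k \<delta> n\<^esub> embed k B D (entry k B D y)"
      using X.m_assoc[OF assms(3) unit_in_X[OF B B] embed_in_X[OF B assms(2) entry_in_TL[OF B]], of D y]
        X_mult_unit[OF B B assms(3)] by simp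
    also have "\<dots> = (\<Sum>C\<in>?S. embed k C B (entry k C B x) \<otimes>\<^bsub>X_alg k \<delta> n\<^esub> embed k B D (entry k B D y))"
      unfolding X_alg_simps(2) motzkin_mult_sum ..
    also have "\<dots> = (\<Sum>C\<in>?S. embed k C D (entry k C B x \<otimes>\<^bsub>TL n (\<delta> - 1)\<^esub> entry k B D y))"
      using B assms(2) by (intro sum.cong refl) (simp add: X_embed_mult entry_in_TL)
    finally show "x \<otimes>\<^bsub>X_alg k \<delta> n\<^esub> (matrix_unit k B B \<otimes>\<^bsub>X_alg k \<delta> n\<^esub> embed k B D (entry k B D y))
        = (\<Sum>C\<in>?S. embed k C D (entry k C B x \<otimes>\<^bsub>TL n (\<delta> - 1)\<^esub> entry k B D y))" .
  qed
  finally have "x \<otimes>\<^bsub>X_alg k \<delta> n\<^esub> y \<otimes>\<^bsub>X_alg k \<delta> n\<^esub> matrix_unit k D D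
      = (\<Sum>B\<in>?S. \<Sum>C\<in>?S. embed k C D (entry k C B x \<otimes>\<^bsub>TL n (\<delta> - 1)\<^esub> entry k B D y))" .
  then have "entry k A D (x \<otimes>\<^bsub>X_alg k \<delta> n\<^esub> y)
      = (\<Sum>B\<in>?S. entry k A D (\<Sum>C\<in>?S. embed k C D (entry k C B x \<otimes>\<^bsub>TL n (\<delta> - 1)\<^esub> entry k B D y)))"
    unfolding entE[OF X.m_closed[OF assms(3,4)]] by (simp only: entry_sum)
  also have "\<dots> = (\<Sum>B\<in>?S. entry k A B x \<otimes>\<^bsub>TL n (\<delta> - 1)\<^esub> entry k B D y)"
    by (intro sum.cong refl entD T.m_closed entry_in_TL)
  finally show ?thesis .
qed

lemma entry_one:
  assumes "A \<in> subsets_n k n" "B \<in> subsets_n k n"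
  shows "entry k A B \<one>\<^bsub>X_alg k \<delta> n\<^esub> = (if A = B then \<one>\<^bsub>TL n (\<delta> - 1)\<^esub> else 0)"
proof -
  have "entry k A B \<one>\<^bsub>X_alg k \<delta> n\<^esub> = (\<Sum>C\<in>subsets_n k n. if A = C then (if A = B then \<one>\<^bsub>TL n (\<delta> - 1)\<^esub> else 0) else 0)"
    unfolding X_alg_simps(5) entry_sum
  proof (intro sum.cong refl)
    fix C assume C: "C \<in> subsets_n k n"
    show "entry k A B (matrix_unit k C C) = (if A = C then (if A = B then \<one>\<^bsub>TL n (\<delta> - 1)\<^esub> else 0) else 0)"
      unfolding matrix_unit_embed[OF C] using entry_embed[OF C C assms TL_one_closed, of "\<delta> - 1"] by auto
  qed
  then show ?thesis using assms(1) by (simp only: sum.delta' finite_subsets_n if_True)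
qed

text \<open>Matrices act on column vectors over \<open>N\<close>: the axioms follow from those of
  \<open>N\<close> together with \<open>entry_mult\<close>, \<open>entry_one\<close> and the
  additivity of \<open>entry\<close>.\<close>

lemma Q_tensor_module:
  fixes N :: "(diagram \<Rightarrow> 'k, 'm) module"
  assumes N: "left_module (TL n (\<delta> - 1)) N"
  shows "left_module (X_alg k \<delta> n) (Q_tensor k \<delta> n N)"
proof -
  let ?S = "subsets_n k n" and ?X = "X_alg k \<delta> n" and ?Q = "Q_tensor k \<delta> n N"
  interpret N: left_module "TL n (\<delta> - 1)" N by (rule N)
  have ab: "abelian_group ?Q"
  proof -
    interpret TG: abelian_group "tensor_group ?S N" by (rule tensor_group_abelian[OF N])
    have eq: "carrier ?Q = carrier (tensor_group ?S N)" "add ?Q = add (tensor_group ?S N)" "zero ?Q = zero (tensor_group ?S N)"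
      by (simp_all add: Q_tensor_simps tensor_group_def tensor_carrier_def)
    show ?thesis
    proof (rule abelian_groupI)
      fix w assume "w \<in> carrier ?Q"
      then have "w \<in> carrier (tensor_group ?S N)" by (simp only: eq)
      then show "\<exists>w'\<in>carrier ?Q. w' \<oplus>\<^bsub>?Q\<^esub> w = \<zero>\<^bsub>?Q\<^esub>"
        unfolding eq using TG.l_neg by (intro bexI[OF _ TG.a_inv_closed])
    qed (simp_all only: eq TG.a_closed TG.zero_closed TG.a_ac TG.l_zero TG.r_zero)
  qed
  have wN: "w B \<in> carrier N" if "w \<in> carrier ?Q" "B \<in> ?S" for w B using that by (auto simp: Q_tensor_simps)
  have tc: "(\<lambda>B. entry k C B x \<odot>\<^bsub>N\<^esub> w B) \<in> ?S \<rightarrow> carrier N" if "C \<in> ?S" "w \<in> carrier ?Q" for C w x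
    using entry_in_TL[OF that(1)] wN[OF that(2)] by auto
  have closed: "x \<odot>\<^bsub>?Q\<^esub> w \<in> carrier ?Q" if "x \<in> carrier ?X" "w \<in> carrier ?Q" for x w
    unfolding Q_smult[OF N that] unfolding Q_tensor_simps(1)
    using tc that(2) by (intro restrict_PiE_iff[THEN iffD2] ballI N.M.finsum_closed) auto
  show ?thesis
  proof (intro left_module.intro left_module_axioms.intro ringX ab)
    show "x \<odot>\<^bsub>?Q\<^esub> w \<in> carrier ?Q" if "x \<in> carrier ?X" "w \<in> carrier ?Q" for x w by (rule closed[OF that])
    show "(x \<oplus>\<^bsub>?X\<^esub> y) \<odot>\<^bsub>?Q\<^esub> w = x \<odot>\<^bsub>?Q\<^esub> w \<oplus>\<^bsub>?Q\<^esub> y \<odot>\<^bsub>?Q\<^esub> w"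
      if x: "x \<in> carrier ?X" and y: "y \<in> carrier ?X" and w: "w \<in> carrier ?Q" for x y w
      unfolding Q_smult[OF N x w] Q_smult[OF N y w] Q_smult[OF N X.a_closed[OF x y] w] unfolding Q_tensor_simps(3)
    proof (rule restrict_ext)
      fix C assume C: "C \<in> ?S"
      have "finsum N (\<lambda>B. entry k C B (x \<oplus>\<^bsub>?X\<^esub> y) \<odot>\<^bsub>N\<^esub> w B) ?S
          = finsum N (\<lambda>B. entry k C B x \<odot>\<^bsub>N\<^esub> w B \<oplus>\<^bsub>N\<^esub> entry k C B y \<odot>\<^bsub>N\<^esub> w B) ?S"
        unfolding X_alg_simps(3) entry_linear
        using N.smult_l_distr[OF entry_in_TL[OF C] entry_in_TL[OF C] wN[OF w]] tc[OF C w]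
        by (intro N.M.finsum_cong') (auto simp: TL_simps(3) Pi_iff)
      then show "finsum N (\<lambda>B. entry k C B (x \<oplus>\<^bsub>?X\<^esub> y) \<odot>\<^bsub>N\<^esub> w B) ?S
        = (\<lambda>C\<in>?S. finsum N (\<lambda>B. entry k C B x \<odot>\<^bsub>N\<^esub> w B) ?S) C \<oplus>\<^bsub>N\<^esub> (\<lambda>C\<in>?S. finsum N (\<lambda>B. entry k C B y \<odot>\<^bsub>N\<^esub> w B) ?S) C"
        using N.M.finsum_addf[OF tc[OF C w] tc[OF C w]] C by simp
    qed
    show "x \<odot>\<^bsub>?Q\<^esub> (w \<oplus>\<^bsub>?Q\<^esub> w') = x \<odot>\<^bsub>?Q\<^esub> w \<oplus>\<^bsub>?Q\<^esub> x \<odot>\<^bsub>?Q\<^esub> w'"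
      if x: "x \<in> carrier ?X" and w: "w \<in> carrier ?Q" and w': "w' \<in> carrier ?Q" for x w w'
      unfolding Q_smult[OF N x w] Q_smult[OF N x w'] Q_smult[OF N x abelian_groupE(1)[OF ab w w']] unfolding Q_tensor_simps(3)
    proof (rule restrict_ext)
      fix C assume C: "C \<in> ?S"
      have "finsum N (\<lambda>B. entry k C B x \<odot>\<^bsub>N\<^esub> (\<lambda>C\<in>?S. w C \<oplus>\<^bsub>N\<^esub> w' C) B) ?S
          = finsum N (\<lambda>B. entry k C B x \<odot>\<^bsub>N\<^esub> w B \<oplus>\<^bsub>N\<^esub> entry k C B x \<odot>\<^bsub>N\<^esub> w' B) ?S"
        using N.smult_r_distr[OF entry_in_TL[OF C] wN[OF w] wN[OF w']] tc[OF C w] tc[OF C w']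
        by (intro N.M.finsum_cong') (auto simp: Pi_iff)
      then show "finsum N (\<lambda>B. entry k C B x \<odot>\<^bsub>N\<^esub> (\<lambda>C\<in>?S. w C \<oplus>\<^bsub>N\<^esub> w' C) B) ?S
        = (\<lambda>C\<in>?S. finsum N (\<lambda>B. entry k C B x \<odot>\<^bsub>N\<^esub> w B) ?S) C \<oplus>\<^bsub>N\<^esub> (\<lambda>C\<in>?S. finsum N (\<lambda>B. entry k C B x \<odot>\<^bsub>N\<^esub> w' B) ?S) C"
        using N.M.finsum_addf[OF tc[OF C w] tc[OF C w']] C by simp
    qed
    show "(x \<otimes>\<^bsub>?X\<^esub> y) \<odot>\<^bsub>?Q\<^esub> w = x \<odot>\<^bsub>?Q\<^esub> (y \<odot>\<^bsub>?Q\<^esub> w)"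
      if x: "x \<in> carrier ?X" and y: "y \<in> carrier ?X" and w: "w \<in> carrier ?Q" for x y w
      unfolding Q_smult[OF N x closed[OF y w]] Q_smult[OF N X.m_closed[OF x y] w]
    proof (rule restrict_ext)
      fix C assume C: "C \<in> ?S"
      let ?f = "\<lambda>D B. entry k C B x \<odot>\<^bsub>N\<^esub> (entry k B D y \<odot>\<^bsub>N\<^esub> w D)"
      have f: "?f D B \<in> carrier N" if "D \<in> ?S" "B \<in> ?S" for D B
        using entry_in_TL that wN[OF w] C by simp
      have "finsum N (\<lambda>D. entry k C D (x \<otimes>\<^bsub>?X\<^esub> y) \<odot>\<^bsub>N\<^esub> w D) ?S = finsum N (\<lambda>D. finsum N (?f D) ?S) ?S"
      proof (rule N.M.finsum_cong'[OF refl])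
        show "(\<lambda>D. finsum N (?f D) ?S) \<in> ?S \<rightarrow> carrier N" using f by (intro Pi_I N.M.finsum_closed) auto
        fix D assume D: "D \<in> ?S"
        have "entry k C D (x \<otimes>\<^bsub>?X\<^esub> y) \<odot>\<^bsub>N\<^esub> w D
            = finsum N (\<lambda>B. (entry k C B x \<otimes>\<^bsub>TL n (\<delta> - 1)\<^esub> entry k B D y) \<odot>\<^bsub>N\<^esub> w D) ?S"
          unfolding entry_mult[OF C D x y]
          by (rule conjunct2[OF sum_smult[OF N TL_simps(3,2) finite_subsets_n _ wN[OF w D]]])
             (use entry_in_TL C in simp)
        also have "\<dots> = finsum N (?f D) ?S"
          using f[OF D] N.smult_assoc1[OF entry_in_TL[OF C] entry_in_TL wN[OF w D]] by (intro N.M.finsum_cong') auto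
        finally show "entry k C D (x \<otimes>\<^bsub>?X\<^esub> y) \<odot>\<^bsub>N\<^esub> w D = finsum N (?f D) ?S" .
      qed
      also have "\<dots> = finsum N (\<lambda>B. finsum N (\<lambda>D. ?f D B) ?S) ?S"
        by (rule N.M.finsum_swap[OF finite_subsets_n finite_subsets_n f])
      also have "\<dots> = finsum N (\<lambda>B. entry k C B x \<odot>\<^bsub>N\<^esub> (y \<odot>\<^bsub>?Q\<^esub> w) B) ?S"
      proof (rule N.M.finsum_cong'[OF refl])
        show "(\<lambda>B. entry k C B x \<odot>\<^bsub>N\<^esub> (y \<odot>\<^bsub>?Q\<^esub> w) B) \<in> ?S \<rightarrow> carrier N" by (rule tc[OF C closed[OF y w]])
        fix B assume B: "B \<in> ?S"
        show "finsum N (\<lambda>D. ?f D B) ?S = entry k C B x \<odot>\<^bsub>N\<^esub> (y \<odot>\<^bsub>?Q\<^esub> w) B"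
          unfolding Q_smult[OF N y w] using N.smult_finsum[OF finite_subsets_n entry_in_TL[OF C] tc[OF B w]] B by simp
      qed
      finally show "finsum N (\<lambda>B. entry k C B (x \<otimes>\<^bsub>?X\<^esub> y) \<odot>\<^bsub>N\<^esub> w B) ?S
          = finsum N (\<lambda>B. entry k C B x \<odot>\<^bsub>N\<^esub> (y \<odot>\<^bsub>?Q\<^esub> w) B) ?S" .
    qed
    show "\<one>\<^bsub>?X\<^esub> \<odot>\<^bsub>?Q\<^esub> w = w" if w: "w \<in> carrier ?Q" for w
      unfolding Q_smult[OF N X.one_closed w]
    proof (rule PiE_ext[of _ ?S "\<lambda>_. carrier N"])
      show "w \<in> ?S \<rightarrow>\<^sub>E carrier N" using w by (simp add: Q_tensor_simps)
      show "(\<lambda>C\<in>?S. finsum N (\<lambda>B. entry k C B \<one>\<^bsub>?X\<^esub> \<odot>\<^bsub>N\<^esub> w B) ?S) \<in> ?S \<rightarrow>\<^sub>E carrier N"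
        using closed[OF X.one_closed w] unfolding Q_smult[OF N X.one_closed w] by (simp add: Q_tensor_simps)
      fix C assume C: "C \<in> ?S"
      have "finsum N (\<lambda>B. entry k C B \<one>\<^bsub>?X\<^esub> \<odot>\<^bsub>N\<^esub> w B) ?S = finsum N (\<lambda>B. if B = C then w C else \<zero>\<^bsub>N\<^esub>) ?S"
        using wN[OF w] C N.smult_l_null by (intro N.M.finsum_cong') (auto simp: entry_one TL_simps(2))
      then show "(\<lambda>C\<in>?S. finsum N (\<lambda>B. entry k C B \<one>\<^bsub>?X\<^esub> \<odot>\<^bsub>N\<^esub> w B) ?S) C = w C"
        using N.M.finsum_delta[OF finite_subsets_n C wN[OF w C]] C by simp
    qed
  qed
qed

text \<open>A single nonzero coordinate of an element of \<open>H\<close> can be moved to any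
  position by \<open>embed\<close> and then acted on by \<open>TL\<close>. Simplicity of
  \<open>N\<close> thus puts all pure tensors into \<open>H\<close>, and these add up to
  everything.\<close>

lemma simple_Q_tensor:
  fixes N :: "(diagram \<Rightarrow> 'k, 'm) module"
  assumes simple: "simple_module (TL n (\<delta> - 1)) N"
  shows "simple_module (X_alg k \<delta> n) (Q_tensor k \<delta> n N)"
proof -
  let ?S = "subsets_n k n" and ?X = "X_alg k \<delta> n" and ?Q = "Q_tensor k \<delta> n N"
  have N: "left_module (TL n (\<delta> - 1)) N" and nz: "carrier N \<noteq> {\<zero>\<^bsub>N\<^esub>}"
    and irr: "\<And>H. submodule H (TL n (\<delta> - 1)) N \<Longrightarrow> H = {\<zero>\<^bsub>N\<^esub>} \<or> H = carrier N"
    using simple by (auto simp: simple_module_def)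
  interpret N: left_module "TL n (\<delta> - 1)" N by (rule N)
  interpret Q: left_module ?X ?Q by (rule Q_tensor_module[OF N])
  \<comment> \<open>The pure tensor of the basis vector at \<open>D\<close> with
    \<open>v\<close>.\<close>
  define pure where "pure D v = (\<lambda>C\<in>?S. if C = D then v else \<zero>\<^bsub>N\<^esub>)" for D v
  have pure_closed: "pure D v \<in> carrier ?Q" if "v \<in> carrier N" for D v
    using that by (auto simp: pure_def Q_tensor_simps)
  have wN: "w B \<in> carrier N" if "w \<in> carrier ?Q" "B \<in> ?S" for w B using that by (auto simp: Q_tensor_simps)
  have act: "embed k D C r \<odot>\<^bsub>?Q\<^esub> w = pure D (r \<odot>\<^bsub>N\<^esub> w C)"
    if D: "D \<in> ?S" and C: "C \<in> ?S" and r: "r \<in> carrier (TL n (\<delta> - 1))" and w: "w \<in> carrier ?Q" for D C r w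
    unfolding Q_smult[OF N embed_in_X[OF D C r] w] pure_def
  proof (rule restrict_ext)
    fix C' assume C': "C' \<in> ?S"
    have e: "entry k C' B (embed k D C r) = (if C' = D \<and> B = C then r else 0)" if "B \<in> ?S" for B
      by (rule entry_embed[OF D C C' that r[unfolded TL_simps(1)]])
    have rw: "r \<odot>\<^bsub>N\<^esub> w C \<in> carrier N" using r wN[OF w C] by simp
    have "finsum N (\<lambda>B. entry k C' B (embed k D C r) \<odot>\<^bsub>N\<^esub> w B) ?S
        = finsum N (\<lambda>B. if B = C then (if C' = D then r \<odot>\<^bsub>N\<^esub> w C else \<zero>\<^bsub>N\<^esub>) else \<zero>\<^bsub>N\<^esub>) ?S"
      using rw wN[OF w] N.smult_l_null by (intro N.M.finsum_cong') (auto simp: e TL_simps(2))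
    also have "\<dots> = (if C' = D then r \<odot>\<^bsub>N\<^esub> w C else \<zero>\<^bsub>N\<^esub>)"
      using rw by (intro N.M.finsum_delta[OF finite_subsets_n C]) simp
    finally show "finsum N (\<lambda>B. entry k C' B (embed k D C r) \<odot>\<^bsub>N\<^esub> w B) ?S = (if C' = D then r \<odot>\<^bsub>N\<^esub> w C else \<zero>\<^bsub>N\<^esub>)" .
  qed
  have A0: "{1..n} \<in> ?S" using nk by (simp add: subsets_n_def)
  have "carrier ?Q \<noteq> {\<zero>\<^bsub>?Q\<^esub>}"
  proof
    assume Q0: "carrier ?Q = {\<zero>\<^bsub>?Q\<^esub>}"
    have "v = \<zero>\<^bsub>N\<^esub>" if "v \<in> carrier N" for v
    proof -
      have "pure {1..n} v = \<zero>\<^bsub>?Q\<^esub>" using pure_closed[OF that] Q0 by blast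
      then have "pure {1..n} v {1..n} = \<zero>\<^bsub>?Q\<^esub> {1..n}" by (rule arg_cong)
      then show ?thesis using A0 by (simp only: pure_def Q_tensor_simps(2) restrict_apply' if_True simp_thms)
    qed
    then show False using nz N.M.zero_closed by blast
  qed
  moreover have "H = {\<zero>\<^bsub>?Q\<^esub>} \<or> H = carrier ?Q" if H: "submodule H ?X ?Q" for H
  proof (cases "H = {\<zero>\<^bsub>?Q\<^esub>}")
    case False
    note HD = submoduleD[OF H]
    obtain w where w: "w \<in> H" "w \<noteq> \<zero>\<^bsub>?Q\<^esub>" using False HD(2) by blast
    have wQ: "w \<in> carrier ?Q" using w(1) HD(1) by blast
    have "\<exists>C\<in>?S. w C \<noteq> \<zero>\<^bsub>N\<^esub>"
    proof (rule ccontr)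
      assume "\<not> (\<exists>C\<in>?S. w C \<noteq> \<zero>\<^bsub>N\<^esub>)"
      then have "w = \<zero>\<^bsub>?Q\<^esub>"
        using wQ by (intro PiE_ext[of _ ?S "\<lambda>_. carrier N"]) (auto simp: Q_tensor_simps)
      then show False using w(2) by simp
    qed
    then obtain C0 where C0: "C0 \<in> ?S" "w C0 \<noteq> \<zero>\<^bsub>N\<^esub>" by blast
    \<comment> \<open>All positions are demanded at once, so that \<open>V = carrier N\<close> puts
      every pure tensor into \<open>H\<close>.\<close>
    define V where "V = {v \<in> carrier N. \<forall>D\<in>?S. pure D v \<in> H}"
    have "submodule V (TL n (\<delta> - 1)) N"
    proof (rule N.submodule_intro)
      show "V \<subseteq> carrier N" by (auto simp: V_def)
      have "pure D \<zero>\<^bsub>N\<^esub> = \<zero>\<^bsub>?Q\<^esub>" for D by (simp add: pure_def Q_tensor_simps(2))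
      then show "\<zero>\<^bsub>N\<^esub> \<in> V" using HD(2) by (simp add: V_def)
      fix v v' assume v: "v \<in> V" "v' \<in> V"
      then have vN: "v \<in> carrier N" "v' \<in> carrier N" by (auto simp: V_def)
      have "pure D (v \<oplus>\<^bsub>N\<^esub> v') = pure D v \<oplus>\<^bsub>?Q\<^esub> pure D v'" for D
        using vN by (auto simp: pure_def Q_tensor_simps(3) fun_eq_iff)
      then show "v \<oplus>\<^bsub>N\<^esub> v' \<in> V" using v HD(3) vN by (auto simp: V_def)
    next
      fix r v assume r: "r \<in> carrier (TL n (\<delta> - 1))" and v: "v \<in> V"
      then have vN: "v \<in> carrier N" by (auto simp: V_def)
      have "pure D (r \<odot>\<^bsub>N\<^esub> v) \<in> H" if D: "D \<in> ?S" for D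
      proof -
        have "embed k D D r \<odot>\<^bsub>?Q\<^esub> pure D v \<in> H" using HD(4)[OF embed_in_X[OF D D r]] v D by (auto simp: V_def)
        moreover have "pure D v D = v" using D by (simp add: pure_def)
        ultimately show ?thesis using act[OF D D r pure_closed[OF vN]] by simp
      qed
      then show "r \<odot>\<^bsub>N\<^esub> v \<in> V" using r vN by (simp add: V_def)
    qed
    moreover have "w C0 \<in> V"
    proof -
      have "pure D (w C0) \<in> H" if D: "D \<in> ?S" for D
        using HD(4)[OF embed_in_X[OF D C0(1) T.one_closed] w(1)] act[OF D C0(1) T.one_closed wQ] wN[OF wQ C0(1)] by simp
      then show ?thesis using wN[OF wQ C0(1)] by (simp add: V_def)
    qed
    ultimately have V: "V = carrier N" using irr C0(2) by blast
    have "u \<in> H" if u: "u \<in> carrier ?Q" for u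
    proof -
      \<comment> \<open>Rebuild \<open>u\<close> from its coordinates, one position at a
        time.\<close>
      have "(\<lambda>C\<in>?S. if C \<in> J then u C else \<zero>\<^bsub>N\<^esub>) \<in> H" if "finite J" "J \<subseteq> ?S" for J
        using that
      proof (induction J rule: finite_induct)
        case empty
        show ?case using HD(2) by (simp only: Q_tensor_simps(2) empty_iff if_False)
      next
        case (insert D J)
        have uD: "u D \<in> carrier N" using wN[OF u] insert.prems by simp
        have "(\<lambda>C\<in>?S. if C \<in> insert D J then u C else \<zero>\<^bsub>N\<^esub>)
            = pure D (u D) \<oplus>\<^bsub>?Q\<^esub> (\<lambda>C\<in>?S. if C \<in> J then u C else \<zero>\<^bsub>N\<^esub>)"
          using insert.hyps wN[OF u] by (auto simp: pure_def Q_tensor_simps(3) fun_eq_iff)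
        moreover have "pure D (u D) \<in> H" using uD V insert.prems by (auto simp: V_def)
        moreover have "(\<lambda>C\<in>?S. if C \<in> J then u C else \<zero>\<^bsub>N\<^esub>) \<in> H" using insert.IH insert.prems by blast
        ultimately show ?case by (simp only: HD(3))
      qed
      from this[OF finite_subsets_n subset_refl] have "(\<lambda>C\<in>?S. if C \<in> ?S then u C else \<zero>\<^bsub>N\<^esub>) \<in> H" .
      moreover have "(\<lambda>C\<in>?S. if C \<in> ?S then u C else \<zero>\<^bsub>N\<^esub>) = u"
        using u by (intro PiE_ext[of _ ?S "\<lambda>_. carrier N"]) (auto simp: Q_tensor_simps wN[OF u])
      ultimately show ?thesis by simp
    qed
    then show ?thesis using HD(1) by blast
  qed simp
  ultimately show ?thesis using Q_tensor_module[OF N] unfolding simple_module_def by blast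
qed

text \<open>The inverse of the Morita correspondence: \<open>N\<close> is the part of
  \<open>M\<close> fixed by one diagonal matrix unit, with \<open>TL\<close> acting as the corner of
  \<open>X(n)\<close> there.\<close>

lemma simple_X_module:
  fixes M :: "(diagram \<Rightarrow> 'k, 'm) module"
  assumes simple: "simple_module (X_alg k \<delta> n) M"
  shows "\<exists>N :: (diagram \<Rightarrow> 'k, 'm) module. simple_module (TL n (\<delta> - 1)) N \<and>
      module_iso (X_alg k \<delta> n) (Q_tensor k \<delta> n N) M \<noteq> {}"
proof -
  let ?S = "subsets_n k n" and ?X = "X_alg k \<delta> n" and ?T = "TL n (\<delta> - 1)"
  have M: "left_module ?X M" and nz: "carrier M \<noteq> {\<zero>\<^bsub>M\<^esub>}"
    and irr: "\<And>H. submodule H ?X M \<Longrightarrow> H = {\<zero>\<^bsub>M\<^esub>} \<or> H = carrier M"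
    using simple by (auto simp: simple_module_def)
  interpret M: left_module ?X M by (rule M)
  \<comment> \<open>Any set with \<open>n\<close> elements would serve; the choice fixes which
    corner acts.\<close>
  have "{1..n} \<in> ?S" using nk by (simp add: subsets_n_def)
  then obtain A where A: "A \<in> ?S" by blast
  let ?u = "\<lambda>B C. matrix_unit k B C :: diagram \<Rightarrow> 'k"
  define N :: "(diagram \<Rightarrow> 'k, 'm) module" where
    "N = \<lparr> carrier = {m \<in> carrier M. ?u A A \<odot>\<^bsub>M\<^esub> m = m}, mult = mult M, one = one M, zero = zero M, add = add M,
       smult = (\<lambda>r m. embed k A A r \<odot>\<^bsub>M\<^esub> m) \<rparr>"
  have Ns: "zero N = zero M" "add N = add M" "r \<odot>\<^bsub>N\<^esub> m = embed k A A r \<odot>\<^bsub>M\<^esub> m" for r m by (simp_all add: N_def)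
  have Nc: "m \<in> carrier N \<longleftrightarrow> m \<in> carrier M \<and> ?u A A \<odot>\<^bsub>M\<^esub> m = m" for m by (simp add: N_def)
  have u0: "(0 :: diagram \<Rightarrow> 'k) \<odot>\<^bsub>M\<^esub> m = \<zero>\<^bsub>M\<^esub>" if "m \<in> carrier M" for m
    using M.smult_l_null[OF that] by (simp add: X_alg_simps)
  have uu: "?u B C \<odot>\<^bsub>M\<^esub> (?u C' D \<odot>\<^bsub>M\<^esub> m) = (if C = C' then ?u B D \<odot>\<^bsub>M\<^esub> m else \<zero>\<^bsub>M\<^esub>)"
    if "B \<in> ?S" "C \<in> ?S" "C' \<in> ?S" "D \<in> ?S" "m \<in> carrier M" for B C C' D m
    using M.smult_assoc1[OF unit_in_X[OF that(1,2)] unit_in_X[OF that(3,4)] that(5)] X_unit_unit[OF that(1-4)] u0[OF that(5)]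
    by (cases "C = C'") simp_all
  have ue: "?u B C \<odot>\<^bsub>M\<^esub> (embed k C D r \<odot>\<^bsub>M\<^esub> m) = embed k B D r \<odot>\<^bsub>M\<^esub> m"
    if "B \<in> ?S" "C \<in> ?S" "D \<in> ?S" "r \<in> carrier ?T" "m \<in> carrier M" for B C D r m
    using M.smult_assoc1[OF unit_in_X[OF that(1,2)] embed_in_X[OF that(2,3,4)] that(5)] X_unit_mult[OF that(1,2,2,3,4)] by simp
  have uN: "?u A C \<odot>\<^bsub>M\<^esub> m \<in> carrier N" if "C \<in> ?S" "m \<in> carrier M" for C m
    unfolding Nc using uu[OF A A A that] M.smult_closed[OF unit_in_X[OF A that(1)] that(2)] by simp
  have eN: "embed k A A r \<odot>\<^bsub>M\<^esub> m \<in> carrier N" if "r \<in> carrier ?T" "m \<in> carrier M" for r m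
    unfolding Nc using ue[OF A A A that] M.smult_closed[OF embed_in_X[OF A A that(1)] that(2)] by simp
  have NM: "m \<in> carrier M" if "m \<in> carrier N" for m using that Nc by blast
  have aN: "m \<oplus>\<^bsub>M\<^esub> m' \<in> carrier N" if "m \<in> carrier N" "m' \<in> carrier N" for m m'
    using that M.smult_r_distr[OF unit_in_X[OF A A], of m m'] unfolding Nc by simp
  have zN: "\<zero>\<^bsub>M\<^esub> \<in> carrier N" unfolding Nc using M.smult_r_null[OF unit_in_X[OF A A]] by simp
  have abN: "abelian_group N"
  proof (rule abelian_groupI)
    fix m assume m: "m \<in> carrier N"
    \<comment> \<open>The negative of \<open>m\<close> is written as an action of the corner, so
      that it visibly lies in \<open>N\<close>.\<close>
    let ?m = "embed k A A (\<ominus>\<^bsub>?T\<^esub> \<one>\<^bsub>?T\<^esub>) \<odot>\<^bsub>M\<^esub> m"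
    have e: "embed k A A (\<ominus>\<^bsub>?T\<^esub> \<one>\<^bsub>?T\<^esub>) \<oplus>\<^bsub>?X\<^esub> ?u A A = \<zero>\<^bsub>?X\<^esub>"
    proof -
      have "\<ominus>\<^bsub>?T\<^esub> \<one>\<^bsub>?T\<^esub> + \<one>\<^bsub>?T\<^esub> = 0" using T.l_neg[OF T.one_closed] by (simp only: TL_simps(2,3))
      then show ?thesis unfolding X_alg_simps matrix_unit_embed[OF A] embed_linear(1)[symmetric] by (simp only: embed_linear)
    qed
    have "?m \<oplus>\<^bsub>M\<^esub> ?u A A \<odot>\<^bsub>M\<^esub> m = \<zero>\<^bsub>M\<^esub>"
      using M.smult_l_distr[OF embed_in_X[OF A A] unit_in_X[OF A A] NM[OF m], of "\<ominus>\<^bsub>?T\<^esub> \<one>\<^bsub>?T\<^esub>"] e M.smult_l_null[OF NM[OF m]]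
      by simp
    then have "?m \<oplus>\<^bsub>M\<^esub> m = \<zero>\<^bsub>M\<^esub>" using m Nc by simp
    then show "\<exists>m'\<in>carrier N. m' \<oplus>\<^bsub>N\<^esub> m = \<zero>\<^bsub>N\<^esub>"
      using eN[OF _ NM[OF m], of "\<ominus>\<^bsub>?T\<^esub> \<one>\<^bsub>?T\<^esub>"] by (intro bexI[of _ ?m]) (simp_all add: Ns)
  qed (use aN zN NM M.M.a_ac in \<open>auto simp: Ns\<close>)
  have N: "left_module ?T N"
  proof (intro left_module.intro left_module_axioms.intro ringT abN)
    show "r \<odot>\<^bsub>N\<^esub> m \<in> carrier N" if "r \<in> carrier ?T" "m \<in> carrier N" for r m
      unfolding Ns by (rule eN[OF that(1) NM[OF that(2)]])
    show "(r \<oplus>\<^bsub>?T\<^esub> s) \<odot>\<^bsub>N\<^esub> m = r \<odot>\<^bsub>N\<^esub> m \<oplus>\<^bsub>N\<^esub> s \<odot>\<^bsub>N\<^esub> m"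
      if "r \<in> carrier ?T" "s \<in> carrier ?T" "m \<in> carrier N" for r s m
      unfolding Ns TL_simps(3) embed_linear(1)
      using M.smult_l_distr[OF embed_in_X[OF A A that(1)] embed_in_X[OF A A that(2)] NM[OF that(3)]]
      by (simp add: X_alg_simps)
    show "r \<odot>\<^bsub>N\<^esub> (m \<oplus>\<^bsub>N\<^esub> m') = r \<odot>\<^bsub>N\<^esub> m \<oplus>\<^bsub>N\<^esub> r \<odot>\<^bsub>N\<^esub> m'"
      if "r \<in> carrier ?T" "m \<in> carrier N" "m' \<in> carrier N" for r m m'
      unfolding Ns by (rule M.smult_r_distr[OF embed_in_X[OF A A that(1)] NM[OF that(2)] NM[OF that(3)]])
    show "(r \<otimes>\<^bsub>?T\<^esub> s) \<odot>\<^bsub>N\<^esub> m = r \<odot>\<^bsub>N\<^esub> (s \<odot>\<^bsub>N\<^esub> m)"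
      if "r \<in> carrier ?T" "s \<in> carrier ?T" "m \<in> carrier N" for r s m
      unfolding Ns
      using M.smult_assoc1[OF embed_in_X[OF A A that(1)] embed_in_X[OF A A that(2)] NM[OF that(3)]]
        X_embed_mult[OF A A A A that(1,2)] by simp
    show "\<one>\<^bsub>?T\<^esub> \<odot>\<^bsub>N\<^esub> m = m" if "m \<in> carrier N" for m
      unfolding Ns using that Nc matrix_unit_embed[OF A, of A] by simp
  qed
  interpret N: left_module ?T N by (rule N)
  \<comment> \<open>The identity is the sum of the diagonal matrix units, and each of them factors
    through the chosen set \<open>A\<close>.\<close>
  have decomp: "m = finsum M (\<lambda>C. ?u C A \<odot>\<^bsub>M\<^esub> (?u A C \<odot>\<^bsub>M\<^esub> m)) ?S" if m: "m \<in> carrier M" for m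
  proof -
    have "m = (\<Sum>C\<in>?S. ?u C C) \<odot>\<^bsub>M\<^esub> m" using M.smult_one[OF m] by (simp add: X_alg_simps(5))
    also have "\<dots> = finsum M (\<lambda>C. ?u C C \<odot>\<^bsub>M\<^esub> m) ?S"
      by (rule conjunct2[OF sum_smult[OF M X_alg_simps(3,4) finite_subsets_n _ m]]) (simp add: unit_in_X)
    also have "\<dots> = finsum M (\<lambda>C. ?u C A \<odot>\<^bsub>M\<^esub> (?u A C \<odot>\<^bsub>M\<^esub> m)) ?S"
      using uu[OF _ A A _ m] unit_in_X m by (intro M.M.finsum_cong') (auto simp: A)
    finally show ?thesis .
  qed
  have Nzero: "m = \<zero>\<^bsub>M\<^esub>" if m: "m \<in> carrier M" and 0: "\<And>C. C \<in> ?S \<Longrightarrow> ?u A C \<odot>\<^bsub>M\<^esub> m = \<zero>\<^bsub>M\<^esub>" for m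
  proof -
    have "finsum M (\<lambda>C. ?u C A \<odot>\<^bsub>M\<^esub> (?u A C \<odot>\<^bsub>M\<^esub> m)) ?S = finsum M (\<lambda>C. \<zero>\<^bsub>M\<^esub>) ?S"
      using M.smult_r_null[OF unit_in_X[OF _ A]] by (intro M.M.finsum_cong') (auto simp: 0)
    then show ?thesis using decomp[OF m] by simp
  qed
  have simpleN: "simple_module ?T N"
    unfolding simple_module_def
  proof (intro conjI allI impI N)
    show "carrier N \<noteq> {\<zero>\<^bsub>N\<^esub>}"
    proof
      assume "carrier N = {\<zero>\<^bsub>N\<^esub>}"
      then have "m = \<zero>\<^bsub>M\<^esub>" if "m \<in> carrier M" for m using Nzero[OF that] uN[OF _ that] by (simp add: Ns)
      then show False using nz M.M.zero_closed by blast
    qed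
    fix H assume H: "submodule H ?T N"
    note HD = submoduleD[OF H]
    \<comment> \<open>The elements of \<open>M\<close> all of whose components, moved into
      \<open>N\<close>, lie in \<open>H\<close>. This submodule of \<open>M\<close> meets
      \<open>N\<close> exactly in \<open>H\<close>, so simplicity of \<open>M\<close> decides about
      \<open>H\<close>.\<close>
    define W where "W = {m \<in> carrier M. \<forall>C\<in>?S. ?u A C \<odot>\<^bsub>M\<^esub> m \<in> H}"
    have "submodule W ?X M"
    proof (rule M.submodule_intro)
      show "W \<subseteq> carrier M" by (auto simp: W_def)
      show "\<zero>\<^bsub>M\<^esub> \<in> W" using HD(2) M.smult_r_null[OF unit_in_X[OF A]] by (simp add: W_def Ns)
      show "m \<oplus>\<^bsub>M\<^esub> m' \<in> W" if "m \<in> W" "m' \<in> W" for m m'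
        using that HD(3) M.smult_r_distr[OF unit_in_X[OF A]] by (simp add: W_def Ns)
      fix x m assume x: "x \<in> carrier ?X" and m: "m \<in> W"
      then have mM: "m \<in> carrier M" and mH: "\<And>C. C \<in> ?S \<Longrightarrow> ?u A C \<odot>\<^bsub>M\<^esub> m \<in> H" by (auto simp: W_def)
      have "?u A C \<odot>\<^bsub>M\<^esub> (x \<odot>\<^bsub>M\<^esub> m) \<in> H" if C: "C \<in> ?S" for C
      proof -
        let ?g = "\<lambda>B. entry k C B x \<odot>\<^bsub>N\<^esub> (?u A B \<odot>\<^bsub>M\<^esub> m)"
        have terms: "?u A C \<odot>\<^bsub>M\<^esub> (x \<odot>\<^bsub>M\<^esub> (?u B A \<odot>\<^bsub>M\<^esub> (?u A B \<odot>\<^bsub>M\<^esub> m))) = ?g B" if B: "B \<in> ?S" for B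
        proof -
          have v: "?u A B \<odot>\<^bsub>M\<^esub> m \<in> carrier M" using unit_in_X[OF A B] mM by simp
          show ?thesis
            using M.smult_assoc1[OF x unit_in_X[OF B A] v] M.smult_assoc1[OF unit_in_X[OF A C] X.m_closed[OF x unit_in_X[OF B A]] v]
              X_corner[OF A A C B x] by (simp add: Ns)
        qed
        have gH: "?g B \<in> H" if "B \<in> ?S" for B using HD(4)[OF entry_in_TL[OF C] mH[OF that]] .
        have gM: "?g B \<in> carrier M" if "B \<in> ?S" for B using gH[OF that] HD(1) NM by blast
        have c1: "(\<lambda>B. ?u B A \<odot>\<^bsub>M\<^esub> (?u A B \<odot>\<^bsub>M\<^esub> m)) \<in> ?S \<rightarrow> carrier M" using unit_in_X A mM by auto
        then have c2: "(\<lambda>B. x \<odot>\<^bsub>M\<^esub> (?u B A \<odot>\<^bsub>M\<^esub> (?u A B \<odot>\<^bsub>M\<^esub> m))) \<in> ?S \<rightarrow> carrier M" using x by auto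
        have "?u A C \<odot>\<^bsub>M\<^esub> (x \<odot>\<^bsub>M\<^esub> m) = ?u A C \<odot>\<^bsub>M\<^esub> (x \<odot>\<^bsub>M\<^esub> finsum M (\<lambda>B. ?u B A \<odot>\<^bsub>M\<^esub> (?u A B \<odot>\<^bsub>M\<^esub> m)) ?S)"
          using decomp[OF mM] by simp
        also have "\<dots> = finsum M (\<lambda>B. ?u A C \<odot>\<^bsub>M\<^esub> (x \<odot>\<^bsub>M\<^esub> (?u B A \<odot>\<^bsub>M\<^esub> (?u A B \<odot>\<^bsub>M\<^esub> m)))) ?S"
          unfolding M.smult_finsum[OF finite_subsets_n x c1] by (rule M.smult_finsum[OF finite_subsets_n unit_in_X[OF A C] c2])
        also have "\<dots> = finsum M ?g ?S" by (rule M.M.finsum_cong'[OF refl _ terms]) (use gM in auto)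
        also have "\<dots> \<in> H"
        proof -
          have "finsum M ?g J \<in> H" if "finite J" "J \<subseteq> ?S" for J
            using that
          proof (induction J rule: finite_induct)
            case empty then show ?case using HD(2) by (simp add: Ns)
          next
            case (insert B J)
            have "?g \<in> J \<rightarrow> carrier M" "?g B \<in> carrier M" using gM insert.prems by auto
            from M.M.finsum_insert[OF insert.hyps this] show ?case
              using HD(3)[OF gH[of B] insert.IH] insert.prems by (simp add: Ns)
          qed
          then show ?thesis by simp
        qed
        finally show ?thesis .
      qed
      then show "x \<odot>\<^bsub>M\<^esub> m \<in> W" using x mM by (simp add: W_def)
    qed
    then have W: "W = {\<zero>\<^bsub>M\<^esub>} \<or> W = carrier M" by (rule irr)
    have HW: "H \<subseteq> W"
    proof
      fix h assume h: "h \<in> H"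
      then have hN: "h \<in> carrier M" "?u A A \<odot>\<^bsub>M\<^esub> h = h" using HD(1) Nc by auto
      have "?u A C \<odot>\<^bsub>M\<^esub> h \<in> H" if C: "C \<in> ?S" for C
        using uu[OF A C A A hN(1)] h HD(2) unfolding hN(2) by (auto simp: Ns)
      then show "h \<in> W" using hN by (simp add: W_def)
    qed
    show "H = {\<zero>\<^bsub>N\<^esub>} \<or> H = carrier N"
    proof (cases "W = {\<zero>\<^bsub>M\<^esub>}")
      case True
      then show ?thesis using HW HD(2) by (auto simp: Ns)
    next
      case False
      have "m \<in> H" if m: "m \<in> carrier N" for m
      proof -
        have "m \<in> W" using False W NM[OF m] by blast
        then have "?u A A \<odot>\<^bsub>M\<^esub> m \<in> H" using A unfolding W_def by blast
        then show ?thesis using m Nc by simp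
      qed
      then show ?thesis using HD(1) by blast
    qed
  qed
  \<comment> \<open>\<open>N\<close> and \<open>M\<close> share addition and zero but are different
    records, so their finite sums have to be identified.\<close>
  have finsumN: "finsum N f J = finsum M f J" if "finite J" "f \<in> J \<rightarrow> carrier N" for f :: "nat set \<Rightarrow> 'm" and J
    using that
  proof (induction J rule: finite_induct)
    case empty
    show ?case unfolding N.M.finsum_empty M.M.finsum_empty by (rule Ns)
  next
    case (insert i J)
    then have 1: "f \<in> J \<rightarrow> carrier N" "f i \<in> carrier N" by auto
    then have 2: "f \<in> J \<rightarrow> carrier M" "f i \<in> carrier M" using NM by auto
    show ?case
      unfolding N.M.finsum_insert[OF insert.hyps 1] M.M.finsum_insert[OF insert.hyps 2] insert.IH[OF 1(1)] Ns ..
  qed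
  let ?Q = "Q_tensor k \<delta> n N"
  \<comment> \<open>The unit at (\<open>C\<close>, \<open>A\<close>) sends the coordinate at
    \<open>C\<close> from the corner to row \<open>C\<close>; the inverse map collects the
    components of \<open>m\<close> under the units at (\<open>A\<close>, \<open>C\<close>).\<close>
  define \<psi> where "\<psi> w = finsum M (\<lambda>C. ?u C A \<odot>\<^bsub>M\<^esub> w C) ?S" for w
  have wN: "w B \<in> carrier N" if "w \<in> carrier ?Q" "B \<in> ?S" for w B using that by (auto simp: Q_tensor_simps)
  have wM: "w B \<in> carrier M" if "w \<in> carrier ?Q" "B \<in> ?S" for w B using wN[OF that] NM by blast
  have c: "(\<lambda>C. ?u C A \<odot>\<^bsub>M\<^esub> w C) \<in> ?S \<rightarrow> carrier M" if "w \<in> carrier ?Q" for w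
    using wM[OF that] unit_in_X[OF _ A] by auto
  have \<psi>_closed: "\<psi> w \<in> carrier M" if "w \<in> carrier ?Q" for w
    unfolding \<psi>_def by (rule M.M.finsum_closed[OF c[OF that]])
  have "\<psi> \<in> module_iso ?X ?Q M"
    unfolding module_iso_def
  proof (intro CollectI conjI ballI)
    show "\<psi> \<in> iso (add_monoid ?Q) (add_monoid M)"
      unfolding iso_def
    proof (intro CollectI conjI)
      show "\<psi> \<in> hom (add_monoid ?Q) (add_monoid M)"
      proof (rule homI)
        show "\<psi> w \<in> carrier (add_monoid M)" if "w \<in> carrier (add_monoid ?Q)" for w
          using \<psi>_closed that by simp
        fix w w' assume "w \<in> carrier (add_monoid ?Q)" "w' \<in> carrier (add_monoid ?Q)"
        then have w: "w \<in> carrier ?Q" "w' \<in> carrier ?Q" by simp_all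
        have "\<psi> (w \<oplus>\<^bsub>?Q\<^esub> w') = finsum M (\<lambda>C. ?u C A \<odot>\<^bsub>M\<^esub> w C \<oplus>\<^bsub>M\<^esub> ?u C A \<odot>\<^bsub>M\<^esub> w' C) ?S"
          unfolding \<psi>_def Q_tensor_simps(3) Ns
          using M.smult_r_distr[OF unit_in_X[OF _ A] wM[OF w(1)] wM[OF w(2)]] c[OF w(1)] c[OF w(2)]
          by (intro M.M.finsum_cong') (auto simp: Pi_iff)
        also have "\<dots> = \<psi> w \<oplus>\<^bsub>M\<^esub> \<psi> w'" unfolding \<psi>_def by (rule M.M.finsum_addf[OF c[OF w(1)] c[OF w(2)]])
        finally show "\<psi> (w \<otimes>\<^bsub>add_monoid ?Q\<^esub> w') = \<psi> w \<otimes>\<^bsub>add_monoid M\<^esub> \<psi> w'" by simp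
      qed
      have "bij_betw \<psi> (carrier ?Q) (carrier M)"
      proof (rule bij_betw_byWitness[of _ "\<lambda>m. \<lambda>C\<in>?S. ?u A C \<odot>\<^bsub>M\<^esub> m"])
        show "\<psi> ` carrier ?Q \<subseteq> carrier M" using \<psi>_closed by auto
        show "(\<lambda>m. \<lambda>C\<in>?S. ?u A C \<odot>\<^bsub>M\<^esub> m) ` carrier M \<subseteq> carrier ?Q" using uN by (auto simp: Q_tensor_simps)
        show "\<forall>m\<in>carrier M. \<psi> (\<lambda>C\<in>?S. ?u A C \<odot>\<^bsub>M\<^esub> m) = m"
        proof
          fix m assume m: "m \<in> carrier M"
          have "\<psi> (\<lambda>C\<in>?S. ?u A C \<odot>\<^bsub>M\<^esub> m) = finsum M (\<lambda>C. ?u C A \<odot>\<^bsub>M\<^esub> (?u A C \<odot>\<^bsub>M\<^esub> m)) ?S"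
            unfolding \<psi>_def using unit_in_X A m by (intro M.M.finsum_cong') auto
          then show "\<psi> (\<lambda>C\<in>?S. ?u A C \<odot>\<^bsub>M\<^esub> m) = m" using decomp[OF m] by simp
        qed
        show "\<forall>w\<in>carrier ?Q. (\<lambda>C\<in>?S. ?u A C \<odot>\<^bsub>M\<^esub> \<psi> w) = w"
        proof
          fix w assume w: "w \<in> carrier ?Q"
          have eq: "?u A D \<odot>\<^bsub>M\<^esub> \<psi> w = w D" if D: "D \<in> ?S" for D
          proof -
            have "?u A D \<odot>\<^bsub>M\<^esub> \<psi> w = finsum M (\<lambda>C. ?u A D \<odot>\<^bsub>M\<^esub> (?u C A \<odot>\<^bsub>M\<^esub> w C)) ?S"
              unfolding \<psi>_def by (rule M.smult_finsum[OF finite_subsets_n unit_in_X[OF A D] c[OF w]])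
            also have "\<dots> = finsum M (\<lambda>C. if C = D then w D else \<zero>\<^bsub>M\<^esub>) ?S"
            proof (rule M.M.finsum_cong'[OF refl])
              show "(\<lambda>C. if C = D then w D else \<zero>\<^bsub>M\<^esub>) \<in> ?S \<rightarrow> carrier M" using wM[OF w D] by auto
              fix C assume C: "C \<in> ?S"
              show "?u A D \<odot>\<^bsub>M\<^esub> (?u C A \<odot>\<^bsub>M\<^esub> w C) = (if C = D then w D else \<zero>\<^bsub>M\<^esub>)"
                using uu[OF A D C A wM[OF w C]] wN[OF w C] by (auto simp: Nc)
            qed
            also have "\<dots> = w D" by (rule M.M.finsum_delta[OF finite_subsets_n D wM[OF w D]])
            finally show ?thesis .
          qed
          show "(\<lambda>C\<in>?S. ?u A C \<odot>\<^bsub>M\<^esub> \<psi> w) = w"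
            using w wN[OF w] by (intro PiE_ext[of _ ?S "\<lambda>_. carrier N"]) (auto simp: eq Q_tensor_simps)
        qed
      qed
      then show "bij_betw \<psi> (carrier (add_monoid ?Q)) (carrier (add_monoid M))" by simp
    qed
    fix x w assume x: "x \<in> carrier ?X" and w: "w \<in> carrier ?Q"
    \<comment> \<open>Both sides of the equation expand to the double sum of the
      \<open>?f C B\<close>, summed in the two possible orders.\<close>
    let ?f = "\<lambda>C B. embed k C A (entry k C B x) \<odot>\<^bsub>M\<^esub> w B"
    have f: "?f C B \<in> carrier M" if "C \<in> ?S" "B \<in> ?S" for C B
      using embed_in_X[OF that(1) A entry_in_TL[OF that(1)]] wM[OF w that(2)] by simp
    have "\<psi> (x \<odot>\<^bsub>?Q\<^esub> w) = finsum M (\<lambda>C. finsum M (?f C) ?S) ?S"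
      unfolding \<psi>_def Q_smult[OF N x w]
    proof (rule M.M.finsum_cong'[OF refl])
      show "(\<lambda>C. finsum M (?f C) ?S) \<in> ?S \<rightarrow> carrier M" using f by (intro Pi_I M.M.finsum_closed) auto
      fix C assume C: "C \<in> ?S"
      have g: "(\<lambda>B. entry k C B x \<odot>\<^bsub>N\<^esub> w B) \<in> ?S \<rightarrow> carrier N" using entry_in_TL[OF C] wN[OF w] by auto
      then have g': "(\<lambda>B. entry k C B x \<odot>\<^bsub>N\<^esub> w B) \<in> ?S \<rightarrow> carrier M" using NM by auto
      have "?u C A \<odot>\<^bsub>M\<^esub> finsum N (\<lambda>B. entry k C B x \<odot>\<^bsub>N\<^esub> w B) ?S
          = finsum M (\<lambda>B. ?u C A \<odot>\<^bsub>M\<^esub> (entry k C B x \<odot>\<^bsub>N\<^esub> w B)) ?S"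
        unfolding finsumN[OF finite_subsets_n g] by (rule M.smult_finsum[OF finite_subsets_n unit_in_X[OF C A] g'])
      also have "\<dots> = finsum M (?f C) ?S"
        using f[OF C] ue[OF C A A entry_in_TL[OF C] wM[OF w]] by (intro M.M.finsum_cong') (auto simp: Ns)
      finally show "?u C A \<odot>\<^bsub>M\<^esub> (\<lambda>C\<in>?S. finsum N (\<lambda>B. entry k C B x \<odot>\<^bsub>N\<^esub> w B) ?S) C = finsum M (?f C) ?S"
        using C by simp
    qed
    also have "\<dots> = finsum M (\<lambda>B. finsum M (\<lambda>C. ?f C B) ?S) ?S"
      by (rule M.M.finsum_swap[OF finite_subsets_n finite_subsets_n f])
    also have "\<dots> = finsum M (\<lambda>B. x \<odot>\<^bsub>M\<^esub> (?u B A \<odot>\<^bsub>M\<^esub> w B)) ?S"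
    proof (rule M.M.finsum_cong'[OF refl])
      show "(\<lambda>B. x \<odot>\<^bsub>M\<^esub> (?u B A \<odot>\<^bsub>M\<^esub> w B)) \<in> ?S \<rightarrow> carrier M" using c[OF w] x by auto
      fix B assume B: "B \<in> ?S"
      have "x \<odot>\<^bsub>M\<^esub> (?u B A \<odot>\<^bsub>M\<^esub> w B) = (\<Sum>C\<in>?S. embed k C A (entry k C B x)) \<odot>\<^bsub>M\<^esub> w B"
        using M.smult_assoc1[OF x unit_in_X[OF B A] wM[OF w B]] X_mult_unit[OF B A x] by simp
      also have "\<dots> = finsum M (\<lambda>C. ?f C B) ?S"
        by (rule conjunct2[OF sum_smult[OF M X_alg_simps(3,4) finite_subsets_n _ wM[OF w B]]])
           (simp add: embed_in_X A entry_in_TL)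
      finally show "finsum M (\<lambda>C. ?f C B) ?S = x \<odot>\<^bsub>M\<^esub> (?u B A \<odot>\<^bsub>M\<^esub> w B)" ..
    qed
    also have "\<dots> = x \<odot>\<^bsub>M\<^esub> \<psi> w"
      unfolding \<psi>_def by (rule M.smult_finsum[OF finite_subsets_n x c[OF w], symmetric])
    finally show "\<psi> (x \<odot>\<^bsub>?Q\<^esub> w) = x \<odot>\<^bsub>M\<^esub> \<psi> w" .
  qed
  then show ?thesis using simpleN by blast
qed

end

theorem theorem4p4:
  fixes \<delta> :: "'k::field" and n k :: nat
  assumes "n \<le> k"
  shows
    "(semisimple_ring (X_alg k \<delta> n) \<longleftrightarrow> semisimple_ring (TL n (\<delta> - 1))) \<and>
     (semisimple_ring (X_alg k \<delta> n) \<longrightarrow>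
        (\<forall>M :: (diagram \<Rightarrow> 'k, 'm) module. simple_module (X_alg k \<delta> n) M \<longrightarrow>
           (\<exists>N :: (diagram \<Rightarrow> 'k, 'm) module. simple_module (TL n (\<delta> - 1)) N \<and>
              module_iso (X_alg k \<delta> n) (Q_tensor k \<delta> n N) M \<noteq> {})) \<and>
        (\<forall>N :: (diagram \<Rightarrow> 'k, 'n) module. simple_module (TL n (\<delta> - 1)) N \<longrightarrow>
           simple_module (X_alg k \<delta> n) (Q_tensor k \<delta> n N))) \<and>
     ((\<forall>m\<le>k. semisimple_ring (TL m (\<delta> - 1))) \<longrightarrow> semisimple_ring (PTL k \<delta>))"
proof (intro conjI impI allI)
  show "semisimple_ring (X_alg k \<delta> n) \<longleftrightarrow> semisimple_ring (TL n (\<delta> - 1))"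
    by (rule semisimple_X_alg_iff[OF assms])
  show "semisimple_ring (PTL k \<delta>)" if "\<forall>m\<le>k. semisimple_ring (TL m (\<delta> - 1))"
    using that by (intro semisimple_PTL) blast
  assume "semisimple_ring (X_alg k \<delta> n)"
  then have ring: "ring (X_alg k \<delta> n)" by (rule semisimple_ring_is_ring)
  show "\<exists>N :: (diagram \<Rightarrow> 'k, 'm) module. simple_module (TL n (\<delta> - 1)) N \<and>
      module_iso (X_alg k \<delta> n) (Q_tensor k \<delta> n N) M \<noteq> {}"
    if "simple_module (X_alg k \<delta> n) M" for M :: "(diagram \<Rightarrow> 'k, 'm) module"
    by (rule simple_X_module[OF assms ring that])
  show "simple_module (X_alg k \<delta> n) (Q_tensor k \<delta> n N)"
    if "simple_module (TL n (\<delta> - 1)) N" for N :: "(diagram \<Rightarrow> 'k, 'n) module"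
    by (rule simple_Q_tensor[OF assms ring that])
qed

end
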